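(* Let $1<p<2$ and let $g$ be analytic on the unit disc $\mathbb{D}$ such that the operator $T_g(f)(z)=\int_0^z f(\zeta)g'(\zeta)\,d\zeta$ is bounded as an operator $T_g: BMOA_p\to BMOA_p$. Then the following are equivalent: (i) $T_g: BMOA\to BMOA_p$ is compact; (ii) $T_g: BMOA_p\to BMOA_p$ is compact; (iii) $T_g: BMOA_p\to BMOA_p$ is weakly compact; (iv) $T_g: VMOA_p\to VMOA_p$ is weakly compact; (v) $T_g(BMOA_p)\subseteq VMOA_p$; (vi) $T_g(BMOA)\subseteq VMOA_p$; (vii) the function $g$ satisfies $$\lim_{|I|\to0}\frac{\left(\log\frac{2}{|I|}\right)^p}{|I|}\int_{S(I)}|g'(z)|^p(1-|z|^2)^{p-1}\,dm(z)=0.$$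
   Context: $\mathbb{D}$ is the open unit disc, $H(\mathbb{D})$ the space of analytic functions on $\mathbb{D}$, $dm$ the normalized Lebesgue area measure on $\mathbb{D}$, and $\varphi_a(z)=\frac{a-z}{1-\bar a z}$ for $a\in\mathbb{D}$. For $p\geq 1$, $BMOA_p$ is the Banach space of $f\in H(\mathbb{D})$ with finite norm $$\|f\|_{BMOA_p}^p=|f(0)|^p+\sup_{a\in\mathbb{D}}\int_{\mathbb{D}}|f'(z)|^p(1-|z|^2)^{p-2}(1-|\varphi_a(z)|^2)\,dm(z).$$ $VMOA_p$ is the closed subspace, with the same norm, of those $f\in BMOA_p$ for which $\lim_{|a|\to1}\int_{\mathbb{D}}|f'(z)|^p(1-|z|^2)^{p-2}(1-|\varphi_a(z)|^2)\,dm(z)=0$. $BMOA=BMOA_2$ is the classical space of analytic functions of bounded mean oscillation. For an arc $I\subset\partial\mathbb{D}$ of length $|I|$, the Carleson square is $S(I)=\{re^{it}:e^{it}\in I,\ 1-|I|<r<1\}$; the limit as $|I|\to0$ is uniform over all arcs $I$ with $|I|\to0$. *)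

theory Defs
  imports "HOL-Complex_Analysis.Complex_Analysis"
begin

text \<open>
  A complex normed space of functions is given by a carrier \<open>V\<close>, closed under pointwise
  addition and scalar multiplication, and a norm \<open>N\<close> that is meaningful on \<open>V\<close> only.
\<close>

definition norm_topology ::
    "(complex \<Rightarrow> complex) set \<Rightarrow> ((complex \<Rightarrow> complex) \<Rightarrow> real) \<Rightarrow> (complex \<Rightarrow> complex) topology"
  where "norm_topology V N = Metric_space.mtopology V (\<lambda>f g. N (\<lambda>z. f z - g z))"

definition dual_space ::
    "(complex \<Rightarrow> complex) set \<Rightarrow> ((complex \<Rightarrow> complex) \<Rightarrow> real) \<Rightarrow> ((complex \<Rightarrow> complex) \<Rightarrow> complex) set"
  where "dual_space V N = {\<Lambda>.
    (\<forall>f\<in>V. \<forall>h\<in>V. \<Lambda> (\<lambda>z. f z + h z) = \<Lambda> f + \<Lambda> h) \<and>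
    (\<forall>c. \<forall>f\<in>V. \<Lambda> (\<lambda>z. c * f z) = c * \<Lambda> f) \<and>
    (\<exists>C. \<forall>f\<in>V. cmod (\<Lambda> f) \<le> C * N f)}"

definition weak_topology ::
    "(complex \<Rightarrow> complex) set \<Rightarrow> ((complex \<Rightarrow> complex) \<Rightarrow> real) \<Rightarrow> (complex \<Rightarrow> complex) topology"
  where "weak_topology V N =
    topology_generated_by {{f \<in> V. \<Lambda> f \<in> U} | \<Lambda> U. \<Lambda> \<in> dual_space V N \<and> open U}"

text \<open>
  All operator notions below include well-definedness, that is, \<open>T\<close> maps \<open>V\<close> into \<open>W\<close>.
\<close>

definition linear_operator ::
    "(complex \<Rightarrow> complex) set \<Rightarrow> (complex \<Rightarrow> complex) set
      \<Rightarrow> ((complex \<Rightarrow> complex) \<Rightarrow> (complex \<Rightarrow> complex)) \<Rightarrow> bool"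
  where "linear_operator V W T \<longleftrightarrow>
    T ` V \<subseteq> W \<and>
    (\<forall>f\<in>V. \<forall>h\<in>V. T (\<lambda>z. f z + h z) = (\<lambda>z. T f z + T h z)) \<and>
    (\<forall>c. \<forall>f\<in>V. T (\<lambda>z. c * f z) = (\<lambda>z. c * T f z))"

definition bounded_operator ::
    "(complex \<Rightarrow> complex) set \<Rightarrow> ((complex \<Rightarrow> complex) \<Rightarrow> real)
      \<Rightarrow> (complex \<Rightarrow> complex) set \<Rightarrow> ((complex \<Rightarrow> complex) \<Rightarrow> real)
      \<Rightarrow> ((complex \<Rightarrow> complex) \<Rightarrow> (complex \<Rightarrow> complex)) \<Rightarrow> bool"
  where "bounded_operator V N W M T \<longleftrightarrow>
    linear_operator V W T \<and> (\<exists>C. \<forall>f\<in>V. M (T f) \<le> C * N f)"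

definition compact_operator ::
    "(complex \<Rightarrow> complex) set \<Rightarrow> ((complex \<Rightarrow> complex) \<Rightarrow> real)
      \<Rightarrow> (complex \<Rightarrow> complex) set \<Rightarrow> ((complex \<Rightarrow> complex) \<Rightarrow> real)
      \<Rightarrow> ((complex \<Rightarrow> complex) \<Rightarrow> (complex \<Rightarrow> complex)) \<Rightarrow> bool"
  where "compact_operator V N W M T \<longleftrightarrow>
    linear_operator V W T \<and>
    compactin (norm_topology W M) (norm_topology W M closure_of (T ` {f \<in> V. N f \<le> 1}))"

definition weakly_compact_operator ::
    "(complex \<Rightarrow> complex) set \<Rightarrow> ((complex \<Rightarrow> complex) \<Rightarrow> real)
      \<Rightarrow> (complex \<Rightarrow> complex) set \<Rightarrow> ((complex \<Rightarrow> complex) \<Rightarrow> real)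
      \<Rightarrow> ((complex \<Rightarrow> complex) \<Rightarrow> (complex \<Rightarrow> complex)) \<Rightarrow> bool"
  where "weakly_compact_operator V N W M T \<longleftrightarrow>
    linear_operator V W T \<and>
    compactin (weak_topology W M) (weak_topology W M closure_of (T ` {f \<in> V. N f \<le> 1}))"

abbreviation unit_disc :: "complex set"
  where "unit_disc \<equiv> ball 0 1"

text \<open>
  Analytic functions on the disc are represented by total functions that vanish off the disc,
  so that equality in the space is equality of functions and the norms below separate points.
\<close>

definition analytic_disc :: "(complex \<Rightarrow> complex) set"
  where "analytic_disc = {f. f holomorphic_on unit_disc \<and> (\<forall>z. z \<notin> unit_disc \<longrightarrow> f z = 0)}"

definition disc_area :: "complex measure"
  where "disc_area = uniform_measure lborel unit_disc"

definition disc_aut :: "complex \<Rightarrow> complex \<Rightarrow> complex"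
  where "disc_aut a z = (a - z) / (1 - cnj a * z)"

definition bmoa_integral :: "real \<Rightarrow> (complex \<Rightarrow> complex) \<Rightarrow> complex \<Rightarrow> ennreal"
  where "bmoa_integral p f a =
    (\<integral>\<^sup>+ z \<in> unit_disc. ennreal (cmod (deriv f z) powr p * (1 - (cmod z)\<^sup>2) powr (p - 2)
        * (1 - (cmod (disc_aut a z))\<^sup>2)) \<partial>disc_area)"

definition BMOA :: "real \<Rightarrow> (complex \<Rightarrow> complex) set"
  where "BMOA p = {f \<in> analytic_disc. (SUP a\<in>unit_disc. bmoa_integral p f a) < \<infinity>}"

definition bmoa_norm :: "real \<Rightarrow> (complex \<Rightarrow> complex) \<Rightarrow> real"
  where "bmoa_norm p f =
    (cmod (f 0) powr p + enn2real (SUP a\<in>unit_disc. bmoa_integral p f a)) powr (1 / p)"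

definition VMOA :: "real \<Rightarrow> (complex \<Rightarrow> complex) set"
  where "VMOA p = {f \<in> BMOA p. (bmoa_integral p f \<longlongrightarrow> 0) (filtercomap cmod (at_left 1))}"

definition integral_operator :: "(complex \<Rightarrow> complex) \<Rightarrow> (complex \<Rightarrow> complex) \<Rightarrow> (complex \<Rightarrow> complex)"
  where "integral_operator g f = (\<lambda>z. if z \<in> unit_disc
    then contour_integral (linepath 0 z) (\<lambda>\<zeta>. f \<zeta> * deriv g \<zeta>) else 0)"

definition circle_arc :: "real \<Rightarrow> real \<Rightarrow> complex set"
  where "circle_arc s l = cis ` {s..s + l}"

text \<open>
  The second argument is the length of the arc (not normalised, so the whole circle has length
  \<open>2 * pi\<close>); it is passed separately because the set does not carry it. Arcs are taken closed:
  the end points only contribute radii, which are null sets.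
\<close>

definition carleson_square :: "complex set \<Rightarrow> real \<Rightarrow> complex set"
  where "carleson_square I l = {of_real r * cis t | r t. cis t \<in> I \<and> 1 - l < r \<and> r < 1}"

text \<open>
  The filter below lets the length tend to 0 from the right while leaving the initial angle
  arbitrary, so the limit is uniform over all arcs.
\<close>

definition vanishing_log_carleson :: "real \<Rightarrow> (complex \<Rightarrow> complex) \<Rightarrow> bool"
  where "vanishing_log_carleson p g \<longleftrightarrow>
    ((\<lambda>(s, l). ennreal (ln (2 / l) powr p / l) *
        (\<integral>\<^sup>+ z \<in> carleson_square (circle_arc s l) l.
          ennreal (cmod (deriv g z) powr p * (1 - (cmod z)\<^sup>2) powr (p - 1)) \<partial>disc_area))
      \<longlongrightarrow> 0) (filtercomap snd (at_right (0::real)))"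

end

theory Submission
  imports Defs
begin

text \<open>
  Write \<open>\<mu>\<close> for the measure \<open>|g'|^p (1 - |z|^2)^(p-1) dm\<close>. Testing the bounded operator \<open>T\<close> on
  \<open>Ln (1 - cnj a * z)^2 / log (1/(1 - |a|))\<close> shows that \<open>\<mu>\<close> is a logarithmic Carleson measure. Conversely,
  along the segment from a point \<open>z\<close> of a Carleson box to the centre of the box, the Cauchy-Schwarz
  inequality controls \<open>|f(z) - f(a)|^2\<close> by an area integral of \<open>|f'|^2\<close> at the cost of one factor
  \<open>log (1/(1 - |z|))\<close>, which the logarithmic Carleson condition absorbs; so \<open>\<mu>\<close> embeds \<open>BMOA\<close> box by box,
  with a small constant on small boxes when \<open>\<mu>\<close> is vanishing. Together with Montel's theorem this gives
  compactness of \<open>T\<close> and \<open>T(BMOA) \<subseteq> VMOA_p\<close> from (vii).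

  If (vii) fails, a gliding hump of test functions gives \<open>F \<in> BMOA_p\<close>, the locally uniform limit
  of a norm bounded sequence \<open>F_n\<close> in \<open>VMOA_p\<close>, such that \<open>T F \<notin> VMOA_p\<close>. This contradicts (v) and (vi).
  If \<open>T\<close> were weakly compact, the \<open>T F_n \<in> VMOA_p\<close> would have a weak cluster point, which can only be
  \<open>T F\<close>, although a bounded functional that vanishes on \<open>VMOA_p\<close> separates \<open>T F\<close> from the \<open>T F_n\<close>.
\<close>

subsection \<open>Area means\<close>

text \<open>The logarithms balance as follows. A function in \<open>BMOA\<close> can grow like
  log(1/(1 - |z|)); at the centre of a box this growth is paid exactly by the factor log^p in (vii).
  There remains the oscillation inside the box. The part of a box of size u within distance u/2^j of
  the circle has \<mu>-mass at most a constant times u (1 + j)^(-p), which is summable because p >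
  1. Hence \<mu> multiplied by one logarithm is still a Carleson measure, and this is the logarithm
  lost to Cauchy-Schwarz.

  The bound p \<le> 2 gives x^p \<le> 1 + x^2, so that the L^2 oscillation of \<open>BMOA\<close>
  controls the L^p embedding, and, through the Bloch bound, the inclusion of \<open>BMOA p\<close>
  in \<open>BMOA 2\<close>. Sufficiency can therefore be proved on \<open>BMOA 2\<close>, the
  largest space, while the counterexample of the necessity part lies in \<open>BMOA p\<close>.
  Carleson squares are replaced throughout by comparable Euclidean balls centred on the
  circle.\<close>

lemma lborel_complex_eq:
  "(lborel :: complex measure) = distr (lborel \<Otimes>\<^sub>M lborel) borel (\<lambda>(x, y). Complex x y)"
proof (rule lborel_eqI)
  have meas: "(\<lambda>(x, y). Complex x y) \<in> borel_measurable (lborel \<Otimes>\<^sub>M lborel)"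
    by (simp add: Complex_eq case_prod_unfold)
  fix l u :: complex
  assume le: "\<And>b. b \<in> Basis \<Longrightarrow> l \<bullet> b \<le> u \<bullet> b"
  have vim: "(\<lambda>(x, y). Complex x y) -` box l u \<inter> space (lborel \<Otimes>\<^sub>M lborel)
      = {Re l<..<Re u} \<times> {Im l<..<Im u}"
    by (auto simp: box_def Basis_complex_def space_pair_measure)
  have "Re l \<le> Re u" "Im l \<le> Im u"
    using le[of 1] le[of \<i>] by (auto simp: Basis_complex_def)
  then show "emeasure (distr (lborel \<Otimes>\<^sub>M lborel) borel (\<lambda>(x, y). Complex x y)) (box l u)
      = ennreal (\<Prod>b\<in>Basis. (u - l) \<bullet> b)"
    using meas by (simp add: emeasure_distr vim lborel.emeasure_pair_measure_Times
        Basis_complex_def ennreal_mult)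
qed simp

lemma nn_integral_lborel_complex:
  assumes [measurable]: "f \<in> borel_measurable borel"
  shows "(\<integral>\<^sup>+ z. f z \<partial>(lborel :: complex measure)) = (\<integral>\<^sup>+ x. \<integral>\<^sup>+ y. f (Complex x y) \<partial>lborel \<partial>lborel)"
    and "(\<integral>\<^sup>+ z. f z \<partial>(lborel :: complex measure)) = (\<integral>\<^sup>+ y. \<integral>\<^sup>+ x. f (Complex x y) \<partial>lborel \<partial>lborel)"
proof -
  have [measurable]: "(\<lambda>(x, y). Complex x y) \<in> borel_measurable (lborel \<Otimes>\<^sub>M lborel)"
    by (simp add: Complex_eq case_prod_unfold)
  have m: "(\<lambda>(x, y). f (Complex x y)) \<in> borel_measurable (lborel \<Otimes>\<^sub>M lborel)"
    by (simp add: Complex_eq case_prod_unfold)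
  have "(\<integral>\<^sup>+ z. f z \<partial>(lborel :: complex measure)) = (\<integral>\<^sup>+ w. (\<lambda>(x, y). f (Complex x y)) w \<partial>(lborel \<Otimes>\<^sub>M lborel))"
    by (subst lborel_complex_eq, subst nn_integral_distr) (auto simp: case_prod_unfold)
  then show "(\<integral>\<^sup>+ z. f z \<partial>(lborel :: complex measure)) = (\<integral>\<^sup>+ x. \<integral>\<^sup>+ y. f (Complex x y) \<partial>lborel \<partial>lborel)"
    and "(\<integral>\<^sup>+ z. f z \<partial>(lborel :: complex measure)) = (\<integral>\<^sup>+ y. \<integral>\<^sup>+ x. f (Complex x y) \<partial>lborel \<partial>lborel)"
    using lborel.nn_integral_fst[OF m] lborel_pair.nn_integral_snd[of "\<lambda>(x, y). f (Complex x y)"] m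
    by simp_all
qed

text \<open>With one coordinate fixed, a shear is a translation in the other one, so Fubini reduces
  the claim to translation invariance on the line.\<close>

lemma nn_integral_lborel_shear:
  assumes [measurable]: "f \<in> borel_measurable borel"
  shows "(\<integral>\<^sup>+ z. f (Complex (Re z + c * Im z) (Im z)) \<partial>lborel) = (\<integral>\<^sup>+ z. f z \<partial>lborel)"
    and "(\<integral>\<^sup>+ z. f (Complex (Re z) (Im z + c * Re z)) \<partial>lborel) = (\<integral>\<^sup>+ z. f z \<partial>lborel)"
proof -
  have [measurable]: "(\<lambda>z. f (Complex (Re z + c * Im z) (Im z))) \<in> borel_measurable borel"
    "(\<lambda>z. f (Complex (Re z) (Im z + c * Re z))) \<in> borel_measurable borel"
    by (simp_all add: Complex_eq)
  have [measurable]: "(\<lambda>x. f (Complex x y)) \<in> borel_measurable borel"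
    "(\<lambda>x. f (Complex y x)) \<in> borel_measurable borel" for y
    by (simp_all add: Complex_eq)
  show "(\<integral>\<^sup>+ z. f (Complex (Re z + c * Im z) (Im z)) \<partial>lborel) = (\<integral>\<^sup>+ z. f z \<partial>lborel)"
    using nn_integral_real_affine[of "\<lambda>x. f (Complex x y)" 1 "c * y" for y]
    by (simp add: nn_integral_lborel_complex(2) add.commute)
  show "(\<integral>\<^sup>+ z. f (Complex (Re z) (Im z + c * Re z)) \<partial>lborel) = (\<integral>\<^sup>+ z. f z \<partial>lborel)"
    using nn_integral_real_affine[of "\<lambda>x. f (Complex y x)" 1 "c * y" for y]
    by (simp add: nn_integral_lborel_complex(1) add.commute)
qed

text \<open>A rotation by an angle other than \<open>\<pi>\<close> is a product of three shears.\<close>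

lemma nn_integral_lborel_rotate:
  assumes [measurable]: "f \<in> borel_measurable borel" and "cos (t / 2) \<noteq> 0"
  shows "(\<integral>\<^sup>+ z. f (cis t * z) \<partial>lborel) = (\<integral>\<^sup>+ z. f z \<partial>lborel)"
proof -
  \<comment> \<open>The matrix product X Y X has diagonal entries 1 + c*s, lower left entry s and
    upper right entry 2*c + c*(c*s). Comparing with the rotation matrix forces s = sin t and c = -
    tan (t/2), so cos (t/2) must not vanish.\<close>
  define c where "c = - tan (t / 2)"
  define s where "s = sin t"
  let ?X = "\<lambda>z. Complex (Re z + c * Im z) (Im z)"
  let ?Y = "\<lambda>z. Complex (Re z) (Im z + s * Re z)"
  have s: "s = 2 * sin (t / 2) * cos (t / 2)"
    using sin_double[of "t / 2"] by (simp add: s_def)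
  have ct: "cos t = 1 + c * s"
    using cos_double_sin[of "t / 2"] assms(2) by (simp add: c_def s tan_def power2_eq_square)
  have "c * s = - 2 * sin (t / 2) ^ 2"
    using assms(2) by (simp add: c_def s tan_def power2_eq_square)
  then have "c + c * (c * s) + c = c * (2 * cos (t / 2) ^ 2)"
    by (simp add: cos_squared_eq algebra_simps)
  also have "\<dots> = - sin t"
    using assms(2) by (simp add: c_def s s_def[symmetric] tan_def power2_eq_square)
  finally have st: "- sin t = c + c * (c * s) + c" ..
  have rot: "cis t * z = ?X (?Y (?X z))" for z
    by (rule complex_eqI) (use ct st in \<open>simp_all add: s_def cis.sel algebra_simps\<close>, algebra+)
  have [measurable]: "(\<lambda>z. f (?X z)) \<in> borel_measurable borel" "(\<lambda>z. f (?X (?Y z))) \<in> borel_measurable borel"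
    by (simp_all add: Complex_eq)
  have "(\<integral>\<^sup>+ z. f (cis t * z) \<partial>lborel) = (\<integral>\<^sup>+ z. f (?X (?Y (?X z))) \<partial>lborel)"
    by (simp only: rot)
  also have "\<dots> = (\<integral>\<^sup>+ z. f (?X (?Y z)) \<partial>lborel)"
    by (rule nn_integral_lborel_shear(1)[of "\<lambda>z. f (?X (?Y z))"]) measurable
  also have "\<dots> = (\<integral>\<^sup>+ z. f (?X z) \<partial>lborel)"
    by (rule nn_integral_lborel_shear(2)[of "\<lambda>z. f (?X z)"]) measurable
  also have "\<dots> = (\<integral>\<^sup>+ z. f z \<partial>lborel)"
    by (rule nn_integral_lborel_shear(1)) measurable
  finally show ?thesis .
qed

text \<open>Equivalently, a^p lies above the tangent of x^p at b. In this homogeneous form it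
  replaces Jensen's inequality for submeans, the convexity behind Minkowski's inequality, and
  Hoelder's inequality for the separating functional.\<close>

lemma young_powr:
  fixes a b p :: real
  assumes "1 < p" "0 \<le> a" "0 \<le> b"
  shows "p * a * b powr (p - 1) \<le> a powr p + (p - 1) * b powr p"
proof -
  have "1 / p + 1 / (p / (p - 1)) = 1" "p / (p - 1) > 1"
    using assms by (simp_all add: field_simps)
  then have "a * b powr (p - 1) \<le> a powr p / p + (b powr (p - 1)) powr (p / (p - 1)) / (p / (p - 1))"
    using assms by (intro Youngs_inequality) auto
  also have "(b powr (p - 1)) powr (p / (p - 1)) = b powr p"
    using assms by (simp add: powr_powr)
  finally show ?thesis
    using assms by (simp add: field_simps)
qed

lemma borel_measurable_ennreal_indicator:
  fixes F :: "'a::topological_space \<Rightarrow> real"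
  assumes "S \<in> sets borel" "continuous_on S F"
  shows "(\<lambda>z. ennreal (F z) * indicator S z) \<in> borel_measurable borel"
proof -
  have "(\<lambda>z. ennreal (indicator S z *\<^sub>R F z)) \<in> borel_measurable borel"
    using borel_measurable_continuous_on_indicator[OF assms] by simp
  also have "(\<lambda>z. ennreal (indicator S z *\<^sub>R F z)) = (\<lambda>z. ennreal (F z) * indicator S z)"
    by (auto simp: indicator_def)
  finally show ?thesis .
qed

text \<open>Cauchy's formula for w \<mapsto> f(c + w*u) on the unit circle. The radius enters
  through an arbitrary vector u rather than a number, so that the inequality can afterwards be
  integrated over u.\<close>

lemma circle_mean_ineq:
  assumes "f holomorphic_on ball c r" and "cmod u < r"
  shows "ennreal (2 * pi * cmod (f c))
    \<le> (\<integral>\<^sup>+ t. ennreal (cmod (f (c + cis t * u))) * indicator {0..2 * pi} t \<partial>lborel)"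
proof -
  define \<psi> where "\<psi> w = f (c + w * u)" for w
  have img: "(\<lambda>w. c + w * u) ` cball 0 1 \<subseteq> ball c r"
  proof (rule image_subsetI)
    fix w :: complex assume "w \<in> cball 0 1"
    then have "cmod w * cmod u \<le> cmod u" by (simp add: mult_left_le_one_le)
    then show "c + w * u \<in> ball c r" using assms(2) by (simp add: norm_mult dist_norm)
  qed
  have "(f \<circ> (\<lambda>w. c + w * u)) holomorphic_on cball 0 1"
    by (rule holomorphic_on_compose_gen[OF _ assms(1) img]) (intro holomorphic_intros)
  then have hol: "\<psi> holomorphic_on cball 0 1" by (simp add: o_def \<psi>_def[abs_def])
  have "((\<lambda>w. \<psi> w / (w - 0)) has_contour_integral (2 * of_real pi * \<i> * \<psi> 0)) (circlepath 0 1)"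
    by (rule Cauchy_integral_circlepath_simple[OF hol]) simp
  then have "((\<lambda>t. \<psi> (cis t) * \<i>) has_integral (2 * of_real pi * \<i> * \<psi> 0)) {0..2 * pi}"
    unfolding circlepath_def by (subst (asm) has_contour_integral_part_circlepath_iff) (simp_all cong: has_integral_cong)
  then have int: "integral {0..2 * pi} (\<lambda>t. \<psi> (cis t) * \<i>) = 2 * of_real pi * \<i> * \<psi> 0"
    and intg: "(\<lambda>t. \<psi> (cis t) * \<i>) integrable_on {0..2 * pi}"
    by (auto simp: has_integral_iff)
  have "continuous_on {0..2 * pi} (\<lambda>t. \<psi> (cis t))"
    by (rule continuous_on_compose2[OF holomorphic_on_imp_continuous_on[OF hol]])
      (auto intro!: continuous_intros)
  then have "continuous_on {0..2 * pi} (\<lambda>t. cmod (\<psi> (cis t)))"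
    by (intro continuous_intros)
  then have intn: "(\<lambda>t. cmod (\<psi> (cis t))) integrable_on {0..2 * pi}"
    by (rule integrable_continuous_interval)
  have "2 * pi * cmod (f c) = cmod (integral {0..2 * pi} (\<lambda>t. \<psi> (cis t) * \<i>))"
    unfolding int by (simp add: norm_mult \<psi>_def)
  also have "\<dots> \<le> integral {0..2 * pi} (\<lambda>t. cmod (\<psi> (cis t)))"
    by (rule integral_norm_bound_integral[OF intg intn]) (simp add: norm_mult)
  finally have "ennreal (2 * pi * cmod (f c)) \<le> ennreal (integral {0..2 * pi} (\<lambda>t. cmod (\<psi> (cis t))))"
    by (rule ennreal_leI)
  also have "\<dots> = (\<integral>\<^sup>+ t. ennreal (cmod (\<psi> (cis t))) * indicator {0..2 * pi} t \<partial>lborel)"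
    using intn by (intro nn_integral_has_integral_lebesgue'[symmetric]) (auto simp: has_integral_iff)
  finally show ?thesis by (simp add: \<psi>_def)
qed

text \<open>Polar coordinates are avoided: the circle inequality is integrated over all u in the
  disc, and after Fubini the rotation by \<open>cis t\<close> does not change the inner area
  integral.\<close>

lemma area_mean_ineq:
  assumes "f holomorphic_on ball c r" and "0 < r"
  shows "ennreal (cmod (f c) * (pi * r\<^sup>2)) \<le> (\<integral>\<^sup>+ z. ennreal (cmod (f z)) * indicator (ball c r) z \<partial>lborel)"
proof -
  define h where "h u = ennreal (cmod (f (c + u))) * indicator (ball 0 r) u" for u
  have hmeas [measurable]: "h \<in> borel_measurable borel"
    unfolding h_def
  proof (rule borel_measurable_ennreal_indicator)
    have "continuous_on (ball 0 r) (\<lambda>u. f (c + u))"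
      by (rule continuous_on_compose2[OF holomorphic_on_imp_continuous_on[OF assms(1)]])
        (auto intro: continuous_on_add continuous_on_const continuous_on_id simp: dist_norm)
    then show "continuous_on (ball 0 r) (\<lambda>u. cmod (f (c + u)))"
      by (rule continuous_on_norm)
  qed simp
  have [measurable]: "(\<lambda>(u, t). h (cis t * u) * indicator {0..2 * pi} t) \<in> borel_measurable (lborel \<Otimes>\<^sub>M lborel)"
  proof -
    have [measurable]: "cis \<in> borel_measurable borel"
      by (intro borel_measurable_continuous_onI continuous_intros)
    show ?thesis by measurable
  qed
  have ev: "emeasure lborel (ball (0::complex) r) = ennreal (pi * r\<^sup>2)"
    using assms by (simp add: emeasure_ball unit_ball_vol_2)
  have "ennreal (2 * pi) * ennreal (cmod (f c) * (pi * r\<^sup>2))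
      = (\<integral>\<^sup>+ u. ennreal (2 * pi * cmod (f c)) * indicator (ball (0::complex) r) u \<partial>lborel)"
    by (subst nn_integral_cmult_indicator) (use ev in \<open>simp_all add: mult_ac flip: ennreal_mult'\<close>)
  also have "\<dots> \<le> (\<integral>\<^sup>+ u. \<integral>\<^sup>+ t. h (cis t * u) * indicator {0..2 * pi} t \<partial>lborel \<partial>lborel)"
  proof (rule nn_integral_mono)
    fix u :: complex
    show "ennreal (2 * pi * cmod (f c)) * indicator (ball 0 r) u
        \<le> (\<integral>\<^sup>+ t. h (cis t * u) * indicator {0..2 * pi} t \<partial>lborel)"
      using circle_mean_ineq[OF assms(1), of u] by (auto simp: h_def indicator_def norm_mult)
  qed
  also have "\<dots> = (\<integral>\<^sup>+ t. \<integral>\<^sup>+ u. h (cis t * u) * indicator {0..2 * pi} t \<partial>lborel \<partial>lborel)"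
    by (rule lborel_pair.Fubini'[of "\<lambda>t u. h (cis t * u) * indicator {0..2 * pi} t"])
       (simp add: case_prod_unfold)
  also have "\<dots> = (\<integral>\<^sup>+ t. (\<integral>\<^sup>+ u. h u \<partial>lborel) * indicator {0..2 * pi} t \<partial>lborel)"
  \<comment> \<open>The angle \<open>pi\<close> is not covered by the three shears; it is a single
    point and drops out almost everywhere.\<close>
  proof (rule nn_integral_cong_AE)
    have "AE t in lborel. t \<noteq> pi" by (rule AE_lborel_singleton)
    then show "AE t in lborel. (\<integral>\<^sup>+ u. h (cis t * u) * indicator {0..2 * pi} t \<partial>lborel)
        = (\<integral>\<^sup>+ u. h u \<partial>lborel) * indicator {0..2 * pi} t"
    proof eventually_elim
      case (elim t)
      have "cos (t / 2) \<noteq> 0" if "t \<in> {0..2 * pi}"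
      proof
        assume "cos (t / 2) = 0"
        moreover have "0 \<le> t / 2" "t / 2 \<le> pi" using that by auto
        ultimately have "t / 2 = pi / 2"
          using cos_inj_pi[of "t / 2" "pi / 2"] by (simp add: cos_pi_half)
        then show False using elim by simp
      qed
      then show ?case
        using nn_integral_lborel_rotate[of h t] by (auto simp: indicator_def)
    qed
  qed
  also have "\<dots> = (\<integral>\<^sup>+ u. h u \<partial>lborel) * ennreal (2 * pi)"
    by (simp add: nn_integral_cmult_indicator)
  also have "(\<integral>\<^sup>+ u. h u \<partial>lborel) = (\<integral>\<^sup>+ z. ennreal (cmod (f z)) * indicator (ball c r) z \<partial>lborel)"
  proof -
    have hm: "(\<lambda>z. ennreal (cmod (f z)) * indicator (ball c r) z) \<in> borel_measurable borel"
      using assms(1) by (intro borel_measurable_ennreal_indicator continuous_on_norm holomorphic_on_imp_continuous_on) auto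
    have "(\<integral>\<^sup>+ z. ennreal (cmod (f z)) * indicator (ball c r) z \<partial>lborel)
       = (\<integral>\<^sup>+ z. ennreal (cmod (f z)) * indicator (ball c r) z \<partial>distr lborel borel ((+) c))"
      by (simp add: lborel_distr_plus)
    also have "\<dots> = (\<integral>\<^sup>+ u. h u \<partial>lborel)"
      by (subst nn_integral_distr) (use hm in \<open>auto simp: h_def indicator_def dist_norm intro!: nn_integral_cong\<close>)
    finally show ?thesis ..
  qed
  finally have "ennreal (2 * pi) * ennreal (cmod (f c) * (pi * r\<^sup>2))
    \<le> ennreal (2 * pi) * (\<integral>\<^sup>+ z. ennreal (cmod (f z)) * indicator (ball c r) z \<partial>lborel)"
    by (simp add: mult.commute)
  then show ?thesis
    by (subst (asm) ennreal_mult_le_mult_iff) auto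
qed

section \<open>Normalized area measure and submeans of powers\<close>

lemma sets_disc_area [simp, measurable_cong]: "sets disc_area = sets borel"
  by (simp add: disc_area_def)

lemma space_disc_area [simp]: "space disc_area = UNIV"
  by (simp add: disc_area_def)

lemma emeasure_lborel_unit_disc: "emeasure lborel unit_disc = ennreal pi"
  by (simp add: emeasure_ball unit_ball_vol_2)

lemma nn_integral_disc_area:
  assumes "f \<in> borel_measurable borel"
  shows "ennreal pi * (\<integral>\<^sup>+ z. f z \<partial>disc_area) = (\<integral>\<^sup>+ z. f z * indicator unit_disc z \<partial>lborel)"
proof -
  have "(\<integral>\<^sup>+ z. f z \<partial>disc_area) = (\<integral>\<^sup>+ z. f z * indicator unit_disc z \<partial>lborel) / ennreal pi"
    using assms unfolding disc_area_def
    by (subst nn_integral_uniform_measure) (simp_all only: emeasure_lborel_unit_disc, auto)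
  then show ?thesis
    by (simp add: ennreal_times_divide mult.commute[of "ennreal pi"] mult_divide_eq_ennreal)
qed

lemma emeasure_disc_area:
  "B \<in> sets borel \<Longrightarrow> emeasure disc_area B = emeasure lborel (unit_disc \<inter> B) / ennreal pi"
  unfolding disc_area_def
  by (subst emeasure_uniform_measure) (simp_all add: emeasure_lborel_unit_disc)

lemma emeasure_disc_area_UNIV [simp]: "emeasure disc_area UNIV = 1"
  by (simp add: emeasure_disc_area emeasure_lborel_unit_disc divide_ennreal)

interpretation disc_area: finite_measure disc_area
  by (rule finite_measureI) simp

lemma emeasure_disc_area_ball_le:
  assumes "0 \<le> r" shows "emeasure disc_area (ball c r) \<le> ennreal (r\<^sup>2)"
proof -
  have "emeasure lborel (unit_disc \<inter> ball c r) \<le> emeasure lborel (ball c r)"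
    by (intro emeasure_mono) auto
  also have "\<dots> = ennreal (r\<^sup>2) * ennreal pi"
    using assms by (simp add: emeasure_ball unit_ball_vol_2 mult.commute flip: ennreal_mult')
  finally show ?thesis by (simp add: emeasure_disc_area divide_le_posI_ennreal mult.commute)
qed

lemma emeasure_disc_area_ball:
  assumes "0 \<le> r" "ball c r \<subseteq> unit_disc" shows "emeasure disc_area (ball c r) = ennreal (r\<^sup>2)"
proof -
  have "unit_disc \<inter> ball c r = ball c r" using assms by auto
  then show ?thesis
    using assms by (simp add: emeasure_disc_area emeasure_ball unit_ball_vol_2 divide_ennreal)
qed

lemma borel_measurable_disc:
  fixes F :: "complex \<Rightarrow> real"
  assumes "continuous_on unit_disc F"
  shows "(\<lambda>z. ennreal (F z) * indicator unit_disc z) \<in> borel_measurable borel"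
  using assms by (intro borel_measurable_ennreal_indicator) auto

text \<open>Jensen's inequality on the ball, by the tangent of x^p at |f(c)|:
  \<open>c1 * |f(z)|\<close> is at most \<open>|f(z)| powr p + c2\<close>. Integrating and inserting
  the submean property for |f| leaves the summand \<open>c2 * r^2\<close> on both sides, where it
  cancels.\<close>

lemma area_submean_powr:
  assumes hol: "f holomorphic_on unit_disc" and sub: "ball c r \<subseteq> unit_disc" and "0 < r" and "1 < p"
  shows "ennreal (cmod (f c) powr p * r\<^sup>2)
    \<le> (\<integral>\<^sup>+ z \<in> ball c r. ennreal (cmod (f z) powr p) \<partial>disc_area)"
proof -
  define X where "X = cmod (f c)"
  have X: "0 \<le> X" by (simp add: X_def)
  have holb: "f holomorphic_on ball c r" using hol sub by (rule holomorphic_on_subset)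
  have cont: "continuous_on (ball c r) (\<lambda>z. cmod (f z))"
    by (intro continuous_on_norm holomorphic_on_imp_continuous_on holb)
  have m1: "(\<lambda>z. ennreal (cmod (f z)) * indicator (ball c r) z) \<in> borel_measurable borel"
    by (rule borel_measurable_ennreal_indicator[OF _ cont]) simp
  have mp: "(\<lambda>z. ennreal (cmod (f z) powr p) * indicator (ball c r) z) \<in> borel_measurable borel"
    by (rule borel_measurable_ennreal_indicator) (use cont \<open>1 < p\<close> in \<open>auto intro!: continuous_on_powr'\<close>)
  have ind: "indicator (ball c r) z * indicator unit_disc z = (indicator (ball c r) z :: ennreal)" for z
    using sub by (auto split: split_indicator)
  have "ennreal pi * ennreal (X * r\<^sup>2) = ennreal (cmod (f c) * (pi * r\<^sup>2))"
    by (simp add: X_def mult_ac flip: ennreal_mult')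
  also have "\<dots> \<le> ennreal pi * (\<integral>\<^sup>+ z \<in> ball c r. ennreal (cmod (f z)) \<partial>disc_area)"
    using area_mean_ineq[OF holb \<open>0 < r\<close>] by (simp add: nn_integral_disc_area[OF m1] mult.assoc ind)
  finally have one: "ennreal (X * r\<^sup>2) \<le> (\<integral>\<^sup>+ z \<in> ball c r. ennreal (cmod (f z)) \<partial>disc_area)"
    by (subst (asm) ennreal_mult_le_mult_iff) auto
  define c1 where "c1 = p * X powr (p - 1)"
  define c2 where "c2 = (p - 1) * X powr p"
  have c: "0 \<le> c1" "0 \<le> c2" using \<open>1 < p\<close> by (auto simp: c1_def c2_def)
  have c1X: "c1 * X = X powr p + c2"
    using X \<open>1 < p\<close> by (cases "X = 0") (auto simp: c1_def c2_def powr_diff algebra_simps)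
  have "ennreal (X powr p * r\<^sup>2) + ennreal (c2 * r\<^sup>2) = ennreal (c1 * (X * r\<^sup>2))"
    using c c1X by (simp add: distrib_right flip: ennreal_plus mult.assoc)
  also have "\<dots> = ennreal c1 * ennreal (X * r\<^sup>2)" using c X by (simp add: ennreal_mult)
  also have "\<dots> \<le> ennreal c1 * (\<integral>\<^sup>+ z \<in> ball c r. ennreal (cmod (f z)) \<partial>disc_area)"
    by (rule mult_left_mono[OF one]) simp
  also have "\<dots> = (\<integral>\<^sup>+ z \<in> ball c r. ennreal (c1 * cmod (f z)) \<partial>disc_area)"
    using m1 c by (subst nn_integral_cmult[symmetric]) (auto simp: ennreal_mult mult.assoc)
  also have "\<dots> \<le> (\<integral>\<^sup>+ z. ennreal (cmod (f z) powr p) * indicator (ball c r) z + ennreal c2 * indicator (ball c r) z \<partial>disc_area)"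
    using young_powr[OF \<open>1 < p\<close> _ X, of "cmod (f _)"] c
    by (intro nn_integral_mono) (auto simp: c1_def c2_def mult_ac intro!: ennreal_leI simp flip: ennreal_plus split: split_indicator)
  also have "\<dots> = (\<integral>\<^sup>+ z \<in> ball c r. ennreal (cmod (f z) powr p) \<partial>disc_area) + ennreal c2 * emeasure disc_area (ball c r)"
  proof -
    have "(\<lambda>z. ennreal c2 * indicator (ball c r) z) \<in> borel_measurable disc_area"
      by (intro borel_measurable_times_ennreal borel_measurable_const borel_measurable_indicator) simp
    then show ?thesis using mp by (subst nn_integral_add) (simp_all add: nn_integral_cmult_indicator)
  qed
  also have "\<dots> = (\<integral>\<^sup>+ z \<in> ball c r. ennreal (cmod (f z) powr p) \<partial>disc_area) + ennreal (c2 * r\<^sup>2)"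
    using c \<open>0 < r\<close> sub by (simp add: emeasure_disc_area_ball ennreal_mult)
  finally show ?thesis by (simp add: X_def)
qed

subsection \<open>Poisson kernels and Carleson boxes\<close>

text \<open>For |z| = 1 this is the classical Poisson kernel at a; here it is used for z inside the
  disc.\<close>

definition poisson :: "complex \<Rightarrow> complex \<Rightarrow> real"
  where "poisson a z = (1 - (cmod a)\<^sup>2) / (cmod (1 - cnj a * z))\<^sup>2"

lemma norm_sq_diff_prod:
  "(cmod (1 - cnj a * z))\<^sup>2 - (cmod (a - z))\<^sup>2 = (1 - (cmod a)\<^sup>2) * (1 - (cmod z)\<^sup>2)"
  by (simp add: cmod_power2 algebra_simps) (simp add: power2_eq_square algebra_simps)

lemma one_minus_cnj_mult_ge: "cmod a \<le> 1 \<Longrightarrow> 1 - cmod z \<le> cmod (1 - cnj a * z)"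
proof -
  assume "cmod a \<le> 1"
  then have "cmod (cnj a * z) \<le> cmod z" by (simp add: norm_mult mult_left_le_one_le)
  then show ?thesis using norm_triangle_ineq2[of 1 "cnj a * z"] by simp
qed

lemma one_minus_cnj_mult_pos: "cmod a \<le> 1 \<Longrightarrow> cmod z < 1 \<Longrightarrow> 0 < cmod (1 - cnj a * z)"
  using one_minus_cnj_mult_ge[of a z] by linarith

lemma one_minus_disc_aut:
  assumes "cmod a \<le> 1" "cmod z < 1"
  shows "1 - (cmod (disc_aut a z))\<^sup>2 = (1 - (cmod z)\<^sup>2) * poisson a z"
  using one_minus_cnj_mult_pos[OF assms] norm_sq_diff_prod[of a z]
  by (auto simp: disc_aut_def poisson_def norm_divide power_divide field_simps)

lemma poisson_nonneg: "cmod a \<le> 1 \<Longrightarrow> 0 \<le> poisson a z"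
  by (simp add: poisson_def abs_square_le_1)

text \<open>The exponent is p - 1 and not p - 2, because 1 - |\<open>disc_aut a z\<close>|^2 equals
  (1 - |z|^2) times \<open>poisson a z\<close>. After this regrouping the point a occurs only in the
  kernel, and the \<open>BMOA p\<close> integrals are Poisson integrals of one fixed
  measure.\<close>

definition bmoa_density :: "real \<Rightarrow> (complex \<Rightarrow> complex) \<Rightarrow> complex \<Rightarrow> real"
  where "bmoa_density p f z = cmod (deriv f z) powr p * (1 - (cmod z)\<^sup>2) powr (p - 1)"

lemma bmoa_density_nonneg [simp]: "0 \<le> bmoa_density p f z"
  by (simp add: bmoa_density_def)

lemma bmoa_integral_eq:
  assumes "a \<in> unit_disc"
  shows "bmoa_integral p f a = (\<integral>\<^sup>+ z \<in> unit_disc. ennreal (bmoa_density p f z * poisson a z) \<partial>disc_area)"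
  unfolding bmoa_integral_def
proof (intro nn_integral_cong)
  fix z
  have "cmod (deriv f z) powr p * (1 - (cmod z)\<^sup>2) powr (p - 2) * (1 - (cmod (disc_aut a z))\<^sup>2)
      = bmoa_density p f z * poisson a z" if z: "z \<in> unit_disc"
  proof -
    have pos: "0 < 1 - (cmod z)\<^sup>2" using z by (simp add: abs_square_less_1)
    have "(1 - (cmod z)\<^sup>2) powr (p - 1) = (1 - (cmod z)\<^sup>2) powr (p - 2) * (1 - (cmod z)\<^sup>2)"
      using pos powr_add[of "1 - (cmod z)\<^sup>2" "p - 2" 1] by simp
    then show ?thesis
      using one_minus_disc_aut[of a z] assms z by (simp add: bmoa_density_def)
  qed
  then show "ennreal (cmod (deriv f z) powr p * (1 - (cmod z)\<^sup>2) powr (p - 2) * (1 - (cmod (disc_aut a z))\<^sup>2)) * indicator unit_disc z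
    = ennreal (bmoa_density p f z * poisson a z) * indicator unit_disc z"
    by (auto split: split_indicator)
qed

lemma continuous_on_poisson: "cmod a \<le> 1 \<Longrightarrow> continuous_on unit_disc (poisson a)"
  unfolding poisson_def
  using one_minus_cnj_mult_pos[of a] by (intro continuous_intros) fastforce

lemma continuous_on_bmoa_density:
  assumes "f holomorphic_on unit_disc" "1 < p"
  shows "continuous_on unit_disc (bmoa_density p f)"
proof -
  have "continuous_on unit_disc (deriv f)"
    using assms by (intro holomorphic_on_imp_continuous_on holomorphic_deriv) auto
  then show ?thesis unfolding bmoa_density_def
    using assms by (intro continuous_intros continuous_on_powr') (auto simp: abs_square_le_1)
qed

lemma le_suminf_ennreal: "f n \<le> (\<Sum>n. f n)" for f :: "nat \<Rightarrow> ennreal"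
  using sum_le_suminf[OF summableI, of "{n}" f] by simp

lemma suminf_ennreal_geometric:
  assumes "0 \<le> c" "0 \<le> r" "r < 1"
  shows "(\<Sum>n. ennreal (c * r ^ n)) = ennreal (c / (1 - r))"
proof (rule suminf_ennreal_eq)
  show "(\<lambda>n. c * r ^ n) sums (c / (1 - r))"
    using sums_mult[OF geometric_sums[of r], of c] assms by simp
qed (use assms in auto)

text \<open>The common frame of the dyadic estimates: a pointwise majorant made of indicators,
  together with one mass bound for each set.\<close>

lemma nn_integral_le_suminf:
  assumes M: "sets M = sets borel"
    and B: "\<And>n. B n \<in> sets borel"
    and le: "\<And>z. f z \<le> (\<Sum>n. ennreal (c n) * indicator (B n) z)"
    and em: "\<And>n. ennreal (c n) * emeasure M (B n) \<le> K * ennreal (d n)"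
  shows "(\<integral>\<^sup>+ z. f z \<partial>M) \<le> K * (\<Sum>n. ennreal (d n))"
proof -
  have "(\<integral>\<^sup>+ z. f z \<partial>M) \<le> (\<integral>\<^sup>+ z. (\<Sum>n. ennreal (c n) * indicator (B n) z) \<partial>M)"
    by (intro nn_integral_mono le)
  also have "\<dots> = (\<Sum>n. \<integral>\<^sup>+ z. ennreal (c n) * indicator (B n) z \<partial>M)"
    using M B by (intro nn_integral_suminf borel_measurable_times_ennreal borel_measurable_const borel_measurable_indicator) simp
  also have "\<dots> = (\<Sum>n. ennreal (c n) * emeasure M (B n))"
    using M B by (simp add: nn_integral_cmult_indicator)
  also have "\<dots> \<le> (\<Sum>n. K * ennreal (d n))"
    by (intro suminf_le em summableI)
  finally show ?thesis by simp
qed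

text \<open>The centre \<open>(1 - h) \<zeta>\<close> of the Poisson kernel is adapted to the Carleson box \<open>ball \<zeta> h\<close>.\<close>

lemma dist_box_le:
  assumes "cmod \<zeta> = 1" "cmod z < 1" "0 \<le> h" "h \<le> 1" "a = of_real (1 - h) * \<zeta>"
  shows "h \<le> cmod (1 - cnj a * z)" "cmod (z - \<zeta>) \<le> 2 * cmod (1 - cnj a * z)"
    "cmod (1 - cnj a * z) \<le> cmod (z - \<zeta>) + h" "cmod a = 1 - h"
proof -
  show a: "cmod a = 1 - h" using assms by (simp add: norm_mult del: of_real_diff)
  have "cmod (cnj a * z) \<le> cmod a" using assms by (simp add: norm_mult mult_left_le)
  then show h: "h \<le> cmod (1 - cnj a * z)"
    using norm_triangle_ineq2[of 1 "cnj a * z"] a by simp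
  have zz: "cnj \<zeta> * \<zeta> = 1" using assms(1) by (simp add: complex_norm_square[symmetric] mult.commute)
  have "cmod (z - \<zeta>) = cmod (cnj \<zeta> * (z - \<zeta>))" using assms(1) by (simp add: norm_mult)
  also have "cnj \<zeta> * (z - \<zeta>) = - (1 - cnj \<zeta> * z)" using zz by (simp add: algebra_simps)
  finally have x: "cmod (z - \<zeta>) = cmod (1 - cnj \<zeta> * z)" by (simp add: norm_minus_commute)
  have d: "cmod (of_real h * cnj \<zeta> * z) \<le> h"
    using assms by (simp add: norm_mult mult_left_le)
  have e: "1 - cnj a * z = (1 - cnj \<zeta> * z) + of_real h * cnj \<zeta> * z"
    by (simp add: assms(5) algebra_simps)
  show "cmod (1 - cnj a * z) \<le> cmod (z - \<zeta>) + h"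
    unfolding e x using norm_triangle_ineq[of "1 - cnj \<zeta> * z" "of_real h * cnj \<zeta> * z"] d by simp
  have "cmod (1 - cnj \<zeta> * z) \<le> cmod (1 - cnj a * z) + h"
    unfolding e using norm_triangle_ineq4[of "(1 - cnj \<zeta> * z) + of_real h * cnj \<zeta> * z" "of_real h * cnj \<zeta> * z"] d by simp
  then show "cmod (z - \<zeta>) \<le> 2 * cmod (1 - cnj a * z)" using h x by simp
qed

text \<open>On the box |1 - cnj a * z| is at most 2*h while 1 - |a|^2 is at least h, so the kernel
  has height of order 1/h.\<close>

lemma poisson_ge:
  assumes "cmod \<zeta> = 1" "cmod z < 1" "0 < h" "h \<le> 1" "a = of_real (1 - h) * \<zeta>" "cmod (z - \<zeta>) < h"
  shows "1 / (4 * h) \<le> poisson a z"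
proof -
  note d = dist_box_le[OF assms(1,2) _ assms(4,5)]
  have "(cmod (1 - cnj a * z))\<^sup>2 \<le> (2 * h)\<^sup>2" using d assms by (intro power_mono) auto
  moreover have "0 < (cmod (1 - cnj a * z))\<^sup>2" using d(1) assms by (intro zero_less_power) auto
  moreover have "h * 1 \<le> h * (2 - h)" using assms by (intro mult_left_mono) auto
  then have "h \<le> 1 - (cmod a)\<^sup>2" unfolding d(4)[OF less_imp_le[OF assms(3)]] by (simp add: power2_eq_square algebra_simps)
  ultimately have "h / (2 * h)\<^sup>2 \<le> poisson a z"
    unfolding poisson_def using assms by (intro frac_le) auto
  then show ?thesis using assms(3) by (simp add: power2_eq_square field_simps)
qed

lemma poisson_le:
  assumes "cmod \<zeta> = 1" "cmod z < 1" "0 < h" "h \<le> 1" "a = of_real (1 - h) * \<zeta>"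
  shows "poisson a z \<le> 2 / h" "\<delta> > 0 \<Longrightarrow> \<delta> \<le> cmod (z - \<zeta>) \<Longrightarrow> poisson a z \<le> 8 * h / \<delta>\<^sup>2"
proof -
  note d = dist_box_le[OF assms(1,2) _ assms(4,5)]
  have a: "1 - (cmod a)\<^sup>2 \<le> 2 * h" "0 \<le> 1 - (cmod a)\<^sup>2"
    unfolding d(4)[OF less_imp_le[OF assms(3)]] using assms(3,4) by (simp_all add: power2_eq_square algebra_simps mult_left_le)
  have *: "poisson a z \<le> 2 * h / s\<^sup>2" if "0 < s" "s \<le> cmod (1 - cnj a * z)" for s
    unfolding poisson_def using a that by (intro frac_le power_mono) auto
  show "poisson a z \<le> 2 / h"
    using *[of h] d(1) assms by (simp add: power2_eq_square)
  show "poisson a z \<le> 8 * h / \<delta>\<^sup>2" if "\<delta> > 0" "\<delta> \<le> cmod (z - \<zeta>)"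
    using *[of "\<delta> / 2"] d(2) that assms by (simp add: power2_eq_square)
qed

lemma box_le_poisson_integral:
  assumes M: "sets M = sets borel"
    and z: "cmod \<zeta> = 1" "0 < h" "h \<le> 1" "a = of_real (1 - h) * \<zeta>"
  shows "emeasure M (ball \<zeta> h \<inter> unit_disc) \<le> ennreal (4 * h) * (\<integral>\<^sup>+ z \<in> unit_disc. ennreal (poisson a z) \<partial>M)"
proof -
  have m: "(\<lambda>z. ennreal (poisson a z) * indicator unit_disc z) \<in> borel_measurable M"
    using M borel_measurable_disc[OF continuous_on_poisson[of a]] dist_box_le(4)[OF z(1) _ _ z(3,4), of 0] z
    by (simp add: measurable_cong_sets[OF M])
  have "emeasure M (ball \<zeta> h \<inter> unit_disc) = (\<integral>\<^sup>+ z. indicator (ball \<zeta> h \<inter> unit_disc) z \<partial>M)"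
    using M by (subst nn_integral_indicator) auto
  also have "\<dots> \<le> (\<integral>\<^sup>+ z. ennreal (4 * h) * (ennreal (poisson a z) * indicator unit_disc z) \<partial>M)"
  proof (intro nn_integral_mono)
    fix w
    have "1 \<le> 4 * h * poisson a w" if "w \<in> ball \<zeta> h \<inter> unit_disc"
      using poisson_ge[OF z(1) _ z(2-4), of w] that z(2) by (simp add: dist_norm norm_minus_commute field_simps)
    then have "1 \<le> ennreal (4 * h) * ennreal (poisson a w)" if "w \<in> ball \<zeta> h \<inter> unit_disc"
      using that z(2) by (simp flip: ennreal_mult' ennreal_1)
    then show "indicator (ball \<zeta> h \<inter> unit_disc) w \<le> ennreal (4 * h) * (ennreal (poisson a w) * indicator unit_disc w)"
      by (auto split: split_indicator)
  qed
  also have "\<dots> = ennreal (4 * h) * (\<integral>\<^sup>+ z \<in> unit_disc. ennreal (poisson a z) \<partial>M)"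
    by (rule nn_integral_cmult[OF m])
  finally show ?thesis .
qed

text \<open>Cover the disc by the balls of radius 2^n * h about \<zeta>. Where the n-th one is first
  needed the kernel is at most 32/h * 4^(-n), and its mass is at most K * 2^n * h; the products sum
  to 64*K. Only boxes centred at the same \<zeta> are involved.\<close>

lemma poisson_integral_le_box:
  assumes M: "sets M = sets borel"
    and z: "cmod \<zeta> = 1" "0 < h" "h \<le> 1" "a = of_real (1 - h) * \<zeta>"
    and box: "\<And>u. 0 < u \<Longrightarrow> emeasure M (ball \<zeta> u) \<le> K * ennreal u"
  shows "(\<integral>\<^sup>+ z \<in> unit_disc. ennreal (poisson a z) \<partial>M) \<le> K * 64"
proof -
  have "(\<integral>\<^sup>+ z \<in> unit_disc. ennreal (poisson a z) \<partial>M) \<le> K * (\<Sum>n. ennreal (32 * (1 / 2) ^ n))"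
  proof (rule nn_integral_le_suminf[where B = "\<lambda>n. ball \<zeta> (2 ^ n * h)" and c = "\<lambda>n. 32 / h * (1 / 4) ^ n"])
    fix w
    show "ennreal (poisson a w) * indicator unit_disc w
      \<le> (\<Sum>n. ennreal (32 / h * (1 / 4) ^ n) * indicator (ball \<zeta> (2 ^ n * h)) w)"
    proof (cases "w \<in> unit_disc")
      case True
      then have w: "cmod w < 1" by simp
      have "\<exists>n::nat. cmod (w - \<zeta>) < 2 ^ n * h"
        using real_arch_pow[of 2 "cmod (w - \<zeta>) / h"] z(2) by (auto simp: field_simps)
      define n where "n = (LEAST n::nat. cmod (w - \<zeta>) < 2 ^ n * h)"
      have n: "cmod (w - \<zeta>) < 2 ^ n * h"
        unfolding n_def by (rule LeastI_ex) fact
      have "poisson a w \<le> 32 / h * (1 / 4) ^ n"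
      proof (cases n)
        case 0
        have "2 / h \<le> 32 / h" using z(2) by (intro divide_right_mono) auto
        then show ?thesis using poisson_le(1)[OF z(1) w z(2-4)] 0 by simp
      next
        case (Suc m)
        have "\<not> cmod (w - \<zeta>) < 2 ^ m * h"
          using not_less_Least[of m "\<lambda>n. cmod (w - \<zeta>) < 2 ^ n * h"] Suc by (simp add: n_def)
        then have "poisson a w \<le> 8 * h / (2 ^ m * h)\<^sup>2"
          using z(2) by (intro poisson_le(2)[OF z(1) w z(2-4)]) auto
        also have "\<dots> = 32 / h * (1 / 4) ^ n"
          using z(2) Suc by (simp add: power2_eq_square power_mult_distrib[symmetric] field_simps)
        finally show ?thesis .
      qed
      then have "ennreal (poisson a w) * indicator unit_disc w
          \<le> ennreal (32 / h * (1 / 4) ^ n) * indicator (ball \<zeta> (2 ^ n * h)) w"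
        using n True by (auto simp: dist_norm norm_minus_commute intro!: ennreal_leI)
      also have "\<dots> \<le> (\<Sum>n. ennreal (32 / h * (1 / 4) ^ n) * indicator (ball \<zeta> (2 ^ n * h)) w)"
        by (rule le_suminf_ennreal)
      finally show ?thesis .
    qed simp
  next
    fix n
    have "ennreal (32 / h * (1 / 4) ^ n) * emeasure M (ball \<zeta> (2 ^ n * h))
        \<le> ennreal (32 / h * (1 / 4) ^ n) * (K * ennreal (2 ^ n * h))"
      using z(2) by (intro mult_left_mono box) auto
    also have "\<dots> = K * (ennreal (32 / h * (1 / 4) ^ n) * ennreal (2 ^ n * h))"
      by (simp add: mult_ac)
    also have "ennreal (32 / h * (1 / 4) ^ n) * ennreal (2 ^ n * h) = ennreal (32 * (1 / 2) ^ n)"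
      using z(2) by (subst ennreal_mult[symmetric]) (auto simp: field_simps power_mult_distrib[symmetric] simp flip: power_mult_distrib)
    finally show "ennreal (32 / h * (1 / 4) ^ n) * emeasure M (ball \<zeta> (2 ^ n * h)) \<le> K * ennreal (32 * (1 / 2) ^ n)" .
  qed (use M in auto)
  also have "\<dots> = K * 64" by (subst suminf_ennreal_geometric) simp_all
  finally show ?thesis .
qed

text \<open>Dyadic rings about c: from one ring to the next the integrand grows by 2^e and the area
  shrinks by 4, so the series converges exactly for e < 2.\<close>

lemma nn_integral_inverse_powr_ball:
  assumes "0 \<le> e" "e < 2" "0 < h"
  shows "(\<integral>\<^sup>+ z \<in> ball c h. ennreal (cmod (z - c) powr (- e)) \<partial>disc_area)
    \<le> ennreal (2 powr e / (1 - 2 powr (e - 2)) * h powr (2 - e))"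
proof -
  have r: "0 \<le> 2 powr (e - 2)" "2 powr (e - 2) < (1::real)"
    using assms by (auto simp: powr_less_one)
  have "(\<integral>\<^sup>+ z \<in> ball c h. ennreal (cmod (z - c) powr (- e)) \<partial>disc_area)
     \<le> 1 * (\<Sum>n. ennreal (2 powr e * h powr (2 - e) * (2 powr (e - 2)) ^ n))"
  proof (rule nn_integral_le_suminf[where B = "\<lambda>n. ball c ((1 / 2) ^ n * h)" and c = "\<lambda>n. ((1 / 2) ^ Suc n * h) powr (- e)"])
    fix w
    show "ennreal (cmod (w - c) powr (- e)) * indicator (ball c h) w
      \<le> (\<Sum>n. ennreal (((1 / 2) ^ Suc n * h) powr (- e)) * indicator (ball c ((1 / 2) ^ n * h)) w)"
    proof (cases "w \<in> ball c h \<and> w \<noteq> c")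
      case True
      then have w: "cmod (w - c) < h" "0 < cmod (w - c)" by (auto simp: dist_norm norm_minus_commute)
      have "\<exists>n::nat. (1 / 2) ^ n * h \<le> cmod (w - c)"
        using real_arch_pow_inv[of "cmod (w - c) / h" "1 / 2"] w assms(3) by (auto simp: field_simps intro: less_imp_le)
      \<comment> \<open>The least such index is positive because w lies inside the ball. Its
        predecessor n gives the ring: the distance is below 2^(-n) * h but at least 2^(-n-1) * h,
        whence the \<open>Suc n\<close> in the coefficients.\<close>
      define m where "m = (LEAST n::nat. (1 / 2) ^ n * h \<le> cmod (w - c))"
      have m: "(1 / 2) ^ m * h \<le> cmod (w - c)"
        unfolding m_def by (rule LeastI_ex) fact
      have "m \<noteq> 0"
      proof
        assume "m = 0" then show False using m w by simp
      qed
      then obtain n where n: "m = Suc n" by (cases m) auto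
      have "\<not> (1 / 2) ^ n * h \<le> cmod (w - c)"
        using not_less_Least[of n "\<lambda>n. (1 / 2) ^ n * h \<le> cmod (w - c)"] n by (simp add: m_def)
      moreover have "cmod (w - c) powr (- e) \<le> ((1 / 2) ^ Suc n * h) powr (- e)"
        using m n assms by (intro powr_mono2') auto
      ultimately have "ennreal (cmod (w - c) powr (- e)) * indicator (ball c h) w
         \<le> ennreal (((1 / 2) ^ Suc n * h) powr (- e)) * indicator (ball c ((1 / 2) ^ n * h)) w"
        using True by (auto simp: dist_norm norm_minus_commute intro!: ennreal_leI)
      also have "\<dots> \<le> (\<Sum>n. ennreal (((1 / 2) ^ Suc n * h) powr (- e)) * indicator (ball c ((1 / 2) ^ n * h)) w)"
        by (rule le_suminf_ennreal)
      finally show ?thesis .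
    qed (auto split: split_indicator)
  next
    fix n
    have "ennreal (((1 / 2) ^ Suc n * h) powr (- e)) * emeasure disc_area (ball c ((1 / 2) ^ n * h))
      \<le> ennreal (((1 / 2) ^ Suc n * h) powr (- e)) * ennreal (((1 / 2) ^ n * h)\<^sup>2)"
      using assms by (intro mult_left_mono emeasure_disc_area_ball_le) auto
    also have "\<dots> = ennreal (((1 / 2) ^ Suc n * h) powr (- e) * ((1 / 2) ^ n * h)\<^sup>2)"
      using assms by (subst ennreal_mult) auto
    also have "((1 / 2) ^ Suc n * h) powr (- e) * ((1 / 2) ^ n * h)\<^sup>2
       = 2 powr e * h powr (2 - e) * (2 powr (e - 2)) ^ n"
    proof -
      define x :: real where "x = (1 / 2) ^ n * h"
      have x: "0 < x" using assms by (simp add: x_def)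
      have "((1 / 2) ^ Suc n * h) powr (- e) * ((1 / 2) ^ n * h)\<^sup>2 = (x / 2) powr (- e) * x powr 2"
        using x by (simp add: x_def)
      also have "\<dots> = 2 powr e * x powr (2 - e)"
        using x by (simp add: powr_divide powr_diff powr_minus field_simps)
      also have "x powr (2 - e) = ((1 / 2) ^ n) powr (2 - e) * h powr (2 - e)"
        using assms by (simp add: x_def powr_mult)
      also have "((1 / 2) ^ n) powr (2 - e) = (2 powr (e - 2)) ^ n"
      proof -
        have "((1 / 2) ^ n :: real) = 2 powr (- real n)"
          by (simp add: powr_minus powr_realpow power_one_over divide_simps)
        then show ?thesis by (simp add: powr_powr algebra_simps flip: powr_realpow)
      qed
      finally show ?thesis by (simp add: mult_ac)
    qed
    finally show "ennreal (((1 / 2) ^ Suc n * h) powr (- e)) * emeasure disc_area (ball c ((1 / 2) ^ n * h))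
      \<le> 1 * ennreal (2 powr e * h powr (2 - e) * (2 powr (e - 2)) ^ n)" by simp
  qed auto
  also have "\<dots> = ennreal (2 powr e / (1 - 2 powr (e - 2)) * h powr (2 - e))"
    using r by (subst suminf_ennreal_geometric) (auto simp: field_simps)
  finally show ?thesis .
qed

section \<open>Chords, arcs and coverings of boxes\<close>

lemma norm_cis_minus_1_sq: "(cmod (cis \<psi> - 1))\<^sup>2 = (2 * sin (\<psi> / 2))\<^sup>2"
proof -
  have "cos \<psi> = 1 - 2 * (sin (\<psi> / 2))\<^sup>2" using cos_double_sin[of "\<psi> / 2"] by simp
  moreover have "(cmod (cis \<psi> - 1))\<^sup>2 = 2 - 2 * cos \<psi>"
    using sin_cos_squared_add[of \<psi>] by (simp add: cmod_power2 power2_diff)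
  ultimately show ?thesis by (simp add: power2_eq_square)
qed

lemma norm_cis_diff_le: "cmod (cis s - cis t) \<le> \<bar>s - t\<bar>"
proof -
  have "cis s - cis t = cis t * (cis (s - t) - 1)"
    by (simp add: right_diff_distrib cis_mult)
  then have eq: "cmod (cis s - cis t) = cmod (cis (s - t) - 1)"
    by (simp add: norm_mult)
  have "\<bar>2 * sin ((s - t) / 2)\<bar> \<le> \<bar>s - t\<bar>"
    using abs_sin_x_le_abs_x[of "(s - t) / 2"] by (simp add: abs_mult)
  then have "(cmod (cis (s - t) - 1))\<^sup>2 \<le> \<bar>s - t\<bar>\<^sup>2"
    unfolding norm_cis_minus_1_sq by (simp only: abs_le_square_iff power2_abs)
  then have "cmod (cis (s - t) - 1) \<le> \<bar>s - t\<bar>" by (rule power2_le_imp_le) simp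
  with eq show ?thesis by simp
qed

text \<open>With y = |\<psi>|/2 \<le> 2 the cubic Taylor bound gives sin y \<ge> y - 4*y/6 = y/3,
  and the chord has length 2 * sin y. The factor 3 is not sharp.\<close>

lemma abs_le_norm_cis_minus_1:
  assumes "\<bar>\<psi>\<bar> \<le> pi" shows "\<bar>\<psi>\<bar> \<le> 3 * cmod (cis \<psi> - 1)"
proof -
  define y where "y = \<bar>\<psi>\<bar> / 2"
  have y: "0 \<le> y" "y \<le> 2" using assms pi_less_4 by (simp_all add: y_def)
  have "\<bar>sin y - (\<Sum>m<3. sin_coeff m * y ^ m)\<bar> \<le> inverse (fact 3) * \<bar>y\<bar> ^ 3"
    by (rule Maclaurin_sin_bound)
  then have "\<bar>sin y - y\<bar> \<le> y * (y * y) / 6"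
    using y by (simp add: eval_nat_numeral sin_coeff_def lessThan_Suc)
  moreover have "y * (y * y) \<le> y * 4" using y by (intro mult_left_mono mult_mono[of y 2 y 2, simplified]) auto
  ultimately have "y / 3 \<le> sin y" by linarith
  have sq: "(cmod (cis \<psi> - 1))\<^sup>2 = (2 * sin y)\<^sup>2"
    unfolding norm_cis_minus_1_sq by (simp add: y_def abs_if)
  have "0 \<le> 2 * sin y" using y \<open>y / 3 \<le> sin y\<close> by linarith
  then have "cmod (cis \<psi> - 1) = 2 * sin y"
    by (rule power2_eq_imp_eq[OF sq norm_ge_zero])
  with \<open>y / 3 \<le> sin y\<close> show ?thesis by (simp add: y_def)
qed

text \<open>The radial projection of z is at distance less than 2*u from \<zeta>, since both |z -
  \<zeta>| and 1 - |z| are below u; the chord-arc factor 3 turns this into the angle 6*u.\<close>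

lemma polar_box:
  assumes \<zeta>: "cmod \<zeta> = 1" and z: "cmod (z - \<zeta>) < u" "cmod z < 1"
  obtains \<psi> where "z = of_real (cmod z) * cis (Arg \<zeta> + \<psi>)" "\<bar>\<psi>\<bar> < 6 * u" "1 - cmod z < u"
proof -
  define \<theta> where "\<theta> = Arg \<zeta>"
  have \<zeta>_cis: "\<zeta> = cis \<theta>" using \<zeta> rcis_cmod_Arg[of \<zeta>] by (simp add: \<theta>_def rcis_def)
  define \<psi> where "\<psi> = Arg (z / \<zeta>)"
  have zeq: "z = of_real (cmod z) * cis (\<theta> + \<psi>)"
  proof -
    have "z / \<zeta> = of_real (cmod z) * cis \<psi>"
      using rcis_cmod_Arg[of "z / \<zeta>"] \<zeta> by (simp add: rcis_def norm_divide \<psi>_def)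
    then show ?thesis using \<zeta> by (simp add: \<zeta>_cis field_simps flip: cis_mult)
  qed
  have nz: "cmod (z - cis (\<theta> + \<psi>)) = 1 - cmod z"
  proof -
    have "z - cis (\<theta> + \<psi>) = of_real (cmod z - 1) * cis (\<theta> + \<psi>)"
      by (subst (1) zeq) (simp add: algebra_simps)
    then show ?thesis using z(2) by (simp only: norm_mult norm_cis norm_of_real) simp
  qed
  have d: "1 - cmod z \<le> cmod (z - \<zeta>)"
    using norm_triangle_ineq2[of \<zeta> z] \<zeta> by (simp add: norm_minus_commute)
  moreover have "cmod (cis \<psi> - 1) = cmod (cis (\<theta> + \<psi>) - \<zeta>)"
  proof -
    have "cis (\<theta> + \<psi>) - \<zeta> = \<zeta> * (cis \<psi> - 1)" by (simp add: \<zeta>_cis algebra_simps flip: cis_mult)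
    then show ?thesis using \<zeta> by (simp add: norm_mult)
  qed
  moreover have "cmod (cis (\<theta> + \<psi>) - \<zeta>) \<le> cmod (z - \<zeta>) + cmod (z - cis (\<theta> + \<psi>))"
    using norm_triangle_ineq4[of "z - \<zeta>" "z - cis (\<theta> + \<psi>)"] by (simp add: algebra_simps)
  ultimately have "cmod (cis \<psi> - 1) < 2 * u" using z nz by linarith
  moreover have "\<bar>\<psi>\<bar> \<le> 3 * cmod (cis \<psi> - 1)"
    using Arg_bounded[of "z / \<zeta>"] by (intro abs_le_norm_cis_minus_1) (auto simp: \<psi>_def)
  ultimately have "\<bar>\<psi>\<bar> < 6 * u" by linarith
  then show ?thesis using zeq d z(1) by (intro that[of \<psi>]) (auto simp: \<theta>_def)
qed

text \<open>The angles of the box fill an interval of length 12*u. A grid of step x needs at most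
  12*u/x + 1 \<le> 13*u/x points, and a point of the layer differs from its grid point by at most x
  in angle and by less than x in radius, whence the radius 2*x.\<close>

lemma annulus_cover:
  assumes M: "sets M = sets borel" and \<zeta>: "cmod \<zeta> = 1" and x: "0 < x" "x \<le> u"
    and S: "\<And>\<xi>. cmod \<xi> = 1 \<Longrightarrow> emeasure M (ball \<xi> (2 * x)) \<le> S"
  shows "emeasure M (ball \<zeta> u \<inter> {z. 1 - x < cmod z \<and> cmod z < 1}) \<le> ennreal (13 * (u / x)) * S"
proof -
  define \<theta> where "\<theta> = Arg \<zeta>"
  define N where "N = nat \<lfloor>12 * u / x\<rfloor> + 1"
  define t where "t j = \<theta> - 6 * u + real j * x" for j
  have sub: "ball \<zeta> u \<inter> {z. 1 - x < cmod z \<and> cmod z < 1} \<subseteq> (\<Union>j<N. ball (cis (t j)) (2 * x))"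
  proof
    fix z assume "z \<in> ball \<zeta> u \<inter> {z. 1 - x < cmod z \<and> cmod z < 1}"
    then have z: "cmod (z - \<zeta>) < u" "1 - x < cmod z" "cmod z < 1"
      by (auto simp: dist_norm norm_minus_commute)
    obtain \<psi> where zeq: "z = of_real (cmod z) * cis (\<theta> + \<psi>)" and \<psi>: "\<bar>\<psi>\<bar> < 6 * u"
      using polar_box[OF \<zeta> z(1,3)] unfolding \<theta>_def by metis
    have nz: "cmod (z - cis (\<theta> + \<psi>)) = 1 - cmod z"
    proof -
      have "z - cis (\<theta> + \<psi>) = of_real (cmod z - 1) * cis (\<theta> + \<psi>)"
        by (subst (1) zeq) (simp add: algebra_simps)
      then show ?thesis using z(3) by (simp only: norm_mult norm_cis norm_of_real) simp
    qed
    define j where "j = nat \<lfloor>(\<psi> + 6 * u) / x\<rfloor>"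
    have "real j \<le> (\<psi> + 6 * u) / x" "(\<psi> + 6 * u) / x < real j + 1"
    proof -
      have "0 \<le> (\<psi> + 6 * u) / x" using \<psi> x by simp
      then show "real j \<le> (\<psi> + 6 * u) / x" "(\<psi> + 6 * u) / x < real j + 1"
        unfolding j_def by (simp_all add: of_nat_nat)
    qed
    then have j: "real j * x \<le> \<psi> + 6 * u" "\<psi> + 6 * u < (real j + 1) * x"
      using x by (auto simp: field_simps)
    have "(\<psi> + 6 * u) / x \<le> 12 * u / x" using \<psi> x by (intro divide_right_mono) auto
    then have "j < N" unfolding j_def N_def using nat_mono[OF floor_mono] by (simp add: less_Suc_eq_le)
    moreover have "cmod (z - cis (t j)) < 2 * x"
    proof -
      have "cmod (cis (\<theta> + \<psi>) - cis (t j)) \<le> \<bar>\<theta> + \<psi> - t j\<bar>"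
        by (rule norm_cis_diff_le)
      also have "\<dots> \<le> x" using j by (auto simp: t_def algebra_simps)
      finally have "cmod (cis (\<theta> + \<psi>) - cis (t j)) \<le> x" .
      then show ?thesis
        using norm_triangle_ineq[of "z - cis (\<theta> + \<psi>)" "cis (\<theta> + \<psi>) - cis (t j)"] nz z(2) by simp
    qed
    ultimately show "z \<in> (\<Union>j<N. ball (cis (t j)) (2 * x))"
      by (auto simp: dist_norm norm_minus_commute)
  qed
  have "emeasure M (ball \<zeta> u \<inter> {z. 1 - x < cmod z \<and> cmod z < 1}) \<le> emeasure M (\<Union>j<N. ball (cis (t j)) (2 * x))"
    using M by (intro emeasure_mono sub) auto
  also have "\<dots> \<le> (\<Sum>j<N. emeasure M (ball (cis (t j)) (2 * x)))"
    by (rule emeasure_subadditive_finite) (simp_all add: M image_subset_iff)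
  also have "\<dots> \<le> (\<Sum>j<N. S)" by (intro sum_mono S) simp
  also have "\<dots> = ennreal (real N) * S" by (simp add: ennreal_of_nat_eq_real_of_nat)
  also have "\<dots> \<le> ennreal (13 * (u / x)) * S"
  proof (intro mult_right_mono ennreal_leI)
    have "0 \<le> 12 * u / x" using x by simp
    then have "real N \<le> 12 * u / x + 1"
      unfolding N_def by (simp add: of_nat_nat)
    moreover have "1 \<le> u / x" using x by simp
    ultimately show "real N \<le> 13 * (u / x)" by simp
  qed simp
  finally show ?thesis .
qed

subsection \<open>Logarithmic Carleson measures\<close>

text \<open>The constant 16 makes \<open>blog\<close> at least 1 on all radii up to 4.\<close>

definition blog :: "real \<Rightarrow> real" where "blog x = ln (16 / x)"

lemma blog_ge_1: "0 < x \<Longrightarrow> x \<le> 4 \<Longrightarrow> 1 \<le> blog x"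
proof -
  assume "0 < x" "x \<le> 4"
  then have "4 \<le> 16 / x" by (simp add: field_simps)
  then have "exp 1 \<le> 16 / x" using exp_le by linarith
  then show ?thesis using \<open>0 < x\<close> by (simp add: blog_def ln_ge_iff)
qed

lemma blog_mono: "0 < x \<Longrightarrow> x \<le> y \<Longrightarrow> blog y \<le> blog x"
  by (simp add: blog_def frac_le)

lemma blog_scale: "0 < x \<Longrightarrow> 0 < c \<Longrightarrow> blog (c * x) = blog x - ln c"
  by (simp add: blog_def ln_div ln_mult)

lemma blog_ge_imp: "0 < v \<Longrightarrow> v \<le> 16 * exp (- B) \<Longrightarrow> B \<le> blog v"
proof -
  assume v: "0 < v" "v \<le> 16 * exp (- B)"
  then have "exp B \<le> 16 / v" by (simp add: exp_minus field_simps)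
  then show ?thesis using v by (simp add: blog_def ln_ge_iff)
qed

lemma ln_2_ge_half: "1 / 2 \<le> ln (2::real)"
  using ln_2_less_1 ln2_ge_two_thirds by linarith

text \<open>The summand 1 is the contribution of \<open>blog u\<close> on the whole box. The factor
  26 is 13 boxes per unit of u/x times their radius 2*x, and \<open>2 powr p\<close> comes from the
  lower bound (1 + j)/2 for \<open>blog\<close> at the scale of layer j.\<close>

definition log_carleson_const :: "real \<Rightarrow> real"
  where "log_carleson_const p = 1 + 26 * 2 powr p * (\<Sum>j. (1 + real j) powr (- p))"

lemma summable_shift_powr: "1 < p \<Longrightarrow> summable (\<lambda>j. (1 + real j) powr (- p))"
  using summable_Suc_iff[of "\<lambda>j. real j powr (- p)"] by (simp add: summable_real_powr_iff add.commute)

text \<open>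
  The layer-cake decomposition of \<open>blog (1 - |z|)\<close> gains one logarithm over the trivial estimate.
\<close>

lemma log_carleson_imp_carleson:
  assumes p: "1 < p" and M: "sets M = sets borel" and \<delta>: "\<delta> \<le> 2"
    and box: "\<And>\<xi> v. cmod \<xi> = 1 \<Longrightarrow> 0 < v \<Longrightarrow> v \<le> \<delta> \<Longrightarrow>
        emeasure M (ball \<xi> v) \<le> K * ennreal (v * blog v powr (- p))"
    and \<zeta>: "cmod \<zeta> = 1" and u: "0 < u" "2 * u \<le> \<delta>"
  shows "(\<integral>\<^sup>+ z \<in> ball \<zeta> u \<inter> unit_disc. ennreal (blog (1 - cmod z)) \<partial>M)
    \<le> K * ennreal (log_carleson_const p * u)"
proof -
  define A where "A j = ball \<zeta> u \<inter> {z. 1 - (1 / 2) ^ j * u < cmod z \<and> cmod z < 1}" for j :: nat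
  have A: "A j \<in> sets M" for j using M by (auto simp: A_def)
  have bl: "1 \<le> blog u" using u \<delta> by (intro blog_ge_1) auto
  \<comment> \<open>A point at distance d from the circle lies in all layers \<open>A j\<close> with
    2^(-j) * u > d. Since ln 2 < 1, the number of these layers dominates
    \<open>blog d - blog u\<close>, so the integral of \<open>blog\<close> becomes a sum of layer
    masses.\<close>
  have le: "ennreal (blog (1 - cmod z)) * indicator (ball \<zeta> u \<inter> unit_disc) z
     \<le> ennreal (blog u) * indicator (ball \<zeta> u) z + (\<Sum>j. indicator (A j) z)" for z
  proof (cases "z \<in> ball \<zeta> u \<inter> unit_disc")
    case True
    define d where "d = 1 - cmod z"
    have "1 - cmod z \<le> cmod (z - \<zeta>)"
      using norm_triangle_ineq2[of \<zeta> z] \<zeta> by (simp add: norm_minus_commute)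
    then have d: "0 < d" "d < u" using True by (auto simp: d_def dist_norm norm_minus_commute)
    have "\<exists>n::nat. (1 / 2) ^ n * u \<le> d"
      using real_arch_pow_inv[of "d / u" "1 / 2"] d u by (auto simp: field_simps intro: less_imp_le)
    define m where "m = (LEAST n::nat. (1 / 2) ^ n * u \<le> d)"
    have m: "(1 / 2) ^ m * u \<le> d" unfolding m_def by (rule LeastI_ex) fact
    have mem: "z \<in> A j" if "j < m" for j
      using not_less_Least[of j "\<lambda>n. (1 / 2) ^ n * u \<le> d"] that True
      by (auto simp: m_def A_def d_def)
    have "blog d \<le> blog ((1 / 2) ^ m * u)" using m u by (intro blog_mono) auto
    also have "\<dots> = blog u + real m * ln 2"
      using u by (simp add: blog_scale ln_realpow ln_div)
    also have "\<dots> \<le> blog u + real m" using ln_2_less_1 by (simp add: mult_left_le)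
    finally have "ennreal (blog d) \<le> ennreal (blog u) + of_nat m"
      using bl by (simp add: ennreal_of_nat_eq_real_of_nat flip: ennreal_plus)
    also have "of_nat m = (\<Sum>j<m. indicator (A j) z :: ennreal)"
      using mem by (simp add: indicator_def)
    also have "\<dots> \<le> (\<Sum>j. indicator (A j) z)" by (rule sum_le_suminf) auto
    finally show ?thesis using True by (simp add: d_def)
  qed simp
  have "(\<integral>\<^sup>+ z \<in> ball \<zeta> u \<inter> unit_disc. ennreal (blog (1 - cmod z)) \<partial>M)
    \<le> (\<integral>\<^sup>+ z. ennreal (blog u) * indicator (ball \<zeta> u) z + (\<Sum>j. indicator (A j) z) \<partial>M)"
    by (intro nn_integral_mono le)
  also have "\<dots> = ennreal (blog u) * emeasure M (ball \<zeta> u) + (\<Sum>j. emeasure M (A j))"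
  proof -
    have [measurable]: "ball \<zeta> u \<in> sets M" "\<And>j. A j \<in> sets M" using M A by auto
    have "(\<integral>\<^sup>+ z. (\<Sum>j. indicator (A j) z) \<partial>M) = (\<Sum>j. emeasure M (A j))"
      using A by (subst nn_integral_suminf) auto
    moreover have "(\<integral>\<^sup>+ z. ennreal (blog u) * indicator (ball \<zeta> u) z \<partial>M) = ennreal (blog u) * emeasure M (ball \<zeta> u)"
      using M by (simp add: nn_integral_cmult_indicator)
    ultimately show ?thesis
      by (subst nn_integral_add) (auto intro!: borel_measurable_suminf_order borel_measurable_indicator borel_measurable_times_ennreal)
  qed
  also have "\<dots> \<le> K * ennreal u + (\<Sum>j. K * ennreal (26 * u * 2 powr p * (1 + real j) powr (- p)))"
  proof (intro add_mono suminf_le summableI)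
    have "ennreal (blog u) * emeasure M (ball \<zeta> u) \<le> ennreal (blog u) * (K * ennreal (u * blog u powr (- p)))"
      using u by (intro mult_left_mono box \<zeta>) auto
    also have "\<dots> = K * ennreal (u * (blog u * blog u powr (- p)))"
      using bl u by (simp add: ennreal_mult mult_ac)
    also have "\<dots> \<le> K * ennreal u"
    proof (intro mult_left_mono ennreal_leI)
      have "blog u * blog u powr (- p) = blog u powr (1 - p)" using bl by (simp add: powr_diff powr_minus divide_simps)
      also have "\<dots> \<le> blog u powr 0" using bl p by (intro powr_mono) auto
      finally show "u * (blog u * blog u powr (- p)) \<le> u" using u bl by (simp add: mult_left_le)
    qed auto
    finally show "ennreal (blog u) * emeasure M (ball \<zeta> u) \<le> K * ennreal u" .
  next
    fix j
    \<comment> \<open>Layer j is covered by boxes of radius 2*x, for which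
      \<open>blog (2 * x)\<close> = \<open>blog (2 * u)\<close> + j ln 2 is at least (1 + j)/2. The
      hypothesis then yields (1 + j)^(-p), which is summable because p > 1.\<close>
    define x where "x = (1 / 2) ^ j * u"
    have x: "0 < x" "x \<le> u" using u by (auto simp: x_def mult_le_cancel_right1 power_le_one)
    have bx: "blog (2 * x) = blog (2 * u) + real j * ln 2"
    proof -
      have "blog (2 * x) = blog ((1 / 2) ^ j * (2 * u))" by (simp add: x_def mult_ac)
      also have "\<dots> = blog (2 * u) - ln ((1 / 2) ^ j)" using u by (intro blog_scale) auto
      also have "\<dots> = blog (2 * u) + real j * ln 2" by (simp add: ln_realpow ln_div)
      finally show ?thesis .
    qed
    have "1 \<le> blog (2 * u)" using u \<delta> by (intro blog_ge_1) auto
    moreover have "real j * (1 / 2) \<le> real j * ln 2" using ln_2_ge_half by (intro mult_left_mono) auto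
    ultimately have "(1 + real j) / 2 \<le> blog (2 * x)" by (simp add: bx)
    then have "blog (2 * x) powr (- p) \<le> ((1 + real j) / 2) powr (- p)"
      using p by (intro powr_mono2') auto
    also have "\<dots> = 2 powr p * (1 + real j) powr (- p)"
      by (simp add: powr_divide powr_minus field_simps)
    finally have b: "blog (2 * x) powr (- p) \<le> 2 powr p * (1 + real j) powr (- p)" .
    have "emeasure M (A j) \<le> ennreal (13 * (u / x)) * (K * ennreal (2 * x * blog (2 * x) powr (- p)))"
      unfolding A_def x_def[symmetric] using x u by (intro annulus_cover[OF M \<zeta>] box) auto
    also have "\<dots> = K * (ennreal (13 * (u / x)) * ennreal (2 * x * blog (2 * x) powr (- p)))"
      by (simp add: mult_ac)
    also have "ennreal (13 * (u / x)) * ennreal (2 * x * blog (2 * x) powr (- p))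
       = ennreal (13 * (u / x) * (2 * x * blog (2 * x) powr (- p)))"
      using x u by (subst ennreal_mult) auto
    also have "13 * (u / x) * (2 * x * blog (2 * x) powr (- p)) = 26 * u * blog (2 * x) powr (- p)"
      using x by simp
    also have "K * ennreal (26 * u * blog (2 * x) powr (- p)) \<le> K * ennreal (26 * u * (2 powr p * (1 + real j) powr (- p)))"
      using b u by (intro mult_left_mono ennreal_leI) auto
    finally show "emeasure M (A j) \<le> K * ennreal (26 * u * 2 powr p * (1 + real j) powr (- p))"
      by (simp add: mult.assoc)
  qed
  also have "\<dots> = K * (ennreal u + ennreal (26 * u * 2 powr p * (\<Sum>j. (1 + real j) powr (- p))))"
  proof -
    have "(\<Sum>j. ennreal (26 * u * 2 powr p * (1 + real j) powr (- p))) = ennreal (26 * u * 2 powr p * (\<Sum>j. (1 + real j) powr (- p)))"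
      using u summable_shift_powr[OF p] by (intro suminf_ennreal_eq sums_mult summable_sums) auto
    then show ?thesis by (simp add: distrib_left)
  qed
  also have "\<dots> = K * ennreal (log_carleson_const p * u)"
    using u suminf_nonneg[OF summable_shift_powr[OF p]]
    by (simp add: log_carleson_const_def algebra_simps flip: ennreal_plus)
  finally show ?thesis .
qed

subsection \<open>Oscillation along segments\<close>

text \<open>Integrate 2 f \<le> l f^2 w + 1/(l w), which is a completed square, and optimise the
  parameter l; the best choice is B / I.\<close>

lemma Cauchy_Schwarz_weighted_integral:
  fixes f w :: "real \<Rightarrow> real"
  assumes f: "continuous_on {a..b} f" and w: "continuous_on {a..b} w"
    and pos: "\<And>t. t \<in> {a..b} \<Longrightarrow> 0 < w t" "\<And>t. t \<in> {a..b} \<Longrightarrow> 0 \<le> f t"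
  shows "(integral {a..b} f)\<^sup>2 \<le> integral {a..b} (\<lambda>t. (f t)\<^sup>2 * w t) * integral {a..b} (\<lambda>t. 1 / w t)"
proof -
  define I where "I = integral {a..b} f"
  define A where "A = integral {a..b} (\<lambda>t. (f t)\<^sup>2 * w t)"
  define B where "B = integral {a..b} (\<lambda>t. 1 / w t)"
  have intf: "f integrable_on {a..b}" using f by (rule integrable_continuous_interval)
  have intA: "(\<lambda>t. (f t)\<^sup>2 * w t) integrable_on {a..b}"
    by (intro integrable_continuous_interval continuous_intros f w)
  have intB: "(\<lambda>t. 1 / w t) integrable_on {a..b}"
    using pos(1) by (intro integrable_continuous_interval continuous_intros w) (metis less_irrefl)
  have I0: "0 \<le> I" unfolding I_def using pos intf by (intro integral_nonneg) auto
  have A0: "0 \<le> A" unfolding A_def 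
  proof (rule integral_nonneg[OF intA])
    fix t assume "t \<in> {a..b}"
    then show "0 \<le> (f t)\<^sup>2 * w t" using pos(1)[of t] by simp
  qed
  have key: "2 * I \<le> l * A + B / l" if "0 < l" for l
  proof -
    note intlA = integrable_cmul[OF intA, of l, unfolded real_scaleR_def]
    note intlB = integrable_cmul[OF intB, of "1 / l", unfolded real_scaleR_def]
    note int2 = integrable_cmul[OF intf, of 2, unfolded real_scaleR_def]
    have "integral {a..b} (\<lambda>t. 2 * f t) \<le> integral {a..b} (\<lambda>t. l * ((f t)\<^sup>2 * w t) + 1 / l * (1 / w t))"
    proof (rule integral_le[OF int2 integrable_add[OF intlA intlB]])
      fix t assume t: "t \<in> {a..b}"
      have "0 \<le> (l * w t * f t - 1)\<^sup>2 / (l * w t)" using pos[OF t] that by simp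
      also have "\<dots> = l * ((f t)\<^sup>2 * w t) + 1 / l * (1 / w t) - 2 * f t"
        using pos(1)[OF t] that by (simp add: field_simps power2_eq_square)
      finally show "2 * f t \<le> l * ((f t)\<^sup>2 * w t) + 1 / l * (1 / w t)" by simp
    qed
    also have "\<dots> = l * A + 1 / l * B"
      unfolding A_def B_def by (subst integral_add[OF intlA intlB]) (simp only: integral_mult_right)
    finally show ?thesis by (simp add: I_def)
  qed
  have "I\<^sup>2 \<le> A * B"
  proof (cases "I = 0 \<or> B \<le> 0")
    case True
    moreover have "0 \<le> B" unfolding B_def using pos intB by (intro integral_nonneg) (auto intro: less_imp_le)
    moreover have "I = 0" if "B = 0"
    proof (rule ccontr)
      assume "I \<noteq> 0"
      then have "0 < I" using I0 by simp
      \<comment> \<open>For B = 0 the optimal parameter degenerates. The value I/(A + 1) makes the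
        right-hand side at most I, which contradicts I > 0.\<close>
      have "2 * I \<le> I / (A + 1) * A + B / (I / (A + 1))" using \<open>0 < I\<close> A0 by (intro key) auto
      also have "\<dots> \<le> I" using \<open>0 < I\<close> A0 that by (simp add: field_simps)
      finally show False using \<open>0 < I\<close> by simp
    qed
    ultimately show ?thesis using A0 by force
  next
    case False
    then have "0 < I" "0 < B" using I0 by auto
    then have "2 * I \<le> B / I * A + B / (B / I)" by (intro key) auto
    then show ?thesis using \<open>0 < I\<close> \<open>0 < B\<close> by (simp add: field_simps power2_eq_square)
  qed
  then show ?thesis by (simp add: I_def A_def B_def)
qed

text \<open>This is the logarithm that Cauchy-Schwarz costs. The affine function runs from the depth
  d of a point of the box to the depth 2*h; ending at 2*h and not at h keeps the slope 2*h - d at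
  least h, also when d = h.\<close>

lemma integral_inverse_affine_le:
  assumes "0 < d" "d \<le> h" "h \<le> 1"
  shows "integral {0..1} (\<lambda>t. 1 / ((1 - t) * d + 2 * h * t)) \<le> blog d / h"
proof -
  define F where "F t = ln ((1 - t) * d + 2 * h * t) / (2 * h - d)" for t
  have pos: "0 < (1 - t) * d + 2 * h * t" if "t \<in> {0..1}" for t
  proof -
    have "t * d \<le> t * (2 * h)" using that assms by (intro mult_left_mono) auto
    then show ?thesis using assms by (simp add: algebra_simps)
  qed
  have hd: "0 < 2 * h - d" using assms by auto
  have "((\<lambda>t. 1 / ((1 - t) * d + 2 * h * t)) has_integral (F 1 - F 0)) {0..1}"
  proof (rule fundamental_theorem_of_calculus)
    fix t :: real assume t: "t \<in> {0..1}"
    have "((\<lambda>t. ln ((1 - t) * d + 2 * h * t)) has_real_derivative 1 / ((1 - t) * d + 2 * h * t) * (2 * h - d)) (at t within {0..1})"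
      using pos[OF t] by (auto intro!: derivative_eq_intros)
    then have "(F has_real_derivative (1 / ((1 - t) * d + 2 * h * t) * (2 * h - d)) / (2 * h - d)) (at t within {0..1})"
      unfolding F_def[abs_def] by (rule DERIV_cdivide)
    then show "(F has_vector_derivative 1 / ((1 - t) * d + 2 * h * t)) (at t within {0..1})"
      using hd by (simp add: has_real_derivative_iff_has_vector_derivative)
  qed simp
  then have "integral {0..1} (\<lambda>t. 1 / ((1 - t) * d + 2 * h * t)) = ln (2 * h / d) / (2 * h - d)"
    using assms by (simp add: integral_unique F_def ln_div diff_divide_distrib)
  also have "\<dots> \<le> ln (16 / d) / h"
    using assms by (intro frac_le) (auto intro!: ln_mono divide_right_mono)
  finally show ?thesis by (simp add: blog_def)
qed

lemma norm_diff_le_segment_integral: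
  assumes hol: "f holomorphic_on unit_disc" and z: "z \<in> unit_disc" and a: "a \<in> unit_disc"
  shows "cmod (f z - f a) \<le> cmod (a - z) * integral {0..1} (\<lambda>t. cmod (deriv f (z + of_real t * (a - z))))"
    and "continuous_on {0..1} (\<lambda>t. cmod (deriv f (z + of_real t * (a - z))))"
proof -
  define \<gamma> where "\<gamma> t = z + of_real t * (a - z)" for t
  have \<gamma>: "\<gamma> t \<in> unit_disc" if "t \<in> {0..1}" for t
  proof -
    have "(1 - t) *\<^sub>R z + t *\<^sub>R a \<in> unit_disc"
      using that z a by (intro convexD) auto
    then show ?thesis by (simp add: \<gamma>_def scaleR_conv_of_real algebra_simps)
  qed
  have contd: "continuous_on unit_disc (deriv f)"
    using hol by (intro holomorphic_on_imp_continuous_on holomorphic_deriv) auto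
  have cont: "continuous_on {0..1} (\<lambda>t. deriv f (\<gamma> t))"
    by (rule continuous_on_compose2[OF contd]) (use \<gamma> in \<open>auto simp: \<gamma>_def intro!: continuous_intros\<close>)
  then show cn: "continuous_on {0..1} (\<lambda>t. cmod (deriv f (z + of_real t * (a - z))))"
    unfolding \<gamma>_def by (rule continuous_on_norm)
  have I: "((\<lambda>t. (a - z) * deriv f (\<gamma> t)) has_integral (f (\<gamma> 1) - f (\<gamma> 0))) {0..1}"
  proof (rule fundamental_theorem_of_calculus)
    fix t :: real assume t: "t \<in> {0..1}"
    have "(f has_field_derivative deriv f (\<gamma> t)) (at (\<gamma> t))"
      using hol \<gamma>[OF t] by (intro holomorphic_derivI[of f unit_disc]) auto
    moreover have "(\<gamma> has_vector_derivative (a - z)) (at t within {0..1})"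
      unfolding \<gamma>_def by (auto intro!: derivative_eq_intros)
    ultimately have "((f \<circ> \<gamma>) has_vector_derivative ((a - z) * deriv f (\<gamma> t))) (at t within {0..1})"
      by (intro field_vector_diff_chain_within) (auto intro: has_field_derivative_at_within)
    then show "((\<lambda>t. f (\<gamma> t)) has_vector_derivative ((a - z) * deriv f (\<gamma> t))) (at t within {0..1})"
      by (simp add: o_def)
  qed simp
  have "\<gamma> 1 = a" "\<gamma> 0 = z" by (simp_all add: \<gamma>_def)
  with integral_unique[OF I] have "f a - f z = integral {0..1} (\<lambda>t. (a - z) * deriv f (\<gamma> t))"
    by simp
  then have "cmod (f z - f a) = cmod (integral {0..1} (\<lambda>t. (a - z) * deriv f (\<gamma> t)))"
    by (metis norm_minus_commute)
  also have "\<dots> \<le> integral {0..1} (\<lambda>t. cmod (a - z) * cmod (deriv f (\<gamma> t)))"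
    using I cont by (intro integral_norm_bound_integral)
      (auto simp: norm_mult intro!: integrable_continuous_interval continuous_intros)
  finally show "cmod (f z - f a) \<le> cmod (a - z) * integral {0..1} (\<lambda>t. cmod (deriv f (z + of_real t * (a - z))))"
    by (simp add: \<gamma>_def)
qed

text \<open>Cauchy-Schwarz along the segment with weight \<open>x t\<close> gives
  \<open>blog d / h\<close> times the integral A of |f'|^2 * x. Each value of |f'|^2 is then
  replaced by its mean over a disc of radius x/2, and Fubini turns A into an area integral over
  points w whose distance to z is controlled by 1 - |w|. The constant 216 is 9*h from the length of
  the segment times 24/h from the exchange.\<close>

lemma pointwise_oscillation:
  assumes hol: "f holomorphic_on unit_disc" and \<zeta>: "cmod \<zeta> = 1" and h: "0 < h" "h \<le> 1 / 2"
    and z: "z \<in> ball \<zeta> h" "cmod z < 1"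
  shows "ennreal ((cmod (f z - f (of_real (1 - 2 * h) * \<zeta>)))\<^sup>2) \<le> ennreal (216 * blog (1 - cmod z)) *
    (\<integral>\<^sup>+ w \<in> {w \<in> ball \<zeta> (5 * h). cmod w < 1 \<and> cmod (z - w) < 4 * (1 - cmod w)}. ennreal ((cmod (deriv f w))\<^sup>2) \<partial>disc_area)"
proof -
  interpret lborel_disc_area: pair_sigma_finite lborel disc_area ..
  define a where "a = of_real (1 - 2 * h) * \<zeta>"
  define d where "d = 1 - cmod z"
  \<comment> \<open>Linear interpolation of the depths of the two end points; by convexity of the
    norm it is a lower bound for 1 - |\<gamma> t|, so discs of radius x/2 about \<gamma> t stay in
    the unit disc.\<close>
  define x where "x t = (1 - t) * d + 2 * h * t" for t
  define \<gamma> where "\<gamma> t = z + of_real t * (a - z)" for t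
  define E where "E = {w \<in> ball \<zeta> (5 * h). cmod w < 1 \<and> cmod (z - w) < 4 * (1 - cmod w)}"
  have na: "cmod a = 1 - 2 * h" using \<zeta> h by (simp add: a_def norm_mult del: of_real_diff)
  have zz: "cmod (z - \<zeta>) < h" using z by (simp add: dist_norm norm_minus_commute)
  have "d \<le> cmod (z - \<zeta>)"
    using norm_triangle_ineq2[of \<zeta> z] \<zeta> by (simp add: norm_minus_commute d_def)
  then have d: "0 < d" "d \<le> h" using z zz by (auto simp: d_def)
  have za: "cmod (a - z) \<le> 3 * h"
  proof -
    have "a - z = (\<zeta> - z) - of_real (2 * h) * \<zeta>" by (simp add: a_def algebra_simps)
    then have "cmod (a - z) \<le> cmod (\<zeta> - z) + cmod (of_real (2 * h) * \<zeta>)"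
      by (metis norm_triangle_ineq4)
    also have "cmod (of_real (2 * h) * \<zeta>) = 2 * h" using \<zeta> h by (simp add: norm_mult)
    finally show ?thesis using zz by (simp add: norm_minus_commute)
  qed
  have disc: "z \<in> unit_disc" "a \<in> unit_disc" using z na h by auto
  have xt: "0 < x t" "2 * h * t \<le> x t" "d \<le> x t" "x t \<le> 2 * h" "h * t \<le> x t" if "t \<in> {0..1}" for t
  proof -
    have "t * d \<le> t * (2 * h)" "(1 - t) * d \<le> (1 - t) * (2 * h)" "0 \<le> (1 - t) * d" "0 \<le> h * t"
      using that d h by (auto intro!: mult_left_mono)
    then show "2 * h * t \<le> x t" "d \<le> x t" "x t \<le> 2 * h" "h * t \<le> x t"
      by (auto simp: x_def algebra_simps)
    then show "0 < x t" using d by linarith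
  qed
  have \<gamma>n: "cmod (\<gamma> t) \<le> 1 - x t" if "t \<in> {0..1}" for t
  proof -
    have "\<gamma> t = of_real (1 - t) * z + of_real t * a" by (simp add: \<gamma>_def algebra_simps)
    then have "cmod (\<gamma> t) \<le> cmod (of_real (1 - t) * z) + cmod (of_real t * a)"
      by (metis norm_triangle_ineq)
    also have "\<dots> = (1 - t) * (1 - d) + t * (1 - 2 * h)"
      using that na by (simp add: norm_mult d_def del: of_real_diff)
    finally show ?thesis by (simp add: x_def algebra_simps)
  qed
  have contx: "continuous_on {0..1} x" unfolding x_def by (intro continuous_intros)
  define G where "G t = cmod (deriv f (\<gamma> t))" for t
  have contG: "continuous_on {0..1} G"
    using norm_diff_le_segment_integral(2)[OF hol disc] by (simp add: G_def \<gamma>_def)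
  define A where "A = integral {0..1} (\<lambda>t. (G t)\<^sup>2 * x t)"
  have A0: "0 \<le> A" unfolding A_def
    using xt contG contx by (intro integral_nonneg integrable_continuous_interval)
      (auto intro!: continuous_intros mult_nonneg_nonneg simp: less_imp_le)
  have holG: "deriv f holomorphic_on unit_disc" using hol by (intro holomorphic_deriv) auto
  have "(cmod (f z - f a))\<^sup>2 \<le> (3 * h * integral {0..1} G)\<^sup>2"
  proof (rule power_mono)
    have "0 \<le> integral {0..1} G"
      using contG by (intro integral_nonneg integrable_continuous_interval) (auto simp: G_def)
    moreover have "cmod (f z - f a) \<le> cmod (a - z) * integral {0..1} G"
      using norm_diff_le_segment_integral(1)[OF hol disc] unfolding G_def[abs_def] \<gamma>_def .
    ultimately show "cmod (f z - f a) \<le> 3 * h * integral {0..1} G"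
      using mult_right_mono[OF za, of "integral {0..1} G"] by linarith
  qed simp
  also have "\<dots> = 9 * h\<^sup>2 * (integral {0..1} G)\<^sup>2" by (simp add: power_mult_distrib)
  also have "\<dots> \<le> 9 * h\<^sup>2 * (A * (blog d / h))"
  proof (intro mult_left_mono)
    have "(integral {0..1} G)\<^sup>2 \<le> A * integral {0..1} (\<lambda>t. 1 / x t)"
      unfolding A_def using xt by (intro Cauchy_Schwarz_weighted_integral contG contx) (auto simp: G_def)
    also have "\<dots> \<le> A * (blog d / h)"
      using integral_inverse_affine_le[of d h] d h A0 by (intro mult_left_mono) (auto simp: x_def)
    finally show "(integral {0..1} G)\<^sup>2 \<le> A * (blog d / h)" .
  qed simp
  also have "\<dots> = 9 * h * blog d * A" using h by (simp add: power2_eq_square)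
  finally have one: "(cmod (f z - f a))\<^sup>2 \<le> 9 * h * blog d * A" .
  have bd: "1 \<le> blog d" using d h by (intro blog_ge_1) auto
  have Emeas [measurable]: "E \<in> sets borel"
  proof -
    have "E = ball \<zeta> (5 * h) \<inter> {w. cmod w < 1} \<inter> {w. cmod (z - w) < 4 * (1 - cmod w)}"
      by (auto simp: E_def)
    also have "open \<dots>" by (intro open_Int open_ball open_Collect_less continuous_intros)
    finally show ?thesis by simp
  qed
  define D where "D w = ennreal ((cmod (deriv f w))\<^sup>2) * indicator unit_disc w" for w
  have Dmeas [measurable]: "D \<in> borel_measurable borel"
    unfolding D_def using holG by (intro borel_measurable_disc continuous_intros holomorphic_on_imp_continuous_on) auto
  \<comment> \<open>The incidence relation for Fubini: w contributes to the mean at parameter t. For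
    such pairs x and 1 - |w| are comparable, and t is at most of order (1 - |w|)/h.\<close>
  define R where "R t w \<longleftrightarrow> t \<in> {0..1} \<and> cmod (w - \<gamma> t) < x t / 2" for t w
  have [measurable]: "\<gamma> \<in> borel_measurable borel" "x \<in> borel_measurable borel"
    unfolding \<gamma>_def x_def by measurable
  have Rmeas [measurable]: "Measurable.pred (lborel \<Otimes>\<^sub>M disc_area) (\<lambda>(t, w). R t w)"
    unfolding R_def by measurable
  have Rfacts: "w \<in> E" "4 / x t \<le> 12 / (1 - cmod w)" "t \<le> 2 * (1 - cmod w) / h" if "R t w" for t w
  proof -
    have t: "t \<in> {0..1}" and wt: "cmod (w - \<gamma> t) < x t / 2" using that by (auto simp: R_def)
    have "cmod (\<gamma> t - z) \<le> t * (3 * h)"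
      using za t by (auto simp: \<gamma>_def norm_mult intro!: mult_left_mono)
    then have wz: "cmod (w - z) < 2 * x t"
      using wt xt(2)[OF t] norm_triangle_ineq[of "w - \<gamma> t" "\<gamma> t - z"] by (simp add: algebra_simps)
    have dw: "x t / 2 < 1 - cmod w"
      using \<gamma>n[OF t] wt norm_triangle_ineq2[of w "\<gamma> t"] by linarith
    have "cmod (w - \<zeta>) < 5 * h"
      using norm_triangle_ineq[of "w - z" "z - \<zeta>"] wz zz xt(4)[OF t] by simp
    then show "w \<in> E"
      using dw wz xt(1)[OF t] by (auto simp: E_def dist_norm norm_minus_commute)
    have "1 - cmod w \<le> 3 * x t"
      using wz xt(3)[OF t] norm_triangle_ineq2[of z w] by (simp add: d_def norm_minus_commute)
    then show "4 / x t \<le> 12 / (1 - cmod w)"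
      using xt(1)[OF t] dw by (simp add: field_simps)
    show "t \<le> 2 * (1 - cmod w) / h"
      using xt(5)[OF t] dw h by (simp add: field_simps)
  qed
  have "ennreal A = (\<integral>\<^sup>+ t. ennreal ((G t)\<^sup>2 * x t) * indicator {0..1} t \<partial>lborel)"
    unfolding A_def using contG contx
  proof (intro nn_integral_has_integral_lebesgue'[symmetric] integrable_integral integrable_continuous_interval continuous_intros)
    fix t :: real assume "t \<in> {0..1}"
    then show "0 \<le> (G t)\<^sup>2 * x t" using xt(1)[of t] by simp
  qed
  also have "\<dots> \<le> (\<integral>\<^sup>+ t. \<integral>\<^sup>+ w. D w * (ennreal (4 / x t) * indicator {(t, w). R t w} (t, w)) \<partial>disc_area \<partial>lborel)"
  proof (intro nn_integral_mono)
    fix t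
    show "ennreal ((G t)\<^sup>2 * x t) * indicator {0..1} t
      \<le> (\<integral>\<^sup>+ w. D w * (ennreal (4 / x t) * indicator {(t, w). R t w} (t, w)) \<partial>disc_area)"
    proof (cases "t \<in> {0..1}")
      case True
      have sub: "ball (\<gamma> t) (x t / 2) \<subseteq> unit_disc"
      proof
        fix w assume "w \<in> ball (\<gamma> t) (x t / 2)"
        then show "w \<in> unit_disc"
          using \<gamma>n[OF True] xt(1)[OF True] norm_triangle_ineq2[of w "\<gamma> t"] by (simp add: dist_norm norm_minus_commute)
      qed
      have "ennreal ((G t)\<^sup>2 * x t) = ennreal (4 / x t) * ennreal (G t powr 2 * (x t / 2)\<^sup>2)"
        using xt(1)[OF True] by (subst ennreal_mult[symmetric]) (auto simp: G_def power2_eq_square field_simps)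
      also have "\<dots> \<le> ennreal (4 / x t) * (\<integral>\<^sup>+ w \<in> ball (\<gamma> t) (x t / 2). ennreal (cmod (deriv f w) powr 2) \<partial>disc_area)"
        unfolding G_def using xt(1)[OF True] by (intro mult_left_mono area_submean_powr holG sub) auto
      also have "\<dots> = (\<integral>\<^sup>+ w. ennreal (4 / x t) * (ennreal (cmod (deriv f w) powr 2) * indicator (ball (\<gamma> t) (x t / 2)) w) \<partial>disc_area)"
      proof (rule nn_integral_cmult[symmetric])
        have "(\<lambda>w. ennreal (cmod (deriv f w) powr 2) * indicator (ball (\<gamma> t) (x t / 2)) w) \<in> borel_measurable borel"
          using holomorphic_on_imp_continuous_on[OF holomorphic_on_subset[OF holG sub]]
          by (intro borel_measurable_ennreal_indicator) (auto intro!: continuous_intros)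
        then show "(\<lambda>w. ennreal (cmod (deriv f w) powr 2) * indicator (ball (\<gamma> t) (x t / 2)) w) \<in> borel_measurable disc_area"
          by simp
      qed
      also have "\<dots> \<le> (\<integral>\<^sup>+ w. D w * (ennreal (4 / x t) * indicator {(t, w). R t w} (t, w)) \<partial>disc_area)"
      proof (intro nn_integral_mono)
        fix w
        have "w \<in> ball (\<gamma> t) (x t / 2) \<Longrightarrow> w \<in> unit_disc \<and> R t w"
          using sub True by (auto simp: R_def dist_norm norm_minus_commute)
        then show "ennreal (4 / x t) * (ennreal (cmod (deriv f w) powr 2) * indicator (ball (\<gamma> t) (x t / 2)) w)
          \<le> D w * (ennreal (4 / x t) * indicator {(t, w). R t w} (t, w))"
          by (cases "w \<in> ball (\<gamma> t) (x t / 2)") (simp_all add: D_def mult_ac)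
      qed
      finally show ?thesis using True by simp
    qed simp
  qed
  also have "\<dots> = (\<integral>\<^sup>+ w. \<integral>\<^sup>+ t. D w * (ennreal (4 / x t) * indicator {(t, w). R t w} (t, w)) \<partial>lborel \<partial>disc_area)"
    by (rule lborel_disc_area.Fubini'[symmetric]) measurable
  \<comment> \<open>For fixed w the integrand in t is at most 12/(1 - |w|) and lives on an interval
    of length at most 2*(1 - |w|)/h; the product 24/h no longer depends on w.\<close>
  also have "\<dots> \<le> (\<integral>\<^sup>+ w. ennreal (24 / h) * (ennreal ((cmod (deriv f w))\<^sup>2) * indicator E w) \<partial>disc_area)"
  proof (intro nn_integral_mono)
    fix w
    show "(\<integral>\<^sup>+ t. D w * (ennreal (4 / x t) * indicator {(t, w). R t w} (t, w)) \<partial>lborel)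
      \<le> ennreal (24 / h) * (ennreal ((cmod (deriv f w))\<^sup>2) * indicator E w)"
    proof (cases "w \<in> E")
      case True
      then have w: "cmod w < 1" by (simp add: E_def)
      have "(\<integral>\<^sup>+ t. D w * (ennreal (4 / x t) * indicator {(t, w). R t w} (t, w)) \<partial>lborel)
        \<le> (\<integral>\<^sup>+ t. (D w * ennreal (12 / (1 - cmod w))) * indicator {0..2 * (1 - cmod w) / h} t \<partial>lborel)"
        using Rfacts
        by (intro nn_integral_mono) (auto simp: mult.assoc R_def split: split_indicator intro!: mult_left_mono ennreal_leI)
      also have "\<dots> = D w * (ennreal (12 / (1 - cmod w)) * ennreal (2 * (1 - cmod w) / h))"
        using w h by (subst nn_integral_cmult_indicator) (auto simp: mult.assoc)
      also have "ennreal (12 / (1 - cmod w)) * ennreal (2 * (1 - cmod w) / h) = ennreal (24 / h)"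
        using w h by (subst ennreal_mult[symmetric]) (auto simp: field_simps)
      finally show ?thesis using True w by (simp add: D_def mult.commute)
    next
      case False
      then have "\<not> R t w" for t using Rfacts(1) by blast
      then show ?thesis by simp
    qed
  qed
  also have "\<dots> = ennreal (24 / h) * (\<integral>\<^sup>+ w \<in> E. ennreal ((cmod (deriv f w))\<^sup>2) \<partial>disc_area)"
  proof (rule nn_integral_cmult)
    have "E \<subseteq> unit_disc" by (auto simp: E_def)
    then have "continuous_on E (\<lambda>w. (cmod (deriv f w))\<^sup>2)"
      by (intro continuous_intros holomorphic_on_imp_continuous_on holomorphic_on_subset[OF holG])
    from borel_measurable_ennreal_indicator[OF Emeas this]
    show "(\<lambda>w. ennreal ((cmod (deriv f w))\<^sup>2) * indicator E w) \<in> borel_measurable disc_area" by simp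
  qed
  finally have two: "ennreal A \<le> ennreal (24 / h) * (\<integral>\<^sup>+ w \<in> E. ennreal ((cmod (deriv f w))\<^sup>2) \<partial>disc_area)" .
  have "ennreal ((cmod (f z - f a))\<^sup>2) \<le> ennreal (9 * h * blog d) * ennreal A"
    using one bd h A0 by (subst ennreal_mult[symmetric]) (auto intro!: ennreal_leI)
  also have "\<dots> \<le> ennreal (9 * h * blog d) * (ennreal (24 / h) * (\<integral>\<^sup>+ w \<in> E. ennreal ((cmod (deriv f w))\<^sup>2) \<partial>disc_area))"
    by (intro mult_left_mono two) simp
  also have "\<dots> = ennreal (9 * h * blog d * (24 / h)) * (\<integral>\<^sup>+ w \<in> E. ennreal ((cmod (deriv f w))\<^sup>2) \<partial>disc_area)"
    using h bd by (subst ennreal_mult) (auto simp: mult.assoc)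
  also have "9 * h * blog d * (24 / h) = 216 * blog (1 - cmod z)" using h by (simp add: d_def)
  finally show ?thesis by (simp add: a_def E_def)
qed

subsection \<open>Growth of functions in \<open>BMOA p\<close>\<close>

lemma borel_measurable_bmoa_density:
  assumes "f holomorphic_on unit_disc" "1 < p"
  shows "(\<lambda>z. ennreal (bmoa_density p f z) * indicator unit_disc z) \<in> borel_measurable borel"
  using assms by (intro borel_measurable_disc continuous_on_bmoa_density)

lemma borel_measurable_bmoa_density_poisson:
  assumes "f holomorphic_on unit_disc" "1 < p" "a \<in> unit_disc"
  shows "(\<lambda>z. ennreal (bmoa_density p f z * poisson a z) * indicator unit_disc z) \<in> borel_measurable borel"
  using assms by (intro borel_measurable_disc continuous_intros continuous_on_bmoa_density continuous_on_poisson) auto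

lemma powr_le_cancel_base: "0 < p \<Longrightarrow> 0 \<le> y \<Longrightarrow> x powr p \<le> y powr p \<Longrightarrow> x \<le> y" for x y p :: real
  using powr_less_mono2[of p y x] by (force simp: not_le)

lemma BMOA_holomorphic: "f \<in> BMOA p \<Longrightarrow> f holomorphic_on unit_disc"
  by (simp add: BMOA_def analytic_disc_def)

lemma BMOA_analytic: "f \<in> BMOA p \<Longrightarrow> f \<in> analytic_disc"
  by (simp add: BMOA_def)

lemma bmoa_norm_nonneg [simp]: "0 \<le> bmoa_norm p f"
  by (simp add: bmoa_norm_def)

lemma bmoa_norm_powr:
  assumes "0 < p"
  shows "bmoa_norm p f powr p = cmod (f 0) powr p + enn2real (SUP a\<in>unit_disc. bmoa_integral p f a)"
  using assms by (simp add: bmoa_norm_def powr_powr)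

lemma bmoa_integral_le_norm:
  assumes "0 < p" "f \<in> BMOA p" "a \<in> unit_disc"
  shows "ennreal (cmod (f 0) powr p) + bmoa_integral p f a \<le> ennreal (bmoa_norm p f powr p)"
proof -
  have "(SUP a\<in>unit_disc. bmoa_integral p f a) < \<infinity>" using assms(2) by (simp add: BMOA_def)
  then have "ennreal (enn2real (SUP a\<in>unit_disc. bmoa_integral p f a)) = (SUP a\<in>unit_disc. bmoa_integral p f a)"
    by simp
  moreover have "bmoa_integral p f a \<le> (SUP a\<in>unit_disc. bmoa_integral p f a)"
    using assms(3) by (intro SUP_upper)
  ultimately show ?thesis
    using assms(1) by (simp add: bmoa_norm_powr add_left_mono ennreal_plus)
qed

lemma bmoa_integral_le_norm':
  assumes "0 < p" "f \<in> BMOA p" "a \<in> unit_disc"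
  shows "bmoa_integral p f a \<le> ennreal (bmoa_norm p f powr p)"
  using bmoa_integral_le_norm[OF assms] by (meson add_increasing order_trans le_iff_add add.commute order_refl zero_le)

lemma norm_at_0_le_bmoa_norm:
  assumes "0 < p"
  shows "cmod (f 0) \<le> bmoa_norm p f"
proof -
  have "cmod (f 0) powr p \<le> bmoa_norm p f powr p"
    using assms by (simp add: bmoa_norm_powr)
  then show ?thesis using powr_le_cancel_base[of p "bmoa_norm p f" "cmod (f 0)"] assms by simp
qed

lemma BMOA_I:
  assumes p: "0 < p" and f: "f \<in> analytic_disc" and c: "0 \<le> c"
    and le: "\<And>a. a \<in> unit_disc \<Longrightarrow> ennreal (cmod (f 0) powr p) + bmoa_integral p f a \<le> ennreal (c powr p)"
  shows "f \<in> BMOA p" "bmoa_norm p f \<le> c"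
proof -
  have le2: "ennreal (cmod (f 0) powr p) + (SUP a\<in>unit_disc. bmoa_integral p f a) \<le> ennreal (c powr p)"
  proof -
    have "ennreal (cmod (f 0) powr p) + (SUP a\<in>unit_disc. bmoa_integral p f a)
        = (SUP a\<in>unit_disc. ennreal (cmod (f 0) powr p) + bmoa_integral p f a)"
      by (subst ennreal_SUP_add_right) auto
    also have "\<dots> \<le> ennreal (c powr p)" using le by (intro SUP_least)
    finally show ?thesis .
  qed
  then have fin: "(SUP a\<in>unit_disc. bmoa_integral p f a) < \<infinity>"
    by (metis ennreal_add_eq_top ennreal_less_top infinity_ennreal_def less_top neq_top_trans)
  then show B: "f \<in> BMOA p" using f by (simp add: BMOA_def)
  have "ennreal (bmoa_norm p f powr p) \<le> ennreal (c powr p)"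
    using le2 fin p by (simp add: bmoa_norm_powr ennreal_plus)
  then have "bmoa_norm p f powr p \<le> c powr p" by simp
  then show "bmoa_norm p f \<le> c" using powr_le_cancel_base[of p c] p c by blast
qed

text \<open>Use the \<open>BMOA p\<close> integral at the point z itself. On the disc of radius d/2
  about z the kernel is at least 1/(7*d), because (5/2)^2 < 7, and the weight is at least
  (d/2)^(p-1), so the submean property of |f'|^p gives the pointwise bound. The constant c is the
  reciprocal of these two lower bounds, and p \<le> 2 enters only in the final constant.\<close>

lemma bloch_bound:
  assumes p: "1 < p" "p \<le> 2" and f: "f \<in> BMOA p" and z: "cmod z < 1"
  shows "cmod (deriv f z) * (1 - cmod z) \<le> 56 * bmoa_norm p f"
proof -
  define d where "d = 1 - cmod z"
  define N where "N = bmoa_norm p f"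
  have d: "0 < d" "d \<le> 1" using z by (auto simp: d_def)
  note hol = BMOA_holomorphic[OF f]
  have holG: "deriv f holomorphic_on unit_disc" using hol by (intro holomorphic_deriv) auto
  have sub: "ball z (d / 2) \<subseteq> unit_disc"
  proof
    fix w assume "w \<in> ball z (d / 2)"
    then show "w \<in> unit_disc" using norm_triangle_ineq2[of w z] d by (simp add: dist_norm norm_minus_commute d_def)
  qed
  define c where "c = 7 * d * (2 / d) powr (p - 1)"
  have c: "0 \<le> c" using d by (simp add: c_def)
  have "ennreal (cmod (deriv f z) powr p * (d / 2)\<^sup>2) \<le> (\<integral>\<^sup>+ w \<in> ball z (d / 2). ennreal (cmod (deriv f w) powr p) \<partial>disc_area)"
    using d p by (intro area_submean_powr holG sub) auto
  also have "\<dots> \<le> (\<integral>\<^sup>+ w. ennreal c * (ennreal (bmoa_density p f w * poisson z w) * indicator unit_disc w) \<partial>disc_area)"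
  proof (intro nn_integral_mono)
    fix w
    show "ennreal (cmod (deriv f w) powr p) * indicator (ball z (d / 2)) w
      \<le> ennreal c * (ennreal (bmoa_density p f w * poisson z w) * indicator unit_disc w)"
    proof (cases "w \<in> ball z (d / 2)")
      case True
      then have w: "w \<in> unit_disc" "cmod (z - w) < d / 2" using sub by (auto simp: dist_norm)
      have dw: "d / 2 \<le> 1 - (cmod w)\<^sup>2"
      proof -
        have "cmod w \<le> 1 - d / 2" using w(2) norm_triangle_ineq2[of w z] by (simp add: d_def norm_minus_commute field_simps)
        moreover have "(cmod w)\<^sup>2 \<le> cmod w" using w by (simp add: power2_eq_square mult_left_le)
        ultimately show ?thesis by simp
      qed
      have dz: "d \<le> 1 - (cmod z)\<^sup>2" "1 - (cmod z)\<^sup>2 \<le> 2 * d"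
      proof -
        have "(1 - cmod z) * 0 \<le> (1 - cmod z) * cmod z" "0 \<le> (1 - cmod z) * (1 - cmod z)"
          using z by (auto intro!: mult_left_mono)
        then show "d \<le> 1 - (cmod z)\<^sup>2" "1 - (cmod z)\<^sup>2 \<le> 2 * d"
          by (simp_all add: d_def power2_eq_square algebra_simps)
      qed
      have "cmod (1 - cnj z * w) \<le> 5 / 2 * d"
      proof -
        have "1 - cnj z * w = of_real (1 - (cmod z)\<^sup>2) + cnj z * (z - w)"
          by (simp add: algebra_simps flip: complex_norm_square)
        then have "cmod (1 - cnj z * w) \<le> cmod (of_real (1 - (cmod z)\<^sup>2)) + cmod (cnj z * (z - w))"
          by (metis norm_triangle_ineq)
        also have "cmod (of_real (1 - (cmod z)\<^sup>2)) \<le> 2 * d" using dz d by (simp only: norm_of_real)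
        also have "cmod (cnj z * (z - w)) \<le> d / 2"
        proof -
          have "cmod (cnj z * (z - w)) \<le> cmod (z - w)"
            using z by (simp add: norm_mult mult_left_le_one_le)
          then show ?thesis using w(2) by simp
        qed
        finally show ?thesis by simp
      qed
      moreover have "0 < cmod (1 - cnj z * w)" using w z by (intro one_minus_cnj_mult_pos) auto
      ultimately have "d / (5 / 2 * d)\<^sup>2 \<le> poisson z w"
        unfolding poisson_def using dz d by (intro frac_le power_mono) auto
      moreover have "1 / (7 * d) \<le> d / (5 / 2 * d)\<^sup>2" using d by (simp add: field_simps power2_eq_square)
      ultimately have P: "1 / (7 * d) \<le> poisson z w" by simp
      have "(d / 2) powr (p - 1) \<le> (1 - (cmod w)\<^sup>2) powr (p - 1)"
        using dw d p by (intro powr_mono2) auto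
      then have "cmod (deriv f w) powr p * ((d / 2) powr (p - 1) * (1 / (7 * d))) \<le> bmoa_density p f w * poisson z w"
        unfolding bmoa_density_def mult.assoc using P d by (intro mult_left_mono mult_mono) auto
      then have "c * (cmod (deriv f w) powr p * ((d / 2) powr (p - 1) * (1 / (7 * d)))) \<le> c * (bmoa_density p f w * poisson z w)"
        using c by (rule mult_left_mono)
      also have "c * (cmod (deriv f w) powr p * ((d / 2) powr (p - 1) * (1 / (7 * d)))) = cmod (deriv f w) powr p"
        using d by (simp add: c_def powr_divide field_simps)
      finally show ?thesis using True w c by (simp add: ennreal_leI flip: ennreal_mult')
    qed simp
  qed
  also have "\<dots> = ennreal c * bmoa_integral p f z"
    using borel_measurable_bmoa_density_poisson[OF hol p(1), of z] z
    by (subst nn_integral_cmult) (simp_all add: bmoa_integral_eq)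
  also have "\<dots> \<le> ennreal c * ennreal (N powr p)"
    unfolding N_def using bmoa_integral_le_norm'[of p f z] p f z by (intro mult_left_mono) auto
  finally have "cmod (deriv f z) powr p * (d / 2)\<^sup>2 \<le> c * N powr p"
    using c by (simp flip: ennreal_mult)
  then have "cmod (deriv f z) powr p * d\<^sup>2 \<le> 4 * c * N powr p" by (simp add: power_divide)
  then have "(cmod (deriv f z) powr p * d\<^sup>2) * d powr (p - 2) \<le> (4 * c * N powr p) * d powr (p - 2)"
    by (rule mult_right_mono) simp
  also have "(cmod (deriv f z) powr p * d\<^sup>2) * d powr (p - 2) = (cmod (deriv f z) * d) powr p"
    using d by (simp add: powr_mult powr_diff)
  also have "(4 * c * N powr p) * d powr (p - 2) = 28 * 2 powr (p - 1) * N powr p"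
    using d by (simp add: c_def powr_divide powr_diff field_simps power2_eq_square)
  also have "\<dots> \<le> 28 * 2 powr 1 * N powr p"
    using p by (intro mult_right_mono mult_left_mono powr_mono) auto
  also have "\<dots> \<le> 56 powr p * N powr p"
    using powr_mono[of 1 p 56] p by (intro mult_right_mono) auto
  also have "\<dots> = (56 * N) powr p" by (simp add: N_def powr_mult)
  finally have "cmod (deriv f z) * d \<le> 56 * N"
    using powr_le_cancel_base[of p "56 * N"] p by (simp add: N_def)
  then show ?thesis by (simp add: d_def N_def)
qed

text \<open>The Bloch bound is integrated along the radius; 57 is 56 plus 1 for |f(0)|, which fits
  because \<open>blog\<close> is at least 1. The estimate makes point evaluations bounded
  functionals and bounded families normal.\<close>

lemma growth_bound:
  assumes p: "1 < p" "p \<le> 2" and f: "f \<in> BMOA p" and z: "cmod z < 1"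
  shows "cmod (f z) \<le> 57 * bmoa_norm p f * blog (1 - cmod z)"
proof -
  define N where "N = bmoa_norm p f"
  define r where "r = cmod z"
  have r: "0 \<le> r" "r < 1" using z by (auto simp: r_def)
  note hol = BMOA_holomorphic[OF f]
  define F where "F t = 56 * N * ln (1 - (1 - t) * r)" for t
  have pos: "0 < 1 - (1 - t) * r" if "t \<in> {0..1}" for t
  proof -
    have "(1 - t) * r \<le> 1 * r" using that r by (intro mult_right_mono) auto
    then show ?thesis using r by simp
  qed
  have I: "((\<lambda>t. 56 * N * (1 / (1 - (1 - t) * r) * r)) has_integral (F 1 - F 0)) {0..1}"
  proof (rule fundamental_theorem_of_calculus)
    fix t :: real assume t: "t \<in> {0..1}"
    have "((\<lambda>t. ln (1 - (1 - t) * r)) has_real_derivative 1 / (1 - (1 - t) * r) * r) (at t within {0..1})"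
      using pos[OF t] by (auto intro!: derivative_eq_intros)
    then have "(F has_real_derivative (56 * N * (1 / (1 - (1 - t) * r) * r))) (at t within {0..1})"
      unfolding F_def[abs_def] by (rule DERIV_cmult)
    then show "(F has_vector_derivative (56 * N * (1 / (1 - (1 - t) * r) * r))) (at t within {0..1})"
      by (simp add: has_real_derivative_iff_has_vector_derivative)
  qed simp
  have disc: "z \<in> unit_disc" "0 \<in> unit_disc" using z by auto
  note seg = norm_diff_le_segment_integral[OF hol disc]
  have "cmod (f z - f 0) \<le> integral {0..1} (\<lambda>t. r * cmod (deriv f (z + of_real t * (0 - z))))"
    using seg(1) by (simp add: r_def)
  also have "\<dots> \<le> integral {0..1} (\<lambda>t. 56 * N * (1 / (1 - (1 - t) * r) * r))"
  proof (rule integral_le)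
    show "(\<lambda>t. r * cmod (deriv f (z + of_real t * (0 - z)))) integrable_on {0..1}"
      by (intro integrable_continuous_interval continuous_on_mult continuous_on_const seg(2))
    show "(\<lambda>t. 56 * N * (1 / (1 - (1 - t) * r) * r)) integrable_on {0..1}"
      using I by (rule has_integral_integrable)
    fix t :: real assume t: "t \<in> {0..1}"
    define w where "w = z + of_real t * (0 - z)"
    have "w = of_real (1 - t) * z" by (simp add: w_def algebra_simps)
    then have w: "cmod w = (1 - t) * r" using t by (simp add: norm_mult r_def del: of_real_diff)
    then have "cmod (deriv f w) * (1 - (1 - t) * r) \<le> 56 * N"
      using bloch_bound[OF p f, of w] pos[OF t] by (simp add: N_def)
    then have "cmod (deriv f w) \<le> 56 * N / (1 - (1 - t) * r)" using pos[OF t] by (simp add: field_simps)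
    then have "r * cmod (deriv f w) \<le> r * (56 * N / (1 - (1 - t) * r))" using r by (intro mult_left_mono)
    then show "r * cmod (deriv f (z + of_real t * (0 - z))) \<le> 56 * N * (1 / (1 - (1 - t) * r) * r)"
      by (simp add: w_def mult_ac)
  qed
  also have "\<dots> = 56 * N * (- ln (1 - r))"
    using integral_unique[OF I] by (simp add: F_def)
  also have "- ln (1 - r) \<le> blog (1 - r)"
    using r by (simp add: blog_def ln_div)
  finally have "cmod (f z - f 0) \<le> 56 * N * blog (1 - r)"
    by (simp add: N_def mult_left_mono)
  moreover have "cmod (f 0) \<le> N * 1" using p by (simp add: N_def norm_at_0_le_bmoa_norm)
  moreover have "N * 1 \<le> N * blog (1 - r)" using r by (intro mult_left_mono blog_ge_1) (auto simp: N_def)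
  ultimately show ?thesis
    using norm_triangle_ineq[of "f z - f 0" "f 0"] by (simp add: N_def r_def algebra_simps)
qed

lemma nn_integral_bmoa_density_box:
  assumes p: "1 < p" and f: "f \<in> BMOA p" and \<zeta>: "cmod \<zeta> = 1" and u: "0 < u"
  shows "(\<integral>\<^sup>+ z \<in> ball \<zeta> u \<inter> unit_disc. ennreal (bmoa_density p f z) \<partial>disc_area) \<le> ennreal (4 * u * bmoa_norm p f powr p)"
proof -
  note hol = BMOA_holomorphic[OF f]
  have main: "(\<integral>\<^sup>+ z \<in> ball \<zeta> u \<inter> unit_disc. ennreal (bmoa_density p f z) \<partial>disc_area) \<le> ennreal (4 * u * bmoa_norm p f powr p)"
    if a: "a \<in> unit_disc" and le: "\<And>z. z \<in> ball \<zeta> u \<inter> unit_disc \<Longrightarrow> 1 \<le> 4 * u * poisson a z" for a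
  proof -
    have "(\<integral>\<^sup>+ z \<in> ball \<zeta> u \<inter> unit_disc. ennreal (bmoa_density p f z) \<partial>disc_area)
      \<le> (\<integral>\<^sup>+ z. ennreal (4 * u) * (ennreal (bmoa_density p f z * poisson a z) * indicator unit_disc z) \<partial>disc_area)"
    proof (intro nn_integral_mono)
      fix z
      have "bmoa_density p f z * 1 \<le> bmoa_density p f z * (4 * u * poisson a z)" if "z \<in> ball \<zeta> u \<inter> unit_disc"
        using le[OF that] by (intro mult_left_mono) auto
      then show "ennreal (bmoa_density p f z) * indicator (ball \<zeta> u \<inter> unit_disc) z
        \<le> ennreal (4 * u) * (ennreal (bmoa_density p f z * poisson a z) * indicator unit_disc z)"
        using u by (auto simp: mult_ac simp flip: ennreal_mult' split: split_indicator intro!: ennreal_leI)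
    qed
    also have "\<dots> = ennreal (4 * u) * bmoa_integral p f a"
      using borel_measurable_bmoa_density_poisson[OF hol p a] a
      by (subst nn_integral_cmult) (simp_all add: bmoa_integral_eq)
    also have "\<dots> \<le> ennreal (4 * u) * ennreal (bmoa_norm p f powr p)"
      using bmoa_integral_le_norm'[of p f a] p f a by (intro mult_left_mono) auto
    finally show ?thesis using u by (simp flip: ennreal_mult')
  qed
  show ?thesis
  proof (cases "u \<le> 1")
    case True
    show ?thesis
    proof (rule main)
      show "of_real (1 - u) * \<zeta> \<in> unit_disc" using True u \<zeta> by (simp add: norm_mult del: of_real_diff)
      fix z assume "z \<in> ball \<zeta> u \<inter> unit_disc"
      then have "1 / (4 * u) \<le> poisson (of_real (1 - u) * \<zeta>) z"
        using u True by (intro poisson_ge[OF \<zeta>]) (auto simp: dist_norm norm_minus_commute)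
      then show "1 \<le> 4 * u * poisson (of_real (1 - u) * \<zeta>) z" using u by (simp add: field_simps)
    qed
  next
    case False
    \<comment> \<open>For u > 1 no point of the disc has depth u; the kernel at 0 is constantly 1,
      which is at least 1/(4*u).\<close>
    then show ?thesis by (intro main[of 0]) (auto simp: poisson_def)
  qed
qed

text \<open>The densities for exponents 2 and p differ by the factor (|f'| (1 - |z|^2))^(2-p), which
  the Bloch bound controls by (112*N)^(2-p). The constant 11 satisfies 1 + 112 \<le> 11^2, the 1
  coming from the value at 0.\<close>

lemma BMOA_subset_BMOA_2:
  assumes p: "1 < p" "p \<le> 2" and f: "f \<in> BMOA p"
  shows "f \<in> BMOA 2" "bmoa_norm 2 f \<le> 11 * bmoa_norm p f"
proof -
  define N where "N = bmoa_norm p f"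
  have N: "0 \<le> N" by (simp add: N_def)
  note hol = BMOA_holomorphic[OF f]
  have le: "ennreal (cmod (f 0) powr 2) + bmoa_integral 2 f a \<le> ennreal ((11 * N) powr 2)" if a: "a \<in> unit_disc" for a
  proof -
    have "bmoa_integral 2 f a \<le> (\<integral>\<^sup>+ z. ennreal ((112 * N) powr (2 - p)) * (ennreal (bmoa_density p f z * poisson a z) * indicator unit_disc z) \<partial>disc_area)"
      unfolding bmoa_integral_eq[OF a]
    proof (intro nn_integral_mono)
      fix z
      have "bmoa_density 2 f z \<le> (112 * N) powr (2 - p) * bmoa_density p f z" if z: "z \<in> unit_disc"
      proof -
        define D where "D = 1 - (cmod z)\<^sup>2"
        define F where "F = cmod (deriv f z)"
        have D: "0 < D" using z by (simp add: D_def abs_square_less_1)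
        have "D \<le> 2 * (1 - cmod z)"
          using zero_le_power2[of "1 - cmod z"] by (simp add: D_def power2_eq_square algebra_simps)
        then have "F * D \<le> F * (2 * (1 - cmod z))" by (intro mult_left_mono) (auto simp: F_def)
        also have "\<dots> \<le> 112 * N" using bloch_bound[OF p f, of z] z by (simp add: F_def N_def algebra_simps)
        finally have "(F * D) powr (2 - p) \<le> (112 * N) powr (2 - p)"
          using p D by (intro powr_mono2) (auto simp: F_def)
        then have "(F * D) powr (2 - p) * (F powr p * D powr (p - 1)) \<le> (112 * N) powr (2 - p) * (F powr p * D powr (p - 1))"
          by (intro mult_right_mono) auto
        moreover have "(F * D) powr (2 - p) * (F powr p * D powr (p - 1)) = F powr 2 * D powr (2 - 1)"
          using D by (cases "F = 0") (simp_all add: F_def powr_mult powr_add[symmetric] mult_ac flip: mult.assoc)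
        ultimately show ?thesis by (simp add: bmoa_density_def F_def D_def)
      qed
      then have "bmoa_density 2 f z * poisson a z \<le> (112 * N) powr (2 - p) * bmoa_density p f z * poisson a z" if "z \<in> unit_disc"
        using that a by (intro mult_right_mono poisson_nonneg) auto
      then show "ennreal (bmoa_density 2 f z * poisson a z) * indicator unit_disc z
        \<le> ennreal ((112 * N) powr (2 - p)) * (ennreal (bmoa_density p f z * poisson a z) * indicator unit_disc z)"
        by (auto simp: mult.assoc simp flip: ennreal_mult' split: split_indicator intro!: ennreal_leI)
    qed
    also have "\<dots> = ennreal ((112 * N) powr (2 - p)) * bmoa_integral p f a"
      using borel_measurable_bmoa_density_poisson[OF hol p(1) a] a
      by (subst nn_integral_cmult) (simp_all add: bmoa_integral_eq)
    also have "\<dots> \<le> ennreal ((112 * N) powr (2 - p)) * ennreal (N powr p)"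
      using bmoa_integral_le_norm'[of p f a] p f a by (intro mult_left_mono) (auto simp: N_def)
    also have "\<dots> = ennreal ((112 * N) powr (2 - p) * N powr p)" by (simp add: ennreal_mult)
    also have "\<dots> \<le> ennreal (112 * N powr 2)"
    proof (rule ennreal_leI)
      have "(112 * N) powr (2 - p) * N powr p = 112 powr (2 - p) * N powr 2"
        using N by (cases "N = 0") (simp_all add: powr_mult powr_add[symmetric] mult.assoc)
      also have "112 powr (2 - p) \<le> (112::real) powr 1" using p by (intro powr_mono) auto
      finally show "(112 * N) powr (2 - p) * N powr p \<le> 112 * N powr 2" by (simp add: mult_right_mono)
    qed
    finally have "bmoa_integral 2 f a \<le> ennreal (112 * N powr 2)" .
    moreover have "ennreal (cmod (f 0) powr 2) \<le> ennreal (N powr 2)"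
      using norm_at_0_le_bmoa_norm[of p f] p by (intro ennreal_leI powr_mono2) (auto simp: N_def)
    ultimately have "ennreal (cmod (f 0) powr 2) + bmoa_integral 2 f a \<le> ennreal (N powr 2) + ennreal (112 * N powr 2)"
      by (intro add_mono)
    also have "\<dots> = ennreal (113 * N powr 2)" by (simp flip: ennreal_plus)
    also have "\<dots> \<le> ennreal ((11 * N) powr 2)" using N by (intro ennreal_leI) (simp add: powr_mult)
    finally show ?thesis .
  qed
  show "f \<in> BMOA 2" "bmoa_norm 2 f \<le> 11 * bmoa_norm p f"
    using BMOA_I[of 2 f "11 * N"] le N BMOA_analytic[OF f] by (auto simp: N_def)
qed

subsection \<open>The embedding theorem\<close>

lemma ennreal_mult3:
  "0 \<le> x \<Longrightarrow> 0 \<le> y \<Longrightarrow> 0 \<le> z \<Longrightarrow> ennreal x * (ennreal y * ennreal z) = ennreal (x * (y * z))"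
  by (simp only: ennreal_mult mult_nonneg_nonneg)

lemma ennreal_lincomb:
  "0 \<le> x \<Longrightarrow> 0 \<le> y \<Longrightarrow> 0 \<le> u \<Longrightarrow> 0 \<le> v \<Longrightarrow>
    ennreal (x * y + u * v) = ennreal x * ennreal y + ennreal u * ennreal v"
  by (simp only: ennreal_mult ennreal_plus mult_nonneg_nonneg)

lemma unit_point_near:
  assumes "w \<noteq> 0" "cmod w < 1"
  obtains \<xi> where "cmod \<xi> = 1" "cmod (w - \<xi>) = 1 - cmod w"
proof
  show "cmod (w / of_real (cmod w)) = 1" using assms by (simp add: norm_divide)
  have "w - w / of_real (cmod w) = (w / of_real (cmod w)) * of_real (cmod w - 1)"
    using assms by (simp add: field_simps)
  then have "cmod (w - w / of_real (cmod w)) = cmod (w / of_real (cmod w)) * \<bar>cmod w - 1\<bar>"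
    by (simp only: norm_mult norm_of_real)
  then show "cmod (w - w / of_real (cmod w)) = 1 - cmod w"
    using assms by (simp add: norm_divide)
qed

text \<open>After Fubini, for fixed w the points z with \<open>R z w\<close> lie in a box of radius
  5*(1 - |w|) about the radial projection of w. The hypothesis bounds the integral of
  \<open>blog\<close> over it by a multiple of 1 - |w|, and |f'|^2 (1 - |w|) is dominated by the
  Carleson density of f. As 1 - |w| < 5*h, these radii stay below 25*h.\<close>

lemma box_oscillation_le:
  assumes M: "sets M = sets borel" "finite_measure M"
    and f: "f \<in> BMOA 2" and \<zeta>: "cmod \<zeta> = 1" and h: "0 < h" "25 * h \<le> u" "u \<le> 1" and c: "0 \<le> c"
    and box: "\<And>\<xi> v. cmod \<xi> = 1 \<Longrightarrow> 0 < v \<Longrightarrow> v \<le> u \<Longrightarrow>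
        (\<integral>\<^sup>+ z \<in> ball \<xi> v \<inter> unit_disc. ennreal (blog (1 - cmod z)) \<partial>M) \<le> K * ennreal (c * v)"
  shows "(\<integral>\<^sup>+ z \<in> ball \<zeta> h \<inter> unit_disc. ennreal ((cmod (f z - f (of_real (1 - 2 * h) * \<zeta>)))\<^sup>2) \<partial>M)
    \<le> K * ennreal (21600 * c * (bmoa_norm 2 f)\<^sup>2 * h)"
proof -
  interpret M: finite_measure M by fact
  interpret MD: pair_sigma_finite M disc_area ..
  note [measurable_cong] = M(1)
  define N where "N = bmoa_norm 2 f"
  note hol = BMOA_holomorphic[OF f]
  have holG: "deriv f holomorphic_on unit_disc" using hol by (intro holomorphic_deriv) auto
  define a where "a = of_real (1 - 2 * h) * \<zeta>"
  define D where "D w = ennreal ((cmod (deriv f w))\<^sup>2) * indicator unit_disc w" for w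
  have Dmeas [measurable]: "D \<in> borel_measurable borel"
    unfolding D_def using holG by (intro borel_measurable_disc continuous_intros holomorphic_on_imp_continuous_on) auto
  define B where "B z = ennreal (blog (1 - cmod z)) * indicator (ball \<zeta> h \<inter> unit_disc) z" for z
  have Bmeas [measurable]: "B \<in> borel_measurable borel"
  proof -
    have [measurable]: "ball \<zeta> h \<inter> unit_disc \<in> sets borel" by simp
    show ?thesis unfolding B_def blog_def by measurable
  qed
  define R where "R z w \<longleftrightarrow> cmod (w - \<zeta>) < 5 * h \<and> cmod (z - w) < 4 * (1 - cmod w)" for z w
  have [measurable]: "Measurable.pred (M \<Otimes>\<^sub>M disc_area) (\<lambda>(z, w). R z w)"
    unfolding R_def by measurable
  have "(\<integral>\<^sup>+ z \<in> ball \<zeta> h \<inter> unit_disc. ennreal ((cmod (f z - f a))\<^sup>2) \<partial>M)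
    \<le> (\<integral>\<^sup>+ z. \<integral>\<^sup>+ w. 216 * B z * D w * indicator {(z, w). R z w} (z, w) \<partial>disc_area \<partial>M)"
  proof (intro nn_integral_mono)
    fix z
    show "ennreal ((cmod (f z - f a))\<^sup>2) * indicator (ball \<zeta> h \<inter> unit_disc) z
      \<le> (\<integral>\<^sup>+ w. 216 * B z * D w * indicator {(z, w). R z w} (z, w) \<partial>disc_area)"
    proof (cases "z \<in> ball \<zeta> h \<inter> unit_disc")
      case True
      let ?E = "{w \<in> ball \<zeta> (5 * h). cmod w < 1 \<and> cmod (z - w) < 4 * (1 - cmod w)}"
      have bz: "0 \<le> blog (1 - cmod z)"
        using blog_ge_1[of "1 - cmod z"] True norm_ge_zero[of z] by simp
      have "ennreal ((cmod (f z - f a))\<^sup>2) \<le> ennreal (216 * blog (1 - cmod z)) * (\<integral>\<^sup>+ w \<in> ?E. ennreal ((cmod (deriv f w))\<^sup>2) \<partial>disc_area)"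
        unfolding a_def using True h by (intro pointwise_oscillation[OF hol \<zeta>]) auto
      also have "\<dots> = 216 * B z * (\<integral>\<^sup>+ w. D w * indicator {(z, w). R z w} (z, w) \<partial>disc_area)"
      proof -
        have lt: "cmod w < 1" if "cmod (z - w) < 4 * (1 - cmod w)" for w
          using le_less_trans[OF norm_ge_zero that] by simp
        have E: "w \<in> ?E \<longleftrightarrow> R z w" "R z w \<Longrightarrow> w \<in> unit_disc" for w
          using lt[of w] by (auto simp: R_def dist_norm norm_minus_commute)
        have "ennreal ((cmod (deriv f w))\<^sup>2) * indicator ?E w = D w * indicator {(z, w). R z w} (z, w)" for w
          using E[of w] by (cases "R z w") (simp_all add: D_def indicator_def)
        then show ?thesis
          using True bz by (simp add: B_def ennreal_mult)
      qed
      also have "\<dots> = (\<integral>\<^sup>+ w. 216 * B z * D w * indicator {(z, w). R z w} (z, w) \<partial>disc_area)"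
      proof -
        have [measurable]: "Measurable.pred disc_area (\<lambda>w. R z w)" unfolding R_def by measurable
        have "(\<lambda>w. D w * indicator {w. R z w} w) \<in> borel_measurable disc_area" by measurable
        also have "(\<lambda>w. D w * indicator {w. R z w} w) = (\<lambda>w. D w * indicator {(z, w). R z w} (z, w))"
          by (simp add: indicator_def)
        finally show ?thesis
          unfolding mult.assoc[of _ "D _"] by (rule nn_integral_cmult[symmetric])
      qed
      finally show ?thesis using True by simp
    qed simp
  qed
  also have "\<dots> = (\<integral>\<^sup>+ w. \<integral>\<^sup>+ z. 216 * B z * D w * indicator {(z, w). R z w} (z, w) \<partial>M \<partial>disc_area)"
    by (rule MD.Fubini'[symmetric]) measurable
  also have "\<dots> \<le> (\<integral>\<^sup>+ w. (K * ennreal (1080 * c)) * (ennreal (bmoa_density 2 f w) * indicator (ball \<zeta> (5 * h) \<inter> unit_disc) w) \<partial>disc_area)"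
  proof (intro nn_integral_mono)
    fix w
    show "(\<integral>\<^sup>+ z. 216 * B z * D w * indicator {(z, w). R z w} (z, w) \<partial>M)
      \<le> (K * ennreal (1080 * c)) * (ennreal (bmoa_density 2 f w) * indicator (ball \<zeta> (5 * h) \<inter> unit_disc) w)"
    proof (cases "w \<in> ball \<zeta> (5 * h) \<inter> unit_disc")
      case True
      then have w: "cmod w < 1" "cmod (w - \<zeta>) < 5 * h" by (auto simp: dist_norm norm_minus_commute)
      have dw: "1 - cmod w < 5 * h"
        using w norm_triangle_ineq2[of \<zeta> w] \<zeta> by (simp add: norm_minus_commute)
      then have "w \<noteq> 0" using h by auto
      then obtain \<xi> where \<xi>: "cmod \<xi> = 1" "cmod (w - \<xi>) = 1 - cmod w" using w(1) unit_point_near by blast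
      have sub: "z \<in> ball \<xi> (5 * (1 - cmod w))" if "R z w" for z
        using that norm_triangle_ineq[of "z - w" "w - \<xi>"] \<xi>(2) by (simp add: R_def dist_norm norm_minus_commute)
      have "(\<integral>\<^sup>+ z. 216 * B z * D w * indicator {(z, w). R z w} (z, w) \<partial>M)
        \<le> (\<integral>\<^sup>+ z. (216 * D w) * (ennreal (blog (1 - cmod z)) * indicator (ball \<xi> (5 * (1 - cmod w)) \<inter> unit_disc) z) \<partial>M)"
        using sub by (intro nn_integral_mono) (auto simp: B_def mult_ac split: split_indicator)
      also have "\<dots> = 216 * D w * (\<integral>\<^sup>+ z \<in> ball \<xi> (5 * (1 - cmod w)) \<inter> unit_disc. ennreal (blog (1 - cmod z)) \<partial>M)"
      proof -
        have [measurable]: "ball \<xi> (5 * (1 - cmod w)) \<inter> unit_disc \<in> sets borel" by simp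
        show ?thesis unfolding blog_def by (rule nn_integral_cmult) measurable
      qed
      also have "\<dots> \<le> 216 * D w * (K * ennreal (c * (5 * (1 - cmod w))))"
        using w dw h by (intro mult_left_mono box \<xi>) auto
      also have "\<dots> = K * (ennreal 216 * (ennreal ((cmod (deriv f w))\<^sup>2) * ennreal (c * (5 * (1 - cmod w)))))"
        using w by (simp add: D_def mult_ac)
      also have "ennreal 216 * (ennreal ((cmod (deriv f w))\<^sup>2) * ennreal (c * (5 * (1 - cmod w))))
        = ennreal (1080 * c * ((cmod (deriv f w))\<^sup>2 * (1 - cmod w)))"
      proof -
        have "216 * ((cmod (deriv f w))\<^sup>2 * (c * (5 * (1 - cmod w)))) = 1080 * c * ((cmod (deriv f w))\<^sup>2 * (1 - cmod w))"
          by simp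
        moreover have "ennreal 216 * (ennreal ((cmod (deriv f w))\<^sup>2) * ennreal (c * (5 * (1 - cmod w))))
          = ennreal (216 * ((cmod (deriv f w))\<^sup>2 * (c * (5 * (1 - cmod w)))))"
          using w c by (intro ennreal_mult3) auto
        ultimately show ?thesis by (simp only:)
      qed
      also have "K * ennreal (1080 * c * ((cmod (deriv f w))\<^sup>2 * (1 - cmod w))) \<le> K * ennreal (1080 * c * bmoa_density 2 f w)"
      proof (intro mult_left_mono ennreal_leI)
        have "(cmod w)\<^sup>2 \<le> cmod w" using w by (simp add: power2_eq_square mult_left_le)
        then have "(cmod (deriv f w))\<^sup>2 * (1 - cmod w) \<le> (cmod (deriv f w))\<^sup>2 * (1 - (cmod w)\<^sup>2)"
          by (intro mult_left_mono) auto
        then show "(cmod (deriv f w))\<^sup>2 * (1 - cmod w) \<le> bmoa_density 2 f w"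
          using w by (simp add: bmoa_density_def abs_square_le_1)
      qed (use c in auto)
      also have "ennreal (1080 * c * bmoa_density 2 f w) = ennreal (1080 * c) * ennreal (bmoa_density 2 f w)"
        using c by (intro ennreal_mult) auto
      finally show ?thesis using True by (simp only: mult.assoc indicator_simps mult_1_right)
    next
      case False
      then have DR: "D w * indicator {(z, w). R z w} (z, w) = 0" for z
        by (auto simp: D_def R_def dist_norm norm_minus_commute split: split_indicator)
      have z0: "216 * B z * D w * indicator {(z, w). R z w} (z, w) = 0" for z
        unfolding mult.assoc[of _ "D w"] DR by simp
      show ?thesis unfolding z0 by simp
    qed
  qed
  also have "\<dots> = (K * ennreal (1080 * c)) * (\<integral>\<^sup>+ w \<in> ball \<zeta> (5 * h) \<inter> unit_disc. ennreal (bmoa_density 2 f w) \<partial>disc_area)"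
  proof (rule nn_integral_cmult)
    have "continuous_on (ball \<zeta> (5 * h) \<inter> unit_disc) (bmoa_density 2 f)"
      using continuous_on_bmoa_density[OF hol] by (rule continuous_on_subset) auto
    from borel_measurable_ennreal_indicator[OF _ this]
    show "(\<lambda>w. ennreal (bmoa_density 2 f w) * indicator (ball \<zeta> (5 * h) \<inter> unit_disc) w) \<in> borel_measurable disc_area" by simp
  qed
  also have "\<dots> \<le> (K * ennreal (1080 * c)) * ennreal (4 * (5 * h) * N powr 2)"
    unfolding N_def using h by (intro mult_left_mono nn_integral_bmoa_density_box f \<zeta>) auto
  also have "\<dots> = K * ennreal (1080 * c * (4 * (5 * h) * N powr 2))"
  proof -
    have "ennreal (1080 * c * (4 * (5 * h) * N powr 2)) = ennreal (1080 * c) * ennreal (4 * (5 * h) * N powr 2)"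
      using c h by (intro ennreal_mult) auto
    then show ?thesis by (simp only: mult.assoc)
  qed
  also have "1080 * c * (4 * (5 * h) * N powr 2) = 21600 * c * N\<^sup>2 * h" by (simp add: N_def)
  finally show ?thesis by (simp add: N_def a_def)
qed

text \<open>Collects 4 * 21600 * \<open>log_carleson_const p\<close> from the oscillation and 4 + 4
  * 57^2 from the value at the box centre, rounded up to a common factor 8.\<close>

definition embedding_const :: "real \<Rightarrow> real"
  where "embedding_const p = 8 * (1 + 21600 * log_carleson_const p + 57 ^ 2)"

lemma log_carleson_const_nonneg: "1 < p \<Longrightarrow> 0 \<le> log_carleson_const p"
  by (simp add: log_carleson_const_def suminf_nonneg summable_shift_powr)

text \<open>
  No maximal function is needed: the extra logarithms pay for the Cauchy-Schwarz inequality
  along segments.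
\<close>

lemma log_carleson_embedding:
  assumes p: "1 < p" "p \<le> 2" and M: "sets M = sets borel" "finite_measure M" and \<delta>: "\<delta> \<le> 2"
    and box: "\<And>\<xi> v. cmod \<xi> = 1 \<Longrightarrow> 0 < v \<Longrightarrow> v \<le> \<delta> \<Longrightarrow>
        emeasure M (ball \<xi> v) \<le> K * ennreal (v * blog v powr (- p))"
    and f: "f \<in> BMOA 2" "bmoa_norm 2 f \<le> 1" and \<zeta>: "cmod \<zeta> = 1" and h: "0 < h" "50 * h \<le> \<delta>"
  shows "(\<integral>\<^sup>+ z \<in> ball \<zeta> h \<inter> unit_disc. ennreal (cmod (f z) powr p) \<partial>M) \<le> K * ennreal (embedding_const p * h)"
proof -
  note [measurable_cong] = M(1)
  define c where "c = log_carleson_const p"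
  have c: "0 \<le> c" using p by (simp add: c_def log_carleson_const_nonneg)
  define a where "a = of_real (1 - 2 * h) * \<zeta>"
  note hol = BMOA_holomorphic[OF f(1)]
  have na: "cmod a = 1 - 2 * h" using \<zeta> h \<delta> by (simp add: a_def norm_mult del: of_real_diff)
  have bh: "1 \<le> blog h" using h \<delta> by (intro blog_ge_1) auto
  have osc: "(\<integral>\<^sup>+ z \<in> ball \<zeta> h \<inter> unit_disc. ennreal ((cmod (f z - f a))\<^sup>2) \<partial>M) \<le> K * ennreal (21600 * c * (bmoa_norm 2 f)\<^sup>2 * h)"
    unfolding a_def
  proof (rule box_oscillation_le[OF M f(1) \<zeta> h(1) _ _ c])
    \<comment> \<open>The passage from logarithmic to weighted Carleson bounds uses boxes of twice
      the radius, so only radii up to \<delta>/2 are available; this doubles 25 to 50.\<close>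
    show "25 * h \<le> \<delta> / 2" "\<delta> / 2 \<le> 1" using h \<delta> by auto
    fix \<xi> v assume "cmod \<xi> = 1" "0 < v" "v \<le> \<delta> / 2"
    then show "(\<integral>\<^sup>+ z \<in> ball \<xi> v \<inter> unit_disc. ennreal (blog (1 - cmod z)) \<partial>M) \<le> K * ennreal (c * v)"
      unfolding c_def using box by (intro log_carleson_imp_carleson[OF p(1) M(1) \<delta>]) auto
  qed
  \<comment> \<open>The value at the centre may be of the order \<open>blog h\<close>. Its p-th
    power is exactly compensated by the factor \<open>blog h powr (- p)\<close> in the mass of the
    box.\<close>
  have fa: "cmod (f a) \<le> 57 * blog h"
  proof -
    have "cmod (f a) \<le> 57 * bmoa_norm 2 f * blog (1 - cmod a)"
      using f na h by (intro growth_bound) auto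
    also have "\<dots> \<le> 57 * 1 * blog h"
      using na h f(2) \<delta> by (intro mult_mono blog_mono) (auto intro: order_trans[OF _ blog_ge_1])
    finally show ?thesis by simp
  qed
  have pw: "cmod (f z) powr p \<le> 4 * (cmod (f z - f a))\<^sup>2 + (4 + 4 * (57 * blog h) powr p)" for z
  proof -
    have tri: "(x + y) powr p \<le> 4 * (x powr p + y powr p)" if "0 \<le> x" "0 \<le> y" for x y :: real
    proof -
      have "(x + y) powr p \<le> (2 * max x y) powr p" using that p by (intro powr_mono2) auto
      also have "\<dots> = 2 powr p * max x y powr p" using that by (simp add: powr_mult)
      also have "\<dots> \<le> 2 powr 2 * (x powr p + y powr p)"
        using p by (intro mult_mono powr_mono) (auto simp: max_def)
      finally show ?thesis by simp
    qed
    \<comment> \<open>Here p \<le> 2 lets the quadratic oscillation estimate serve the exponent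
      p.\<close>
    have sq: "x powr p \<le> 1 + x\<^sup>2" if "0 \<le> x" for x :: real
    proof (cases "x \<le> 1")
      case True
      then have "x powr p \<le> 1" using powr_mono2[of p x 1] that p by simp
      then show ?thesis by (simp add: add_increasing2)
    next
      case False
      then show ?thesis using powr_mono[of p 2 x] p by simp
    qed
    have "cmod (f z) powr p \<le> (cmod (f z - f a) + cmod (f a)) powr p"
      using p norm_triangle_ineq[of "f z - f a" "f a"] by (intro powr_mono2) auto
    also have "\<dots> \<le> 4 * (cmod (f z - f a) powr p + cmod (f a) powr p)" by (rule tri) auto
    also have "\<dots> \<le> 4 * ((1 + (cmod (f z - f a))\<^sup>2) + (57 * blog h) powr p)"
      using fa p by (intro mult_left_mono add_mono sq powr_mono2) auto
    finally show ?thesis by simp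
  qed
  define C where "C = 4 + 4 * (57 * blog h) powr p"
  have [measurable]: "(\<lambda>z. ennreal ((cmod (f z - f a))\<^sup>2) * indicator (ball \<zeta> h \<inter> unit_disc) z) \<in> borel_measurable M"
  proof -
    have "continuous_on (ball \<zeta> h \<inter> unit_disc) (\<lambda>z. (cmod (f z - f a))\<^sup>2)"
      by (intro continuous_intros continuous_on_subset[OF holomorphic_on_imp_continuous_on[OF hol]]) auto
    from borel_measurable_ennreal_indicator[OF _ this] show ?thesis by simp
  qed
  have "(\<integral>\<^sup>+ z \<in> ball \<zeta> h \<inter> unit_disc. ennreal (cmod (f z) powr p) \<partial>M)
    \<le> (\<integral>\<^sup>+ z. 4 * (ennreal ((cmod (f z - f a))\<^sup>2) * indicator (ball \<zeta> h \<inter> unit_disc) z) + ennreal C * indicator (ball \<zeta> h) z \<partial>M)"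
  proof (intro nn_integral_mono)
    fix z
    have "ennreal (cmod (f z) powr p) \<le> 4 * ennreal ((cmod (f z - f a))\<^sup>2) + ennreal C"
    proof -
      have "ennreal (cmod (f z) powr p) \<le> ennreal (4 * (cmod (f z - f a))\<^sup>2 + C)"
        using pw[of z] by (intro ennreal_leI) (simp add: C_def)
      also have "\<dots> = 4 * ennreal ((cmod (f z - f a))\<^sup>2) + ennreal C"
        by (subst ennreal_plus) (auto simp: C_def ennreal_mult)
      finally show ?thesis .
    qed
    then show "ennreal (cmod (f z) powr p) * indicator (ball \<zeta> h \<inter> unit_disc) z
      \<le> 4 * (ennreal ((cmod (f z - f a))\<^sup>2) * indicator (ball \<zeta> h \<inter> unit_disc) z) + ennreal C * indicator (ball \<zeta> h) z"
      by (auto split: split_indicator)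
  qed
  also have "\<dots> = 4 * (\<integral>\<^sup>+ z \<in> ball \<zeta> h \<inter> unit_disc. ennreal ((cmod (f z - f a))\<^sup>2) \<partial>M) + ennreal C * emeasure M (ball \<zeta> h)"
  proof -
    have "(\<lambda>z. ennreal C * indicator (ball \<zeta> h) z) \<in> borel_measurable M"
      by (intro borel_measurable_times_ennreal borel_measurable_const borel_measurable_indicator) (simp add: M(1))
    then show ?thesis
      by (subst nn_integral_add) (auto simp: nn_integral_cmult nn_integral_cmult_indicator M(1))
  qed
  also have "\<dots> \<le> 4 * (K * ennreal (21600 * c * (bmoa_norm 2 f)\<^sup>2 * h)) + ennreal C * (K * ennreal (h * blog h powr (- p)))"
    using osc h by (intro add_mono mult_left_mono box \<zeta>) auto
  also have "\<dots> = K * ennreal (4 * (21600 * c * (bmoa_norm 2 f)\<^sup>2 * h) + C * (h * blog h powr (- p)))"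
  proof -
    have "ennreal (4 * (21600 * c * (bmoa_norm 2 f)\<^sup>2 * h) + C * (h * blog h powr (- p)))
      = ennreal 4 * ennreal (21600 * c * (bmoa_norm 2 f)\<^sup>2 * h) + ennreal C * ennreal (h * blog h powr (- p))"
      using c h by (intro ennreal_lincomb) (auto simp: C_def)
    then show ?thesis by (simp add: distrib_left mult_ac)
  qed
  also have "\<dots> \<le> K * ennreal (embedding_const p * h)"
  proof (intro mult_left_mono ennreal_leI)
    have "(bmoa_norm 2 f)\<^sup>2 \<le> 1" using f(2) by (simp add: power_le_one)
    then have "4 * (21600 * c * (bmoa_norm 2 f)\<^sup>2 * h) \<le> 4 * (21600 * c * 1 * h)"
      using c h by (intro mult_left_mono mult_right_mono) auto
    moreover have "C * blog h powr (- p) \<le> 4 + 4 * 57 ^ 2"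
    proof -
      have "C * blog h powr (- p) = 4 * blog h powr (- p) + 4 * 57 powr p"
        using bh by (simp add: C_def powr_mult powr_minus field_simps)
      moreover have "blog h powr (- p) \<le> 1 powr (- p)" using bh p by (intro powr_mono2') auto
      moreover have "57 powr p \<le> (57::real) powr 2" using p by (intro powr_mono) auto
      ultimately show ?thesis by simp
    qed
    then have "C * blog h powr (- p) * h \<le> (4 + 4 * 57 ^ 2) * h" using h by (intro mult_right_mono) auto
    then have "C * (h * blog h powr (- p)) \<le> 13000 * h" by (simp only: mult_ac) simp
    moreover have "0 \<le> c * h" using c h by simp
    moreover have "embedding_const p * h = 8 * h + 172800 * (c * h) + 25992 * h"
      by (simp add: embedding_const_def c_def[symmetric] algebra_simps)
    ultimately show "4 * (21600 * c * (bmoa_norm 2 f)\<^sup>2 * h) + C * (h * blog h powr (- p)) \<le> embedding_const p * h"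
      using h by linarith
  qed simp
  finally show ?thesis .
qed

subsection \<open>The integral operator\<close>

text \<open>Formed for every analytic function and not just the symbol, so that the box estimates
  apply alike to g, to the images under the operator and to the test functions.\<close>

definition gmeasure :: "real \<Rightarrow> (complex \<Rightarrow> complex) \<Rightarrow> complex measure"
  where "gmeasure p g = density disc_area (\<lambda>z. ennreal (bmoa_density p g z) * indicator unit_disc z)"

lemma sets_gmeasure [simp, measurable_cong]: "sets (gmeasure p g) = sets borel"
  by (simp add: gmeasure_def)

lemma space_gmeasure [simp]: "space (gmeasure p g) = UNIV"
  by (simp add: gmeasure_def)

lemma nn_integral_gmeasure:
  assumes "g holomorphic_on unit_disc" "1 < p" "F \<in> borel_measurable borel"
  shows "(\<integral>\<^sup>+ z. F z \<partial>gmeasure p g) = (\<integral>\<^sup>+ z. ennreal (bmoa_density p g z) * indicator unit_disc z * F z \<partial>disc_area)"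
  unfolding gmeasure_def using borel_measurable_bmoa_density[OF assms(1,2)] assms(3)
  by (subst nn_integral_density) auto

lemma emeasure_gmeasure:
  assumes "g holomorphic_on unit_disc" "1 < p" "A \<in> sets borel"
  shows "emeasure (gmeasure p g) A = (\<integral>\<^sup>+ z \<in> A \<inter> unit_disc. ennreal (bmoa_density p g z) \<partial>disc_area)"
proof -
  have "emeasure (gmeasure p g) A = (\<integral>\<^sup>+ z. indicator A z \<partial>gmeasure p g)"
    using assms(3) by (subst nn_integral_indicator) auto
  also have "\<dots> = (\<integral>\<^sup>+ z \<in> A \<inter> unit_disc. ennreal (bmoa_density p g z) \<partial>disc_area)"
    using assms by (subst nn_integral_gmeasure) (auto intro!: nn_integral_cong split: split_indicator)
  finally show ?thesis .
qed

lemma bmoa_integral_gmeasure: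
  assumes "g holomorphic_on unit_disc" "1 < p" "a \<in> unit_disc"
  shows "bmoa_integral p g a = (\<integral>\<^sup>+ z \<in> unit_disc. ennreal (poisson a z) \<partial>gmeasure p g)"
proof -
  have "(\<lambda>z. ennreal (poisson a z) * indicator unit_disc z) \<in> borel_measurable borel"
    using assms by (intro borel_measurable_disc continuous_on_poisson) auto
  then show ?thesis
    using assms poisson_nonneg[of a] by (subst nn_integral_gmeasure)
      (auto simp: bmoa_integral_eq ennreal_mult intro!: nn_integral_cong split: split_indicator)
qed

lemma emeasure_gmeasure_UNIV:
  assumes "g holomorphic_on unit_disc" "1 < p"
  shows "emeasure (gmeasure p g) UNIV = bmoa_integral p g 0"
  using assms by (simp add: emeasure_gmeasure bmoa_integral_eq poisson_def)

lemma finite_measure_gmeasure: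
  assumes "g holomorphic_on unit_disc" "1 < p" "bmoa_integral p g 0 < \<infinity>"
  shows "finite_measure (gmeasure p g)"
  using assms by (intro finite_measureI) (simp add: emeasure_gmeasure_UNIV)

text \<open>One primitive on the whole disc yields the derivative, the value at 0 and the existence
  of the path integrals together; linearity is then read off the path integrals.\<close>

lemma integral_operator_primitive:
  assumes f: "f holomorphic_on unit_disc" and g: "g holomorphic_on unit_disc"
  shows "\<exists>F. \<forall>z\<in>unit_disc. (F has_field_derivative f z * deriv g z) (at z) \<and>
    integral_operator g f z = F z - F 0 \<and>
    ((\<lambda>\<zeta>. f \<zeta> * deriv g \<zeta>) has_contour_integral integral_operator g f z) (linepath 0 z)"
proof -
  have hol: "(\<lambda>\<zeta>. f \<zeta> * deriv g \<zeta>) holomorphic_on unit_disc"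
    using f g by (intro holomorphic_on_mult holomorphic_deriv) auto
  obtain F where F: "\<And>z. z \<in> unit_disc \<Longrightarrow> (F has_field_derivative f z * deriv g z) (at z within unit_disc)"
    using holomorphic_convex_primitive'[OF convex_ball open_ball hol] by blast
  have F': "(F has_field_derivative f z * deriv g z) (at z)" if "z \<in> unit_disc" for z
    using F[OF that] at_within_open[OF that open_ball] by simp
  have "((\<lambda>\<zeta>. f \<zeta> * deriv g \<zeta>) has_contour_integral F z - F 0) (linepath 0 z)" if z: "z \<in> unit_disc" for z
  proof -
    have "closed_segment 0 z \<subseteq> unit_disc"
      using z by (intro closed_segment_subset) auto
    then show ?thesis
      using contour_integral_primitive[where g = "linepath 0 z" and S = unit_disc, OF F] by simp
  qed
  moreover from this have "integral_operator g f z = F z - F 0" if "z \<in> unit_disc" for z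
    using contour_integral_unique that by (auto simp: integral_operator_def)
  ultimately show ?thesis using F' by (intro exI[of _ F]) metis
qed

lemma integral_operator_props:
  assumes f: "f holomorphic_on unit_disc" and g: "g holomorphic_on unit_disc"
  shows "integral_operator g f \<in> analytic_disc"
    and "integral_operator g f 0 = 0"
    and "\<And>z. z \<in> unit_disc \<Longrightarrow> deriv (integral_operator g f) z = f z * deriv g z"
proof -
  obtain F where F: "\<And>z. z \<in> unit_disc \<Longrightarrow> (F has_field_derivative f z * deriv g z) (at z)"
    "\<And>z. z \<in> unit_disc \<Longrightarrow> integral_operator g f z = F z - F 0"
    using integral_operator_primitive[OF f g] by blast
  have der: "(integral_operator g f has_field_derivative f z * deriv g z) (at z)" if z: "z \<in> unit_disc" for z
  proof -
    have "((\<lambda>z. F z - F 0) has_field_derivative f z * deriv g z) (at z)"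
      using F(1)[OF z] by (auto intro!: derivative_eq_intros)
    then show ?thesis
      by (rule has_field_derivative_transform_within_open[of _ _ _ unit_disc]) (use z F(2) in auto)
  qed
  then show "\<And>z. z \<in> unit_disc \<Longrightarrow> deriv (integral_operator g f) z = f z * deriv g z"
    by (rule DERIV_imp_deriv)
  show "integral_operator g f \<in> analytic_disc"
  proof -
    have "integral_operator g f holomorphic_on unit_disc"
      unfolding holomorphic_on_open[OF open_ball] using der by blast
    then show ?thesis by (simp add: analytic_disc_def integral_operator_def)
  qed
  show "integral_operator g f 0 = 0" using F(2)[of 0] by simp
qed

lemma integral_operator_add:
  assumes "f holomorphic_on unit_disc" "h holomorphic_on unit_disc" "g holomorphic_on unit_disc"
  shows "integral_operator g (\<lambda>z. f z + h z) = (\<lambda>z. integral_operator g f z + integral_operator g h z)"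
proof
  fix z
  show "integral_operator g (\<lambda>z. f z + h z) z = integral_operator g f z + integral_operator g h z"
  proof (cases "z \<in> unit_disc")
    case True
    have "((\<lambda>\<zeta>. f \<zeta> * deriv g \<zeta> + h \<zeta> * deriv g \<zeta>) has_contour_integral
        integral_operator g f z + integral_operator g h z) (linepath 0 z)"
      using integral_operator_primitive[OF assms(1,3)] integral_operator_primitive[OF assms(2,3)] True
      by (intro has_contour_integral_add) blast+
    then show ?thesis using True
      by (simp add: integral_operator_def[of g "\<lambda>z. f z + h z"] distrib_right contour_integral_unique)
  qed (simp add: integral_operator_def)
qed

lemma integral_operator_cmult:
  assumes "f holomorphic_on unit_disc" "g holomorphic_on unit_disc"
  shows "integral_operator g (\<lambda>z. c * f z) = (\<lambda>z. c * integral_operator g f z)"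
proof
  fix z
  show "integral_operator g (\<lambda>z. c * f z) z = c * integral_operator g f z"
  proof (cases "z \<in> unit_disc")
    case True
    have "((\<lambda>\<zeta>. c * (f \<zeta> * deriv g \<zeta>)) has_contour_integral c * integral_operator g f z) (linepath 0 z)"
      using integral_operator_primitive[OF assms] True by (intro has_contour_integral_lmul) blast
    then show ?thesis using True
      by (simp add: integral_operator_def[of g "\<lambda>z. c * f z"] mult.assoc contour_integral_unique)
  qed (simp add: integral_operator_def)
qed

lemma linear_integral_operator:
  assumes "g holomorphic_on unit_disc" "V \<subseteq> analytic_disc" "integral_operator g ` V \<subseteq> W"
  shows "linear_operator V W (integral_operator g)"
  using assms by (auto simp: linear_operator_def analytic_disc_def subset_iff
      intro!: integral_operator_add integral_operator_cmult)

lemma bmoa_density_integral_operator: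
  assumes "f holomorphic_on unit_disc" "g holomorphic_on unit_disc" "z \<in> unit_disc"
  shows "bmoa_density p (integral_operator g f) z = cmod (f z) powr p * bmoa_density p g z"
  using assms by (simp add: bmoa_density_def integral_operator_props norm_mult powr_mult mult.assoc)

text \<open>Since the derivative of the image is f g', its measure has density |f|^p with respect to
  the measure of g. Questions about the operator thereby become embedding questions for one
  measure.\<close>

lemma emeasure_gmeasure_integral_operator:
  assumes f: "f holomorphic_on unit_disc" and g: "g holomorphic_on unit_disc" and p: "1 < p" and A: "A \<in> sets borel"
  shows "emeasure (gmeasure p (integral_operator g f)) A = (\<integral>\<^sup>+ z \<in> A \<inter> unit_disc. ennreal (cmod (f z) powr p) \<partial>gmeasure p g)"
proof -
  have hol: "integral_operator g f holomorphic_on unit_disc"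
    using integral_operator_props(1)[OF f g] by (simp add: analytic_disc_def)
  have "continuous_on (A \<inter> unit_disc) (\<lambda>z. cmod (f z) powr p)"
    using p by (intro continuous_on_powr' continuous_intros continuous_on_subset[OF holomorphic_on_imp_continuous_on[OF f]]) auto
  then have "(\<lambda>z. ennreal (cmod (f z) powr p) * indicator (A \<inter> unit_disc) z) \<in> borel_measurable borel"
    using A by (intro borel_measurable_ennreal_indicator) auto
  then show ?thesis
    unfolding emeasure_gmeasure[OF hol p A]
    by (subst nn_integral_gmeasure[OF g p])
      (auto simp: bmoa_density_integral_operator[OF f g] ennreal_mult mult_ac intro!: nn_integral_cong split: split_indicator)
qed

subsection \<open>The spaces \<open>BMOA p\<close> and \<open>VMOA p\<close>\<close>

text \<open>Localised form for box bounds known only at small radii: inside the ball of radius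
  \<delta> the restricted measure satisfies them at all radii, and outside it the kernel is at most
  8*h/\<delta>^2, which vanishes as a approaches the circle.\<close>

lemma poisson_integral_split:
  assumes M: "sets M = sets borel"
    and z: "cmod \<zeta> = 1" "0 < h" "h \<le> 1" "a = of_real (1 - h) * \<zeta>" and \<delta>: "0 < \<delta>"
    and box: "\<And>u. 0 < u \<Longrightarrow> u \<le> \<delta> \<Longrightarrow> emeasure M (ball \<zeta> u) \<le> K * ennreal u"
  shows "(\<integral>\<^sup>+ z \<in> unit_disc. ennreal (poisson a z) \<partial>M) \<le> K * 64 + ennreal (8 * h / \<delta>\<^sup>2) * emeasure M UNIV"
proof -
  have sp: "space M = UNIV" using sets_eq_imp_space_eq[OF M] by simp
  define M' where "M' = density M (indicator (ball \<zeta> \<delta>))"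
  have M': "sets M' = sets borel" by (simp add: M'_def M)
  have na: "cmod a = 1 - h" using z by (simp add: norm_mult del: of_real_diff)
  have meas: "(\<lambda>z. ennreal (poisson a z) * indicator unit_disc z) \<in> borel_measurable M"
    using borel_measurable_disc[OF continuous_on_poisson[of a]] na z by (simp add: measurable_cong_sets[OF M])
  have ball: "ball \<zeta> r \<in> sets M" for r by (simp add: M)
  have "(\<integral>\<^sup>+ z \<in> unit_disc. ennreal (poisson a z) \<partial>M)
    \<le> (\<integral>\<^sup>+ z. indicator (ball \<zeta> \<delta>) z * (ennreal (poisson a z) * indicator unit_disc z) + ennreal (8 * h / \<delta>\<^sup>2) * 1 \<partial>M)"
  proof (intro nn_integral_mono)
    fix w
    have "poisson a w \<le> 8 * h / \<delta>\<^sup>2" if "w \<in> unit_disc" "w \<notin> ball \<zeta> \<delta>"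
      using poisson_le(2)[OF z(1) _ z(2-4) \<delta>, of w] that by (simp add: dist_norm norm_minus_commute)
    then show "ennreal (poisson a w) * indicator unit_disc w
      \<le> indicator (ball \<zeta> \<delta>) w * (ennreal (poisson a w) * indicator unit_disc w) + ennreal (8 * h / \<delta>\<^sup>2) * 1"
      by (cases "w \<in> ball \<zeta> \<delta>") (auto simp: ennreal_leI split: split_indicator)
  qed
  also have "\<dots> = (\<integral>\<^sup>+ z. indicator (ball \<zeta> \<delta>) z * (ennreal (poisson a z) * indicator unit_disc z) \<partial>M) + ennreal (8 * h / \<delta>\<^sup>2) * emeasure M UNIV"
    using meas ball by (subst nn_integral_add) (auto simp: sp intro!: borel_measurable_times_ennreal borel_measurable_indicator)
  also have "(\<integral>\<^sup>+ z. indicator (ball \<zeta> \<delta>) z * (ennreal (poisson a z) * indicator unit_disc z) \<partial>M)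
    = (\<integral>\<^sup>+ z \<in> unit_disc. ennreal (poisson a z) \<partial>M')"
    unfolding M'_def using meas ball by (subst nn_integral_density) (auto intro!: borel_measurable_indicator)
  also have "\<dots> \<le> K * 64"
  proof (rule poisson_integral_le_box[OF M' z])
    fix u :: real assume u: "0 < u"
    have "emeasure M' (ball \<zeta> u) = emeasure M (ball \<zeta> \<delta> \<inter> ball \<zeta> u)"
      unfolding M'_def using ball[of u] ball[of \<delta>]
      by (subst emeasure_density) (auto simp: indicator_inter_arith[symmetric] intro!: borel_measurable_indicator)
    also have "ball \<zeta> \<delta> \<inter> ball \<zeta> u = ball \<zeta> (min \<delta> u)" by auto
    also have "emeasure M (ball \<zeta> (min \<delta> u)) \<le> K * ennreal (min \<delta> u)" using \<delta> u by (intro box) auto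
    also have "\<dots> \<le> K * ennreal u" by (intro mult_left_mono ennreal_leI) auto
    finally show "emeasure M' (ball \<zeta> u) \<le> K * ennreal u" .
  qed
  finally show ?thesis by (simp add: add_mono)
qed

lemma polar_near_circle:
  assumes "a \<in> unit_disc" "a \<noteq> 0"
  shows "cmod (a / of_real (cmod a)) = 1" "a = of_real (1 - (1 - cmod a)) * (a / of_real (cmod a))"
  using assms by (auto simp: norm_divide)

lemma VMOA_D:
  assumes "f \<in> VMOA p" "0 < e"
  shows "\<exists>r<1. \<forall>a. r < cmod a \<longrightarrow> cmod a < 1 \<longrightarrow> bmoa_integral p f a < e"
proof -
  have "(bmoa_integral p f \<longlongrightarrow> 0) (filtercomap cmod (at_left 1))"
    using assms(1) by (simp add: VMOA_def)
  then have "\<forall>\<^sub>F a in filtercomap cmod (at_left 1). bmoa_integral p f a < e"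
    using assms(2) by (rule order_tendstoD)
  then obtain Q where "eventually Q (at_left (1::real))" "\<And>a. Q (cmod a) \<Longrightarrow> bmoa_integral p f a < e"
    by (auto simp: eventually_filtercomap)
  then show ?thesis by (auto simp: eventually_at_left_field)
qed

lemma VMOA_I:
  assumes "f \<in> BMOA p"
    and "\<And>e. 0 < e \<Longrightarrow> \<exists>r<1. \<forall>a. r < cmod a \<longrightarrow> cmod a < 1 \<longrightarrow> bmoa_integral p f a \<le> ennreal e"
  shows "f \<in> VMOA p"
  unfolding VMOA_def
proof (intro CollectI conjI assms(1) order_tendstoI)
  fix y :: ennreal assume "0 < y"
  have "\<exists>e>0. ennreal e < y"
  proof (cases y)
    case (real r)
    then show ?thesis using \<open>0 < y\<close> by (intro exI[of _ "r / 2"]) (auto simp: ennreal_less_iff)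
  qed (auto intro: exI[of _ 1])
  then obtain e where e: "0 < e" "ennreal e < y" by blast
  then obtain r where r: "r < 1" "\<And>a. r < cmod a \<Longrightarrow> cmod a < 1 \<Longrightarrow> bmoa_integral p f a \<le> ennreal e"
    using assms(2) by blast
  have "eventually (\<lambda>s. r < s \<and> s < 1) (at_left (1::real))"
    using r(1) by (auto simp: eventually_at_left_field)
  then show "\<forall>\<^sub>F a in filtercomap cmod (at_left 1). bmoa_integral p f a < y"
    unfolding eventually_filtercomap using r(2) e(2) by (blast intro: le_less_trans)
qed simp

text \<open>The little-o version of the Carleson characterisation. Small boxes contribute at most 64
  * e/128, and the rest of the finite total mass is damped by the kernel.\<close>

lemma VMOA_I_box:
  assumes p: "1 < p" and f: "f \<in> BMOA p"
    and box: "\<And>e. 0 < e \<Longrightarrow> \<exists>\<delta>>0. \<forall>\<zeta> u. cmod \<zeta> = 1 \<longrightarrow> 0 < u \<longrightarrow> u \<le> \<delta> \<longrightarrow> emeasure (gmeasure p f) (ball \<zeta> u) \<le> ennreal (e * u)"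
  shows "f \<in> VMOA p"
proof (rule VMOA_I[OF f])
  fix e :: real assume e: "0 < e"
  note hol = BMOA_holomorphic[OF f]
  obtain \<delta> where \<delta>: "0 < \<delta>" "\<And>\<zeta> u. cmod \<zeta> = 1 \<Longrightarrow> 0 < u \<Longrightarrow> u \<le> \<delta> \<Longrightarrow> emeasure (gmeasure p f) (ball \<zeta> u) \<le> ennreal (e / 128 * u)"
    using box[of "e / 128"] e by auto
  define N where "N = bmoa_norm p f powr p"
  have N: "emeasure (gmeasure p f) UNIV \<le> ennreal N"
    using bmoa_integral_le_norm'[of p f 0] p f by (simp add: emeasure_gmeasure_UNIV[OF hol] N_def)
  \<comment> \<open>Chosen so that the far part 8*h/\<delta>^2 * N is at most e/2; the cap 1/2 keeps
    a away from 0, where no direction is defined.\<close>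
  define h where "h = min (1 / 2) (e * \<delta>\<^sup>2 / (16 * (N + 1)))"
  have N0: "0 \<le> N" by (simp add: N_def)
  have "0 < e * \<delta>\<^sup>2 / (16 * (N + 1))" using e \<delta>(1) N0 by simp
  then have h: "0 < h" "h \<le> 1 / 2" unfolding h_def by (simp_all only: min_less_iff_conj min.cobounded1) simp
  show "\<exists>r<1. \<forall>a. r < cmod a \<longrightarrow> cmod a < 1 \<longrightarrow> bmoa_integral p f a \<le> ennreal e"
  proof (intro exI[of _ "1 - h"] conjI allI impI)
    fix a assume a: "1 - h < cmod a" "cmod a < 1"
    then have a': "a \<in> unit_disc" "a \<noteq> 0" using h by auto
    note pol = polar_near_circle[OF a']
    have "bmoa_integral p f a \<le> ennreal (e / 128) * 64 + ennreal (8 * (1 - cmod a) / \<delta>\<^sup>2) * emeasure (gmeasure p f) UNIV"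
      unfolding bmoa_integral_gmeasure[OF hol p a'(1)]
    proof (rule poisson_integral_split[OF _ pol(1) _ _ pol(2) \<delta>(1)])
      fix u assume u: "0 < u" "u \<le> \<delta>"
      have "ennreal (e / 128 * u) = ennreal (e / 128) * ennreal u" using e u by (intro ennreal_mult) auto
      then show "emeasure (gmeasure p f) (ball (a / of_real (cmod a)) u) \<le> ennreal (e / 128) * ennreal u"
        using \<delta>(2)[OF pol(1) u] by (simp only:)
    qed (use a in auto)
    also have "\<dots> \<le> ennreal (e / 128) * 64 + ennreal (8 * h / \<delta>\<^sup>2) * ennreal N"
      using a N \<delta> by (intro add_mono mult_mono ennreal_leI divide_right_mono) auto
    also have "\<dots> = ennreal (e / 2 + 8 * h / \<delta>\<^sup>2 * N)"
      using e h N0 ennreal_lincomb[of "e / 128" 64 "8 * h / \<delta>\<^sup>2" N] by simp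
    also have "\<dots> \<le> ennreal e"
    proof (rule ennreal_leI)
      have "h * (16 * (N + 1)) \<le> e * \<delta>\<^sup>2"
      proof -
        have "0 < 16 * (N + 1)" using N0 by simp
        then show ?thesis unfolding h_def by (subst pos_le_divide_eq[symmetric]) simp_all
      qed
      moreover have "h * (16 * N) \<le> h * (16 * (N + 1))" using h by simp
      ultimately show "e / 2 + 8 * h / \<delta>\<^sup>2 * N \<le> e"
        using \<delta> by (simp add: field_simps)
    qed
    finally show "bmoa_integral p f a \<le> ennreal e" .
  qed (use h in auto)
qed

text \<open>
  Minkowski's inequality comes from the pointwise convexity bound below with weights chosen as the
  norms of the two summands.
\<close>

lemma powr_add_le_weighted:
  fixes x y A B p :: real
  assumes p: "1 < p" and A: "0 < A" "0 < B" and x: "0 \<le> x" "0 \<le> y"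
  shows "(x + y) powr p \<le> ((A + B) / A) powr (p - 1) * x powr p + ((A + B) / B) powr (p - 1) * y powr p"
proof -
  define l where "l = A / (A + B)"
  define m where "m = B / (A + B)"
  have lm: "0 < l" "0 < m" "l + m = 1" using A by (auto simp: l_def m_def add_divide_distrib[symmetric])
  define X where "X = x / l"
  define Y where "Y = y / m"
  define Z where "Z = x + y"
  have X: "0 \<le> X" "0 \<le> Y" "0 \<le> Z" using x lm by (auto simp: X_def Y_def Z_def)
  have Z: "l * X + m * Y = Z" using lm by (simp add: X_def Y_def Z_def)
  have "l * (p * X * Z powr (p - 1)) + m * (p * Y * Z powr (p - 1))
     \<le> l * (X powr p + (p - 1) * Z powr p) + m * (Y powr p + (p - 1) * Z powr p)"
    using lm X p by (intro add_mono mult_left_mono young_powr) auto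
  also have "\<dots> = l * X powr p + m * Y powr p + (l + m) * ((p - 1) * Z powr p)"
    by (simp add: algebra_simps)
  also have "l * (p * X * Z powr (p - 1)) + m * (p * Y * Z powr (p - 1)) = p * (Z * Z powr (p - 1))"
    unfolding Z[symmetric] by (simp add: algebra_simps)
  also have "Z * Z powr (p - 1) = Z powr p"
    using X(3) by (cases "Z = 0") (auto simp: powr_diff)
  finally have "Z powr p \<le> l * X powr p + m * Y powr p"
    unfolding lm(3) by (simp add: algebra_simps)
  also have "l * X powr p = ((A + B) / A) powr (p - 1) * x powr p"
  proof -
    have "(A + B) / A = 1 / l" by (simp add: l_def)
    then show ?thesis using lm x by (simp add: X_def powr_divide powr_diff)
  qed
  also have "m * Y powr p = ((A + B) / B) powr (p - 1) * y powr p"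
  proof -
    have "(A + B) / B = 1 / m" by (simp add: m_def)
    then show ?thesis using lm x by (simp add: Y_def powr_divide powr_diff)
  qed
  finally show ?thesis by (simp add: Z_def)
qed

text \<open>The case x = A, y = B of the preceding bound, with equality; hence nothing is lost in
  the triangle inequality.\<close>

lemma weights_sum_powr:
  fixes A B p :: real
  assumes "0 < A" "0 < B"
  shows "((A + B) / A) powr (p - 1) * A powr p + ((A + B) / B) powr (p - 1) * B powr p = (A + B) powr p"
proof -
  have "((A + B) / A) powr (p - 1) * A powr p = (A + B) powr (p - 1) * A"
    "((A + B) / B) powr (p - 1) * B powr p = (A + B) powr (p - 1) * B"
    using assms by (simp_all add: powr_divide powr_diff)
  then have "((A + B) / A) powr (p - 1) * A powr p + ((A + B) / B) powr (p - 1) * B powr p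
     = (A + B) powr (p - 1) * (A + B) powr 1"
    using assms by (simp add: distrib_left)
  then show ?thesis unfolding powr_add[symmetric] by simp
qed

lemma deriv_add_disc:
  assumes "f holomorphic_on unit_disc" "h holomorphic_on unit_disc" "z \<in> unit_disc"
  shows "deriv (\<lambda>z. f z + h z) z = deriv f z + deriv h z"
  using assms by (intro deriv_add holomorphic_on_imp_differentiable_at[of _ unit_disc]) auto

lemma deriv_cmult_disc:
  assumes "f holomorphic_on unit_disc" "z \<in> unit_disc"
  shows "deriv (\<lambda>z. c * f z) z = c * deriv f z"
  using assms by (intro deriv_cmult holomorphic_on_imp_differentiable_at[of _ unit_disc]) auto

lemma bmoa_integral_add_le:
  assumes p: "1 < p" and f: "f holomorphic_on unit_disc" and h: "h holomorphic_on unit_disc"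
    and A: "0 < A" "0 < B" and a: "a \<in> unit_disc"
  shows "bmoa_integral p (\<lambda>z. f z + h z) a
    \<le> ennreal (((A + B) / A) powr (p - 1)) * bmoa_integral p f a + ennreal (((A + B) / B) powr (p - 1)) * bmoa_integral p h a"
proof -
  let ?\<alpha> = "((A + B) / A) powr (p - 1)" and ?\<beta> = "((A + B) / B) powr (p - 1)"
  note mf = borel_measurable_bmoa_density_poisson[OF f p a]
  note mh = borel_measurable_bmoa_density_poisson[OF h p a]
  have "bmoa_integral p (\<lambda>z. f z + h z) a \<le> (\<integral>\<^sup>+ z. ennreal ?\<alpha> * (ennreal (bmoa_density p f z * poisson a z) * indicator unit_disc z)
      + ennreal ?\<beta> * (ennreal (bmoa_density p h z * poisson a z) * indicator unit_disc z) \<partial>disc_area)"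
    unfolding bmoa_integral_eq[OF a]
  proof (intro nn_integral_mono)
    fix z
    have *: "bmoa_density p (\<lambda>z. f z + h z) z * poisson a z
      \<le> ?\<alpha> * (bmoa_density p f z * poisson a z) + ?\<beta> * (bmoa_density p h z * poisson a z)" if z: "z \<in> unit_disc"
    proof -
      have "cmod (deriv f z + deriv h z) powr p \<le> (cmod (deriv f z) + cmod (deriv h z)) powr p"
        using p by (intro powr_mono2 norm_triangle_ineq) auto
      also have "\<dots> \<le> ?\<alpha> * cmod (deriv f z) powr p + ?\<beta> * cmod (deriv h z) powr p"
        using p A by (intro powr_add_le_weighted) auto
      finally have "cmod (deriv (\<lambda>z. f z + h z) z) powr p \<le> ?\<alpha> * cmod (deriv f z) powr p + ?\<beta> * cmod (deriv h z) powr p"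
        by (simp add: deriv_add_disc[OF f h z])
      then have "cmod (deriv (\<lambda>z. f z + h z) z) powr p * ((1 - (cmod z)\<^sup>2) powr (p - 1) * poisson a z)
        \<le> (?\<alpha> * cmod (deriv f z) powr p + ?\<beta> * cmod (deriv h z) powr p) * ((1 - (cmod z)\<^sup>2) powr (p - 1) * poisson a z)"
        using a by (intro mult_right_mono mult_nonneg_nonneg poisson_nonneg) auto
      then show ?thesis by (simp add: bmoa_density_def algebra_simps)
    qed
    have "0 \<le> poisson a z" using a by (intro poisson_nonneg) auto
    show "ennreal (bmoa_density p (\<lambda>z. f z + h z) z * poisson a z) * indicator unit_disc z
      \<le> ennreal ?\<alpha> * (ennreal (bmoa_density p f z * poisson a z) * indicator unit_disc z)
      + ennreal ?\<beta> * (ennreal (bmoa_density p h z * poisson a z) * indicator unit_disc z)"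
    proof (cases "z \<in> unit_disc")
      case True
      have "ennreal (?\<alpha> * (bmoa_density p f z * poisson a z) + ?\<beta> * (bmoa_density p h z * poisson a z))
        = ennreal ?\<alpha> * ennreal (bmoa_density p f z * poisson a z) + ennreal ?\<beta> * ennreal (bmoa_density p h z * poisson a z)"
        using \<open>0 \<le> poisson a z\<close> by (intro ennreal_lincomb) auto
      with ennreal_leI[OF *[OF True]] True show ?thesis by simp
    qed simp
  qed
  also have "\<dots> = ennreal ?\<alpha> * bmoa_integral p f a + ennreal ?\<beta> * bmoa_integral p h a"
  proof -
    have "(\<lambda>z. ennreal ?\<alpha> * (ennreal (bmoa_density p f z * poisson a z) * indicator unit_disc z)) \<in> borel_measurable disc_area"
      "(\<lambda>z. ennreal ?\<beta> * (ennreal (bmoa_density p h z * poisson a z) * indicator unit_disc z)) \<in> borel_measurable disc_area"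
      using mf mh by simp_all
    then show ?thesis
      using mf mh by (subst nn_integral_add) (simp_all add: nn_integral_cmult bmoa_integral_eq[OF a])
  qed
  finally show ?thesis .
qed

text \<open>Stated at a single point a and with free majorants A and B, because the gliding hump
  needs bounds for the summands that change from point to point. The numbers x and y carry the
  values at 0.\<close>

lemma bmoa_integral_minkowski:
  assumes p: "1 < p" and f: "f holomorphic_on unit_disc" and h: "h holomorphic_on unit_disc"
    and A: "0 < A" "0 < B" and a: "a \<in> unit_disc" and xy: "0 \<le> x" "0 \<le> y"
    and le: "ennreal (x powr p) + bmoa_integral p f a \<le> ennreal (A powr p)" "ennreal (y powr p) + bmoa_integral p h a \<le> ennreal (B powr p)"
  shows "ennreal ((x + y) powr p) + bmoa_integral p (\<lambda>z. f z + h z) a \<le> ennreal ((A + B) powr p)"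
proof -
  let ?\<alpha> = "((A + B) / A) powr (p - 1)" and ?\<beta> = "((A + B) / B) powr (p - 1)"
  have "ennreal ((x + y) powr p) \<le> ennreal (?\<alpha> * x powr p + ?\<beta> * y powr p)"
    using p A xy by (intro ennreal_leI powr_add_le_weighted)
  also have "\<dots> = ennreal ?\<alpha> * ennreal (x powr p) + ennreal ?\<beta> * ennreal (y powr p)"
    by (intro ennreal_lincomb) auto
  finally have "ennreal ((x + y) powr p) + bmoa_integral p (\<lambda>z. f z + h z) a
    \<le> (ennreal ?\<alpha> * ennreal (x powr p) + ennreal ?\<beta> * ennreal (y powr p))
      + (ennreal ?\<alpha> * bmoa_integral p f a + ennreal ?\<beta> * bmoa_integral p h a)"
    using p f h A a by (intro add_mono bmoa_integral_add_le)
  also have "\<dots> = ennreal ?\<alpha> * (ennreal (x powr p) + bmoa_integral p f a) + ennreal ?\<beta> * (ennreal (y powr p) + bmoa_integral p h a)"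
    by (simp add: distrib_left add.assoc add.left_commute)
  also have "\<dots> \<le> ennreal ?\<alpha> * ennreal (A powr p) + ennreal ?\<beta> * ennreal (B powr p)"
    by (intro add_mono mult_left_mono le) auto
  also have "\<dots> = ennreal ((A + B) powr p)"
    unfolding weights_sum_powr[OF A, symmetric] by (intro ennreal_lincomb[symmetric]) auto
  finally show ?thesis .
qed

section \<open>Linear and metric structure of \<open>BMOA p\<close> and
  \<open>VMOA p\<close>\<close>

lemma analytic_disc_add: "f \<in> analytic_disc \<Longrightarrow> h \<in> analytic_disc \<Longrightarrow> (\<lambda>z. f z + h z) \<in> analytic_disc"
  by (auto simp: analytic_disc_def intro: holomorphic_on_add)

lemma analytic_disc_cmult: "f \<in> analytic_disc \<Longrightarrow> (\<lambda>z. c * f z) \<in> analytic_disc"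
  by (auto simp: analytic_disc_def intro: holomorphic_intros)

lemma BMOA_add:
  assumes p: "1 < p" and f: "f \<in> BMOA p" and h: "h \<in> BMOA p"
  shows "(\<lambda>z. f z + h z) \<in> BMOA p" "bmoa_norm p (\<lambda>z. f z + h z) \<le> bmoa_norm p f + bmoa_norm p h"
proof -
  have an: "(\<lambda>z. f z + h z) \<in> analytic_disc"
    by (intro analytic_disc_add BMOA_analytic[OF f] BMOA_analytic[OF h])
  have *: "(\<lambda>z. f z + h z) \<in> BMOA p \<and> bmoa_norm p (\<lambda>z. f z + h z) \<le> bmoa_norm p f + bmoa_norm p h + e" if "0 < e" for e
  proof -
    \<comment> \<open>The weights divide by the two norms, so both are raised by e/2 to be positive;
      e is removed at the end.\<close>
    define A where "A = bmoa_norm p f + e / 2"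
    define B where "B = bmoa_norm p h + e / 2"
    have AB: "0 < A" "0 < B" using that by (auto simp: A_def B_def add_nonneg_pos)
    have le: "ennreal (cmod (f 0 + h 0) powr p) + bmoa_integral p (\<lambda>z. f z + h z) a \<le> ennreal ((A + B) powr p)"
      if a: "a \<in> unit_disc" for a
    proof -
      have "ennreal (cmod (f 0 + h 0) powr p) \<le> ennreal ((cmod (f 0) + cmod (h 0)) powr p)"
        using p by (intro ennreal_leI powr_mono2 norm_triangle_ineq) auto
      moreover have "ennreal (bmoa_norm p f powr p) \<le> ennreal (A powr p)" "ennreal (bmoa_norm p h powr p) \<le> ennreal (B powr p)"
        using p \<open>0 < e\<close> by (auto intro!: ennreal_leI powr_mono2 simp: A_def B_def)
      then have "ennreal ((cmod (f 0) + cmod (h 0)) powr p) + bmoa_integral p (\<lambda>z. f z + h z) a \<le> ennreal ((A + B) powr p)"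
        using bmoa_integral_le_norm[of p f a] bmoa_integral_le_norm[of p h a] p f h a AB
        by (intro bmoa_integral_minkowski BMOA_holomorphic[of _ p]) (auto intro: order_trans)
      ultimately show ?thesis by (meson add_right_mono order_trans)
    qed
    show ?thesis
      using BMOA_I[OF _ an, of p "A + B"] le AB p by (auto simp: A_def B_def)
  qed
  show "(\<lambda>z. f z + h z) \<in> BMOA p" using *[of 1] by simp
  show "bmoa_norm p (\<lambda>z. f z + h z) \<le> bmoa_norm p f + bmoa_norm p h"
    by (rule field_le_epsilon) (use * in blast)
qed

lemma bmoa_integral_cmult:
  assumes p: "1 < p" and f: "f holomorphic_on unit_disc" and a: "a \<in> unit_disc"
  shows "bmoa_integral p (\<lambda>z. c * f z) a = ennreal (cmod c powr p) * bmoa_integral p f a"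
proof -
  have "bmoa_integral p (\<lambda>z. c * f z) a
    = (\<integral>\<^sup>+ z. ennreal (cmod c powr p) * (ennreal (bmoa_density p f z * poisson a z) * indicator unit_disc z) \<partial>disc_area)"
    unfolding bmoa_integral_eq[OF a]
  proof (intro nn_integral_cong)
    fix z
    have "bmoa_density p (\<lambda>z. c * f z) z = cmod c powr p * bmoa_density p f z" if "z \<in> unit_disc"
      by (simp add: bmoa_density_def deriv_cmult_disc[OF f that] norm_mult powr_mult)
    then show "ennreal (bmoa_density p (\<lambda>z. c * f z) z * poisson a z) * indicator unit_disc z
      = ennreal (cmod c powr p) * (ennreal (bmoa_density p f z * poisson a z) * indicator unit_disc z)"
      by (cases "z \<in> unit_disc") (simp_all add: mult.assoc ennreal_mult'[of "cmod c powr p"])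
  qed
  then show ?thesis
    using borel_measurable_bmoa_density_poisson[OF f p a] a
    by (simp add: nn_integral_cmult bmoa_integral_eq)
qed

lemma BMOA_cmult_le:
  assumes p: "1 < p" and f: "f \<in> BMOA p"
  shows "(\<lambda>z. c * f z) \<in> BMOA p" "bmoa_norm p (\<lambda>z. c * f z) \<le> cmod c * bmoa_norm p f"
proof -
  have le: "ennreal (cmod (c * f 0) powr p) + bmoa_integral p (\<lambda>z. c * f z) a \<le> ennreal ((cmod c * bmoa_norm p f) powr p)"
    if a: "a \<in> unit_disc" for a
  proof -
    have "ennreal (cmod (c * f 0) powr p) + bmoa_integral p (\<lambda>z. c * f z) a
      = ennreal (cmod c powr p) * (ennreal (cmod (f 0) powr p) + bmoa_integral p f a)"
      using p a BMOA_holomorphic[OF f] by (simp add: bmoa_integral_cmult norm_mult powr_mult ennreal_mult distrib_left)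
    also have "\<dots> \<le> ennreal (cmod c powr p) * ennreal (bmoa_norm p f powr p)"
      using p f a by (intro mult_left_mono bmoa_integral_le_norm) auto
    also have "\<dots> = ennreal ((cmod c * bmoa_norm p f) powr p)" by (simp add: ennreal_mult powr_mult)
    finally show ?thesis .
  qed
  show "(\<lambda>z. c * f z) \<in> BMOA p" "bmoa_norm p (\<lambda>z. c * f z) \<le> cmod c * bmoa_norm p f"
    using BMOA_I[OF _ analytic_disc_cmult[OF BMOA_analytic[OF f]], of p "cmod c * bmoa_norm p f" c] le p by auto
qed

lemma bmoa_norm_cmult:
  assumes p: "1 < p" and f: "f \<in> BMOA p"
  shows "bmoa_norm p (\<lambda>z. c * f z) = cmod c * bmoa_norm p f"
proof (cases "c = 0")
  case True
  then show ?thesis using BMOA_cmult_le(2)[OF p f, of 0] bmoa_norm_nonneg[of p "\<lambda>z. 0"] by simp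
next
  case False
  have "bmoa_norm p (\<lambda>z. inverse c * (c * f z)) \<le> cmod (inverse c) * bmoa_norm p (\<lambda>z. c * f z)"
    by (rule BMOA_cmult_le[OF p BMOA_cmult_le(1)[OF p f]])
  then have "bmoa_norm p f \<le> inverse (cmod c) * bmoa_norm p (\<lambda>z. c * f z)"
    using False by (simp add: norm_inverse mult.assoc[symmetric])
  then have "cmod c * bmoa_norm p f \<le> cmod c * (inverse (cmod c) * bmoa_norm p (\<lambda>z. c * f z))"
    by (rule mult_left_mono) simp
  then have "cmod c * bmoa_norm p f \<le> bmoa_norm p (\<lambda>z. c * f z)"
    using False by (simp add: mult.assoc[symmetric])
  then show ?thesis using BMOA_cmult_le(2)[OF p f, of c] by simp
qed

lemma BMOA_diff:
  assumes p: "1 < p" and f: "f \<in> BMOA p" and h: "h \<in> BMOA p"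
  shows "(\<lambda>z. f z - h z) \<in> BMOA p" "bmoa_norm p (\<lambda>z. f z - h z) \<le> bmoa_norm p f + bmoa_norm p h"
  using BMOA_add[OF p f BMOA_cmult_le(1)[OF p h, of "-1"]] bmoa_norm_cmult[OF p h, of "-1"] by simp_all

lemma VMOA_subset_BMOA: "VMOA p \<subseteq> BMOA p"
  by (auto simp: VMOA_def)

lemma VMOA_add:
  assumes p: "1 < p" and f: "f \<in> VMOA p" and h: "h \<in> VMOA p"
  shows "(\<lambda>z. f z + h z) \<in> VMOA p"
proof (rule VMOA_I)
  have fh: "f \<in> BMOA p" "h \<in> BMOA p" using f h VMOA_subset_BMOA by auto
  then show "(\<lambda>z. f z + h z) \<in> BMOA p" by (rule BMOA_add[OF p])
  fix e :: real assume e: "0 < e"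
  define d where "d = e / (2 * 2 powr (p - 1))"
  have d: "0 < ennreal d" using e by (simp add: d_def)
  obtain r s where r: "r < 1" "\<And>a. r < cmod a \<Longrightarrow> cmod a < 1 \<Longrightarrow> bmoa_integral p f a < ennreal d"
    and s: "s < 1" "\<And>a. s < cmod a \<Longrightarrow> cmod a < 1 \<Longrightarrow> bmoa_integral p h a < ennreal d"
    using VMOA_D[OF f d] VMOA_D[OF h d] by blast
  show "\<exists>r<1. \<forall>a. r < cmod a \<longrightarrow> cmod a < 1 \<longrightarrow> bmoa_integral p (\<lambda>z. f z + h z) a \<le> ennreal e"
  proof (intro exI[of _ "max r s"] conjI allI impI)
    fix a assume a: "max r s < cmod a" "cmod a < 1"
    have "bmoa_integral p (\<lambda>z. f z + h z) a \<le> ennreal (2 powr (p - 1)) * bmoa_integral p f a + ennreal (2 powr (p - 1)) * bmoa_integral p h a"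
      using bmoa_integral_add_le[OF p BMOA_holomorphic[OF fh(1)] BMOA_holomorphic[OF fh(2)], of 1 1 a] a by simp
    also have "\<dots> \<le> ennreal (2 powr (p - 1)) * ennreal d + ennreal (2 powr (p - 1)) * ennreal d"
      using r(2)[of a] s(2)[of a] a by (intro add_mono mult_left_mono) auto
    also have "\<dots> = ennreal e"
      using e by (subst ennreal_lincomb[symmetric]) (auto simp: d_def)
    finally show "bmoa_integral p (\<lambda>z. f z + h z) a \<le> ennreal e" .
  qed (use r s in auto)
qed

lemma VMOA_cmult:
  assumes p: "1 < p" and f: "f \<in> VMOA p"
  shows "(\<lambda>z. c * f z) \<in> VMOA p"
proof (rule VMOA_I)
  have fB: "f \<in> BMOA p" using f VMOA_subset_BMOA by auto
  then show "(\<lambda>z. c * f z) \<in> BMOA p" by (rule BMOA_cmult_le[OF p])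
  fix e :: real assume e: "0 < e"
  define d where "d = e / (cmod c powr p + 1)"
  have d: "0 < d" using e by (simp add: d_def add_nonneg_pos)
  then obtain r where r: "r < 1" "\<And>a. r < cmod a \<Longrightarrow> cmod a < 1 \<Longrightarrow> bmoa_integral p f a < ennreal d"
    using VMOA_D[OF f, of "ennreal d"] by auto
  show "\<exists>r<1. \<forall>a. r < cmod a \<longrightarrow> cmod a < 1 \<longrightarrow> bmoa_integral p (\<lambda>z. c * f z) a \<le> ennreal e"
  proof (intro exI[of _ r] conjI allI impI)
    fix a assume a: "r < cmod a" "cmod a < 1"
    have "bmoa_integral p (\<lambda>z. c * f z) a = ennreal (cmod c powr p) * bmoa_integral p f a"
      using a by (intro bmoa_integral_cmult[OF p BMOA_holomorphic[OF fB]]) auto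
    also have "\<dots> \<le> ennreal (cmod c powr p) * ennreal d"
      using r(2)[of a] a by (intro mult_left_mono) auto
    also have "\<dots> = ennreal (cmod c powr p * d)" using d by (simp add: ennreal_mult)
    also have "\<dots> \<le> ennreal e"
    proof (rule ennreal_leI)
      have "cmod c powr p * d \<le> (cmod c powr p + 1) * d" using d by (intro mult_right_mono) auto
      also have "\<dots> = e" using add_nonneg_pos[OF powr_ge_zero[of "cmod c" p] zero_less_one] by (simp add: d_def)
      finally show "cmod c powr p * d \<le> e" .
    qed
    finally show "bmoa_integral p (\<lambda>z. c * f z) a \<le> ennreal e" .
  qed (use r in auto)
qed

lemma analytic_disc_eqI: "f \<in> analytic_disc \<Longrightarrow> h \<in> analytic_disc \<Longrightarrow> (\<And>z. z \<in> unit_disc \<Longrightarrow> f z = h z) \<Longrightarrow> f = h"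
  by (rule ext) (metis (mono_tags, lifting) analytic_disc_def mem_Collect_eq)

lemma Metric_space_BMOA:
  assumes p: "1 < p" "p \<le> 2"
  shows "Metric_space (BMOA p) (\<lambda>f g. bmoa_norm p (\<lambda>z. f z - g z))"
proof
  show "0 \<le> bmoa_norm p (\<lambda>z. f z - g z)" for f g by simp
  show "bmoa_norm p (\<lambda>z. f z - g z) = bmoa_norm p (\<lambda>z. g z - f z)" for f g
  proof -
    have "bmoa_integral p (\<lambda>z. f z - g z) a = bmoa_integral p (\<lambda>z. g z - f z) a" for a
    proof -
      \<comment> \<open>Symmetry of the distance is required for arbitrary functions, not only for
        members of the space. Where u has no derivative, neither has its negative, and both sides
        are the same default value.\<close>
      have norm_deriv_minus: "cmod (deriv (\<lambda>z. - u z) z) = cmod (deriv u z)" for u :: "complex \<Rightarrow> complex" and z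
      proof (cases "u field_differentiable at z")
        case True
        then show ?thesis by simp
      next
        case False
        have "\<not> (u has_field_derivative D) (at z)" for D using False by (auto simp: field_differentiable_def)
        moreover have "\<not> ((\<lambda>z. - u z) has_field_derivative D) (at z)" for D
          using False field_differentiable_minus[of "\<lambda>z. - u z" "at z"] by (auto simp: field_differentiable_def)
        ultimately show ?thesis unfolding deriv_def by simp
      qed
      have "cmod (deriv (\<lambda>z. g z - f z) z) = cmod (deriv (\<lambda>z. f z - g z) z)" for z
        using norm_deriv_minus[of "\<lambda>z. f z - g z" z] by simp
      then show ?thesis unfolding bmoa_integral_def by simp
    qed
    then show ?thesis unfolding bmoa_norm_def by (simp add: norm_minus_commute)
  qed
  show "bmoa_norm p (\<lambda>z. f z - g z) = 0 \<longleftrightarrow> f = g" if "f \<in> BMOA p" "g \<in> BMOA p" for f g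
  proof
    assume z: "bmoa_norm p (\<lambda>z. f z - g z) = 0"
    show "f = g"
    proof (rule analytic_disc_eqI[OF BMOA_analytic[OF that(1)] BMOA_analytic[OF that(2)]])
      fix w assume "w \<in> unit_disc"
      then show "f w = g w"
        using growth_bound[OF p BMOA_diff(1)[OF p(1) that], of w] z by simp
    qed
  next
    assume "f = g"
    then show "bmoa_norm p (\<lambda>z. f z - g z) = 0"
      using bmoa_norm_cmult[OF p(1) that(1), of 0] by simp
  qed
  show "bmoa_norm p (\<lambda>z. f z - k z) \<le> bmoa_norm p (\<lambda>z. f z - g z) + bmoa_norm p (\<lambda>z. g z - k z)"
    if "f \<in> BMOA p" "g \<in> BMOA p" "k \<in> BMOA p" for f g k
    using BMOA_add(2)[OF p(1) BMOA_diff(1)[OF p(1) that(1,2)] BMOA_diff(1)[OF p(1) that(2,3)]] by simp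
qed

section \<open>Membership criteria by Carleson boxes\<close>

lemma bmoa_integral_le_box:
  assumes p: "1 < p" and f: "f holomorphic_on unit_disc" and a: "a \<in> unit_disc"
    and box: "\<And>\<xi> u. cmod \<xi> = 1 \<Longrightarrow> 0 < u \<Longrightarrow> emeasure (gmeasure p f) (ball \<xi> u) \<le> K * ennreal u"
  shows "bmoa_integral p f a \<le> K * 64"
proof (cases "a = 0")
  case True
  show ?thesis
    unfolding bmoa_integral_gmeasure[OF f p a]
    by (rule poisson_integral_le_box[where \<zeta> = 1 and h = 1]) (use True box[of 1] in auto)
next
  case False
  note pol = polar_near_circle[OF a False]
  show ?thesis
    unfolding bmoa_integral_gmeasure[OF f p a]
    by (rule poisson_integral_le_box[OF _ pol(1) _ _ pol(2)]) (use a box[OF pol(1)] in auto)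
qed

lemma BMOA_I_box:
  assumes p: "1 < p" and f: "f \<in> analytic_disc" and K: "0 \<le> K"
    and box: "\<And>\<xi> u. cmod \<xi> = 1 \<Longrightarrow> 0 < u \<Longrightarrow> emeasure (gmeasure p f) (ball \<xi> u) \<le> ennreal K * ennreal u"
  shows "f \<in> BMOA p"
proof (rule BMOA_I(1))
  fix a assume a: "a \<in> unit_disc"
  have "bmoa_integral p f a \<le> ennreal K * 64"
    using f box by (intro bmoa_integral_le_box[OF p _ a]) (auto simp: analytic_disc_def)
  also have "\<dots> = ennreal (K * 64)" using K by (simp add: ennreal_mult)
  finally have "ennreal (cmod (f 0) powr p) + bmoa_integral p f a \<le> ennreal (cmod (f 0) powr p + K * 64)"
    using K by (simp add: ennreal_plus add_left_mono)
  then show "ennreal (cmod (f 0) powr p) + bmoa_integral p f a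
      \<le> ennreal (((cmod (f 0) powr p + K * 64) powr (1 / p)) powr p)"
    using p K by (simp add: powr_powr)
qed (use p f in auto)

text \<open>A bounded derivative bounds the density, so a box of radius u has mass at most C*u^2,
  which is negligible against u.\<close>

lemma VMOA_I_bounded_deriv:
  assumes p: "1 < p" and f: "f \<in> analytic_disc" and B: "0 \<le> B" "\<And>z. z \<in> unit_disc \<Longrightarrow> cmod (deriv f z) \<le> B"
  shows "f \<in> VMOA p"
proof -
  have hol: "f holomorphic_on unit_disc" using f by (simp add: analytic_disc_def)
  define C where "C = B powr p"
  have C: "0 \<le> C" by (simp add: C_def)
  have dens: "bmoa_density p f z \<le> C" if "z \<in> unit_disc" for z
  proof -
    have "(1 - (cmod z)\<^sup>2) powr (p - 1) \<le> 1 powr (p - 1)"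
      using p that by (intro powr_mono2) (auto simp: abs_square_le_1)
    then have "bmoa_density p f z \<le> B powr p * 1"
      unfolding bmoa_density_def using p B(2)[OF that] by (intro mult_mono powr_mono2) auto
    then show ?thesis by (simp add: C_def)
  qed
  have le: "emeasure (gmeasure p f) A \<le> ennreal C * emeasure disc_area A" if "A \<in> sets borel" for A
  proof -
    have "emeasure (gmeasure p f) A \<le> (\<integral>\<^sup>+ z. ennreal C * indicator A z \<partial>disc_area)"
      unfolding emeasure_gmeasure[OF hol p that] using dens
      by (intro nn_integral_mono) (auto intro!: ennreal_leI split: split_indicator)
    then show ?thesis using that by (simp add: nn_integral_cmult_indicator)
  qed
  have ball: "emeasure (gmeasure p f) (ball \<xi> u) \<le> ennreal (C * u\<^sup>2)" if "0 < u" for \<xi> u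
    using le[of "ball \<xi> u"] mult_left_mono[OF emeasure_disc_area_ball_le[of u \<xi>], of "ennreal C"] that C
    by (simp add: ennreal_mult order_trans)
  have fB: "f \<in> BMOA p"
  proof (rule BMOA_I_box[OF p f C])
    fix \<xi> :: complex and u :: real assume u: "0 < u"
    show "emeasure (gmeasure p f) (ball \<xi> u) \<le> ennreal C * ennreal u"
    proof (cases "u \<le> 1")
      case True
      have "C * u\<^sup>2 \<le> C * u" using True u C by (intro mult_left_mono) (auto simp: power2_eq_square mult_left_le)
      then show ?thesis
        using ball[OF u, of \<xi>] u C by (simp add: order_trans[OF _ ennreal_leI] flip: ennreal_mult)
    next
      case False
      have "emeasure (gmeasure p f) (ball \<xi> u) \<le> ennreal C * emeasure disc_area (ball \<xi> u)" by (rule le) simp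
      also have "\<dots> \<le> ennreal C * emeasure disc_area UNIV" by (intro mult_left_mono emeasure_mono) auto
      also have "\<dots> = ennreal C * ennreal 1" by simp
      also have "\<dots> \<le> ennreal C * ennreal u" using False by (intro mult_left_mono ennreal_leI) auto
      finally show ?thesis .
    qed
  qed
  show ?thesis
  proof (rule VMOA_I_box[OF p fB])
    fix e :: real assume e: "0 < e"
    show "\<exists>\<delta>>0. \<forall>\<zeta> u. cmod \<zeta> = 1 \<longrightarrow> 0 < u \<longrightarrow> u \<le> \<delta> \<longrightarrow> emeasure (gmeasure p f) (ball \<zeta> u) \<le> ennreal (e * u)"
    proof (intro exI[of _ "e / (C + 1)"] conjI allI impI)
      show "0 < e / (C + 1)" using e C by simp
      fix \<zeta> :: complex and u :: real assume u: "0 < u" "u \<le> e / (C + 1)"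
      have "C * u \<le> (C + 1) * u" using u by simp
      also have "\<dots> \<le> e" using u C by (simp add: field_simps)
      finally have "C * u * u \<le> e * u" using u by (intro mult_right_mono) auto
      then show "emeasure (gmeasure p f) (ball \<zeta> u) \<le> ennreal (e * u)"
        using ball[OF u(1), of \<zeta>] by (simp add: power2_eq_square mult.assoc order_trans[OF _ ennreal_leI])
    qed
  qed
qed

subsection \<open>Squared logarithms as test functions\<close>

text \<open>The centre \<xi> is independent of the pole \<zeta>, because a test function at \<zeta>
  has to be checked on boxes everywhere. Either the ball lies in one of radius 3*u about the pole,
  or the integrand is at most 1/u on it.\<close>

lemma nn_integral_inverse_dist_ball:
  assumes "0 < u"
  shows "(\<integral>\<^sup>+ z \<in> ball \<xi> u. ennreal (1 / cmod (z - \<zeta>)) \<partial>disc_area) \<le> ennreal (12 * u)"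
proof (cases "cmod (\<xi> - \<zeta>) \<le> 2 * u")
  case True
  have "(\<integral>\<^sup>+ z \<in> ball \<xi> u. ennreal (1 / cmod (z - \<zeta>)) \<partial>disc_area) \<le> (\<integral>\<^sup>+ z \<in> ball \<zeta> (3 * u). ennreal (cmod (z - \<zeta>) powr (- 1)) \<partial>disc_area)"
  proof (intro nn_integral_mono)
    fix z
    have "z \<in> ball \<zeta> (3 * u)" if "z \<in> ball \<xi> u"
      using that True norm_triangle_ineq[of "z - \<xi>" "\<xi> - \<zeta>"] by (simp add: dist_norm norm_minus_commute)
    moreover have "1 / cmod (z - \<zeta>) = cmod (z - \<zeta>) powr (- 1)"
      by (cases "z = \<zeta>") (auto simp: powr_minus divide_inverse)
    ultimately show "ennreal (1 / cmod (z - \<zeta>)) * indicator (ball \<xi> u) z \<le> ennreal (cmod (z - \<zeta>) powr (- 1)) * indicator (ball \<zeta> (3 * u)) z"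
      by (auto split: split_indicator)
  qed
  also have "\<dots> \<le> ennreal (2 powr 1 / (1 - 2 powr (1 - 2)) * (3 * u) powr (2 - 1))"
    using assms by (intro nn_integral_inverse_powr_ball) auto
  also have "2 powr 1 / (1 - 2 powr (1 - 2)) * (3 * u) powr (2 - 1) = 12 * u"
    using assms by (simp add: powr_minus)
  finally show ?thesis .
next
  case False
  have "(\<integral>\<^sup>+ z \<in> ball \<xi> u. ennreal (1 / cmod (z - \<zeta>)) \<partial>disc_area) \<le> (\<integral>\<^sup>+ z. ennreal (1 / u) * indicator (ball \<xi> u) z \<partial>disc_area)"
  proof (intro nn_integral_mono)
    fix z
    have "1 / cmod (z - \<zeta>) \<le> 1 / u" if "z \<in> ball \<xi> u"
    proof -
      have "u \<le> cmod (z - \<zeta>)"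
        using that False norm_triangle_ineq4[of "z - \<zeta>" "z - \<xi>"] by (simp add: dist_norm norm_minus_commute)
      then show ?thesis using assms by (intro frac_le) auto
    qed
    then show "ennreal (1 / cmod (z - \<zeta>)) * indicator (ball \<xi> u) z \<le> ennreal (1 / u) * indicator (ball \<xi> u) z"
      by (auto intro!: ennreal_leI split: split_indicator)
  qed
  also have "\<dots> = ennreal (1 / u) * emeasure disc_area (ball \<xi> u)" by (simp add: nn_integral_cmult_indicator)
  also have "\<dots> \<le> ennreal (1 / u) * ennreal (u\<^sup>2)"
    using assms by (intro mult_left_mono emeasure_disc_area_ball_le) auto
  also have "\<dots> = ennreal (1 / u * u\<^sup>2)" using assms by (subst ennreal_mult) auto
  also have "\<dots> \<le> ennreal (12 * u)" using assms by (intro ennreal_leI) (simp add: power2_eq_square)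
  finally show ?thesis .
qed

text \<open>The logarithm alone already has a bounded norm and height \<open>blog h\<close> near
  \<zeta>, the largest order possible. Squaring it and dividing by \<open>blog h\<close> preserves
  both properties and adds a third: on compact subsets of the disc the functions tend to 0 as h
  tends to 0, which the gliding hump needs.\<close>

definition test_fun :: "complex \<Rightarrow> real \<Rightarrow> complex \<Rightarrow> complex"
  where "test_fun \<zeta> h z =
    (if z \<in> unit_disc then (Ln (1 - cnj (of_real (1 - h) * \<zeta>) * z))\<^sup>2 / of_real (blog h) else 0)"

context
  fixes \<zeta> :: complex and h :: real
  assumes \<zeta>: "cmod \<zeta> = 1" and h: "0 < h" "h \<le> 1 / 2"
begin

private definition w :: "complex \<Rightarrow> complex" where "w z = 1 - cnj (of_real (1 - h) * \<zeta>) * z"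

lemma w_bounds:
  assumes "z \<in> unit_disc"
  shows "h \<le> cmod (w z)" "cmod (w z) \<le> 2" "cmod (z - \<zeta>) \<le> 2 * cmod (w z)" "cmod (w z) \<le> cmod (z - \<zeta>) + h"
    "0 < Re (w z)" "1 - cmod z \<le> cmod (w z)"
proof -
  have z: "cmod z < 1" using assms by simp
  note d = dist_box_le[OF \<zeta> z _ _ refl, of h]
  show "h \<le> cmod (w z)" "cmod (z - \<zeta>) \<le> 2 * cmod (w z)" "cmod (w z) \<le> cmod (z - \<zeta>) + h"
    using d h by (auto simp: w_def)
  have a: "cmod (of_real (1 - h) * \<zeta>) = 1 - h" using d(4) h by simp
  show "1 - cmod z \<le> cmod (w z)" unfolding w_def using a h by (intro one_minus_cnj_mult_ge) auto
  have n: "cmod (cnj (of_real (1 - h) * \<zeta>) * z) < 1"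
  proof -
    have "cmod (cnj (of_real (1 - h) * \<zeta>) * z) = (1 - h) * cmod z" using a by (simp only: norm_mult complex_mod_cnj)
    also have "\<dots> \<le> 1 * cmod z" using h by (intro mult_right_mono) auto
    finally show ?thesis using z by simp
  qed
  then show "cmod (w z) \<le> 2" using norm_triangle_ineq4[of 1 "cnj (of_real (1 - h) * \<zeta>) * z"] by (simp add: w_def)
  show "0 < Re (w z)" using n complex_Re_le_cmod[of "cnj (of_real (1 - h) * \<zeta>) * z"] by (simp add: w_def)
qed

text \<open>The summand 2 is the room for the argument of \<open>Ln\<close>; it is supplied by ln
  16, that is, by the constant 16 in \<open>blog\<close>.\<close>

lemma blog_ge_2: "2 \<le> blog h" "ln (1 / h) + 2 \<le> blog h"
proof -
  have "blog h = ln 16 + ln (1 / h)" using h by (simp add: blog_def ln_div)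
  moreover have "ln (16::real) = 4 * ln 2" using ln_realpow[of 2 4] by simp
  moreover have "0 \<le> ln (1 / h)" using h by simp
  ultimately show "2 \<le> blog h" "ln (1 / h) + 2 \<le> blog h" using ln_2_ge_half by auto
qed

text \<open>\<open>w z\<close> lies in the right half-plane, so the imaginary part of the principal
  logarithm costs at most 2 and the modulus decides.\<close>

lemma norm_Ln_w:
  assumes "z \<in> unit_disc"
  shows "\<bar>ln (cmod (w z))\<bar> \<le> cmod (Ln (w z))" "cmod (Ln (w z)) \<le> \<bar>ln (cmod (w z))\<bar> + 2"
    "cmod (Ln (w z)) \<le> blog h"
    "\<And>t. 0 < t \<Longrightarrow> t \<le> 1 / 2 \<Longrightarrow> t \<le> cmod (w z) \<Longrightarrow> cmod (Ln (w z)) \<le> ln (1 / t) + 2"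
proof -
  note wb = w_bounds[OF assms]
  have nz: "w z \<noteq> 0" using wb(1) h by auto
  have Re: "Re (Ln (w z)) = ln (cmod (w z))" using nz by simp
  have "\<bar>Im (Ln (w z))\<bar> < pi / 2" using Re_Ln_pos_lt[OF nz] wb(5) by simp
  then have Im: "\<bar>Im (Ln (w z))\<bar> \<le> 2" using pi_less_4 by simp
  show "\<bar>ln (cmod (w z))\<bar> \<le> cmod (Ln (w z))" using abs_Re_le_cmod[of "Ln (w z)"] Re by simp
  show 2: "cmod (Ln (w z)) \<le> \<bar>ln (cmod (w z))\<bar> + 2" using cmod_le[of "Ln (w z)"] Re Im by simp
  show 4: "cmod (Ln (w z)) \<le> ln (1 / t) + 2" if t: "0 < t" "t \<le> 1 / 2" "t \<le> cmod (w z)" for t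
  proof -
    have "ln t \<le> ln (cmod (w z))" using t by (intro ln_mono) auto
    moreover have "ln (cmod (w z)) \<le> ln (1 / t)"
    proof (rule ln_mono)
      have "t * cmod (w z) \<le> 1 / 2 * 2" using t wb(2) by (intro mult_mono) auto
      then show "cmod (w z) \<le> 1 / t" using t by (simp add: field_simps)
    qed (use t in auto)
    ultimately have "\<bar>ln (cmod (w z))\<bar> \<le> ln (1 / t)" using t by (simp add: ln_div)
    then show ?thesis using 2 by simp
  qed
  show "cmod (Ln (w z)) \<le> blog h" using 4[OF h wb(1)] blog_ge_2(2) by simp
qed

lemma test_fun_eq: "z \<in> unit_disc \<Longrightarrow> test_fun \<zeta> h z = (Ln (w z))\<^sup>2 / of_real (blog h)"
  by (simp add: test_fun_def w_def)

lemma norm_test_fun: "z \<in> unit_disc \<Longrightarrow> cmod (test_fun \<zeta> h z) = (cmod (Ln (w z)))\<^sup>2 / blog h"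
  using blog_ge_2 by (simp add: test_fun_eq norm_divide norm_power)

lemma test_fun_deriv:
  assumes z: "z \<in> unit_disc"
  shows "(test_fun \<zeta> h has_field_derivative
      2 * Ln (w z) * (- cnj (of_real (1 - h) * \<zeta>) / w z) / of_real (blog h)) (at z)"
proof -
  have "w z \<notin> \<real>\<^sub>\<le>\<^sub>0" using w_bounds(5)[OF z] complex_nonpos_Reals_iff by auto
  moreover have "(w has_field_derivative - cnj (of_real (1 - h) * \<zeta>)) (at z)"
    unfolding w_def[abs_def] by (auto intro!: derivative_eq_intros)
  ultimately have "((\<lambda>z. Ln (w z)) has_field_derivative inverse (w z) * - cnj (of_real (1 - h) * \<zeta>)) (at z)"
    by (intro DERIV_chain2[of Ln] has_field_derivative_Ln)
  from DERIV_cdivide[OF DERIV_power[OF this, of 2], of "of_real (blog h)"]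
  have "((\<lambda>z. (Ln (w z))\<^sup>2 / of_real (blog h)) has_field_derivative
      2 * Ln (w z) * (- cnj (of_real (1 - h) * \<zeta>) / w z) / of_real (blog h)) (at z)"
    by (simp add: divide_inverse mult_ac)
  then show ?thesis
    by (rule has_field_derivative_transform_within_open[of _ _ _ unit_disc]) (use z test_fun_eq in auto)
qed

lemma test_fun_analytic: "test_fun \<zeta> h \<in> analytic_disc"
proof -
  have "test_fun \<zeta> h holomorphic_on unit_disc"
    unfolding holomorphic_on_open[OF open_ball] using test_fun_deriv by blast
  then show ?thesis by (simp add: analytic_disc_def test_fun_def)
qed

lemma test_fun_0: "test_fun \<zeta> h 0 = 0"
  by (simp add: test_fun_def)

text \<open>The parameter s measures the logarithm against its maximum \<open>blog h\<close>. The
  value s = 1 is always admissible and gives the uniform norm bound; away from \<zeta> a value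
  tending to 0 with h is admissible and gives the decay of the mass.\<close>

lemma test_fun_deriv_le:
  assumes z: "z \<in> unit_disc" and s: "cmod (Ln (w z)) \<le> s * blog h"
  shows "cmod (deriv (test_fun \<zeta> h) z) \<le> s * (2 / cmod (w z))"
proof -
  have d: "deriv (test_fun \<zeta> h) z = 2 * Ln (w z) * (- cnj (of_real (1 - h) * \<zeta>) / w z) / of_real (blog h)"
    by (rule DERIV_imp_deriv[OF test_fun_deriv[OF z]])
  have a: "cmod (cnj (of_real (1 - h) * \<zeta>)) \<le> 1"
    using \<zeta> h by (simp add: norm_mult del: of_real_diff)
  have wp: "0 < cmod (w z)" using w_bounds(1)[OF z] h by linarith
  have "cmod (deriv (test_fun \<zeta> h) z) = (cmod (Ln (w z)) / blog h) * (2 / cmod (w z)) * cmod (cnj (of_real (1 - h) * \<zeta>))"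
    unfolding d using blog_ge_2(1) by (simp only: norm_mult norm_divide norm_minus_cancel norm_of_real) (simp add: mult_ac)
  also have "\<dots> \<le> (cmod (Ln (w z)) / blog h) * (2 / cmod (w z)) * 1"
    using a wp blog_ge_2(1) by (intro mult_left_mono) auto
  also have "\<dots> \<le> s * (2 / cmod (w z)) * 1"
    using s blog_ge_2(1) wp by (intro mult_right_mono) (auto simp: field_simps)
  finally show ?thesis by simp
qed

lemma test_fun_density_le:
  assumes p: "1 < p" "p \<le> 2" and z: "z \<in> unit_disc" and s: "0 \<le> s" "cmod (Ln (w z)) \<le> s * blog h"
  shows "bmoa_density p (test_fun \<zeta> h) z \<le> s powr p * (32 * (1 / cmod (z - \<zeta>)))"
proof -
  define x where "x = cmod (z - \<zeta>)"
  have "1 - cmod z \<le> x" using norm_triangle_ineq2[of \<zeta> z] \<zeta> by (simp add: norm_minus_commute x_def)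
  then have x: "0 < x" using z by simp
  have D: "1 - (cmod z)\<^sup>2 \<le> 2 * x"
    using zero_le_power2[of "1 - cmod z"] \<open>1 - cmod z \<le> x\<close> by (simp add: power2_eq_square algebra_simps)
  have "cmod (deriv (test_fun \<zeta> h) z) \<le> s * (2 / cmod (w z))" by (rule test_fun_deriv_le[OF z s(2)])
  also have "\<dots> \<le> s * (4 / x)"
  proof (intro mult_left_mono s(1))
    have "0 < cmod (w z)" using w_bounds(1)[OF z] h by linarith
    then show "2 / cmod (w z) \<le> 4 / x" using w_bounds(3)[OF z] x by (simp add: x_def divide_simps)
  qed
  finally have "cmod (deriv (test_fun \<zeta> h) z) powr p \<le> (s * (4 / x)) powr p" using p by (intro powr_mono2) auto
  moreover have "(1 - (cmod z)\<^sup>2) powr (p - 1) \<le> (2 * x) powr (p - 1)"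
    using p D z by (intro powr_mono2) (auto simp: abs_square_le_1)
  ultimately have "bmoa_density p (test_fun \<zeta> h) z \<le> (s * (4 / x)) powr p * (2 * x) powr (p - 1)"
    unfolding bmoa_density_def by (intro mult_mono) auto
  also have "\<dots> = s powr p * (4 powr p * 2 powr (p - 1)) * (1 / x)"
    using x s by (simp add: powr_mult powr_divide powr_diff)
  also have "\<dots> \<le> s powr p * (4 powr 2 * 2 powr 1) * (1 / x)"
    using p x by (intro mult_right_mono mult_left_mono mult_mono powr_mono) auto
  finally show ?thesis by (simp add: x_def)
qed

text \<open>With s = 1 the density is at most 32/|z - \<zeta>|, and 1/|z - \<zeta>| integrates to at
  most 12*u over any ball of radius u. The bound is uniform in h and in the position of the
  box.\<close>

lemma test_fun_box:
  assumes p: "1 < p" "p \<le> 2" and u: "0 < u"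
  shows "emeasure (gmeasure p (test_fun \<zeta> h)) (ball \<xi> u) \<le> ennreal 384 * ennreal u"
proof -
  have hol: "test_fun \<zeta> h holomorphic_on unit_disc" using test_fun_analytic by (simp add: analytic_disc_def)
  have "emeasure (gmeasure p (test_fun \<zeta> h)) (ball \<xi> u)
    \<le> (\<integral>\<^sup>+ z. ennreal 32 * (ennreal (1 / cmod (z - \<zeta>)) * indicator (ball \<xi> u) z) \<partial>disc_area)"
    unfolding emeasure_gmeasure[OF hol p(1) borel_open[OF open_ball]]
  proof (intro nn_integral_mono)
    fix z
    have "bmoa_density p (test_fun \<zeta> h) z \<le> 32 * (1 / cmod (z - \<zeta>))" if "z \<in> unit_disc"
      using test_fun_density_le[OF p that, of 1] norm_Ln_w(3)[OF that] by simp
    then have "ennreal (bmoa_density p (test_fun \<zeta> h) z) \<le> ennreal 32 * ennreal (1 / cmod (z - \<zeta>))" if "z \<in> unit_disc"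
      using that by (subst ennreal_mult[symmetric]) (auto intro!: ennreal_leI)
    then show "ennreal (bmoa_density p (test_fun \<zeta> h) z) * indicator (ball \<xi> u \<inter> unit_disc) z
      \<le> ennreal 32 * (ennreal (1 / cmod (z - \<zeta>)) * indicator (ball \<xi> u) z)"
      by (cases "z \<in> ball \<xi> u \<inter> unit_disc") simp_all
  qed
  also have "\<dots> = ennreal 32 * (\<integral>\<^sup>+ z \<in> ball \<xi> u. ennreal (1 / cmod (z - \<zeta>)) \<partial>disc_area)"
  proof (rule nn_integral_cmult)
    have [measurable]: "ball \<xi> u \<in> sets borel" by simp
    have "(\<lambda>z. ennreal (1 / cmod (z - \<zeta>)) * indicator (ball \<xi> u) z) \<in> borel_measurable borel" by measurable
    then show "(\<lambda>z. ennreal (1 / cmod (z - \<zeta>)) * indicator (ball \<xi> u) z) \<in> borel_measurable disc_area" by simp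
  qed
  also have "\<dots> \<le> ennreal 32 * ennreal (12 * u)"
    by (intro mult_left_mono nn_integral_inverse_dist_ball u) simp
  also have "\<dots> = ennreal 384 * ennreal u" using u ennreal_mult[of 32 "12 * u"] ennreal_mult[of 384 u] by simp
  finally show ?thesis .
qed

lemma test_fun_bmoa_integral_le:
  assumes p: "1 < p" "p \<le> 2" and a: "a \<in> unit_disc"
  shows "bmoa_integral p (test_fun \<zeta> h) a \<le> ennreal (24576 powr p)"
proof -
  have "bmoa_integral p (test_fun \<zeta> h) a \<le> ennreal 384 * 64"
    using test_fun_analytic by (intro bmoa_integral_le_box[OF p(1) _ a] test_fun_box p) (auto simp: analytic_disc_def)
  also have "\<dots> = ennreal (24576 powr 1)" by simp
  also have "\<dots> \<le> ennreal (24576 powr p)" using p by (intro ennreal_leI powr_mono) auto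
  finally show ?thesis .
qed

lemma test_fun_VMOA: "1 < p \<Longrightarrow> test_fun \<zeta> h \<in> VMOA p"
proof (rule VMOA_I_bounded_deriv[OF _ test_fun_analytic])
  fix z assume z: "z \<in> unit_disc"
  have "cmod (deriv (test_fun \<zeta> h) z) \<le> 1 * (2 / cmod (w z))"
    using norm_Ln_w(3)[OF z] by (intro test_fun_deriv_le[OF z]) simp
  also have "\<dots> \<le> 2 / h" using w_bounds(1)[OF z] h by (simp add: frac_le)
  finally show "cmod (deriv (test_fun \<zeta> h) z) \<le> 2 / h" .
qed (use h in auto)

lemma test_fun_norm_le:
  assumes p: "1 < p" "p \<le> 2"
  shows "test_fun \<zeta> h \<in> BMOA p" "bmoa_norm p (test_fun \<zeta> h) \<le> 24576"
  using BMOA_I[OF _ test_fun_analytic, of p 24576] test_fun_bmoa_integral_le[OF p] p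
  by (auto simp: test_fun_0)

lemma test_fun_le: "z \<in> unit_disc \<Longrightarrow> cmod (test_fun \<zeta> h z) \<le> blog h"
  using norm_Ln_w(3)[of z] blog_ge_2(1) power_mono[OF norm_Ln_w(3)[of z], of 2]
  by (simp add: norm_test_fun power2_eq_square field_simps)

lemma test_fun_le_interior:
  assumes "0 < t" "t \<le> 1 / 2" "cmod z \<le> 1 - t"
  shows "cmod (test_fun \<zeta> h z) \<le> (ln (1 / t) + 2)\<^sup>2 / blog h"
proof -
  have z: "z \<in> unit_disc" using assms by simp
  have "cmod (Ln (w z)) \<le> ln (1 / t) + 2"
    using assms w_bounds(6)[OF z] by (intro norm_Ln_w(4)[OF z]) auto
  then show ?thesis
    unfolding norm_test_fun[OF z] using blog_ge_2(1) by (intro divide_right_mono power_mono) auto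
qed

lemma test_fun_ge:
  assumes hs: "h \<le> 1 / 64" and z: "z \<in> ball \<zeta> h \<inter> unit_disc"
  shows "blog h / 4 \<le> cmod (test_fun \<zeta> h z)"
proof -
  have z': "z \<in> unit_disc" "cmod (z - \<zeta>) < h" using z by (auto simp: dist_norm norm_minus_commute)
  have w: "cmod (w z) \<le> 2 * h" "0 < cmod (w z)" using w_bounds(1,4)[OF z'(1)] z'(2) h by auto
  \<comment> \<open>The hypothesis h \<le> 1/64 says exactly that 16/h \<le> (1/(2*h))^2.\<close>
  have "blog h \<le> 2 * ln (1 / (2 * h))"
  proof -
    have "16 / h \<le> (1 / (2 * h))\<^sup>2" using hs h by (simp add: power2_eq_square field_simps)
    then have "ln (16 / h) \<le> ln ((1 / (2 * h))\<^sup>2)" using h by (intro ln_mono) auto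
    also have "\<dots> = 2 * ln (1 / (2 * h))" using h by (simp add: ln_realpow)
    finally show ?thesis by (simp add: blog_def)
  qed
  also have "ln (1 / (2 * h)) \<le> - ln (cmod (w z))"
    using w h ln_mono[of "cmod (w z)" "2 * h"] by (simp add: ln_div)
  also have "- ln (cmod (w z)) \<le> cmod (Ln (w z))" using norm_Ln_w(1)[OF z'(1)] by simp
  finally have "blog h / 2 \<le> cmod (Ln (w z))" by simp
  then have "(blog h / 2)\<^sup>2 \<le> (cmod (Ln (w z)))\<^sup>2" using blog_ge_2(1) by (intro power_mono) auto
  then show ?thesis
    using blog_ge_2(1) by (simp add: norm_test_fun[OF z'(1)] power2_eq_square field_simps)
qed

text \<open>The ball of radius t about \<zeta> carries at most 384*t by the box bound. Outside it
  the logarithm is at most ln (2/t) + 2, a small fraction of \<open>blog h\<close> once h is small.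
  So the total mass tends to 0 as h tends to 0, although the norms need not.\<close>

lemma test_fun_mass_le:
  assumes p: "1 < p" "p \<le> 2" and t: "0 < t" "t \<le> 1 / 2"
  shows "emeasure (gmeasure p (test_fun \<zeta> h)) UNIV \<le> ennreal (384 * t + 768 * ((ln (2 / t) + 2) / blog h) powr p)"
proof -
  define s where "s = (ln (2 / t) + 2) / blog h"
  have s: "0 \<le> s" using t blog_ge_2(1) by (auto simp: s_def intro!: divide_nonneg_nonneg add_nonneg_nonneg)
  have hol: "test_fun \<zeta> h holomorphic_on unit_disc" using test_fun_analytic by (simp add: analytic_disc_def)
  have "emeasure (gmeasure p (test_fun \<zeta> h)) UNIV
    \<le> emeasure (gmeasure p (test_fun \<zeta> h)) (ball \<zeta> t) + emeasure (gmeasure p (test_fun \<zeta> h)) (- ball \<zeta> t)"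
    by (subst plus_emeasure) auto
  also have "\<dots> \<le> ennreal (384 * t) + ennreal (768 * s powr p)"
  proof (rule add_mono)
    show "emeasure (gmeasure p (test_fun \<zeta> h)) (ball \<zeta> t) \<le> ennreal (384 * t)"
      using test_fun_box[OF p t(1), of \<zeta>] t by (simp add: ennreal_mult)
    have "emeasure (gmeasure p (test_fun \<zeta> h)) (- ball \<zeta> t)
      \<le> (\<integral>\<^sup>+ z. ennreal (s powr p * 32) * (ennreal (1 / cmod (z - \<zeta>)) * indicator (ball \<zeta> 2) z) \<partial>disc_area)"
      unfolding emeasure_gmeasure[OF hol p(1) borel_comp[OF borel_open[OF open_ball]]]
    proof (intro nn_integral_mono)
      fix z
      show "ennreal (bmoa_density p (test_fun \<zeta> h) z) * indicator (- ball \<zeta> t \<inter> unit_disc) z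
        \<le> ennreal (s powr p * 32) * (ennreal (1 / cmod (z - \<zeta>)) * indicator (ball \<zeta> 2) z)"
      proof (cases "z \<in> - ball \<zeta> t \<inter> unit_disc")
        case True
        then have z: "z \<in> unit_disc" and tz: "t \<le> cmod (z - \<zeta>)" by (auto simp: dist_norm norm_minus_commute)
        have "cmod (Ln (w z)) \<le> ln (1 / (t / 2)) + 2"
          using t w_bounds(3)[OF z] tz by (intro norm_Ln_w(4)[OF z]) auto
        then have "cmod (Ln (w z)) \<le> s * blog h" using blog_ge_2(1) by (simp add: s_def)
        then have "bmoa_density p (test_fun \<zeta> h) z \<le> s powr p * 32 * (1 / cmod (z - \<zeta>))"
          using test_fun_density_le[OF p z s] by (simp only: mult.assoc)
        then have "ennreal (bmoa_density p (test_fun \<zeta> h) z) \<le> ennreal (s powr p * 32) * ennreal (1 / cmod (z - \<zeta>))"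
          by (subst ennreal_mult[symmetric]) (auto intro!: ennreal_leI)
        moreover have "z \<in> ball \<zeta> 2"
          using z \<zeta> norm_triangle_ineq4[of \<zeta> z] by (simp add: dist_norm)
        ultimately show ?thesis using True by simp
      qed simp
    qed
    also have "\<dots> = ennreal (s powr p * 32) * (\<integral>\<^sup>+ z \<in> ball \<zeta> 2. ennreal (1 / cmod (z - \<zeta>)) \<partial>disc_area)"
    proof (rule nn_integral_cmult)
      have [measurable]: "ball \<zeta> 2 \<in> sets borel" by simp
      have "(\<lambda>z. ennreal (1 / cmod (z - \<zeta>)) * indicator (ball \<zeta> 2) z) \<in> borel_measurable borel" by measurable
      then show "(\<lambda>z. ennreal (1 / cmod (z - \<zeta>)) * indicator (ball \<zeta> 2) z) \<in> borel_measurable disc_area" by simp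
    qed
    also have "\<dots> \<le> ennreal (s powr p * 32) * ennreal (12 * 2)"
      by (intro mult_left_mono nn_integral_inverse_dist_ball) auto
    also have "\<dots> = ennreal (s powr p * 32 * (12 * 2))" by (rule ennreal_mult[symmetric]) auto
    finally show "emeasure (gmeasure p (test_fun \<zeta> h)) (- ball \<zeta> t) \<le> ennreal (768 * s powr p)"
      by (simp add: mult.commute)
  qed
  also have "\<dots> = ennreal (384 * t + 768 * s powr p)" using t by (simp add: ennreal_plus)
  finally show ?thesis by (simp add: s_def)
qed

end

subsection \<open>Symbols of logarithmic Carleson type\<close>

lemma bmoa_integral_split:
  assumes p: "1 < p" and f: "f holomorphic_on unit_disc" and a: "a \<in> unit_disc" and \<delta>: "0 < \<delta>"
    and box: "\<And>\<xi> u. cmod \<xi> = 1 \<Longrightarrow> 0 < u \<Longrightarrow> u \<le> \<delta> \<Longrightarrow> emeasure (gmeasure p f) (ball \<xi> u) \<le> K * ennreal u"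
  shows "bmoa_integral p f a \<le> K * 64 + ennreal (8 / \<delta>\<^sup>2) * emeasure (gmeasure p f) UNIV"
proof -
  obtain \<zeta> h where z: "cmod \<zeta> = 1" "0 < h" "h \<le> 1" "a = of_real (1 - h) * \<zeta>"
  proof (cases "a = 0")
    case True then show ?thesis using that[of 1 1] by simp
  next
    case False
    show ?thesis using polar_near_circle[OF a False] a by (intro that[of "a / of_real (cmod a)" "1 - cmod a"]) auto
  qed
  have "bmoa_integral p f a \<le> K * 64 + ennreal (8 * h / \<delta>\<^sup>2) * emeasure (gmeasure p f) UNIV"
    unfolding bmoa_integral_gmeasure[OF f p a] using box z(1)
    by (intro poisson_integral_split[OF _ z \<delta>]) auto
  also have "\<dots> \<le> K * 64 + ennreal (8 / \<delta>\<^sup>2) * emeasure (gmeasure p f) UNIV"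
    using z \<delta> by (intro add_left_mono mult_right_mono ennreal_leI divide_right_mono) auto
  finally show ?thesis .
qed

text \<open>With the radii capped by \<delta>, one K at \<delta> = 2 expresses the bounded
  condition, and every K > 0 at some \<delta> the vanishing one.\<close>

definition log_carleson :: "real \<Rightarrow> (complex \<Rightarrow> complex) \<Rightarrow> real \<Rightarrow> real \<Rightarrow> bool"
  where "log_carleson p g K \<delta> \<longleftrightarrow> (\<forall>\<xi> v. cmod \<xi> = 1 \<longrightarrow> 0 < v \<longrightarrow> v \<le> \<delta> \<longrightarrow>
    emeasure (gmeasure p g) (ball \<xi> v) \<le> ennreal K * ennreal (v * blog v powr (- p)))"

lemma log_carleson_mono: "log_carleson p g K \<delta> \<Longrightarrow> \<delta>' \<le> \<delta> \<Longrightarrow> log_carleson p g K \<delta>'"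
  by (auto simp: log_carleson_def)

locale bmoa_symbol =
  fixes p :: real and g :: "complex \<Rightarrow> complex"
  assumes p: "1 < p" "p \<le> 2" and g: "g holomorphic_on unit_disc"
    and finite_mass: "bmoa_integral p g 0 < \<infinity>"
begin

abbreviation T :: "(complex \<Rightarrow> complex) \<Rightarrow> complex \<Rightarrow> complex"
  where "T \<equiv> integral_operator g"

definition mass :: real where "mass = enn2real (bmoa_integral p g 0)"

lemma emeasure_g_UNIV: "emeasure (gmeasure p g) UNIV = ennreal mass"
  using finite_mass by (simp add: emeasure_gmeasure_UNIV[OF g p(1)] mass_def)

lemma mass_nonneg: "0 \<le> mass"
  by (simp add: mass_def)

lemma T_holomorphic: "f holomorphic_on unit_disc \<Longrightarrow> T f holomorphic_on unit_disc"
  using integral_operator_props(1)[OF _ g] by (simp add: analytic_disc_def)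

lemma embedding_const_nonneg: "0 \<le> embedding_const p"
  using log_carleson_const_nonneg[OF p(1)] by (simp add: embedding_const_def)

lemma T_box_le:
  assumes lc: "log_carleson p g K \<delta>" and \<delta>: "\<delta> \<le> 2" and f: "f \<in> BMOA 2" "bmoa_norm 2 f \<le> 1"
    and \<zeta>: "cmod \<zeta> = 1" and h: "0 < h" "50 * h \<le> \<delta>"
  shows "emeasure (gmeasure p (T f)) (ball \<zeta> h) \<le> ennreal K * ennreal (embedding_const p * h)"
  unfolding emeasure_gmeasure_integral_operator[OF BMOA_holomorphic[OF f(1)] g p(1) borel_open[OF open_ball]]
  using lc by (intro log_carleson_embedding[OF p _ finite_measure_gmeasure[OF g p(1) finite_mass] \<delta> _ f \<zeta> h])
    (auto simp: log_carleson_def)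

text \<open>Near the circle the annulus of width \<delta>/100 is covered by boxes of radius
  \<delta>/50, the largest that \<open>T_box_le\<close> admits; the remaining subdisc is handled by
  the bound \<eta>. The factor 104 is 13 * 4 * 2.\<close>

lemma T_mass_le:
  assumes lc: "log_carleson p g K \<delta>" and K: "0 \<le> K" and \<delta>: "0 < \<delta>" "\<delta> \<le> 2" and f: "f \<in> BMOA 2" "bmoa_norm 2 f \<le> 1"
    and \<eta>: "0 \<le> \<eta>" "\<And>z. cmod z \<le> 1 - \<delta> / 100 \<Longrightarrow> cmod (f z) \<le> \<eta>"
  shows "emeasure (gmeasure p (T f)) UNIV \<le> ennreal (104 * K * embedding_const p + \<eta> powr p * mass)"
proof -
  define x where "x = \<delta> / 100"
  have x: "0 < x" "x \<le> 4" using \<delta> by (auto simp: x_def)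
  note hol = BMOA_holomorphic[OF f(1)]
  have C: "0 \<le> embedding_const p" by (rule embedding_const_nonneg)
  \<comment> \<open>The ball of radius 4 about 1 contains the unit disc, so A is the full annulus,
    written in the form that \<open>annulus_cover\<close> expects.\<close>
  define A where "A = ball 1 4 \<inter> {z. 1 - x < cmod z \<and> cmod z < 1}"
  have A: "A \<in> sets borel" unfolding A_def by (auto intro!: borel_open open_Int open_Collect_conj open_Collect_less continuous_intros)
  have "emeasure (gmeasure p (T f)) UNIV = emeasure (gmeasure p (T f)) A + emeasure (gmeasure p (T f)) (- A)"
    using A by (subst plus_emeasure) (auto simp: Compl_partition)
  also have "\<dots> \<le> ennreal (104 * K * embedding_const p) + ennreal (\<eta> powr p * mass)"
  proof (rule add_mono)
    have "emeasure (gmeasure p (T f)) A \<le> ennreal (13 * (4 / x)) * (ennreal K * ennreal (embedding_const p * (2 * x)))"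
      unfolding A_def using x \<delta> by (intro annulus_cover T_box_le[OF lc \<delta>(2) f]) (auto simp: x_def)
    also have "\<dots> = ennreal (13 * (4 / x) * (K * (embedding_const p * (2 * x))))"
      using x K C by (intro ennreal_mult3) auto
    also have "13 * (4 / x) * (K * (embedding_const p * (2 * x))) = 104 * K * embedding_const p"
      using x by simp
    finally show "emeasure (gmeasure p (T f)) A \<le> ennreal (104 * K * embedding_const p)" .
    have "emeasure (gmeasure p (T f)) (- A) \<le> (\<integral>\<^sup>+ z. ennreal (\<eta> powr p) \<partial>gmeasure p g)"
      unfolding emeasure_gmeasure_integral_operator[OF hol g p(1) borel_comp[OF A]]
    proof (intro nn_integral_mono)
      fix z
      have "cmod (f z) powr p \<le> \<eta> powr p" if z: "z \<in> - A \<inter> unit_disc"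
      proof -
        have "z \<in> ball 1 4" using z norm_triangle_ineq4[of 1 z] by (simp add: dist_norm)
        then have "cmod z \<le> 1 - \<delta> / 100" using z by (auto simp: x_def A_def)
        then show ?thesis using p \<eta> by (intro powr_mono2) auto
      qed
      then show "ennreal (cmod (f z) powr p) * indicator (- A \<inter> unit_disc) z \<le> ennreal (\<eta> powr p)"
        by (auto intro!: ennreal_leI split: split_indicator)
    qed
    also have "\<dots> = ennreal (\<eta> powr p) * ennreal mass" by (simp add: emeasure_g_UNIV)
    finally show "emeasure (gmeasure p (T f)) (- A) \<le> ennreal (\<eta> powr p * mass)"
      using mass_nonneg by (simp add: ennreal_mult)
  qed
  also have "\<dots> = ennreal (104 * K * embedding_const p + \<eta> powr p * mass)"
    using K C mass_nonneg by (simp add: ennreal_plus)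
  finally show ?thesis .
qed

definition vanishing :: bool
  where "vanishing \<longleftrightarrow> (\<forall>e>0. \<exists>\<delta>>0. log_carleson p g e \<delta>)"

lemma vanishing_D:
  assumes vanishing "0 < e"
  obtains \<delta> where "0 < \<delta>" "\<delta> \<le> 2" "log_carleson p g e \<delta>"
proof -
  obtain \<delta> where "0 < \<delta>" "log_carleson p g e \<delta>" using assms by (auto simp: vanishing_def)
  then show ?thesis using that[of "min \<delta> 2"] log_carleson_mono by auto
qed

text \<open>
  Smallness on a compact subdisc makes \<open>T f\<close> small in \<open>BMOA p\<close>: the boxes near the circle
  are handled uniformly in \<open>f\<close> by the embedding.
\<close>

lemma T_small:
  assumes v: vanishing and e: "0 < e"
  obtains r \<eta> where "r < 1" "0 < \<eta>"
    "\<And>f a. f \<in> BMOA 2 \<Longrightarrow> bmoa_norm 2 f \<le> 1 \<Longrightarrow> (\<And>z. cmod z \<le> r \<Longrightarrow> cmod (f z) \<le> \<eta>) \<Longrightarrow>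
       a \<in> unit_disc \<Longrightarrow> bmoa_integral p (T f) a \<le> ennreal e"
proof -
  define C where "C = embedding_const p + 1"
  have C: "0 < C" "embedding_const p \<le> C" using embedding_const_nonneg by (auto simp: C_def)
  define e1 where "e1 = e / (128 * C)"
  have e1: "0 < e1" using e C by (simp add: e1_def)
  obtain \<delta> where \<delta>: "0 < \<delta>" "\<delta> \<le> 2" "log_carleson p g e1 \<delta>" using vanishing_D[OF v e1] .
  \<comment> \<open>The second scale depends on the first: outside the boxes of radius \<delta>/50
    the kernel is bounded only by 8/(\<delta>/50)^2, so the total mass must be small against
    (\<delta>/50)^2.\<close>
  define m where "m = e * (\<delta> / 50)\<^sup>2 / 16"
  have m: "0 < m" using e \<delta> by (simp add: m_def)
  define e2 where "e2 = m / (208 * C)"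
  have e2: "0 < e2" using m C by (simp add: e2_def)
  obtain \<delta>2 where \<delta>2: "0 < \<delta>2" "\<delta>2 \<le> 2" "log_carleson p g e2 \<delta>2" using vanishing_D[OF v e2] .
  define X where "X = m / (2 * (mass + 1))"
  define \<eta> where "\<eta> = X powr (1 / p)"
  have "0 < X" using m mass_nonneg by (simp add: X_def)
  then have "0 < \<eta>" "\<eta> powr p = X" using p by (simp_all add: \<eta>_def powr_powr)
  then have \<eta>: "0 < \<eta>" "\<eta> powr p = m / (2 * (mass + 1))" by (simp_all only: X_def)
  show ?thesis
  proof (rule that[of "1 - \<delta>2 / 100" \<eta>])
    fix f a assume f: "f \<in> BMOA 2" "bmoa_norm 2 f \<le> 1" and le: "\<And>z. cmod z \<le> 1 - \<delta>2 / 100 \<Longrightarrow> cmod (f z) \<le> \<eta>"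
      and a: "a \<in> unit_disc"
    have "emeasure (gmeasure p (T f)) UNIV \<le> ennreal (104 * e2 * embedding_const p + \<eta> powr p * mass)"
      using e2 \<eta> by (intro T_mass_le[OF \<delta>2(3) _ \<delta>2(1,2) f _ le]) auto
    also have "\<dots> \<le> ennreal m"
    proof (rule ennreal_leI)
      have "104 * e2 * embedding_const p \<le> 104 * e2 * C" using e2 C by (intro mult_left_mono) auto
      also have "\<dots> = m / 2" using C by (simp add: e2_def)
      finally have 1: "104 * e2 * embedding_const p \<le> m / 2" .
      have "\<eta> powr p * mass \<le> m / (2 * (mass + 1)) * (mass + 1)"
        unfolding \<eta>(2) using m mass_nonneg by (intro mult_left_mono) auto
      also have "\<dots> = m / 2"
      proof -
        have "m / (2 * q) * q = m / 2" if "0 < q" for q :: real using that by simp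
        from this[of "mass + 1"] show ?thesis using mass_nonneg by simp
      qed
      finally show "104 * e2 * embedding_const p + \<eta> powr p * mass \<le> m" using 1 by simp
    qed
    finally have mm: "emeasure (gmeasure p (T f)) UNIV \<le> ennreal m" .
    have "bmoa_integral p (T f) a \<le> ennreal (e1 * embedding_const p) * 64 + ennreal (8 / (\<delta> / 50)\<^sup>2) * emeasure (gmeasure p (T f)) UNIV"
    proof (rule bmoa_integral_split[OF p(1) T_holomorphic[OF BMOA_holomorphic[OF f(1)]] a])
      fix \<xi> u assume u: "cmod \<xi> = 1" "0 < u" "u \<le> \<delta> / 50"
      have "emeasure (gmeasure p (T f)) (ball \<xi> u) \<le> ennreal e1 * ennreal (embedding_const p * u)"
        using u by (intro T_box_le[OF \<delta>(3,2) f]) auto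
      also have "\<dots> = ennreal (e1 * embedding_const p) * ennreal u"
        using e1 u embedding_const_nonneg by (simp add: ennreal_mult mult.assoc)
      finally show "emeasure (gmeasure p (T f)) (ball \<xi> u) \<le> ennreal (e1 * embedding_const p) * ennreal u" .
    qed (use \<delta> in auto)
    also have "\<dots> \<le> ennreal (e1 * embedding_const p) * 64 + ennreal (8 / (\<delta> / 50)\<^sup>2) * ennreal m"
      by (intro add_left_mono mult_left_mono mm) simp
    also have "\<dots> = ennreal (e1 * embedding_const p * 64 + 8 / (\<delta> / 50)\<^sup>2 * m)"
      using ennreal_lincomb[of "e1 * embedding_const p" 64 "8 / (\<delta> / 50)\<^sup>2" m] e1 m embedding_const_nonneg by simp
    also have "\<dots> \<le> ennreal e"
    proof (rule ennreal_leI)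
      have "e1 * embedding_const p * 64 \<le> e1 * C * 64" using e1 C by (intro mult_right_mono mult_left_mono) auto
      also have "\<dots> = e / 2" using C by (simp add: e1_def)
      finally have 1: "e1 * embedding_const p * 64 \<le> e / 2" .
      have "8 / (\<delta> / 50)\<^sup>2 * m = e / 2" using \<delta> by (simp add: m_def)
      then show "e1 * embedding_const p * 64 + 8 / (\<delta> / 50)\<^sup>2 * m \<le> e" using 1 by linarith
    qed
    finally show "bmoa_integral p (T f) a \<le> ennreal e" .
  qed (use \<delta>2 \<eta> in auto)
qed

lemma T_VMOA_unit_ball:
  assumes v: vanishing and f: "f \<in> BMOA 2" "bmoa_norm 2 f \<le> 1"
  shows "T f \<in> VMOA p"
proof -
  note hol = BMOA_holomorphic[OF f(1)]
  have box: "\<exists>\<delta>>0. \<delta> \<le> 1 \<and> (\<forall>\<zeta> u. cmod \<zeta> = 1 \<longrightarrow> 0 < u \<longrightarrow> u \<le> \<delta> \<longrightarrow> emeasure (gmeasure p (T f)) (ball \<zeta> u) \<le> ennreal e * ennreal u)"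
    if e: "0 < e" for e
  proof -
    define e1 where "e1 = e / (embedding_const p + 1)"
    have e1: "0 < e1" "e1 * embedding_const p \<le> e"
      using e embedding_const_nonneg by (auto simp: e1_def field_simps)
    obtain \<delta> where \<delta>: "0 < \<delta>" "\<delta> \<le> 2" "log_carleson p g e1 \<delta>" using vanishing_D[OF v e1(1)] .
    show ?thesis
    proof (intro exI[of _ "\<delta> / 50"] conjI allI impI)
      fix \<zeta> u assume u: "cmod \<zeta> = 1" "0 < u" "u \<le> \<delta> / 50"
      have "emeasure (gmeasure p (T f)) (ball \<zeta> u) \<le> ennreal e1 * ennreal (embedding_const p * u)"
        using u by (intro T_box_le[OF \<delta>(3,2) f]) auto
      also have "\<dots> = ennreal (e1 * embedding_const p) * ennreal u"
        using e1 u embedding_const_nonneg by (simp add: ennreal_mult mult.assoc)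
      also have "\<dots> \<le> ennreal e * ennreal u" using e1 by (intro mult_right_mono ennreal_leI) auto
      finally show "emeasure (gmeasure p (T f)) (ball \<zeta> u) \<le> ennreal e * ennreal u" .
    qed (use \<delta> in auto)
  qed
  \<comment> \<open>Small boxes are controlled by \<open>box\<close>, large ones by the total mass,
    which is finite because the growth bound makes f bounded on the subdisc left over by the
    annulus.\<close>
  have fB: "T f \<in> BMOA p"
  proof -
    obtain \<delta> where \<delta>: "0 < \<delta>" "\<delta> \<le> 2" "log_carleson p g 1 \<delta>" using vanishing_D[OF v, of 1] by auto
    define \<eta> where "\<eta> = 57 * blog (\<delta> / 100)"
    have bl: "1 \<le> blog (\<delta> / 100)" using \<delta> by (intro blog_ge_1) auto
    have M: "emeasure (gmeasure p (T f)) UNIV \<le> ennreal (104 * 1 * embedding_const p + \<eta> powr p * mass)"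
    proof (rule T_mass_le[OF \<delta>(3) _ \<delta>(1,2) f])
      fix z assume z: "cmod z \<le> 1 - \<delta> / 100"
      have "cmod (f z) \<le> 57 * bmoa_norm 2 f * blog (1 - cmod z)"
        using z \<delta> by (intro growth_bound f) auto
      also have "\<dots> \<le> 57 * 1 * blog (\<delta> / 100)"
      proof (intro mult_mono blog_mono)
        have "1 \<le> blog (1 - cmod z)" using z \<delta> norm_ge_zero[of z] by (intro blog_ge_1) linarith+
        then show "0 \<le> blog (1 - cmod z)" by simp
      qed (use z \<delta> f(2) bl in auto)
      finally show "cmod (f z) \<le> \<eta>" by (simp add: \<eta>_def)
    qed (use bl in \<open>auto simp: \<eta>_def\<close>)
    define m where "m = 104 * 1 * embedding_const p + \<eta> powr p * mass"
    have m: "0 \<le> m" using embedding_const_nonneg mass_nonneg by (simp add: m_def)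
    obtain d where d: "0 < d" "d \<le> 1" "\<And>\<zeta> u. cmod \<zeta> = 1 \<Longrightarrow> 0 < u \<Longrightarrow> u \<le> d \<Longrightarrow> emeasure (gmeasure p (T f)) (ball \<zeta> u) \<le> ennreal 1 * ennreal u"
      using box[of 1] by auto
    show ?thesis
    proof (rule BMOA_I_box[OF p(1) integral_operator_props(1)[OF hol g], of "1 + m / d"])
      fix \<xi> :: complex and u :: real assume u: "cmod \<xi> = 1" "0 < u"
      have "emeasure (gmeasure p (T f)) (ball \<xi> u) \<le> ennreal ((1 + m / d) * u)"
      proof (cases "u \<le> d")
        case True
        have "emeasure (gmeasure p (T f)) (ball \<xi> u) \<le> ennreal u" using d(3)[OF u True] by simp
        also have "\<dots> \<le> ennreal ((1 + m / d) * u)" using u m d by (intro ennreal_leI) (simp add: algebra_simps)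
        finally show ?thesis .
      next
        case False
        have "emeasure (gmeasure p (T f)) (ball \<xi> u) \<le> emeasure (gmeasure p (T f)) UNIV" by (intro emeasure_mono) auto
        also have "\<dots> \<le> ennreal m" using M by (simp add: m_def)
        also have "\<dots> \<le> ennreal ((1 + m / d) * u)"
        proof (rule ennreal_leI)
          have "m / d * d \<le> m / d * u" using False m d by (intro mult_left_mono) auto
          then show "m \<le> (1 + m / d) * u" using d u by (simp add: algebra_simps)
        qed
        finally show ?thesis .
      qed
      also have "\<dots> = ennreal (1 + m / d) * ennreal u" using u m d by (intro ennreal_mult) auto
      finally show "emeasure (gmeasure p (T f)) (ball \<xi> u) \<le> ennreal (1 + m / d) * ennreal u" .
    qed (use m d in auto)
  qed
  show ?thesis
  proof (rule VMOA_I_box[OF p(1) fB])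
    fix e :: real assume e: "0 < e"
    then obtain \<delta> where "0 < \<delta>" and \<delta>: "\<And>\<zeta> u. cmod \<zeta> = 1 \<Longrightarrow> 0 < u \<Longrightarrow> u \<le> \<delta> \<Longrightarrow> emeasure (gmeasure p (T f)) (ball \<zeta> u) \<le> ennreal e * ennreal u"
      using box by blast
    then show "\<exists>\<delta>>0. \<forall>\<zeta> u. cmod \<zeta> = 1 \<longrightarrow> 0 < u \<longrightarrow> u \<le> \<delta> \<longrightarrow> emeasure (gmeasure p (T f)) (ball \<zeta> u) \<le> ennreal (e * u)"
      using e by (intro exI[of _ \<delta>]) (auto simp: ennreal_mult')
  qed
qed

lemma T_VMOA:
  assumes v: vanishing and f: "f \<in> BMOA 2"
  shows "T f \<in> VMOA p"
proof -
  define N where "N = bmoa_norm 2 f"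
  have N: "0 \<le> N" by (simp add: N_def)
  define c where "c = inverse (N + 1)"
  have c: "0 < c" using N by (simp add: c_def)
  define u where "u z = of_real c * f z" for z
  have u: "u \<in> BMOA 2" unfolding u_def[abs_def] using f by (intro BMOA_cmult_le) auto
  have "bmoa_norm 2 u = c * bmoa_norm 2 f"
    unfolding u_def[abs_def] using bmoa_norm_cmult[of 2 f "of_real c"] f c by simp
  also have "\<dots> \<le> 1" using N by (simp add: c_def N_def[symmetric] divide_simps)
  finally have "T u \<in> VMOA p" by (intro T_VMOA_unit_ball v u)
  then have "(\<lambda>z. of_real (1 / c) * T u z) \<in> VMOA p" by (rule VMOA_cmult[OF p(1)])
  also have "(\<lambda>z. of_real (1 / c) * T u z) = T (\<lambda>z. of_real (1 / c) * u z)"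
    using integral_operator_cmult[OF BMOA_holomorphic[OF u] g, of "of_real (1 / c)"] by simp
  also have "(\<lambda>z. of_real (1 / c) * u z) = f" using c by (auto simp: u_def)
  finally show ?thesis .
qed

text \<open>For bounded f the whole factor \<open>blog u powr (- p)\<close> is left over, and it
  tends to 0. This puts the images of the partial sums of the humps into \<open>VMOA p\<close> even
  when (vii) fails.\<close>

lemma T_bounded_VMOA:
  assumes lc: "log_carleson p g K \<delta>" and \<delta>: "0 < \<delta>" and K: "0 \<le> K"
    and f: "f \<in> BMOA p" "T f \<in> BMOA p" and B: "0 \<le> B" "\<And>z. z \<in> unit_disc \<Longrightarrow> cmod (f z) \<le> B"
  shows "T f \<in> VMOA p"
proof (rule VMOA_I_box[OF p(1) f(2)])
  fix e :: real assume e: "0 < e"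
  define C where "C = B powr p * K + 1"
  have C: "0 < C" using K by (simp add: C_def add_nonneg_pos)
  define d where "d = min (min \<delta> 1) (16 * exp (- (C / e)))"
  have d: "0 < d" using \<delta> by (simp add: d_def)
  show "\<exists>\<delta>>0. \<forall>\<zeta> u. cmod \<zeta> = 1 \<longrightarrow> 0 < u \<longrightarrow> u \<le> \<delta> \<longrightarrow> emeasure (gmeasure p (T f)) (ball \<zeta> u) \<le> ennreal (e * u)"
  proof (intro exI[of _ d] conjI allI impI d)
    fix \<zeta> :: complex and u :: real assume u: "cmod \<zeta> = 1" "0 < u" "u \<le> d"
    have u': "u \<le> \<delta>" "u \<le> 1" "u \<le> 16 * exp (- (C / e))" using u(3) by (auto simp: d_def)
    have "C / e \<le> blog u" using u(2) u'(3) by (rule blog_ge_imp)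
    moreover have b1: "1 \<le> blog u" using u u' by (intro blog_ge_1) auto
    then have "blog u powr (- p) \<le> blog u powr (- 1)" using p by (intro powr_mono) auto
    moreover have "blog u powr (- 1) = 1 / blog u" using b1 by (simp add: powr_minus divide_inverse)
    moreover have "1 / blog u \<le> e / C" using \<open>C / e \<le> blog u\<close> b1 C e by (simp add: field_simps)
    ultimately have bl: "blog u powr (- p) \<le> e / C" by linarith
    have "emeasure (gmeasure p (T f)) (ball \<zeta> u) \<le> (\<integral>\<^sup>+ z. ennreal (B powr p) * indicator (ball \<zeta> u) z \<partial>gmeasure p g)"
      unfolding emeasure_gmeasure_integral_operator[OF BMOA_holomorphic[OF f(1)] g p(1) borel_open[OF open_ball]]
      using B p by (intro nn_integral_mono) (auto intro!: ennreal_leI powr_mono2 split: split_indicator)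
    also have "\<dots> = ennreal (B powr p) * emeasure (gmeasure p g) (ball \<zeta> u)" by (simp add: nn_integral_cmult_indicator)
    also have "\<dots> \<le> ennreal (B powr p) * (ennreal K * ennreal (u * blog u powr (- p)))"
      using lc u u' by (intro mult_left_mono) (auto simp: log_carleson_def)
    also have "\<dots> = ennreal (B powr p * (K * (u * blog u powr (- p))))"
      using K u by (intro ennreal_mult3) auto
    also have "\<dots> \<le> ennreal (e * u)"
    proof (rule ennreal_leI)
      have "B powr p * (K * (u * blog u powr (- p))) \<le> C * (u * blog u powr (- p))"
        using u by (simp add: C_def mult.assoc[symmetric] mult_right_mono)
      also have "\<dots> \<le> C * (u * (e / C))" using u C bl by (intro mult_left_mono) auto
      also have "\<dots> = e * u" using C by simp
      finally show "B powr p * (K * (u * blog u powr (- p))) \<le> e * u" .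
    qed
    finally show "emeasure (gmeasure p (T f)) (ball \<zeta> u) \<le> ennreal (e * u)" .
  qed
qed

end

subsection \<open>Locally uniform limits\<close>

lemma uniform_limit_deriv:
  assumes hol: "\<And>n. f n holomorphic_on unit_disc"
    and lim: "\<And>K. compact K \<Longrightarrow> K \<subseteq> unit_disc \<Longrightarrow> uniform_limit K f F sequentially"
  shows "F holomorphic_on unit_disc" "\<And>z. z \<in> unit_disc \<Longrightarrow> (\<lambda>n. deriv (f n) z) \<longlonglongrightarrow> deriv F z"
proof -
  have loc: "\<exists>d>0. cball x d \<subseteq> unit_disc \<and> uniform_limit (cball x d) f F sequentially" if x: "x \<in> unit_disc" for x
  proof -
    obtain d where "0 < d" "cball x d \<subseteq> unit_disc"
      using open_contains_cball[of unit_disc] x by blast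
    then show ?thesis using lim[of "cball x d"] by auto
  qed
  show holF: "F holomorphic_on unit_disc"
    by (rule holomorphic_uniform_sequence[OF open_ball hol loc])
  have "\<exists>g'. \<forall>x\<in>unit_disc. (F has_field_derivative g' x) (at x) \<and> (\<lambda>n. deriv (f n) x) \<longlonglongrightarrow> g' x"
    by (rule has_complex_derivative_uniform_sequence[OF open_ball _ loc])
      (auto intro!: holomorphic_derivI[OF hol open_ball])
  then show "\<And>z. z \<in> unit_disc \<Longrightarrow> (\<lambda>n. deriv (f n) z) \<longlonglongrightarrow> deriv F z"
    using DERIV_imp_deriv by metis
qed

text \<open>The integrals need not converge along the sequence; pointwise convergence of the
  derivatives and lower semicontinuity suffice.\<close>

lemma bmoa_integral_Fatou:
  assumes p: "1 < p" and hol: "\<And>n. f n holomorphic_on unit_disc" and a: "a \<in> unit_disc"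
    and lim: "\<And>z. z \<in> unit_disc \<Longrightarrow> (\<lambda>n. deriv (f n) z) \<longlonglongrightarrow> deriv F z"
    and le: "\<And>n. bmoa_integral p (f n) a \<le> C"
  shows "bmoa_integral p F a \<le> C"
proof -
  define u where "u n z = ennreal (bmoa_density p (f n) z * poisson a z) * indicator unit_disc z" for n z
  have lim_u: "(\<lambda>n. u n z) \<longlonglongrightarrow> ennreal (bmoa_density p F z * poisson a z) * indicator unit_disc z" for z
  proof (cases "z \<in> unit_disc")
    case True
    have "(\<lambda>n. cmod (deriv (f n) z) powr p) \<longlonglongrightarrow> cmod (deriv F z) powr p"
      using p by (intro tendsto_powr' tendsto_norm lim[OF True] tendsto_const) auto
    then have "(\<lambda>n. ennreal (bmoa_density p (f n) z * poisson a z)) \<longlonglongrightarrow> ennreal (bmoa_density p F z * poisson a z)"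
      unfolding bmoa_density_def by (intro tendsto_ennrealI tendsto_mult tendsto_const)
    then show ?thesis using True by (simp add: u_def)
  qed (simp add: u_def)
  have "bmoa_integral p F a = (\<integral>\<^sup>+ z. liminf (\<lambda>n. u n z) \<partial>disc_area)"
    unfolding bmoa_integral_eq[OF a] by (intro nn_integral_cong) (simp add: lim_imp_Liminf[OF trivial_limit_sequentially lim_u])
  also have "\<dots> \<le> liminf (\<lambda>n. \<integral>\<^sup>+ z. u n z \<partial>disc_area)"
    using borel_measurable_bmoa_density_poisson[OF hol p a] by (intro nn_integral_liminf) (simp add: u_def)
  also have "\<dots> \<le> C"
  proof (intro Liminf_le always_eventually allI)
    show "(\<integral>\<^sup>+ z. u n z \<partial>disc_area) \<le> C" for n
      using le[of n] by (simp only: u_def bmoa_integral_eq[OF a])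
  qed simp
  finally show ?thesis .
qed

text \<open>Norm balls are closed under locally uniform convergence. The value at 0 and the integral
  share one bound, so Fatou is applied to a tail on which the value at 0 has nearly reached its
  limit, with an error e that is removed at the end.\<close>

lemma BMOA_limit:
  assumes p: "1 < p" and f: "\<And>n. f n \<in> BMOA p" "\<And>n. bmoa_norm p (f n) \<le> C" and F: "F \<in> analytic_disc"
    and lim: "\<And>K. compact K \<Longrightarrow> K \<subseteq> unit_disc \<Longrightarrow> uniform_limit K f F sequentially"
  shows "F \<in> BMOA p" "bmoa_norm p F \<le> C"
proof -
  note hol = BMOA_holomorphic[OF f(1)]
  have C: "0 \<le> C" using f(2)[of 0] bmoa_norm_nonneg order_trans by blast
  have lim0: "(\<lambda>n. f n 0) \<longlonglongrightarrow> F 0"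
    using tendsto_uniform_limitI[OF lim[of "{0}"]] by simp
  have le: "ennreal (cmod (F 0) powr p) + bmoa_integral p F a \<le> ennreal (C powr p)" if a: "a \<in> unit_disc" for a
  proof -
    have bd: "ennreal (cmod (f n 0) powr p) + bmoa_integral p (f n) a \<le> ennreal (C powr p)" for n
      using bmoa_integral_le_norm[of p "f n" a] f a p C powr_mono2[of p "bmoa_norm p (f n)" C]
      by (auto intro: order_trans ennreal_leI)
    have "ennreal (cmod (F 0) powr p) + bmoa_integral p F a \<le> ennreal (C powr p) + ennreal e" if e: "0 < e" for e
    proof -
      have "(\<lambda>n. cmod (f n 0) powr p) \<longlonglongrightarrow> cmod (F 0) powr p"
        using p by (intro tendsto_powr' tendsto_norm lim0 tendsto_const) auto
      then have "eventually (\<lambda>n. cmod (F 0) powr p - e < cmod (f n 0) powr p) sequentially"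
        using e by (intro order_tendstoD) auto
      then obtain N where N: "\<And>n. N \<le> n \<Longrightarrow> cmod (F 0) powr p - e < cmod (f n 0) powr p"
        by (auto simp: eventually_sequentially)
      have "bmoa_integral p F a \<le> ennreal (C powr p + e - cmod (F 0) powr p)"
      proof (rule bmoa_integral_Fatou[OF p, where f = "\<lambda>n. f (n + N)"])
        show "(\<lambda>n. deriv (f (n + N)) z) \<longlonglongrightarrow> deriv F z" if "z \<in> unit_disc" for z
          using LIMSEQ_ignore_initial_segment[OF uniform_limit_deriv(2)[OF hol lim that]] .
        fix n
        have "bmoa_integral p (f (n + N)) a \<le> ennreal (C powr p) - ennreal (cmod (f (n + N) 0) powr p)"
          using bd[of "n + N"] by (simp add: ennreal_le_minus_iff add.commute)
        also have "\<dots> = ennreal (C powr p - cmod (f (n + N) 0) powr p)" by (rule ennreal_minus) simp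
        also have "\<dots> \<le> ennreal (C powr p + e - cmod (F 0) powr p)"
          using N[of "n + N"] by (intro ennreal_leI) simp
        finally show "bmoa_integral p (f (n + N)) a \<le> ennreal (C powr p + e - cmod (F 0) powr p)" .
      qed (use hol a in auto)
      then have "ennreal (cmod (F 0) powr p) + bmoa_integral p F a
          \<le> ennreal (cmod (F 0) powr p) + ennreal (C powr p + e - cmod (F 0) powr p)"
        by (rule add_left_mono)
      also have "\<dots> = ennreal (C powr p + e)"
      proof (subst ennreal_plus[symmetric])
        have "cmod (f N 0) \<le> C" using norm_at_0_le_bmoa_norm[of p "f N"] f(2)[of N] p by simp
        then have "cmod (f N 0) powr p \<le> C powr p" using p by (intro powr_mono2) auto
        then show "0 \<le> C powr p + e - cmod (F 0) powr p" using N[of N] by simp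
      qed simp_all
      also have "\<dots> = ennreal (C powr p) + ennreal e" using e by (intro ennreal_plus) auto
      finally show ?thesis .
    qed
    then show ?thesis by (rule ennreal_le_epsilon)
  qed
  show "F \<in> BMOA p" "bmoa_norm p F \<le> C"
    using BMOA_I[OF _ F C, of p] le p by auto
qed

subsection \<open>The vanishing condition on Carleson squares\<close>

text \<open>Angles within 6*v of \<open>Arg \<xi>\<close> form an arc of length 12*v; the depth of a
  Carleson square equals the length of its arc, hence 12*v occurs twice.\<close>

lemma box_subset_carleson_square:
  assumes "cmod \<xi> = 1" "0 < v"
  shows "ball \<xi> v \<inter> unit_disc \<subseteq> carleson_square (circle_arc (Arg \<xi> - 6 * v) (12 * v)) (12 * v)"
proof
  fix z assume "z \<in> ball \<xi> v \<inter> unit_disc"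
  then have "cmod (z - \<xi>) < v" "cmod z < 1" by (auto simp: dist_norm norm_minus_commute)
  then obtain \<psi> where "z = of_real (cmod z) * cis (Arg \<xi> + \<psi>)" "\<bar>\<psi>\<bar> < 6 * v" "1 - cmod z < v"
    using polar_box[OF assms(1)] by metis
  moreover from this have "cis (Arg \<xi> + \<psi>) \<in> circle_arc (Arg \<xi> - 6 * v) (12 * v)"
    unfolding circle_arc_def by (intro imageI) (auto simp: abs_if split: if_splits)
  ultimately show "z \<in> carleson_square (circle_arc (Arg \<xi> - 6 * v) (12 * v)) (12 * v)"
    unfolding carleson_square_def using \<open>cmod z < 1\<close> assms(2)
    by (intro CollectI exI[of _ "cmod z"] exI[of _ "Arg \<xi> + \<psi>"]) auto
qed

lemma carleson_square_subset_box:
  assumes "0 < l" "l \<le> 1"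
  shows "carleson_square (circle_arc s l) l \<subseteq> ball (cis s) (2 * l) \<inter> unit_disc"
proof
  fix z assume "z \<in> carleson_square (circle_arc s l) l"
  then obtain r t where z: "z = of_real r * cis t" "cis t \<in> circle_arc s l" "1 - l < r" "r < 1"
    by (auto simp: carleson_square_def)
  then obtain t' where t': "cis t = cis t'" "s \<le> t'" "t' \<le> s + l" by (auto simp: circle_arc_def)
  have "cmod (z - cis t) = 1 - r"
  proof -
    have "z - cis t = of_real (r - 1) * cis t" by (simp add: z algebra_simps)
    then show ?thesis using z by (simp only: norm_mult norm_cis norm_of_real) simp
  qed
  moreover have "cmod (cis t - cis s) \<le> l"
    using norm_cis_diff_le[of t' s] t' by simp
  ultimately have "cmod (z - cis s) < 2 * l"
    using norm_triangle_ineq[of "z - cis t" "cis t - cis s"] z by simp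
  moreover have "cmod z < 1" using z assms by (simp add: norm_mult)
  ultimately show "z \<in> ball (cis s) (2 * l) \<inter> unit_disc"
    by (simp add: dist_norm norm_minus_commute)
qed

context bmoa_symbol
begin

abbreviation square_integral :: "real \<Rightarrow> real \<Rightarrow> ennreal"
  where "square_integral s l \<equiv> (\<integral>\<^sup>+ z \<in> carleson_square (circle_arc s l) l.
          ennreal (cmod (deriv g z) powr p * (1 - (cmod z)\<^sup>2) powr (p - 1)) \<partial>disc_area)"

lemma vanishing_log_carleson_iff:
  "vanishing_log_carleson p g \<longleftrightarrow>
    (\<forall>e>0. \<exists>d>0. \<forall>s l. 0 < l \<longrightarrow> l < d \<longrightarrow> ennreal (ln (2 / l) powr p / l) * square_integral s l < e)"
proof -
  define \<Phi> where "\<Phi> = (\<lambda>(s, l). ennreal (ln (2 / l) powr p / l) * square_integral s l)"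
  have ev: "eventually (\<lambda>x. \<Phi> x < e) (filtercomap snd (at_right (0::real)))
      \<longleftrightarrow> (\<exists>d>0. \<forall>s l. 0 < l \<longrightarrow> l < d \<longrightarrow> \<Phi> (s, l) < e)" for e
  proof
    assume "eventually (\<lambda>x. \<Phi> x < e) (filtercomap snd (at_right (0::real)))"
    then obtain Q where Q: "eventually Q (at_right (0::real))" "\<And>x. Q (snd x) \<Longrightarrow> \<Phi> x < e"
      by (auto simp: eventually_filtercomap)
    then obtain d where d: "0 < d" "\<And>l. 0 < l \<Longrightarrow> l < d \<Longrightarrow> Q l"
      unfolding eventually_at_right_field by blast
    have "\<Phi> (s, l) < e" if "0 < l" "l < d" for s l
      using Q(2)[of "(s, l)"] d(2)[OF that] by simp
    then show "\<exists>d>0. \<forall>s l. 0 < l \<longrightarrow> l < d \<longrightarrow> \<Phi> (s, l) < e"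
      using d(1) by blast
  next
    assume "\<exists>d>0. \<forall>s l. 0 < l \<longrightarrow> l < d \<longrightarrow> \<Phi> (s, l) < e"
    then obtain d where d: "0 < d" "\<And>s l. 0 < l \<Longrightarrow> l < d \<Longrightarrow> \<Phi> (s, l) < e" by blast
    have "eventually (\<lambda>l. 0 < l \<and> l < d) (at_right (0::real))"
      using d(1) by (auto simp: eventually_at_right_field)
    then show "eventually (\<lambda>x. \<Phi> x < e) (filtercomap snd (at_right (0::real)))"
      unfolding eventually_filtercomap
    proof (intro exI[of _ "\<lambda>l. 0 < l \<and> l < d"] conjI allI impI)
      fix x :: "real \<times> real" assume "0 < snd x \<and> snd x < d"
      then show "\<Phi> x < e" using d(2)[of "snd x" "fst x"] by simp
    qed
  qed
  have "vanishing_log_carleson p g \<longleftrightarrow> (\<Phi> \<longlongrightarrow> 0) (filtercomap snd (at_right (0::real)))"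
    by (simp add: vanishing_log_carleson_def \<Phi>_def)
  also have "\<dots> \<longleftrightarrow> (\<forall>e>0. eventually (\<lambda>x. \<Phi> x < e) (filtercomap snd (at_right (0::real))))"
    by (simp add: order_tendsto_iff)
  finally show ?thesis unfolding ev by (simp add: \<Phi>_def)
qed

lemma vanishing_iff: "vanishing_log_carleson p g \<longleftrightarrow> vanishing"
proof
  assume v: "vanishing_log_carleson p g"
  show vanishing
    unfolding vanishing_def
  proof (intro allI impI)
    fix e :: real assume e: "0 < e"
    then have "0 < ennreal (e / 48)" by simp
    with v[unfolded vanishing_log_carleson_iff]
    obtain d where d: "0 < d" "\<And>s l. 0 < l \<Longrightarrow> l < d \<Longrightarrow> ennreal (ln (2 / l) powr p / l) * square_integral s l < ennreal (e / 48)"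
      by blast
    \<comment> \<open>The first bound gives 12*v < d. The second gives 16/v \<le> (2/l)^2 for l =
      12*v, so that ln (2/l) is at least half of \<open>blog v\<close>. This half costs 2^p \<le> 4,
      and 48 is 4 * 12.\<close>
    define \<delta> where "\<delta> = min (d / 24) (1 / 576)"
    show "\<exists>\<delta>>0. log_carleson p g e \<delta>"
      unfolding log_carleson_def
    proof (intro exI[of _ \<delta>] conjI allI impI)
      show "0 < \<delta>" using d by (simp add: \<delta>_def)
      fix \<xi> v assume v: "cmod \<xi> = 1" "0 < v" "v \<le> \<delta>"
      have v': "12 * v < d" "v \<le> 1 / 576" using v d(1) by (auto simp: \<delta>_def)
      define l where "l = 12 * v"
      define s where "s = Arg \<xi> - 6 * v"
      have l: "0 < l" "l < d" using v v' by (auto simp: l_def)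
      have bl: "1 \<le> blog v" using v v' by (intro blog_ge_1) auto
      have ln: "blog v / 2 \<le> ln (2 / l)"
      proof -
        have "16 / v \<le> (2 / l)\<^sup>2" using v v' by (simp add: l_def power2_eq_square field_simps)
        then have "ln (16 / v) \<le> ln ((2 / l)\<^sup>2)" using v by (intro ln_mono) auto
        then show ?thesis using l by (simp add: ln_realpow blog_def)
      qed
      define c where "c = ln (2 / l) powr p / l"
      have "0 < ln (2 / l)" using ln bl by linarith
      then have c: "0 < c" using l unfolding c_def by simp
      have "emeasure (gmeasure p g) (ball \<xi> v) \<le> square_integral s l"
        unfolding emeasure_gmeasure[OF g p(1) borel_open[OF open_ball]] bmoa_density_def l_def s_def
        using box_subset_carleson_square[OF v(1,2)]
        by (intro nn_integral_mono) (auto split: split_indicator)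
      also have "\<dots> = ennreal (1 / c) * (ennreal c * square_integral s l)"
        using c by (simp add: mult.assoc[symmetric] flip: ennreal_mult)
      also have "\<dots> \<le> ennreal (1 / c) * ennreal (e / 48)"
        using d(2)[OF l, of s] by (intro mult_left_mono) (auto simp: c_def)
      also have "\<dots> = ennreal (1 / c * (e / 48))" using c e by (intro ennreal_mult[symmetric]) auto
      also have "\<dots> \<le> ennreal (e * (v * blog v powr (- p)))"
      proof (rule ennreal_leI)
        have "(blog v / 2) powr p \<le> ln (2 / l) powr p" using ln bl p by (intro powr_mono2) auto
        then have "blog v powr p / 4 \<le> ln (2 / l) powr p"
        proof -
          have "2 powr p \<le> (2::real) powr 2" using p by (intro powr_mono) auto
          then have "blog v powr p / 4 \<le> blog v powr p / 2 powr p" by (intro divide_left_mono) auto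
          also have "\<dots> = (blog v / 2) powr p" using bl by (simp add: powr_divide)
          finally show ?thesis using \<open>(blog v / 2) powr p \<le> ln (2 / l) powr p\<close> by simp
        qed
        then have "blog v powr p / 4 / l \<le> c" unfolding c_def using l by (intro divide_right_mono) auto
        moreover have "0 < blog v powr p / 4 / l" using bl l by simp
        ultimately have "1 / c \<le> 1 / (blog v powr p / 4 / l)" by (intro frac_le) auto
        also have "\<dots> = 48 * (v * blog v powr (- p))" using bl by (simp add: l_def powr_minus field_simps)
        finally have "1 / c * (e / 48) \<le> 48 * (v * blog v powr (- p)) * (e / 48)" using e by (intro mult_right_mono) auto
        then show "1 / c * (e / 48) \<le> e * (v * blog v powr (- p))" by (simp add: mult_ac)
      qed
      also have "\<dots> = ennreal e * ennreal (v * blog v powr (- p))" using e by (intro ennreal_mult') auto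
      finally show "emeasure (gmeasure p g) (ball \<xi> v) \<le> ennreal e * ennreal (v * blog v powr (- p))" .
    qed
  qed
next
  assume v: vanishing
  show "vanishing_log_carleson p g"
    unfolding vanishing_log_carleson_iff
  proof (intro allI impI)
    fix y :: ennreal assume "0 < y"
    have "\<exists>e>0. ennreal (2 * e) < y"
    proof (cases y)
      case (real r)
      then show ?thesis using \<open>0 < y\<close> by (intro exI[of _ "r / 4"]) (auto simp: ennreal_less_iff)
    qed (auto intro: exI[of _ 1])
    then obtain e where e: "0 < e" "ennreal (2 * e) < y" by blast
    obtain \<delta> where \<delta>: "0 < \<delta>" "\<delta> \<le> 2" "log_carleson p g e \<delta>" using vanishing_D[OF v e(1)] .
    show "\<exists>d>0. \<forall>s l. 0 < l \<longrightarrow> l < d \<longrightarrow> ennreal (ln (2 / l) powr p / l) * square_integral s l < y"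
    proof (intro exI[of _ "\<delta> / 2"] conjI allI impI)
      fix s l :: real assume l: "0 < l" "l < \<delta> / 2"
      then have l1: "l < 1" using \<delta> by simp
      have bl: "1 \<le> blog (2 * l)" using l l1 by (intro blog_ge_1) auto
      have ln: "0 \<le> ln (2 / l)" "ln (2 / l) \<le> blog (2 * l)"
        using l l1 by (auto simp: blog_def intro!: ln_mono divide_right_mono)
      have "square_integral s l \<le> emeasure (gmeasure p g) (ball (cis s) (2 * l))"
        unfolding emeasure_gmeasure[OF g p(1) borel_open[OF open_ball]] bmoa_density_def
        using carleson_square_subset_box[of l s] l l1
        by (intro nn_integral_mono) (auto split: split_indicator)
      also have "\<dots> \<le> ennreal e * ennreal (2 * l * blog (2 * l) powr (- p))"
        using \<delta>(3) l unfolding log_carleson_def by auto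
      finally have "ennreal (ln (2 / l) powr p / l) * square_integral s l
        \<le> ennreal (ln (2 / l) powr p / l) * (ennreal e * ennreal (2 * l * blog (2 * l) powr (- p)))"
        by (intro mult_left_mono) auto
      also have "\<dots> = ennreal (ln (2 / l) powr p / l * (e * (2 * l * blog (2 * l) powr (- p))))"
        using e l by (intro ennreal_mult3) auto
      also have "\<dots> \<le> ennreal (2 * e)"
      proof (rule ennreal_leI)
        have "ln (2 / l) powr p / l * (e * (2 * l * blog (2 * l) powr (- p))) = 2 * e * (ln (2 / l) powr p * blog (2 * l) powr (- p))"
          using l by (simp add: field_simps)
        also have "\<dots> \<le> 2 * e * (blog (2 * l) powr p * blog (2 * l) powr (- p))"
          using e ln p by (intro mult_left_mono mult_right_mono powr_mono2) auto
        also have "blog (2 * l) powr p * blog (2 * l) powr (- p) = 1" using bl by (simp add: powr_minus)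
        finally show "ln (2 / l) powr p / l * (e * (2 * l * blog (2 * l) powr (- p))) \<le> 2 * e" by simp
      qed
      finally show "ennreal (ln (2 / l) powr p / l) * square_integral s l < y" using e by simp
    qed (use \<delta> in auto)
  qed
qed

end

subsection \<open>Boundedness implies the logarithmic Carleson condition\<close>

text \<open>The constant function gives the finiteness of the mass of g, and the test function of
  size v gives the bound for boxes of radius v \<le> 1/64. Larger boxes are compared with the total
  mass.\<close>

lemma bounded_imp_log_carleson:
  assumes p: "1 < p" "p \<le> 2" and g: "g holomorphic_on unit_disc"
    and bdd: "bounded_operator (BMOA p) (bmoa_norm p) (BMOA p) (bmoa_norm p) (integral_operator g)"
  shows "bmoa_symbol p g" "\<exists>K\<ge>0. log_carleson p g K 2"
proof -
  let ?T = "integral_operator g"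
  have map: "\<And>f. f \<in> BMOA p \<Longrightarrow> ?T f \<in> BMOA p"
    using bdd by (auto simp: bounded_operator_def linear_operator_def)
  obtain C0 where C0: "\<And>f. f \<in> BMOA p \<Longrightarrow> bmoa_norm p (?T f) \<le> C0 * bmoa_norm p f"
    using bdd unfolding bounded_operator_def by blast
  define C where "C = max C0 0"
  have C: "0 \<le> C" "\<And>f. f \<in> BMOA p \<Longrightarrow> bmoa_norm p (?T f) \<le> C * bmoa_norm p f"
  proof -
    show "0 \<le> C" by (simp add: C_def)
    fix f assume f: "f \<in> BMOA p"
    have "C0 * bmoa_norm p f \<le> C * bmoa_norm p f" by (intro mult_right_mono) (auto simp: C_def)
    then show "bmoa_norm p (?T f) \<le> C * bmoa_norm p f" using C0[OF f] by simp
  qed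
  \<comment> \<open>The constant 1, cut off because members of the spaces vanish outside the disc.
    The densities of its image and of g agree.\<close>
  define one :: "complex \<Rightarrow> complex" where "one z = (if z \<in> unit_disc then 1 else 0)" for z
  have one_hol: "one holomorphic_on unit_disc"
    by (rule holomorphic_transform[of "\<lambda>_. 1"]) (auto simp: one_def)
  have one: "one \<in> BMOA p"
  proof -
    have "deriv one z = 0" if "z \<in> unit_disc" for z
    proof (rule DERIV_imp_deriv)
      show "(one has_field_derivative 0) (at z)"
        by (rule has_field_derivative_transform_within_open[of "\<lambda>_. 1" _ _ unit_disc]) (use that in \<open>auto simp: one_def\<close>)
    qed
    then have "one \<in> VMOA p"
      using one_hol by (intro VMOA_I_bounded_deriv[OF p(1), of _ 0]) (auto simp: analytic_disc_def one_def)
    then show ?thesis using VMOA_subset_BMOA by auto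
  qed
  have "bmoa_integral p (?T one) 0 = bmoa_integral p g 0"
    by (auto simp: bmoa_integral_eq bmoa_density_integral_operator[OF one_hol g] one_def
        intro!: nn_integral_cong split: split_indicator)
  moreover have "bmoa_integral p (?T one) 0 < \<infinity>"
    using bmoa_integral_le_norm'[of p "?T one" 0] map[OF one] p by (auto intro: le_less_trans)
  ultimately show S: "bmoa_symbol p g" using p g by unfold_locales auto
  interpret bmoa_symbol p g by (rule S)
  define K1 where "K1 = 4 * (C * 24576) powr p * 4 powr p"
  define K2 where "K2 = mass * 64 * blog (1 / 64) powr p"
  have b64: "1 \<le> blog (1 / 64)" by (intro blog_ge_1) auto
  have K: "0 \<le> K1" "0 \<le> K2" using mass_nonneg by (auto simp: K1_def K2_def)
  have "log_carleson p g (K1 + K2) 2"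
    unfolding log_carleson_def
  proof (intro allI impI)
    fix \<xi> v assume v: "cmod \<xi> = 1" "0 < v" "v \<le> (2::real)"
    have bv: "1 \<le> blog v" using v by (intro blog_ge_1) auto
    have "emeasure (gmeasure p g) (ball \<xi> v) \<le> ennreal ((K1 + K2) * (v * blog v powr (- p)))"
    proof (cases "v \<le> 1 / 64")
      case True
      have v12: "v \<le> 1 / 2" using True by simp
      let ?f = "test_fun \<xi> v"
      note tf = test_fun_norm_le[OF v(1,2) v12 p]
      note hol = BMOA_holomorphic[OF tf(1)]
      define a where "a = of_real (1 - v) * \<xi>"
      have a: "a \<in> unit_disc" using v True by (simp add: a_def norm_mult del: of_real_diff)
      \<comment> \<open>The height \<open>blog v / 4\<close> of the test function on the box turns
        the norm of its image, read at the adapted point a, into a bound for the mass of the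
        box.\<close>
      have "ennreal ((blog v / 4) powr p) * emeasure (gmeasure p g) (ball \<xi> v \<inter> unit_disc)
        = (\<integral>\<^sup>+ z \<in> ball \<xi> v \<inter> unit_disc. ennreal ((blog v / 4) powr p) \<partial>gmeasure p g)"
        by (subst nn_integral_cmult_indicator) auto
      also have "\<dots> \<le> (\<integral>\<^sup>+ z \<in> (ball \<xi> v \<inter> unit_disc) \<inter> unit_disc. ennreal (cmod (?f z) powr p) \<partial>gmeasure p g)"
        using test_fun_ge[OF v(1,2) v12 True] bv p
        by (intro nn_integral_mono) (auto intro!: ennreal_leI powr_mono2 split: split_indicator)
      also have "\<dots> = emeasure (gmeasure p (?T ?f)) (ball \<xi> v \<inter> unit_disc)"
        by (rule emeasure_gmeasure_integral_operator[OF hol g p(1), symmetric]) auto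
      also have "\<dots> \<le> ennreal (4 * v) * bmoa_integral p (?T ?f) a"
        unfolding bmoa_integral_gmeasure[OF T_holomorphic[OF hol] p(1) a]
        using v v12 by (intro box_le_poisson_integral[where \<zeta> = \<xi>]) (auto simp: a_def)
      also have "\<dots> \<le> ennreal (4 * v) * ennreal ((C * 24576) powr p)"
      proof (intro mult_left_mono)
        have "bmoa_integral p (?T ?f) a \<le> ennreal (bmoa_norm p (?T ?f) powr p)"
          using map[OF tf(1)] a p by (intro bmoa_integral_le_norm') auto
        also have "\<dots> \<le> ennreal ((C * 24576) powr p)"
          using C(2)[OF tf(1)] mult_left_mono[OF tf(2) C(1)] p by (intro ennreal_leI powr_mono2) auto
        finally show "bmoa_integral p (?T ?f) a \<le> ennreal ((C * 24576) powr p)" .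
      qed simp
      also have "\<dots> = ennreal (4 * v * (C * 24576) powr p)" using v by (intro ennreal_mult[symmetric]) auto
      finally have le: "ennreal ((blog v / 4) powr p) * emeasure (gmeasure p g) (ball \<xi> v \<inter> unit_disc)
          \<le> ennreal (4 * v * (C * 24576) powr p)" .
      have "emeasure (gmeasure p g) (ball \<xi> v) = emeasure (gmeasure p g) (ball \<xi> v \<inter> unit_disc)"
        by (simp add: emeasure_gmeasure[OF g p(1)] Int_assoc)
      also have "\<dots> = ennreal ((4 / blog v) powr p) * (ennreal ((blog v / 4) powr p) * emeasure (gmeasure p g) (ball \<xi> v \<inter> unit_disc))"
      proof -
        have "(4 / blog v) powr p * (blog v / 4) powr p = 1" using bv by (simp add: powr_mult[symmetric])
        then have "ennreal ((4 / blog v) powr p) * ennreal ((blog v / 4) powr p) = 1"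
          by (simp add: ennreal_mult[symmetric] del: ennreal_1 flip: ennreal_1)
        then show ?thesis by (simp add: mult.assoc[symmetric])
      qed
      also have "\<dots> \<le> ennreal ((4 / blog v) powr p) * ennreal (4 * v * (C * 24576) powr p)"
        by (intro mult_left_mono le) simp
      also have "\<dots> = ennreal ((4 / blog v) powr p * (4 * v * (C * 24576) powr p))"
        using v by (intro ennreal_mult[symmetric]) auto
      also have "(4 / blog v) powr p * (4 * v * (C * 24576) powr p) = K1 * (v * blog v powr (- p))"
        using bv by (simp add: K1_def powr_divide powr_minus field_simps)
      also have "ennreal \<dots> \<le> ennreal ((K1 + K2) * (v * blog v powr (- p)))"
        using K v by (intro ennreal_leI mult_right_mono) auto
      finally show ?thesis .
    next
      case False
      have "emeasure (gmeasure p g) (ball \<xi> v) \<le> emeasure (gmeasure p g) UNIV" by (intro emeasure_mono) auto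
      also have "\<dots> = ennreal (K2 * (1 / 64 * blog (1 / 64) powr (- p)))"
        using b64 by (simp add: emeasure_g_UNIV K2_def powr_minus)
      also have "\<dots> \<le> ennreal ((K1 + K2) * (v * blog v powr (- p)))"
      proof (intro ennreal_leI mult_mono)
        show "blog (1 / 64) powr (- p) \<le> blog v powr (- p)"
          using False v bv p by (intro powr_mono2' blog_mono) auto
      qed (use K v False in auto)
      finally show ?thesis .
    qed
    also have "\<dots> = ennreal (K1 + K2) * ennreal (v * blog v powr (- p))"
      using K v by (intro ennreal_mult) auto
    finally show "emeasure (gmeasure p g) (ball \<xi> v) \<le> ennreal (K1 + K2) * ennreal (v * blog v powr (- p))" .
  qed
  then show "\<exists>K\<ge>0. log_carleson p g K 2" using K by (intro exI[of _ "K1 + K2"]) auto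
qed

subsection \<open>The gliding hump\<close>

lemma poisson_le_interior:
  assumes "0 < q" "cmod b \<le> 1 - q" "cmod z < 1"
  shows "poisson b z \<le> 1 / q\<^sup>2"
proof -
  have b: "cmod b \<le> 1" using assms by simp
  have "1 - cmod b \<le> cmod (1 - cnj z * b)" using assms by (intro one_minus_cnj_mult_ge) auto
  also have "cmod (1 - cnj z * b) = cmod (1 - cnj b * z)"
    by (metis complex_cnj_cnj complex_cnj_diff complex_cnj_mult complex_cnj_one complex_mod_cnj mult.commute)
  finally have "q \<le> cmod (1 - cnj b * z)" using assms by simp
  then show ?thesis
    unfolding poisson_def using assms b by (intro frac_le power_mono) auto
qed

lemma bmoa_integral_le_mass:
  assumes p: "1 < p" and f: "f holomorphic_on unit_disc" and b: "0 < q" "cmod b \<le> 1 - q"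
  shows "bmoa_integral p f b \<le> ennreal (1 / q\<^sup>2) * emeasure (gmeasure p f) UNIV"
proof -
  have "b \<in> unit_disc" using b by simp
  then have "bmoa_integral p f b = (\<integral>\<^sup>+ z \<in> unit_disc. ennreal (poisson b z) \<partial>gmeasure p f)"
    by (rule bmoa_integral_gmeasure[OF f p])
  also have "\<dots> \<le> (\<integral>\<^sup>+ z. ennreal (1 / q\<^sup>2) \<partial>gmeasure p f)"
    using poisson_le_interior[OF b] by (intro nn_integral_mono) (auto intro!: ennreal_leI split: split_indicator)
  finally show ?thesis by simp
qed

text \<open>A test function of very small size is negligible on a given subdisc in both senses
  needed: in value, and in the \<open>BMOA p\<close> integrals at points of the subdisc, which are
  at most 1/q^2 times its total mass. The threshold does not depend on \<zeta>.\<close>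

lemma test_fun_small:
  assumes p: "1 < p" "p \<le> 2" and r: "r < 1" and t: "0 < t"
  obtains B where "\<And>\<zeta> h. cmod \<zeta> = 1 \<Longrightarrow> 0 < h \<Longrightarrow> h \<le> 1 / 2 \<Longrightarrow> B \<le> blog h \<Longrightarrow>
      (\<forall>z. cmod z \<le> r \<longrightarrow> cmod (test_fun \<zeta> h z) \<le> t) \<and> (\<forall>b. cmod b \<le> r \<longrightarrow> bmoa_integral p (test_fun \<zeta> h) b \<le> ennreal t)"
proof -
  define q where "q = min (1 - r) (1 / 2)"
  have q: "0 < q" "q \<le> 1 / 2" "r \<le> 1 - q" using r unfolding q_def by (auto simp: min_def)
  define m where "m = t * q\<^sup>2"
  have m: "0 < m" using t q by (simp add: m_def)
  define s where "s = min (m / 768) (1 / 2)"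
  have s: "0 < s" "s \<le> 1 / 2" "s \<le> m / 768" using m by (auto simp: s_def)
  define c where "c = ln (2 / s) + 2"
  have c: "0 < c" using s by (simp add: c_def add_nonneg_pos)
  \<comment> \<open>The first entry makes the values at most t. The second makes c /
    \<open>blog h\<close> at most 1 and at most m/1536, so that 768 times its p-th power is at most
    m/2; the choice of s bounds 384*s by m/2.\<close>
  define B where "B = max ((ln (1 / q) + 2)\<^sup>2 / t) (c + 1536 * c / m)"
  show ?thesis
  proof (rule that[of B], intro conjI allI impI)
    fix \<zeta> h assume z: "cmod \<zeta> = 1" and h: "0 < h" "h \<le> (1 / 2 :: real)" and B: "B \<le> blog h"
    have bl: "2 \<le> blog h" by (rule blog_ge_2[OF z h])
    have B1: "(ln (1 / q) + 2)\<^sup>2 / t \<le> blog h" and B2: "c + 1536 * c / m \<le> blog h"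
      using B by (auto simp: B_def)
    show "cmod (test_fun \<zeta> h w) \<le> t" if "cmod w \<le> r" for w
    proof -
      have "cmod (test_fun \<zeta> h w) \<le> (ln (1 / q) + 2)\<^sup>2 / blog h"
        using that q by (intro test_fun_le_interior[OF z h]) auto
      also have "\<dots> \<le> t" using B1 t bl by (simp add: field_simps)
      finally show ?thesis .
    qed
    fix b assume b: "cmod b \<le> r"
    note hol = BMOA_holomorphic[OF test_fun_norm_le(1)[OF z h p]]
    have pos: "0 \<le> 1536 * c / m" using c m by simp
    have cb: "c / blog h \<le> 1" using B2 bl pos by simp
    have cb2: "c / blog h \<le> m / 1536"
    proof -
      have "1536 * c / m \<le> blog h" using B2 c by simp
      then show ?thesis using m bl by (simp add: field_simps)
    qed
    have "(c / blog h) powr p \<le> (c / blog h) powr 1"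
      using cb c bl p powr_mono'[of 1 p "c / blog h"] by simp
    also have "(c / blog h) powr 1 = c / blog h" using c bl by simp
    finally have "(c / blog h) powr p \<le> m / 1536" using cb2 by (rule order_trans)
    then have "384 * s + 768 * (c / blog h) powr p \<le> m" using s by simp
    then have "emeasure (gmeasure p (test_fun \<zeta> h)) UNIV \<le> ennreal m"
      using test_fun_mass_le[OF z h p s(1,2)] by (auto simp: c_def intro: order_trans ennreal_leI)
    then have "bmoa_integral p (test_fun \<zeta> h) b \<le> ennreal (1 / q\<^sup>2) * ennreal m"
      using bmoa_integral_le_mass[OF p(1) hol q(1), of b] b q
      by (meson mult_left_mono order_trans zero_le)
    also have "\<dots> = ennreal t" using q t by (simp add: m_def flip: ennreal_mult)
    finally show "bmoa_integral p (test_fun \<zeta> h) b \<le> ennreal t" .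
  qed
qed

section \<open>Selection of the humps when (vii) fails\<close>

context bmoa_symbol
begin

text \<open>Continuity of the measure from below. The mass that witnesses the failure of (vii) must
  be caught inside a compact subdisc, since later humps are small only there.\<close>

lemma inner_box:
  assumes "c < emeasure (gmeasure p g) (ball \<xi> v)"
  shows "\<exists>\<rho><1. c < emeasure (gmeasure p g) (ball \<xi> v \<inter> cball 0 \<rho>)"
proof -
  define A where "A n = ball \<xi> v \<inter> cball 0 (1 - 1 / real (Suc n))" for n
  have inc: "incseq A"
  proof (rule incseq_SucI)
    fix n
    have "1 / real (Suc (Suc n)) \<le> 1 / real (Suc n)" by (intro divide_left_mono) auto
    then show "A n \<subseteq> A (Suc n)" by (auto simp: A_def)
  qed
  have U: "(\<Union>n. A n) = ball \<xi> v \<inter> unit_disc"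
  proof
    show "(\<Union>n. A n) \<subseteq> ball \<xi> v \<inter> unit_disc"
    proof
      fix z assume "z \<in> (\<Union>n. A n)"
      then obtain n where "z \<in> ball \<xi> v" "cmod z \<le> 1 - 1 / real (Suc n)" by (auto simp: A_def)
      moreover have "0 < 1 / real (Suc n)" by simp
      then have "cmod z < 1" using \<open>cmod z \<le> 1 - 1 / real (Suc n)\<close> by linarith
      ultimately show "z \<in> ball \<xi> v \<inter> unit_disc" by simp
    qed
    show "ball \<xi> v \<inter> unit_disc \<subseteq> (\<Union>n. A n)"
    proof
      fix z assume z: "z \<in> ball \<xi> v \<inter> unit_disc"
      then have "0 < 1 - cmod z" by simp
      then obtain n where "inverse (real (Suc n)) < 1 - cmod z" using reals_Archimedean by blast
      then have "z \<in> A n" using z by (auto simp: A_def divide_inverse simp del: of_nat_Suc)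
      then show "z \<in> (\<Union>n. A n)" by blast
    qed
  qed
  have "(SUP n. emeasure (gmeasure p g) (A n)) = emeasure (gmeasure p g) (\<Union>n. A n)"
    by (rule SUP_emeasure_incseq[OF _ inc]) (auto simp: A_def)
  also have "\<dots> = emeasure (gmeasure p g) (ball \<xi> v)"
    unfolding U by (simp add: emeasure_gmeasure[OF g p(1)] Int_assoc)
  finally have "c < (SUP n. emeasure (gmeasure p g) (A n))" using assms by simp
  then obtain n where "c < emeasure (gmeasure p g) (A n)" by (auto simp: less_SUP_iff)
  then show ?thesis by (intro exI[of _ "1 - 1 / real (Suc n)"]) (auto simp: A_def)
qed

lemma not_vanishingE:
  assumes "\<not> vanishing"
  obtains e where "0 < e" "\<And>\<delta>. 0 < \<delta> \<Longrightarrow> \<exists>\<xi> v. cmod \<xi> = 1 \<and> 0 < v \<and> v \<le> \<delta> \<and>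
    ennreal e * ennreal (v * blog v powr (- p)) < emeasure (gmeasure p g) (ball \<xi> v)"
proof -
  obtain e where e: "0 < e" "\<forall>\<delta>>0. \<not> log_carleson p g e \<delta>" using assms by (auto simp: vanishing_def)
  then show ?thesis by (intro that[of e]) (auto simp: log_carleson_def not_le)
qed

text \<open>
  A state \<open>(\<zeta>, h, r, S)\<close> consists of the test function at \<open>\<zeta>\<close> of size \<open>h\<close>, a radius \<open>r\<close> beyond which it
  is negligible, and a bound \<open>S\<close> for the sum of all humps so far; the next hump must dominate \<open>S\<close>.
\<close>

definition hump_state :: "real \<Rightarrow> nat \<Rightarrow> complex \<times> real \<times> real \<times> real \<Rightarrow> bool"
  where "hump_state e n = (\<lambda>(\<zeta>, h, r, S). cmod \<zeta> = 1 \<and> 0 < h \<and> h \<le> 1 / 64 \<and> h \<le> (1 / 2) ^ n \<and>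
    r < 1 \<and> 1 - (1 / 2) ^ n \<le> r \<and> 0 \<le> S \<and> blog h \<le> S \<and>
    ennreal e * ennreal (h * blog h powr (- p)) < emeasure (gmeasure p g) (ball \<zeta> h \<inter> cball 0 r) \<and>
    (\<forall>b. r < cmod b \<longrightarrow> cmod b < 1 \<longrightarrow> bmoa_integral p (test_fun \<zeta> h) b \<le> ennreal (((1 / 2) ^ n) powr p)))"

text \<open>On its box a hump is at least \<open>blog h' / 4\<close>, while earlier humps and the
  tail together are at most S + 1, which is at most \<open>blog h' / 16\<close>; more than
  \<open>blog h' / 8\<close> survives. S grows by \<open>blog h'\<close>, the bound of the new test
  function on the disc.\<close>

definition hump_step :: "nat \<Rightarrow> complex \<times> real \<times> real \<times> real \<Rightarrow> complex \<times> real \<times> real \<times> real \<Rightarrow> bool"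
  where "hump_step n = (\<lambda>(\<zeta>, h, r, S) (\<zeta>', h', r', S'). r \<le> r' \<and> S' = S + blog h' \<and> 16 * (S + 1) \<le> blog h' \<and>
    (\<forall>z. cmod z \<le> r \<longrightarrow> cmod (test_fun \<zeta>' h' z) \<le> (1 / 2) ^ Suc n) \<and>
    (\<forall>b. cmod b \<le> r \<longrightarrow> bmoa_integral p (test_fun \<zeta>' h') b \<le> ennreal (((1 / 2) ^ Suc n) powr p)))"

lemma hump_extend:
  assumes e: "0 < e" "\<And>\<delta>. 0 < \<delta> \<Longrightarrow> \<exists>\<xi> v. cmod \<xi> = 1 \<and> 0 < v \<and> v \<le> \<delta> \<and>
      ennreal e * ennreal (v * blog v powr (- p)) < emeasure (gmeasure p g) (ball \<xi> v)"
    and r: "r < 1" and S: "0 \<le> S"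
  shows "\<exists>\<zeta>' h' r' S'. hump_state e (Suc n) (\<zeta>', h', r', S') \<and> hump_step n (\<zeta>, h, r, S) (\<zeta>', h', r', S')"
proof -
  define t where "t = min ((1 / 2) ^ Suc n) (((1 / 2) ^ Suc n) powr p)"
  have t: "0 < t" "t \<le> (1 / 2) ^ Suc n" "t \<le> ((1 / 2) ^ Suc n) powr p" by (auto simp: t_def)
  obtain B where B: "\<And>\<zeta> h. cmod \<zeta> = 1 \<Longrightarrow> 0 < h \<Longrightarrow> h \<le> 1 / 2 \<Longrightarrow> B \<le> blog h \<Longrightarrow>
      (\<forall>z. cmod z \<le> r \<longrightarrow> cmod (test_fun \<zeta> h z) \<le> t) \<and> (\<forall>b. cmod b \<le> r \<longrightarrow> bmoa_integral p (test_fun \<zeta> h) b \<le> ennreal t)"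
    using test_fun_small[OF p r t(1)] by blast
  define \<delta> where "\<delta> = min (min (1 / 64) ((1 / 2) ^ Suc n)) (min (16 * exp (- B)) (16 * exp (- (16 * (S + 1)))))"
  have "0 < \<delta>" by (simp add: \<delta>_def)
  then obtain \<xi> v where v: "cmod \<xi> = 1" "0 < v" "v \<le> \<delta>"
    "ennreal e * ennreal (v * blog v powr (- p)) < emeasure (gmeasure p g) (ball \<xi> v)" using e(2) by blast
  have v': "v \<le> 1 / 64" "v \<le> (1 / 2) ^ Suc n" "B \<le> blog v" "16 * (S + 1) \<le> blog v"
    using v(2,3) by (auto simp: \<delta>_def intro!: blog_ge_imp)
  have v12: "v \<le> 1 / 2" using v' by simp
  obtain \<rho> where \<rho>: "\<rho> < 1" "ennreal e * ennreal (v * blog v powr (- p)) < emeasure (gmeasure p g) (ball \<xi> v \<inter> cball 0 \<rho>)"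
    using inner_box[OF v(4)] by blast
  obtain R where R: "R < 1" "\<And>b. R < cmod b \<Longrightarrow> cmod b < 1 \<Longrightarrow> bmoa_integral p (test_fun \<xi> v) b < ennreal (((1 / 2) ^ Suc n) powr p)"
    using VMOA_D[OF test_fun_VMOA[OF v(1,2) v12 p(1)], of "ennreal (((1 / 2) ^ Suc n) powr p)"] by auto
  \<comment> \<open>The new radius must exceed the old one, capture the mass in the box (\<rho>),
    lie beyond the range where the new test function is noticeable (R), and exhaust the disc as n
    grows.\<close>
  define r' where "r' = max (max r \<rho>) (max R (1 - (1 / 2) ^ Suc n))"
  have r': "r \<le> r'" "\<rho> \<le> r'" "R \<le> r'" "1 - (1 / 2) ^ Suc n \<le> r'" "r' < 1"
    using r \<rho> R by (auto simp: r'_def)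
  have "emeasure (gmeasure p g) (ball \<xi> v \<inter> cball 0 \<rho>) \<le> emeasure (gmeasure p g) (ball \<xi> v \<inter> cball 0 r')"
    using r' by (intro emeasure_mono) auto
  then have "hump_state e (Suc n) (\<xi>, v, r', S + blog v)"
    unfolding hump_state_def prod.case
    using v v' r' S \<rho>(2) R(2) blog_ge_2(1)[OF v(1,2) v12] by (auto intro: less_le_trans less_imp_le simp del: power_Suc)
  moreover have "hump_step n (\<zeta>, h, r, S) (\<xi>, v, r', S + blog v)"
  proof -
    have b: "(\<forall>z. cmod z \<le> r \<longrightarrow> cmod (test_fun \<xi> v z) \<le> t) \<and> (\<forall>b. cmod b \<le> r \<longrightarrow> bmoa_integral p (test_fun \<xi> v) b \<le> ennreal t)"
      using B[OF v(1,2) v12 v'(3)] .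
    then show ?thesis
      unfolding hump_step_def prod.case using r'(1) v'(4) t
      by (auto intro: order_trans ennreal_leI simp del: power_Suc)
  qed
  ultimately show ?thesis by blast
qed

lemma hump_sequence:
  assumes "\<not> vanishing"
  obtains e x where "0 < e" "\<And>n. hump_state e (Suc n) (x n)" "\<And>n. hump_step (Suc n) (x n) (x (Suc n))"
proof -
  obtain e where e: "0 < e" "\<And>\<delta>. 0 < \<delta> \<Longrightarrow> \<exists>\<xi> v. cmod \<xi> = 1 \<and> 0 < v \<and> v \<le> \<delta> \<and>
    ennreal e * ennreal (v * blog v powr (- p)) < emeasure (gmeasure p g) (ball \<xi> v)"
    using not_vanishingE[OF assms] by blast
  have "\<exists>x. \<forall>n. hump_state e (Suc n) (x n) \<and> hump_step (Suc n) (x n) (x (Suc n))"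
  proof (rule dependent_nat_choice)
    show "\<exists>x. hump_state e (Suc 0) x"
      \<comment> \<open>The construction starts from radius 0 and sum 0, with an arbitrary point and
        size as predecessor.\<close>
      using hump_extend[OF e, of 0 0 0 undefined undefined] by auto
    fix x n assume x: "hump_state e (Suc n) x"
    obtain \<zeta> h r S where xe: "x = (\<zeta>, h, r, S)" by (cases x) auto
    then have "r < 1" "0 \<le> S" using x by (auto simp: hump_state_def)
    then show "\<exists>y. hump_state e (Suc (Suc n)) y \<and> hump_step (Suc n) x y"
      unfolding xe using hump_extend[OF e, of r S "Suc n" \<zeta> h] by blast
  qed
  then obtain x where "\<And>n. hump_state e (Suc n) (x n)" "\<And>n. hump_step (Suc n) (x n) (x (Suc n))" by blast
  then show ?thesis by (rule that[OF e(1)])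
qed

text \<open>F is the sum of the test functions. At a given b at most one of them is noticeable, so
  Minkowski's inequality bounds all partial sums by one test function plus a geometric series. On
  the captured part of its box a single term dominates the sum, and the failure of (vii) turns its
  height into a lower bound for the integral of \<open>T F\<close> at the point adapted to the
  box.\<close>

lemma gliding_hump:
  assumes nv: "\<not> vanishing"
  obtains F Fs C e a where
    "F \<in> BMOA p" "0 < C" "0 < e"
    "\<And>N. Fs N \<in> VMOA p" "\<And>N. bmoa_norm p (Fs N) \<le> C" "\<And>N. \<exists>B. \<forall>z\<in>unit_disc. cmod (Fs N z) \<le> B"
    "\<And>K. compact K \<Longrightarrow> K \<subseteq> unit_disc \<Longrightarrow> uniform_limit K Fs F sequentially"
    "\<And>n. a n \<in> unit_disc" "(\<lambda>n. cmod (a n)) \<longlonglongrightarrow> 1"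
    "\<And>n::nat. ennreal e \<le> bmoa_integral p (T F) (a n)"
proof -
  obtain e x where e: "0 < e" and st: "\<And>n. hump_state e (Suc n) (x n)" and step: "\<And>n. hump_step (Suc n) (x n) (x (Suc n))"
    using hump_sequence[OF nv] by blast
  define \<zeta> where "\<zeta> n = fst (x n)" for n
  define h where "h n = fst (snd (x n))" for n
  define r where "r n = fst (snd (snd (x n)))" for n
  define S where "S n = snd (snd (snd (x n)))" for n
  have xe: "x n = (\<zeta> n, h n, r n, S n)" for n by (simp add: \<zeta>_def h_def r_def S_def)
  have st1: "cmod (\<zeta> n) = 1" "0 < h n" "h n \<le> 1 / 64" "h n \<le> (1 / 2) ^ Suc n" "r n < 1" "1 - (1 / 2) ^ Suc n \<le> r n"
    "blog (h n) \<le> S n" for n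
    using st[of n] unfolding xe hump_state_def prod.case by auto
  have st2: "ennreal e * ennreal (h n * blog (h n) powr (- p)) < emeasure (gmeasure p g) (ball (\<zeta> n) (h n) \<inter> cball 0 (r n))" for n
    using st[of n] unfolding xe hump_state_def prod.case by auto
  define f where "f n = test_fun (\<zeta> n) (h n)" for n
  have st3: "bmoa_integral p (f n) b \<le> ennreal (((1 / 2) ^ Suc n) powr p)" if "r n < cmod b" "cmod b < 1" for n b
    using st[of n] that unfolding xe hump_state_def prod.case f_def by blast
  have step1: "r n \<le> r (Suc n)" "S (Suc n) = S n + blog (h (Suc n))" "16 * (S n + 1) \<le> blog (h (Suc n))" for n
    using step[of n] unfolding xe hump_step_def prod.case by auto
  have step2: "cmod (f (Suc n) z) \<le> (1 / 2) ^ Suc (Suc n)" if "cmod z \<le> r n" for n z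
    using step[of n] that unfolding xe hump_step_def prod.case f_def by blast
  have step3: "bmoa_integral p (f (Suc n)) b \<le> ennreal (((1 / 2) ^ Suc (Suc n)) powr p)" if "cmod b \<le> r n" for n b
    using step[of n] that unfolding xe hump_step_def prod.case f_def by blast
  have h12: "h n \<le> 1 / 2" for n using st1(3)[of n] by simp
  note tf = st1(1) st1(2) h12
  have incr: "r m \<le> r n" if "m \<le> n" for m n using lift_Suc_mono_le[of r, OF step1(1) that] .
  have early: "cmod (f n z) \<le> (1 / 2) ^ Suc n" if "m < n" "cmod z \<le> r m" for m n z
  proof -
    obtain k where k: "n = Suc k" using \<open>m < n\<close> by (cases n) auto
    then show ?thesis using step2[of z k] incr[of m k] that by auto
  qed
  have early_int: "bmoa_integral p (f n) b \<le> ennreal (((1 / 2) ^ Suc n) powr p)" if "m < n" "cmod b \<le> r m" for m n b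
  proof -
    obtain k where k: "n = Suc k" using \<open>m < n\<close> by (cases n) auto
    then show ?thesis using step3[of b k] incr[of m k] that by auto
  qed
  have Ssum: "(\<Sum>m\<le>n. blog (h m)) \<le> S n" for n
    by (induction n) (use st1(7) step1(2) in auto)
  have fV: "f n \<in> VMOA p" for n unfolding f_def by (rule test_fun_VMOA[OF tf p(1)])
  have fB: "f n \<in> BMOA p" for n using fV VMOA_subset_BMOA by auto
  note fhol = BMOA_holomorphic[OF fB]
  have fle: "cmod (f n z) \<le> blog (h n)" if "z \<in> unit_disc" for n z
    unfolding f_def by (rule test_fun_le[OF tf that])
  have fint: "bmoa_integral p (f n) b \<le> ennreal (24576 powr p)" if "b \<in> unit_disc" for n b
    unfolding f_def by (rule test_fun_bmoa_integral_le[OF tf p that])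
  have half: "(\<Sum>n<N. (1 / 2) ^ Suc n) \<le> (1::real)" for N :: nat
  proof -
    have "(\<Sum>n<N. (1 / 2) ^ Suc n) = 1 - (1 / 2 :: real) ^ N" by (induction N) auto
    then show ?thesis by simp
  qed
  define Fs where "Fs N z = (\<Sum>n<N. f n z)" for N z
  define F where "F z = (if z \<in> unit_disc then \<Sum>n. f n z else 0)" for z
  have Fs0: "Fs 0 = (\<lambda>z. 0 * f 0 z)" by (auto simp: Fs_def)
  have FsS: "Fs (Suc N) = (\<lambda>z. Fs N z + f N z)" for N by (auto simp: Fs_def)
  have FsV: "Fs N \<in> VMOA p" for N
  proof (induction N)
    case 0
    show ?case unfolding Fs0 by (rule VMOA_cmult[OF p(1) fV])
  next
    case (Suc N)
    show ?case unfolding FsS by (rule VMOA_add[OF p(1) Suc fV])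
  qed
  have FsB: "Fs N \<in> BMOA p" for N using FsV VMOA_subset_BMOA by auto
  have bound: "bmoa_integral p (Fs N) b \<le> ennreal (24578 powr p)" if b: "b \<in> unit_disc" for N b
  proof -
    \<comment> \<open>The indices noticeable at b. If m < n were both bad, then |b| >
      \<open>r m\<close>, since otherwise n would still be negligible at b; but beyond
      \<open>r m\<close> the m-th function is negligible.\<close>
    define bad where "bad = {n. \<not> bmoa_integral p (f n) b \<le> ennreal (((1 / 2) ^ Suc n) powr p)}"
    define c where "c n = (if n \<in> bad then 24576 else (1 / 2) ^ Suc n :: real)" for n
    have c: "0 < c n" "bmoa_integral p (f n) b \<le> ennreal (c n powr p)" for n
      using fint[OF b, of n] by (auto simp: c_def bad_def)
    have uniq: "m = n" if "m \<in> bad" "n \<in> bad" for m n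
    proof -
      have False if "m < n" "m \<in> bad" "n \<in> bad" for m n
      proof -
        have "r m < cmod b" using early_int[of m n b] that by (force simp: bad_def not_le)
        then show False using st3[of m b] that b by (auto simp: bad_def)
      qed
      then show ?thesis using that by (metis linorder_neqE_nat)
    qed
    have csum: "(\<Sum>n<N. c n) \<le> 24577"
    proof -
      have "(\<Sum>n<N. c n) \<le> (\<Sum>n<N. (1 / 2) ^ Suc n + (if n \<in> bad then 24576 else 0))"
        by (intro sum_mono) (auto simp: c_def)
      also have "\<dots> = (\<Sum>n<N. (1 / 2) ^ Suc n) + (\<Sum>n\<in>{..<N} \<inter> bad. 24576)"
        by (simp add: sum.distrib sum.inter_restrict[symmetric] del: power_Suc)
      also have "card ({..<N} \<inter> bad) \<le> Suc 0" using uniq by (subst card_le_Suc0_iff_eq) auto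
      then have "(\<Sum>n\<in>{..<N} \<inter> bad. 24576) \<le> (24576::real)" by simp
      finally show ?thesis using half[of N] by simp
    qed
    \<comment> \<open>The partial sums vanish at 0. The extra summand 1 keeps the majorant positive
      at the start of the induction, as Minkowski's inequality requires; it is the last unit in
      24578 = 24576 + 1 + 1.\<close>
    have "ennreal (0 powr p) + bmoa_integral p (Fs N) b \<le> ennreal ((1 + (\<Sum>n<N. c n)) powr p)"
    proof (induction N)
      case 0
      have "bmoa_integral p (Fs 0) b = 0"
        unfolding Fs0 using bmoa_integral_cmult[OF p(1) fhol b, of 0 0] p by simp
      then show ?case by simp
    next
      case (Suc N)
      have "ennreal ((0 + 0) powr p) + bmoa_integral p (\<lambda>z. Fs N z + f N z) b \<le> ennreal (((1 + (\<Sum>n<N. c n)) + c N) powr p)"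
        using c Suc by (intro bmoa_integral_minkowski[OF p(1) BMOA_holomorphic[OF FsB] fhol _ _ b])
          (auto intro!: add_pos_nonneg sum_nonneg less_imp_le[OF c(1)])
      then show ?case by (simp add: FsS add.assoc)
    qed
    also have "\<dots> \<le> ennreal (24578 powr p)"
      using csum p by (intro ennreal_leI powr_mono2) (auto intro!: add_nonneg_nonneg sum_nonneg less_imp_le[OF c(1)])
    finally show ?thesis by simp
  qed
  have Fs_zero: "Fs N 0 = 0" for N
    by (simp add: Fs_def f_def test_fun_def)
  have Fs_norm: "bmoa_norm p (Fs N) \<le> 24578" for N
    using BMOA_I(2)[of p "Fs N" 24578] bound BMOA_analytic[OF FsB] p by (simp add: Fs_zero)
  have ulim: "uniform_limit K Fs F sequentially" if K: "compact K" "K \<subseteq> unit_disc" for K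
  proof -
    obtain R where R: "R < 1" "\<And>z. z \<in> K \<Longrightarrow> cmod z \<le> R"
    proof (cases "K = {}")
      case True then show ?thesis using that[of 0] by auto
    next
      case False
      obtain z where "z \<in> K" "\<And>y. y \<in> K \<Longrightarrow> cmod y \<le> cmod z"
        using continuous_attains_sup[OF K(1) False, of cmod] by (auto intro: continuous_intros)
      then show ?thesis using that[of "cmod z"] K(2) by auto
    qed
    obtain k where k: "(1 / 2) ^ k < 1 - R" using real_arch_pow_inv[of "1 - R" "1 / 2"] R by auto
    have "(1 / 2) ^ Suc k \<le> ((1 / 2) ^ k :: real)" by simp
    then have Rk: "R \<le> r k" using k st1(6)[of k] by linarith
    have "uniform_limit K (\<lambda>n z. \<Sum>i<n. f i z) (\<lambda>z. suminf (\<lambda>i. f i z)) sequentially"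
    proof (rule Weierstrass_m_test_ev)
      show "summable (\<lambda>n. (1 / 2) ^ Suc n :: real)" by (subst summable_Suc_iff) (simp add: summable_geometric)
      have le: "cmod (f n z) \<le> (1 / 2) ^ Suc n" if "k < n" "z \<in> K" for n z
        using early[OF that(1), of z] R(2)[OF that(2)] Rk by auto
      show "\<forall>\<^sub>F n in sequentially. \<forall>z\<in>K. norm (f n z) \<le> (1 / 2) ^ Suc n"
        by (rule eventually_mono[OF eventually_gt_at_top[of k]]) (use le in blast)
    qed
    moreover have "uniform_limit K (\<lambda>n z. \<Sum>i<n. f i z) (\<lambda>z. suminf (\<lambda>i. f i z)) sequentially \<longleftrightarrow> uniform_limit K Fs F sequentially"
      using K(2) by (intro uniform_limit_cong') (auto simp: Fs_def F_def)
    ultimately show ?thesis by simp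
  qed
  have FA: "F \<in> analytic_disc"
    using uniform_limit_deriv(1)[OF BMOA_holomorphic[OF FsB] ulim] by (simp add: analytic_disc_def F_def)
  have FB: "F \<in> BMOA p" by (rule BMOA_limit(1)[OF p(1) FsB Fs_norm FA ulim])
  note Fhol = BMOA_holomorphic[OF FB]
  have lower: "blog (h (Suc n)) / 8 \<le> cmod (F z)" if z: "z \<in> ball (\<zeta> (Suc n)) (h (Suc n))" "cmod z \<le> r (Suc n)" for n z
  proof -
    have zd: "z \<in> unit_disc" using z(2) st1(5)[of "Suc n"] by simp
    have lim: "(\<lambda>N. Fs N z) \<longlonglongrightarrow> F z" using tendsto_uniform_limitI[OF ulim[of "{z}"]] zd by simp
    have "blog (h (Suc n)) / 8 \<le> cmod (Fs N z)" if N: "Suc n < N" for N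
    proof -
      have "Fs N z = (\<Sum>m<Suc (Suc n). f m z) + (\<Sum>m\<in>{Suc (Suc n)..<N}. f m z)"
        unfolding Fs_def lessThan_atLeast0 using N by (intro sum.atLeastLessThan_concat[symmetric]) auto
      also have "(\<Sum>m<Suc (Suc n). f m z) = (\<Sum>m\<le>n. f m z) + f (Suc n) z"
        by (simp add: lessThan_Suc_atMost[symmetric])
      finally have "Fs N z = (\<Sum>m\<le>n. f m z) + f (Suc n) z + (\<Sum>m\<in>{Suc (Suc n)..<N}. f m z)" .
      then have "f (Suc n) z = Fs N z - (\<Sum>m\<le>n. f m z) - (\<Sum>m\<in>{Suc (Suc n)..<N}. f m z)" by simp
      then have "cmod (f (Suc n) z) \<le> cmod (Fs N z) + cmod (\<Sum>m\<le>n. f m z) + cmod (\<Sum>m\<in>{Suc (Suc n)..<N}. f m z)"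
        by (metis norm_triangle_ineq4 add_right_mono order_trans)
      moreover have "cmod (\<Sum>m\<le>n. f m z) \<le> (\<Sum>m\<le>n. blog (h m))" by (intro sum_norm_le fle zd)
      moreover have "cmod (\<Sum>m\<in>{Suc (Suc n)..<N}. f m z) \<le> (\<Sum>m\<in>{Suc (Suc n)..<N}. (1 / 2) ^ Suc m)"
        using z(2) by (intro sum_norm_le early[of "Suc n"]) auto
      moreover have "(\<Sum>m\<in>{Suc (Suc n)..<N}. (1 / 2) ^ Suc m) \<le> (\<Sum>m<N. (1 / 2) ^ Suc m :: real)"
        by (intro sum_mono2) auto
      moreover have "blog (h (Suc n)) / 4 \<le> cmod (f (Suc n) z)"
        unfolding f_def using z(1) zd st1(3)[of "Suc n"] by (intro test_fun_ge[OF tf]) auto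
      ultimately have "blog (h (Suc n)) / 4 \<le> cmod (Fs N z) + S n + 1" using Ssum[of n] half[of N] by linarith
      moreover have "0 \<le> S n + 1" "16 * (S n + 1) \<le> blog (h (Suc n))"
        using step1(3)[of n] st1(7)[of n] blog_ge_2(1)[OF tf, of n] by auto
      ultimately show ?thesis by argo
    qed
    then show ?thesis
      using tendsto_norm[OF lim] by (intro LIMSEQ_le_const[of "\<lambda>N. cmod (Fs N z)"]) (auto intro!: exI[of _ "Suc (Suc n)"])
  qed
  define a where "a n = of_real (1 - h (Suc n)) * \<zeta> (Suc n)" for n
  have na: "cmod (a n) = 1 - h (Suc n)" for n
    using st1(1)[of "Suc n"] st1(3)[of "Suc n"] by (simp add: a_def norm_mult del: of_real_diff)
  have aD: "a n \<in> unit_disc" for n using na st1(2)[of "Suc n"] by simp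
  have "(\<lambda>n. h (Suc n)) \<longlonglongrightarrow> 0"
  proof (rule tendsto_sandwich[OF _ _ tendsto_const])
    show "(\<lambda>n. (1 / 2) ^ Suc (Suc n) :: real) \<longlonglongrightarrow> 0"
      by (intro LIMSEQ_Suc LIMSEQ_realpow_zero) auto
  qed (use st1(2,4) in \<open>auto intro!: always_eventually less_imp_le simp del: power_Suc\<close>)
  then have "(\<lambda>n. 1 - h (Suc n)) \<longlonglongrightarrow> 1 - 0" by (intro tendsto_intros)
  then have lim_a: "(\<lambda>n. cmod (a n)) \<longlonglongrightarrow> 1" by (simp add: na)
  \<comment> \<open>From |F| \<ge> \<open>blog H / 8\<close> on a set of mass more than e * H *
    \<open>blog H powr (- p)\<close> the logarithms cancel, leaving e * H / \<open>8 powr p\<close>;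
    the comparison of box and kernel divides by 4*H.\<close>
  define e' where "e' = e / (4 * 8 powr p)"
  have e': "0 < e'" using e by (simp add: e'_def)
  have low: "ennreal e' \<le> bmoa_integral p (T F) (a n)" for n
  proof -
    define H where "H = h (Suc n)"
    define A where "A = ball (\<zeta> (Suc n)) H \<inter> cball 0 (r (Suc n))"
    have H: "0 < H" "H \<le> 1" "1 \<le> blog H"
      using st1(2,3)[of "Suc n"] blog_ge_2(1)[OF tf, of "Suc n"] by (auto simp: H_def)
    have AD: "A \<subseteq> unit_disc" "A \<in> sets borel" using st1(5)[of "Suc n"] by (auto simp: A_def)
    have "ennreal (e' * (4 * H)) = ennreal ((blog H / 8) powr p) * (ennreal e * ennreal (H * blog H powr (- p)))"
    proof -
      have "e' * (4 * H) = (blog H / 8) powr p * (e * (H * blog H powr (- p)))"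
        using H by (simp add: e'_def powr_divide powr_minus field_simps)
      moreover have "ennreal ((blog H / 8) powr p) * (ennreal e * ennreal (H * blog H powr (- p)))
          = ennreal ((blog H / 8) powr p * (e * (H * blog H powr (- p))))"
        using e H by (intro ennreal_mult3) auto
      ultimately show ?thesis by (simp only:)
    qed
    also have "\<dots> \<le> ennreal ((blog H / 8) powr p) * emeasure (gmeasure p g) A"
      using less_imp_le[OF st2[of "Suc n"]] by (intro mult_left_mono) (auto simp: A_def H_def)
    also have "\<dots> = (\<integral>\<^sup>+ z \<in> A. ennreal ((blog H / 8) powr p) \<partial>gmeasure p g)"
      using AD by (subst nn_integral_cmult_indicator) auto
    also have "\<dots> \<le> (\<integral>\<^sup>+ z \<in> A \<inter> unit_disc. ennreal (cmod (F z) powr p) \<partial>gmeasure p g)"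
      using lower[of _ n] AD H p
      by (intro nn_integral_mono) (auto simp: A_def H_def intro!: ennreal_leI powr_mono2 split: split_indicator)
    also have "\<dots> = emeasure (gmeasure p (T F)) A"
      by (rule emeasure_gmeasure_integral_operator[OF Fhol g p(1) AD(2), symmetric])
    also have "\<dots> \<le> emeasure (gmeasure p (T F)) (ball (\<zeta> (Suc n)) H \<inter> unit_disc)"
      using AD by (intro emeasure_mono) (auto simp: A_def)
    also have "\<dots> \<le> ennreal (4 * H) * bmoa_integral p (T F) (a n)"
      unfolding bmoa_integral_gmeasure[OF T_holomorphic[OF Fhol] p(1) aD]
      using H by (intro box_le_poisson_integral[where \<zeta> = "\<zeta> (Suc n)"] st1(1)) (auto simp: a_def H_def)
    finally have "ennreal (1 / (4 * H)) * ennreal (e' * (4 * H)) \<le> ennreal (1 / (4 * H)) * (ennreal (4 * H) * bmoa_integral p (T F) (a n))"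
      by (intro mult_left_mono) auto
    also have "ennreal (1 / (4 * H)) * (ennreal (4 * H) * bmoa_integral p (T F) (a n)) = bmoa_integral p (T F) (a n)"
      using H by (simp add: mult.assoc[symmetric] flip: ennreal_mult)
    also have "ennreal (1 / (4 * H)) * ennreal (e' * (4 * H)) = ennreal e'"
      using H e' by (simp flip: ennreal_mult)
    finally show ?thesis .
  qed
  show ?thesis
  proof (rule that[of F 24578 e' Fs a, OF FB _ e' FsV Fs_norm _ ulim aD lim_a low])
    fix N
    have "cmod (Fs N z) \<le> (\<Sum>n<N. blog (h n))" if "z \<in> unit_disc" for z
      unfolding Fs_def by (intro sum_norm_le fle that)
    then show "\<exists>B. \<forall>z\<in>unit_disc. cmod (Fs N z) \<le> B" by blast
  qed simp
qed

end

subsection \<open>Weak cluster points\<close>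

text \<open>The closed tails of the sequence have the finite intersection property. No convergent
  subsequence is claimed, since the topology need not be metrizable. The conclusion, that closed
  conditions on continuous complex functions persist, fits both the weak topology and the product
  topology.\<close>

lemma compactin_cluster_point:
  fixes s :: "nat \<Rightarrow> 'a"
  assumes K: "compactin X K" and s: "\<And>n. s n \<in> K"
  shows "\<exists>y\<in>K. \<forall>(\<phi> :: 'a \<Rightarrow> complex) C m.
    continuous_map X euclidean \<phi> \<longrightarrow> closed C \<longrightarrow> (\<forall>n\<ge>m. \<phi> (s n) \<in> C) \<longrightarrow> \<phi> y \<in> C"
proof -
  have KX: "K \<subseteq> topspace X" using K by (rule compactin_subset_topspace)
  define Tl where "Tl m = X closure_of (s ` {m..})" for m
  have tail: "s n \<in> Tl m" if "m \<le> n" for m n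
    using closure_of_subset[of "s ` {m..}" X] that s KX by (auto simp: Tl_def)
  have "K \<inter> \<Inter>(range Tl) \<noteq> {}"
  proof -
    have "\<forall>C\<in>range Tl. closedin X C" by (auto simp: Tl_def)
    moreover have "K \<inter> \<Inter>\<F> \<noteq> {}" if \<F>: "finite \<F>" "\<F> \<subseteq> range Tl" for \<F>
    proof -
      obtain M where M: "finite M" "\<F> = Tl ` M" using finite_subset_image[OF \<F>] by auto
      have "s (Max (insert 0 M)) \<in> Tl m" if m: "m \<in> M" for m using M(1) m by (intro tail Max_ge) auto
      then show ?thesis using s[of "Max (insert 0 M)"] M(2) by blast
    qed
    ultimately show ?thesis using K[unfolded compactin_fip] by blast
  qed
  then obtain y where y: "y \<in> K" "\<And>m. y \<in> Tl m" by blast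
  show ?thesis
  proof (intro bexI[OF _ y(1)] allI impI)
    fix \<phi> :: "'a \<Rightarrow> complex" and C m
    assume \<phi>: "continuous_map X euclidean \<phi>" and C: "closed C" and le: "\<forall>n\<ge>m. \<phi> (s n) \<in> C"
    have "closedin X {x \<in> topspace X. \<phi> x \<in> C}"
      using \<phi> C by (intro closedin_continuous_map_preimage[OF \<phi>]) auto
    moreover have "s ` {m..} \<subseteq> {x \<in> topspace X. \<phi> x \<in> C}" using le s KX by auto
    ultimately have "Tl m \<subseteq> {x \<in> topspace X. \<phi> x \<in> C}" unfolding Tl_def by (intro closure_of_minimal)
    then show "\<phi> y \<in> C" using y(2)[of m] by auto
  qed
qed

lemma topspace_weak_topology [simp]: "topspace (weak_topology V N) = V"
proof -
  have "(\<lambda>_. 0) \<in> dual_space V N" by (auto simp: dual_space_def intro: exI[of _ 0])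
  then have "\<exists>\<Lambda> U. V = {f \<in> V. \<Lambda> f \<in> U} \<and> \<Lambda> \<in> dual_space V N \<and> open U"
    by (intro exI[of _ "\<lambda>_. 0"] exI[of _ UNIV]) auto
  then show ?thesis unfolding weak_topology_def topology_generated_by_topspace by blast
qed

lemma continuous_map_weak_topology:
  assumes "\<Lambda> \<in> dual_space V N"
  shows "continuous_map (weak_topology V N) euclidean \<Lambda>"
  unfolding continuous_map_def
proof (intro conjI allI impI)
  fix U :: "complex set" assume "openin euclidean U"
  then show "openin (weak_topology V N) {x \<in> topspace (weak_topology V N). \<Lambda> x \<in> U}"
    unfolding topspace_weak_topology unfolding weak_topology_def
    using assms by (intro topology_generated_by_Basis) auto
qed auto

lemma weak_cluster_point:
  assumes cpt: "compactin (weak_topology V N) (weak_topology V N closure_of S)" and S: "S \<subseteq> V" and s: "\<And>n. s n \<in> S"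
  obtains H where "H \<in> V" "\<And>\<Lambda> L. \<Lambda> \<in> dual_space V N \<Longrightarrow> (\<lambda>n. \<Lambda> (s n)) \<longlonglongrightarrow> L \<Longrightarrow> \<Lambda> H = L"
proof -
  have mem: "s n \<in> weak_topology V N closure_of S" for n
    using closure_of_subset[of S "weak_topology V N"] S s by auto
  obtain H where "H \<in> weak_topology V N closure_of S"
    and "\<forall>(\<phi> :: (complex \<Rightarrow> complex) \<Rightarrow> complex) C m. continuous_map (weak_topology V N) euclidean \<phi> \<longrightarrow> closed C \<longrightarrow>
      (\<forall>n\<ge>m. \<phi> (s n) \<in> C) \<longrightarrow> \<phi> H \<in> C"
    using compactin_cluster_point[where s = s, OF cpt mem] by (rule bexE)
  then have H: "H \<in> weak_topology V N closure_of S"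
    "\<And>(\<phi> :: (complex \<Rightarrow> complex) \<Rightarrow> complex) C m. continuous_map (weak_topology V N) euclidean \<phi> \<Longrightarrow> closed C \<Longrightarrow>
      (\<And>n. m \<le> n \<Longrightarrow> \<phi> (s n) \<in> C) \<Longrightarrow> \<phi> H \<in> C"
    by blast+
  show ?thesis
  proof (rule that[of H])
    show "H \<in> V" using H(1) closure_of_subset_topspace[of "weak_topology V N" S] by auto
    fix \<Lambda> L assume \<Lambda>: "\<Lambda> \<in> dual_space V N" and lim: "(\<lambda>n. \<Lambda> (s n)) \<longlonglongrightarrow> L"
    have "dist (\<Lambda> H) L \<le> e" if "0 < e" for e
    proof -
      obtain m where "\<And>n. m \<le> n \<Longrightarrow> dist (\<Lambda> (s n)) L < e"
        using lim \<open>0 < e\<close> unfolding lim_sequentially by blast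
      then have "\<Lambda> H \<in> cball L e"
        by (intro H(2)[OF continuous_map_weak_topology[OF \<Lambda>], of _ m]) (auto simp: dist_commute intro: less_imp_le)
      then show ?thesis by (simp add: dist_commute)
    qed
    then have "dist (\<Lambda> H) L \<le> 0 + e" if "0 < e" for e using that by simp
    then have "dist (\<Lambda> H) L \<le> 0" by (rule field_le_epsilon)
    then show "\<Lambda> H = L" by simp
  qed
qed

text \<open>The identity is continuous from the norm to the weak topology, so K is weakly compact.
  The separating functionals make the weak topology Hausdorff, hence K is weakly closed and contains
  the weak closure of S.\<close>

lemma norm_compact_imp_weak_compact:
  assumes ms: "Metric_space V (\<lambda>f h. N (\<lambda>z. f z - h z))"
    and diff: "\<And>f h. f \<in> V \<Longrightarrow> h \<in> V \<Longrightarrow> (\<lambda>z. f z - h z) \<in> V"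
    and sep: "\<And>f h. f \<in> V \<Longrightarrow> h \<in> V \<Longrightarrow> f \<noteq> h \<Longrightarrow> \<exists>\<Lambda>\<in>dual_space V N. \<Lambda> f \<noteq> \<Lambda> h"
    and K: "compactin (norm_topology V N) K" and S: "S \<subseteq> K"
  shows "compactin (weak_topology V N) (weak_topology V N closure_of S)"
proof -
  interpret Metric_space V "\<lambda>f h. N (\<lambda>z. f z - h z)" by (rule ms)
  have "continuous_map mtopology (weak_topology V N) id"
    unfolding weak_topology_def
  proof (rule continuous_on_generated_topo)
    show "id ` topspace mtopology \<subseteq> \<Union> {{f \<in> V. \<Lambda> f \<in> U} |\<Lambda> U. \<Lambda> \<in> dual_space V N \<and> open U}"
      using topspace_weak_topology[of V N] by (simp add: weak_topology_def)
    fix W assume "W \<in> {{f \<in> V. \<Lambda> f \<in> U} |\<Lambda> U. \<Lambda> \<in> dual_space V N \<and> open U}"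
    then obtain \<Lambda> U where W: "W = {f \<in> V. \<Lambda> f \<in> U}" "\<Lambda> \<in> dual_space V N" "open U" by blast
    obtain C where C: "\<And>f. f \<in> V \<Longrightarrow> cmod (\<Lambda> f) \<le> C * N f" using W(2) unfolding dual_space_def by blast
    have add: "\<Lambda> (\<lambda>z. f z + h z) = \<Lambda> f + \<Lambda> h" if "f \<in> V" "h \<in> V" for f h using W(2) that by (auto simp: dual_space_def)
    have "openin mtopology W"
      unfolding openin_mtopology
    proof (intro conjI allI impI)
      show "W \<subseteq> V" using W by auto
      fix f assume f: "f \<in> W"
      then have "\<Lambda> f \<in> U" "f \<in> V" using W by auto
      then obtain r where r: "0 < r" "ball (\<Lambda> f) r \<subseteq> U" using W(3) open_contains_ball by blast
      show "\<exists>r>0. mball f r \<subseteq> W"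
      proof (intro exI[of _ "r / (\<bar>C\<bar> + 1)"] conjI subsetI)
        show "0 < r / (\<bar>C\<bar> + 1)" using r by simp
        fix h assume h: "h \<in> mball f (r / (\<bar>C\<bar> + 1))"
        then have hV: "h \<in> V" and d: "N (\<lambda>z. f z - h z) < r / (\<bar>C\<bar> + 1)" by auto
        define k where "k z = h z - f z" for z
        have k: "k \<in> V" unfolding k_def[abs_def] using diff hV \<open>f \<in> V\<close> by blast
        have Nk: "N k = N (\<lambda>z. f z - h z)" using commute[of f h] by (simp add: k_def[abs_def])
        then have Nk0: "0 \<le> N k" using nonneg[of f h] by simp
        have "\<Lambda> h = \<Lambda> f + \<Lambda> k" using add[OF \<open>f \<in> V\<close> k] by (simp add: k_def)
        then have "cmod (\<Lambda> f - \<Lambda> h) = cmod (\<Lambda> k)" by simp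
        also have "\<dots> \<le> C * N k" by (rule C[OF k])
        also have "\<dots> \<le> (\<bar>C\<bar> + 1) * N k" using Nk0 by (intro mult_right_mono) auto
        also have "\<dots> < r" using d unfolding Nk[symmetric] by (simp add: pos_less_divide_eq mult.commute)
        finally have "\<Lambda> h \<in> ball (\<Lambda> f) r" by (simp add: dist_norm)
        then show "h \<in> W" using r(2) hV W(1) by auto
      qed
    qed
    then show "openin mtopology (id -` W \<inter> topspace mtopology)"
      using W(1) by (auto simp: Int_absorb2 Collect_restrict)
  qed
  then have "compactin (weak_topology V N) (id ` K)"
    using K unfolding norm_topology_def by (rule image_compactin[rotated])
  then have Kw: "compactin (weak_topology V N) K" by simp
  have "Hausdorff_space (weak_topology V N)"
    unfolding Hausdorff_space_def topspace_weak_topology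
  proof (intro allI impI)
    fix f h assume fh: "f \<in> V \<and> h \<in> V \<and> f \<noteq> h"
    then obtain \<Lambda> where \<Lambda>: "\<Lambda> \<in> dual_space V N" "\<Lambda> f \<noteq> \<Lambda> h" using sep by blast
    obtain A B where AB: "open A" "open B" "\<Lambda> f \<in> A" "\<Lambda> h \<in> B" "A \<inter> B = {}" using hausdorff[OF \<Lambda>(2)] by blast
    have op: "openin (weak_topology V N) {x \<in> V. \<Lambda> x \<in> U}" if "open U" for U
      unfolding weak_topology_def using \<Lambda>(1) that by (intro topology_generated_by_Basis) auto
    show "\<exists>U W. openin (weak_topology V N) U \<and> openin (weak_topology V N) W \<and> f \<in> U \<and> h \<in> W \<and> disjnt U W"
      using op[OF AB(1)] op[OF AB(2)] AB fh
      by (intro exI[of _ "{x \<in> V. \<Lambda> x \<in> A}"] exI[of _ "{x \<in> V. \<Lambda> x \<in> B}"]) (auto simp: disjnt_def)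
  qed
  then have "closedin (weak_topology V N) K" using Kw by (rule compactin_imp_closedin)
  then show ?thesis
    using closed_compactin[OF Kw closure_of_minimal[OF S]] by simp
qed

lemma evaluation_in_dual:
  assumes p: "1 < p" "p \<le> 2" and V: "V \<subseteq> BMOA p" and z: "z \<in> unit_disc"
  shows "(\<lambda>f. f z) \<in> dual_space V (bmoa_norm p)"
  unfolding dual_space_def
proof (intro CollectI conjI exI[of _ "57 * blog (1 - cmod z)"] ballI)
  fix f assume "f \<in> V"
  then show "cmod (f z) \<le> 57 * blog (1 - cmod z) * bmoa_norm p f"
    using growth_bound[OF p, of f z] V z by (auto simp: mult_ac)
qed auto

text \<open>
  The functional is a cluster point of the pairings of \<open>u'\<close> with \<open>cnj H' * |H'|^(p - 2)\<close> under the weights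
  at \<open>a n\<close>; Tychonoff's theorem takes the place of the Hahn-Banach theorem.
\<close>

lemma separating_functional:
  assumes p: "1 < p" "p \<le> 2" and H: "H \<in> BMOA p" and a: "\<And>n. a n \<in> unit_disc" "(\<lambda>n. cmod (a n)) \<longlonglongrightarrow> 1"
    and e: "0 < e" "\<And>n. ennreal e \<le> bmoa_integral p H (a n)"
  obtains \<Lambda> where "\<Lambda> \<in> dual_space (BMOA p) (bmoa_norm p)" "\<And>u. u \<in> VMOA p \<Longrightarrow> \<Lambda> u = 0" "\<Lambda> H \<noteq> 0"
proof -
  define G where "G u z = indicator unit_disc z *\<^sub>R deriv u z" for u z
  have Gmeas: "G u \<in> borel_measurable borel" if "u \<in> BMOA p" for u
    unfolding G_def[abs_def] using BMOA_holomorphic[OF that]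
    by (intro borel_measurable_continuous_on_indicator holomorphic_on_imp_continuous_on holomorphic_deriv) auto
  note [measurable] = Gmeas[OF H]
  define w where "w n z = indicator unit_disc z *\<^sub>R ((1 - (cmod z)\<^sup>2) powr (p - 1) * poisson (a n) z)" for n z
  have w0: "0 \<le> w n z" for n z using poisson_nonneg[of "a n" z] a(1)[of n] by (simp add: w_def)
  have wmeas [measurable]: "w n \<in> borel_measurable borel" for n
    unfolding w_def[abs_def] using a(1)[of n] p
    by (intro borel_measurable_continuous_on_indicator continuous_intros continuous_on_powr' continuous_on_poisson) (auto simp: abs_square_le_1)
  \<comment> \<open>The duality element of H' in L^p: its modulus is |H'|^(p-1), and its product
    with H' is |H'|^p. At zeros of H' it is 0.\<close>
  define q where "q z = cnj (G H z) * of_real (cmod (G H z) powr (p - 2))" for z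
  have qmeas [measurable]: "q \<in> borel_measurable borel"
  proof -
    have [measurable]: "cnj \<in> borel_measurable borel" by (intro borel_measurable_continuous_onI continuous_intros)
    show ?thesis unfolding q_def[abs_def] by measurable
  qed
  have nq: "cmod (q z) = cmod (G H z) powr (p - 1)" for z
    using powr_add[of "cmod (G H z)" 1 "p - 2"] by (cases "G H z = 0") (auto simp: q_def norm_mult)
  have Gq: "G H z * q z = of_real (cmod (G H z) powr p)" for z
  proof (cases "G H z = 0")
    case False
    have "G H z * q z = of_real ((cmod (G H z))\<^sup>2) * of_real (cmod (G H z) powr (p - 2))"
      unfolding q_def complex_norm_square by (simp add: mult_ac)
    also have "\<dots> = of_real (cmod (G H z) powr 2 * cmod (G H z) powr (p - 2))" by simp
    also have "cmod (G H z) powr 2 * cmod (G H z) powr (p - 2) = cmod (G H z) powr p" by (simp only: powr_add[symmetric]) simp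
    finally show ?thesis .
  qed simp
  define \<phi> where "\<phi> n u z = G u z * q z * of_real (w n z)" for n u z
  define D where "D n u z = cmod (G u z) powr p * w n z" for n u z
  define J where "J n u = enn2real (bmoa_integral p u (a n))" for n u
  have D_eq: "ennreal (D n u z) = ennreal (bmoa_density p u z * poisson (a n) z) * indicator unit_disc z" for n u z
    by (cases "z \<in> unit_disc") (auto simp: D_def G_def w_def bmoa_density_def mult.assoc)
  have D0: "0 \<le> D n u z" for n u z using w0 by (simp add: D_def)
  have Dint: "integrable disc_area (D n u)" "integral\<^sup>L disc_area (D n u) = J n u" "ennreal (J n u) = bmoa_integral p u (a n)"
    if u: "u \<in> BMOA p" for n u
  proof -
    note [measurable] = Gmeas[OF u]
    have m: "D n u \<in> borel_measurable disc_area" unfolding D_def[abs_def] by measurable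
    have nn: "(\<integral>\<^sup>+ z. ennreal (D n u z) \<partial>disc_area) = bmoa_integral p u (a n)"
      by (simp add: D_eq bmoa_integral_eq[OF a(1)])
    have fin: "bmoa_integral p u (a n) < \<infinity>"
      using bmoa_integral_le_norm'[of p u "a n"] p u a by (auto intro: le_less_trans)
    show "integrable disc_area (D n u)" using m D0 nn fin by (intro integrableI_nonneg) auto
    show "integral\<^sup>L disc_area (D n u) = J n u" using m D0 nn by (subst integral_eq_nn_integral) (auto simp: J_def)
    show "ennreal (J n u) = bmoa_integral p u (a n)" using fin by (simp add: J_def)
  qed
  have J_le: "0 \<le> J n u" "J n u \<le> bmoa_norm p u powr p" if "u \<in> BMOA p" for n u
  proof -
    show "0 \<le> J n u" by (simp add: J_def)
    have "ennreal (J n u) \<le> ennreal (bmoa_norm p u powr p)"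
      using Dint(3)[OF that, of n] bmoa_integral_le_norm'[of p u "a n"] p that a by simp
    then show "J n u \<le> bmoa_norm p u powr p" by simp
  qed
  \<comment> \<open>Young's inequality with a free scale s, in place of Hoelder's. After integration
    s = 1/N gives the uniform bound B, and a large s gives decay on \<open>VMOA p\<close>.\<close>
  have pw: "p * s * cmod (\<phi> n u z) \<le> s powr p * D n u z + (p - 1) * D n H z" if "0 \<le> s" for n u z s
  proof -
    have "p * (s * cmod (G u z)) * cmod (G H z) powr (p - 1) \<le> (s * cmod (G u z)) powr p + (p - 1) * cmod (G H z) powr p"
      using that p by (intro young_powr) auto
    then have "p * (s * cmod (G u z)) * cmod (G H z) powr (p - 1) * w n z \<le> ((s * cmod (G u z)) powr p + (p - 1) * cmod (G H z) powr p) * w n z"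
      using w0 by (rule mult_right_mono)
    then show ?thesis using that w0[of n z] by (simp add: \<phi>_def D_def norm_mult nq powr_mult algebra_simps)
  qed
  have \<phi>int: "integrable disc_area (\<phi> n u)" if u: "u \<in> BMOA p" for n u
  proof (rule Bochner_Integration.integrable_bound)
    note [measurable] = Gmeas[OF u]
    show "\<phi> n u \<in> borel_measurable disc_area" unfolding \<phi>_def[abs_def] by measurable
    show "integrable disc_area (\<lambda>z. D n u z + (p - 1) * D n H z)" using Dint(1)[OF u, of n] Dint(1)[OF H, of n] by simp
    have "cmod (\<phi> n u z) \<le> D n u z + (p - 1) * D n H z" for z
    proof -
      have "1 * cmod (\<phi> n u z) \<le> p * cmod (\<phi> n u z)" using p by (intro mult_right_mono) auto
      then show ?thesis using pw[of 1 n u z] by simp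
    qed
    then show "AE z in disc_area. norm (\<phi> n u z) \<le> norm (D n u z + (p - 1) * D n H z)"
      using D0 p by (auto intro!: AE_I2 order_trans[OF _ abs_ge_self])
  qed
  define L where "L n u = integral\<^sup>L disc_area (\<phi> n u)" for n u
  have Lle: "p * s * cmod (L n u) \<le> s powr p * J n u + (p - 1) * J n H" if u: "u \<in> BMOA p" and s: "0 \<le> s" for n u s
  proof -
    have "p * s * cmod (L n u) \<le> p * s * integral\<^sup>L disc_area (\<lambda>z. cmod (\<phi> n u z))"
      unfolding L_def using s p by (intro mult_left_mono integral_norm_bound) auto
    also have "\<dots> = integral\<^sup>L disc_area (\<lambda>z. p * s * cmod (\<phi> n u z))" by simp
    also have "\<dots> \<le> integral\<^sup>L disc_area (\<lambda>z. s powr p * D n u z + (p - 1) * D n H z)"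
      using \<phi>int[OF u, of n] Dint(1)[OF u, of n] Dint(1)[OF H, of n] pw[OF s] by (intro integral_mono) auto
    also have "\<dots> = s powr p * J n u + (p - 1) * J n H"
      using Dint[OF u, of n] Dint[OF H, of n] by simp
    finally show ?thesis .
  qed
  define B where "B = (1 + (p - 1) * bmoa_norm p H powr p) / p"
  have Lbound: "cmod (L n u) \<le> B * bmoa_norm p u" if u: "u \<in> BMOA p" for n u
  proof (cases "bmoa_norm p u = 0")
    case True
    have "u z = 0" for z
    proof (cases "z \<in> unit_disc")
      case zd: True
      then show ?thesis using growth_bound[OF p u, of z] True by simp
    qed (use BMOA_analytic[OF u] in \<open>auto simp: analytic_disc_def\<close>)
    then have "u = (\<lambda>z. 0)" by auto
    then have "\<phi> n u = (\<lambda>z. 0)" by (simp add: \<phi>_def[abs_def] G_def)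
    then show ?thesis by (simp add: L_def True)
  next
    case False
    define N where "N = bmoa_norm p u"
    have N: "0 < N" using False by (simp add: N_def less_le)
    have "p * (1 / N) * cmod (L n u) \<le> (1 / N) powr p * J n u + (p - 1) * J n H" using N by (intro Lle[OF u]) auto
    also have "\<dots> \<le> (1 / N) powr p * N powr p + (p - 1) * bmoa_norm p H powr p"
      using J_le[OF u, of n] J_le[OF H, of n] p by (intro add_mono mult_left_mono) (auto simp: N_def)
    also have "(1 / N) powr p * N powr p = 1" using N by (simp add: powr_divide)
    finally show ?thesis using N p by (simp add: B_def N_def[symmetric] field_simps)
  qed
  have Ladd: "L n (\<lambda>z. u z + v z) = L n u + L n v" if u: "u \<in> BMOA p" and v: "v \<in> BMOA p" for n u v
  proof -
    have "\<phi> n (\<lambda>z. u z + v z) = (\<lambda>z. \<phi> n u z + \<phi> n v z)"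
    proof
      fix z show "\<phi> n (\<lambda>z. u z + v z) z = \<phi> n u z + \<phi> n v z"
        using deriv_add_disc[OF BMOA_holomorphic[OF u] BMOA_holomorphic[OF v], of z]
        by (cases "z \<in> unit_disc") (auto simp: \<phi>_def G_def algebra_simps)
    qed
    then show ?thesis unfolding L_def using \<phi>int[OF u, of n] \<phi>int[OF v, of n] by simp
  qed
  have Lmult: "L n (\<lambda>z. c * u z) = c * L n u" if u: "u \<in> BMOA p" for n u c
  proof -
    have "\<phi> n (\<lambda>z. c * u z) = (\<lambda>z. c * \<phi> n u z)"
    proof
      fix z show "\<phi> n (\<lambda>z. c * u z) z = c * \<phi> n u z"
        using deriv_cmult_disc[OF BMOA_holomorphic[OF u], of z c]
        by (cases "z \<in> unit_disc") (auto simp: \<phi>_def G_def algebra_simps)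
    qed
    then show ?thesis unfolding L_def by simp
  qed
  have LH: "L n H \<in> {x. e \<le> Re x}" for n
  proof -
    have "\<phi> n H = (\<lambda>z. of_real (D n H z))" by (auto simp: \<phi>_def D_def Gq)
    then have "L n H = of_real (J n H)" using Dint(2)[OF H, of n] by (simp add: L_def)
    moreover have "e \<le> J n H"
      using e(2)[of n] Dint(3)[OF H, of n] J_le(1)[OF H, of n] by (metis ennreal_le_iff)
    ultimately show ?thesis by simp
  qed
  \<comment> \<open>\<open>J n u\<close> tends to 0 while \<open>J n H\<close> stays below M. The
    scale s = 2*M/d is fixed first, and n is then taken so large that \<open>J n u\<close> is at
    most M / \<open>s powr p\<close>.\<close>
  have LV: "\<exists>m. \<forall>n\<ge>m. L n u \<in> cball 0 d" if u: "u \<in> VMOA p" and d: "0 < d" for u d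
  proof -
    have uB: "u \<in> BMOA p" using u VMOA_subset_BMOA by auto
    define M where "M = bmoa_norm p H powr p + 1"
    have M: "0 < M" by (simp add: M_def add_nonneg_pos)
    define s where "s = 2 * M / d"
    have s: "0 < s" using M d by (simp add: s_def)
    define t where "t = M / s powr p"
    have t: "0 < t" using M s by (simp add: t_def)
    obtain r where r: "r < 1" "\<And>b. r < cmod b \<Longrightarrow> cmod b < 1 \<Longrightarrow> bmoa_integral p u b < ennreal t"
      using VMOA_D[OF u, of "ennreal t"] t by auto
    have "eventually (\<lambda>n. r < cmod (a n)) sequentially" using a(2) r(1) by (rule order_tendstoD)
    then obtain m where m: "\<And>n. m \<le> n \<Longrightarrow> r < cmod (a n)" by (auto simp: eventually_sequentially)
    have "cmod (L n u) \<le> d" if "m \<le> n" for n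
    proof -
      have "bmoa_integral p u (a n) < ennreal t" using r(2) m[OF that] a(1)[of n] by auto
      then have "J n u \<le> t" using Dint(3)[OF uB, of n] t by (metis ennreal_le_iff less_imp_le)
      have "p * s * cmod (L n u) \<le> s powr p * J n u + (p - 1) * J n H" using s by (intro Lle[OF uB]) auto
      also have "\<dots> \<le> s powr p * t + (p - 1) * M"
        using \<open>J n u \<le> t\<close> J_le[OF H, of n] p by (intro add_mono mult_left_mono) (auto simp: M_def)
      also have "s powr p * t = M" using s by (simp add: t_def)
      finally have "p * s * cmod (L n u) \<le> p * M" by (simp add: algebra_simps)
      then have "s * cmod (L n u) \<le> M" using p by (simp add: mult.assoc)
      then have "2 * M / d * cmod (L n u) \<le> M" by (simp add: s_def)
      then show ?thesis using M d by (simp add: field_simps)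
    qed
    then show ?thesis by (intro exI[of _ m]) auto
  qed
  define X where "X = product_topology (\<lambda>_. euclidean :: complex topology) (BMOA p)"
  define K where "K = PiE (BMOA p) (\<lambda>u. cball 0 (B * bmoa_norm p u) :: complex set)"
  have cK: "compactin X K" unfolding X_def K_def compactin_PiE by auto
  define s where "s n = restrict (L n) (BMOA p)" for n
  have sK: "s n \<in> K" for n using Lbound by (auto simp: s_def K_def)
  obtain \<Lambda> where "\<Lambda> \<in> K"
    and "\<forall>(\<psi> :: ((complex \<Rightarrow> complex) \<Rightarrow> complex) \<Rightarrow> complex) C m. continuous_map X euclidean \<psi> \<longrightarrow> closed C \<longrightarrow>
      (\<forall>n\<ge>m. \<psi> (s n) \<in> C) \<longrightarrow> \<psi> \<Lambda> \<in> C"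
    using compactin_cluster_point[where s = s, OF cK sK] by (rule bexE)
  then have \<Lambda>: "\<Lambda> \<in> K"
    "\<And>(\<psi> :: ((complex \<Rightarrow> complex) \<Rightarrow> complex) \<Rightarrow> complex) C m. continuous_map X euclidean \<psi> \<Longrightarrow> closed C \<Longrightarrow>
      (\<And>n. m \<le> n \<Longrightarrow> \<psi> (s n) \<in> C) \<Longrightarrow> \<psi> \<Lambda> \<in> C"
    by blast+
  have proj: "continuous_map X euclidean (\<lambda>F. F u)" if "u \<in> BMOA p" for u
    unfolding X_def by (rule continuous_map_product_projection[OF that])
  have projm: "continuous_map X euclidean (\<lambda>F. c * F u)" if "u \<in> BMOA p" for u c
  proof -
    have "continuous_map euclidean euclidean (\<lambda>x::complex. c * x)"
      by (simp add: continuous_on_mult_left continuous_on_id)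
    from continuous_map_compose[OF proj[OF that] this] show ?thesis by (simp add: o_def)
  qed
  show ?thesis
  proof (rule that[of \<Lambda>])
    show "\<Lambda> \<in> dual_space (BMOA p) (bmoa_norm p)"
      unfolding dual_space_def
    proof (intro CollectI conjI ballI allI)
      fix u v assume uv: "u \<in> BMOA p" "v \<in> BMOA p"
      note sum = BMOA_add(1)[OF p(1) uv]
      \<comment> \<open>Linearity holds for every \<open>L n\<close> and is a closed condition on
        finitely many coordinates, so it persists at the cluster point.\<close>
      have "\<Lambda> (\<lambda>z. u z + v z) - \<Lambda> u - \<Lambda> v \<in> {0}"
        by (rule \<Lambda>(2)[where m = 0]) (use uv sum Ladd[OF uv] in \<open>auto simp: s_def intro!: continuous_map_diff proj\<close>)
      then show "\<Lambda> (\<lambda>z. u z + v z) = \<Lambda> u + \<Lambda> v" by (simp add: algebra_simps)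
    next
      fix c u assume u: "u \<in> BMOA p"
      note cu = BMOA_cmult_le(1)[OF p(1) u, of c]
      have "\<Lambda> (\<lambda>z. c * u z) - c * \<Lambda> u \<in> {0}"
        by (rule \<Lambda>(2)[where m = 0]) (use u cu Lmult[OF u] in \<open>auto simp: s_def intro!: continuous_map_diff proj projm\<close>)
      then show "\<Lambda> (\<lambda>z. c * u z) = c * \<Lambda> u" by simp
    next
      show "\<exists>C. \<forall>u\<in>BMOA p. cmod (\<Lambda> u) \<le> C * bmoa_norm p u"
        using \<Lambda>(1) by (intro exI[of _ B]) (auto simp: K_def PiE_def Pi_def)
    qed
    show "\<Lambda> u = 0" if u: "u \<in> VMOA p" for u
    proof -
      have uB: "u \<in> BMOA p" using u VMOA_subset_BMOA by auto
      have "cmod (\<Lambda> u) \<le> 0 + d" if d: "0 < d" for d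
      proof -
        obtain m where "\<And>n. m \<le> n \<Longrightarrow> L n u \<in> cball 0 d" using LV[OF u d] by blast
        then have "\<Lambda> u \<in> cball 0 d" using uB by (intro \<Lambda>(2)[OF proj[OF uB], of _ m]) (auto simp: s_def)
        then show ?thesis by simp
      qed
      then have "cmod (\<Lambda> u) \<le> 0" by (rule field_le_epsilon)
      then show ?thesis by simp
    qed
    have "\<Lambda> H \<in> {x. e \<le> Re x}"
      using LH H by (intro \<Lambda>(2)[OF proj[OF H], of _ 0]) (auto simp: s_def intro: closed_halfspace_Re_ge)
    then show "\<Lambda> H \<noteq> 0" using e(1) by auto
  qed
qed

subsection \<open>The equivalences\<close>

lemma not_VMOA_I:
  assumes e: "0 < e" and a: "\<And>n. a n \<in> unit_disc" "(\<lambda>n. cmod (a n)) \<longlonglongrightarrow> 1"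
    "\<And>n::nat. ennreal e \<le> bmoa_integral p f (a n)"
  shows "f \<notin> VMOA p"
proof
  assume "f \<in> VMOA p"
  then obtain r where r: "r < 1" "\<And>b. r < cmod b \<Longrightarrow> cmod b < 1 \<Longrightarrow> bmoa_integral p f b < ennreal e"
    using VMOA_D[of f p "ennreal e"] e by auto
  have "eventually (\<lambda>n. r < cmod (a n)) sequentially" using a(2) r(1) by (rule order_tendstoD)
  then obtain n where "r < cmod (a n)" by (auto simp: eventually_sequentially)
  then have "bmoa_integral p f (a n) < ennreal e" using r(2) a(1)[of n] by auto
  then show False using a(3)[of n] by (simp add: not_le[symmetric])
qed

context bmoa_symbol
begin

lemma T_add: "f holomorphic_on unit_disc \<Longrightarrow> h holomorphic_on unit_disc \<Longrightarrow> T (\<lambda>z. f z + h z) = (\<lambda>z. T f z + T h z)"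
  by (rule integral_operator_add[OF _ _ g])

lemma T_cmult: "f holomorphic_on unit_disc \<Longrightarrow> T (\<lambda>z. c * f z) = (\<lambda>z. c * T f z)"
  by (rule integral_operator_cmult[OF _ g])

lemma T_pointwise_limit:
  assumes hol: "\<And>n. f n holomorphic_on unit_disc"
    and lim: "\<And>K. compact K \<Longrightarrow> K \<subseteq> unit_disc \<Longrightarrow> uniform_limit K f F sequentially" and z: "z \<in> unit_disc"
  shows "(\<lambda>n. T (f n) z) \<longlonglongrightarrow> T F z"
proof -
  have sub: "closed_segment 0 z \<subseteq> unit_disc" using z by (intro closed_segment_subset) auto
  have holF: "F holomorphic_on unit_disc" by (rule uniform_limit_deriv(1)[OF hol lim])
  have contg: "continuous_on (closed_segment 0 z) (deriv g)"
    using holomorphic_deriv[OF g open_ball] sub by (intro holomorphic_on_imp_continuous_on) (rule holomorphic_on_subset)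
  have contF: "continuous_on (closed_segment 0 z) F"
    using holF sub by (intro holomorphic_on_imp_continuous_on) (rule holomorphic_on_subset)
  have "uniform_limit (closed_segment 0 z) (\<lambda>n \<zeta>. f n \<zeta> * deriv g \<zeta>) (\<lambda>\<zeta>. F \<zeta> * deriv g \<zeta>) sequentially"
    using sub contF contg
    by (intro uniform_lim_mult lim uniform_limit_const compact_imp_bounded compact_continuous_image) auto
  moreover have "(\<lambda>\<zeta>. f n \<zeta> * deriv g \<zeta>) contour_integrable_on linepath 0 z" for n
    using integral_operator_primitive[OF hol g, of n] z unfolding contour_integrable_on_def by blast
  ultimately have "(\<lambda>n. contour_integral (linepath 0 z) (\<lambda>\<zeta>. f n \<zeta> * deriv g \<zeta>))
      \<longlonglongrightarrow> contour_integral (linepath 0 z) (\<lambda>\<zeta>. F \<zeta> * deriv g \<zeta>)"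
    by (intro contour_integral_uniform_limit(2)[where B = "cmod z"]) auto
  then show ?thesis using z by (simp add: integral_operator_def)
qed

lemma not_vanishing_imp_not_VMOA:
  assumes "\<not> vanishing"
  shows "\<exists>F\<in>BMOA p. T F \<notin> VMOA p"
proof -
  obtain F Fs C e a where F: "F \<in> BMOA p" and e: "0 < (e::real)" and a: "\<And>n. a n \<in> unit_disc" "(\<lambda>n. cmod (a n)) \<longlonglongrightarrow> 1"
    "\<And>n::nat. ennreal e \<le> bmoa_integral p (T F) (a n)"
    using gliding_hump[OF assms] by metis
  have "T F \<notin> VMOA p" by (rule not_VMOA_I[OF e a])
  then show ?thesis using F by blast
qed

text \<open>
  A weakly compact image of the humps would contain a weak cluster point, which evaluations
  identify with a multiple of \<open>T F\<close>.
\<close>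

lemma weakly_compact_imp_vanishing:
  assumes map: "\<And>f. f \<in> BMOA p \<Longrightarrow> T f \<in> BMOA p" and K: "0 \<le> K" "log_carleson p g K 2"
    and W: "W = BMOA p \<or> W = VMOA p" and S: "S \<subseteq> W"
    and mem: "\<And>f. f \<in> VMOA p \<Longrightarrow> bmoa_norm p f \<le> d \<Longrightarrow> T f \<in> S" and d: "0 < d"
    and cpt: "compactin (weak_topology W (bmoa_norm p)) (weak_topology W (bmoa_norm p) closure_of S)"
  shows vanishing
proof (rule ccontr)
  assume "\<not> vanishing"
  then obtain F C e Fs a where F: "F \<in> BMOA p" and C: "0 < (C::real)" and e: "0 < (e::real)"
    and Fs: "\<And>N. Fs N \<in> VMOA p" "\<And>N. bmoa_norm p (Fs N) \<le> C" "\<And>N. \<exists>B. \<forall>z\<in>unit_disc. cmod (Fs N z) \<le> B"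
    and lim: "\<And>K. compact K \<Longrightarrow> K \<subseteq> unit_disc \<Longrightarrow> uniform_limit K Fs F sequentially"
    and a: "\<And>n. a n \<in> unit_disc" "(\<lambda>n. cmod (a n)) \<longlonglongrightarrow> 1" "\<And>n::nat. ennreal e \<le> bmoa_integral p (T F) (a n)"
    by (rule gliding_hump) (rule that, assumption+)
  have FsB: "Fs N \<in> BMOA p" for N using Fs(1) VMOA_subset_BMOA by auto
  \<comment> \<open>Scales the humps into the ball of radius d, the only one whose image is known to
    lie in S.\<close>
  define c where "c = d / C"
  have c: "0 < c" using d C by (simp add: c_def)
  define s where "s N = T (\<lambda>z. of_real c * Fs N z)" for N
  have s_eq: "s N = (\<lambda>z. of_real c * T (Fs N) z)" for N
    unfolding s_def by (rule T_cmult[OF BMOA_holomorphic[OF FsB]])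
  have sS: "s N \<in> S" for N
    unfolding s_def
  proof (rule mem)
    show "(\<lambda>z. of_real c * Fs N z) \<in> VMOA p" by (rule VMOA_cmult[OF p(1) Fs(1)])
    have "bmoa_norm p (\<lambda>z. of_real c * Fs N z) = c * bmoa_norm p (Fs N)"
      using bmoa_norm_cmult[OF p(1) FsB, of "of_real c" N] c by simp
    also have "\<dots> \<le> c * C" using c Fs(2) by (intro mult_left_mono) auto
    finally show "bmoa_norm p (\<lambda>z. of_real c * Fs N z) \<le> d" using C by (simp add: c_def)
  qed
  have WB: "W \<subseteq> BMOA p" using W VMOA_subset_BMOA by auto
  obtain H where H: "H \<in> W"
    and cl: "\<And>\<Lambda> L. \<Lambda> \<in> dual_space W (bmoa_norm p) \<Longrightarrow> (\<lambda>n. \<Lambda> (s n)) \<longlonglongrightarrow> L \<Longrightarrow> \<Lambda> H = L"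
    by (rule weak_cluster_point[where s = s, OF cpt S sS]) (rule that, assumption+)
  have TF: "T F \<in> BMOA p" by (rule map[OF F])
  have H_eq: "H = (\<lambda>z. of_real c * T F z)"
  proof (rule analytic_disc_eqI)
    show "H \<in> analytic_disc" using H WB BMOA_analytic by blast
    show "(\<lambda>z. of_real c * T F z) \<in> analytic_disc" by (rule analytic_disc_cmult[OF BMOA_analytic[OF TF]])
    fix z assume z: "z \<in> unit_disc"
    have "(\<lambda>n. s n z) \<longlonglongrightarrow> of_real c * T F z"
      unfolding s_eq by (intro tendsto_mult_left T_pointwise_limit[OF BMOA_holomorphic[OF FsB] lim z])
    then show "H z = of_real c * T F z"
      using cl[OF evaluation_in_dual[OF p WB z]] by blast
  qed
  have TF_eq: "T F = (\<lambda>z. of_real (1 / c) * H z)" using c by (auto simp: H_eq)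
  have "T F \<notin> VMOA p" by (rule not_VMOA_I[OF e a])
  moreover have "T F \<in> VMOA p"
    using W
  proof
    assume "W = VMOA p"
    then show ?thesis unfolding TF_eq using H by (intro VMOA_cmult[OF p(1)]) simp
  next
    assume WB: "W = BMOA p"
    \<comment> \<open>The partial sums are bounded functions, so their images lie in
      \<open>VMOA p\<close> and are annihilated by \<Lambda>. Then \<Lambda> also vanishes at the
      cluster point H, a multiple of \<open>T F\<close>, where it should not.\<close>
    obtain \<Lambda> where \<Lambda>: "\<Lambda> \<in> dual_space (BMOA p) (bmoa_norm p)" "\<And>u. u \<in> VMOA p \<Longrightarrow> \<Lambda> u = 0" "\<Lambda> (T F) \<noteq> 0"
      using separating_functional[OF p TF a(1,2) e a(3)] by blast
    have "s N \<in> VMOA p" for N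
    proof -
      obtain B where B: "\<forall>z\<in>unit_disc. cmod (Fs N z) \<le> B" using Fs(3) by blast
      then have "0 \<le> B" using norm_ge_zero[of "Fs N 0"] by (metis centre_in_ball order_trans zero_less_one)
      then have "T (Fs N) \<in> VMOA p"
        using B by (intro T_bounded_VMOA[OF K(2) _ K(1) FsB map[OF FsB], of B]) auto
      then show ?thesis unfolding s_eq by (rule VMOA_cmult[OF p(1)])
    qed
    then have "\<Lambda> H = 0" using cl[of \<Lambda> 0] \<Lambda>(1,2) WB by simp
    moreover have "\<Lambda> (T F) = of_real (1 / c) * \<Lambda> H"
      unfolding TF_eq using \<Lambda>(1) H WB unfolding dual_space_def by blast
    ultimately show ?thesis using \<Lambda>(3) by simp
  qed
  ultimately show False by blast
qed

text \<open>Montel's theorem gives a locally uniform limit, which stays in the same ball by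
  \<open>BMOA_limit\<close>, and \<open>T_small\<close> upgrades convergence to norm convergence of
  the images. The target W is left open so that both \<open>BMOA p\<close> and \<open>VMOA p\<close>
  are served, and the radius c because the inclusion of \<open>BMOA p\<close> in
  \<open>BMOA 2\<close> is not contractive.\<close>

lemma T_compact_image:
  assumes v: vanishing and ms: "Metric_space W (\<lambda>f h. bmoa_norm p (\<lambda>z. f z - h z))" and VW: "VMOA p \<subseteq> W"
  shows "compactin (norm_topology W (bmoa_norm p)) (T ` {f \<in> BMOA 2. bmoa_norm 2 f \<le> c})"
proof -
  interpret Metric_space W "\<lambda>f h. bmoa_norm p (\<lambda>z. f z - h z)" by (rule ms)
  let ?B = "{f \<in> BMOA 2. bmoa_norm 2 f \<le> c}"
  have TW: "T f \<in> W" if "f \<in> BMOA 2" for f using T_VMOA[OF v that] VW by auto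
  show ?thesis
    unfolding norm_topology_def compactin_sequentially
  proof (intro conjI allI impI)
    show "T ` ?B \<subseteq> W" using TW by auto
    fix \<sigma> :: "nat \<Rightarrow> complex \<Rightarrow> complex" assume "range \<sigma> \<subseteq> T ` ?B"
    then have "\<forall>n. \<exists>f. f \<in> ?B \<and> \<sigma> n = T f" by blast
    then obtain f where f: "\<And>n. f n \<in> ?B" "\<And>n. \<sigma> n = T (f n)" by metis
    have f2: "f n \<in> BMOA 2" "bmoa_norm 2 (f n) \<le> c" for n using f(1)[of n] by auto
    have c: "0 \<le> c" using f2(2)[of 0] bmoa_norm_nonneg[of 2 "f 0"] by linarith
    obtain f1 r where f1: "f1 holomorphic_on unit_disc" "strict_mono (r :: nat \<Rightarrow> nat)"
      "\<And>K. compact K \<Longrightarrow> K \<subseteq> unit_disc \<Longrightarrow> uniform_limit K (f \<circ> r) f1 sequentially"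
    proof (rule Montel[of unit_disc ?B f])
      show "h holomorphic_on unit_disc" if "h \<in> ?B" for h using that BMOA_holomorphic by auto
      show "range f \<subseteq> ?B" using f(1) by auto
      fix K :: "complex set" assume K: "compact K" "K \<subseteq> unit_disc"
      show "\<exists>B. \<forall>h\<in>?B. \<forall>z\<in>K. norm (h z) \<le> B"
      proof (cases "K = {}")
        case False
        obtain y where y: "y \<in> K" "\<And>z. z \<in> K \<Longrightarrow> cmod z \<le> cmod y"
          using continuous_attains_sup[OF K(1) False, of cmod] by (auto intro: continuous_intros)
        have y1: "cmod y < 1" using y(1) K(2) by auto
        have "cmod (h z) \<le> 57 * c * blog (1 - cmod y)" if h: "h \<in> ?B" and z: "z \<in> K" for h z
        proof -
          have z1: "cmod z < 1" using z K(2) by auto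
          have "cmod (h z) \<le> 57 * bmoa_norm 2 h * blog (1 - cmod z)"
            using h z1 by (intro growth_bound) auto
          also have "\<dots> \<le> 57 * c * blog (1 - cmod y)"
          proof (intro mult_mono blog_mono)
            have "1 \<le> blog (1 - cmod z)" using z1 norm_ge_zero[of z] by (intro blog_ge_1) linarith+
            then show "0 \<le> blog (1 - cmod z)" by simp
          qed (use h c y(2)[OF z] y1 in auto)
          finally show ?thesis .
        qed
        then show ?thesis by blast
      qed auto
    qed (auto intro: that)
    define f0 where "f0 z = (if z \<in> unit_disc then f1 z else 0)" for z
    have lim: "uniform_limit K (f \<circ> r) f0 sequentially" if K: "compact K" "K \<subseteq> unit_disc" for K
    proof -
      have "uniform_limit K (f \<circ> r) f1 sequentially \<longleftrightarrow> uniform_limit K (f \<circ> r) f0 sequentially"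
        using K(2) by (intro uniform_limit_cong') (auto simp: f0_def)
      then show ?thesis using f1(3)[OF K] by simp
    qed
    have "f0 holomorphic_on unit_disc" by (rule holomorphic_transform[OF f1(1)]) (auto simp: f0_def)
    then have f0A: "f0 \<in> analytic_disc" by (simp add: analytic_disc_def f0_def)
    have f0: "f0 \<in> BMOA 2" "bmoa_norm 2 f0 \<le> c"
      using BMOA_limit[of 2 "f \<circ> r" c f0] f2 f0A lim by auto
    have "limitin mtopology (\<sigma> \<circ> r) (T f0) sequentially"
      unfolding limit_metric_sequentially
    proof (intro conjI allI impI)
      show "T f0 \<in> W" by (rule TW[OF f0(1)])
      fix \<epsilon> :: real assume \<epsilon>: "0 < \<epsilon>"
      \<comment> \<open>Scales differences of two members of the ball, of norm at most 2*c, into the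
        unit ball on which \<open>T_small\<close> applies; the added 1 covers c = 0.\<close>
      define s where "s = 1 / (2 * c + 1)"
      have s: "0 < s" "s \<le> 1" "s * (2 * c) \<le> 1" using c by (auto simp: s_def field_simps)
      define t where "t = \<epsilon> / 2 * s"
      have t: "0 < t" using \<epsilon> s by (simp add: t_def)
      obtain \<rho> \<eta> where \<rho>: "\<rho> < 1" "0 < \<eta>"
        and small: "\<And>u a. u \<in> BMOA 2 \<Longrightarrow> bmoa_norm 2 u \<le> 1 \<Longrightarrow> (\<And>z. cmod z \<le> \<rho> \<Longrightarrow> cmod (u z) \<le> \<eta>) \<Longrightarrow>
          a \<in> unit_disc \<Longrightarrow> bmoa_integral p (T u) a \<le> ennreal (t powr p)"
        using T_small[OF v, of "t powr p"] t by (metis powr_gt_zero less_irrefl)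
      have "cball 0 \<rho> \<subseteq> unit_disc" using \<rho> by auto
      then have "uniform_limit (cball 0 \<rho>) (f \<circ> r) f0 sequentially" by (intro lim) auto
      then obtain N where N: "\<And>n z. N \<le> n \<Longrightarrow> cmod z \<le> \<rho> \<Longrightarrow> dist (f (r n) z) (f0 z) < \<eta>"
        using uniform_limitD[of _ _ _ sequentially \<eta>] \<rho>(2) by (fastforce simp: eventually_sequentially)
      show "\<exists>N. \<forall>n\<ge>N. (\<sigma> \<circ> r) n \<in> W \<and> bmoa_norm p (\<lambda>z. (\<sigma> \<circ> r) n z - T f0 z) < \<epsilon>"
      proof (intro exI[of _ N] allI impI conjI)
        fix n assume n: "N \<le> n"
        show "(\<sigma> \<circ> r) n \<in> W" using f TW f2 by simp
        define h where "h z = f (r n) z - f0 z" for z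
        define u where "u z = of_real s * h z" for z
        have h: "h \<in> BMOA 2" "bmoa_norm 2 h \<le> 2 * c"
          unfolding h_def[abs_def] using BMOA_diff[of 2 "f (r n)" f0] f2[of "r n"] f0 by auto
        have u: "u \<in> BMOA 2" unfolding u_def[abs_def] using h by (intro BMOA_cmult_le) auto
        have "bmoa_norm 2 u = s * bmoa_norm 2 h"
          unfolding u_def[abs_def] using bmoa_norm_cmult[of 2 h "of_real s"] h s by simp
        also have "\<dots> \<le> s * (2 * c)" using s h by (intro mult_left_mono) auto
        finally have nu: "bmoa_norm 2 u \<le> 1" using s by simp
        have "cmod (u z) \<le> \<eta>" if z: "cmod z \<le> \<rho>" for z
        proof -
          have "cmod (u z) = s * cmod (h z)" using s by (simp add: u_def norm_mult)
          also have "\<dots> \<le> 1 * cmod (h z)" using s by (intro mult_right_mono) auto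
          also have "\<dots> \<le> \<eta>" using N[OF n z] by (simp add: h_def dist_norm)
          finally show ?thesis .
        qed
        then have I: "bmoa_integral p (T u) a \<le> ennreal (t powr p)" if "a \<in> unit_disc" for a
          using small[OF u nu _ that] by blast
        note Tu = integral_operator_props[OF BMOA_holomorphic[OF u] g]
        have "bmoa_norm p (T u) \<le> t"
          using BMOA_I(2)[OF _ Tu(1), of p t] I Tu(2) t p by simp
        have TuB: "T u \<in> BMOA p" using T_VMOA[OF v u] VMOA_subset_BMOA by auto
        have "T h = (\<lambda>z. of_real (1 / s) * T u z)"
          using T_cmult[OF BMOA_holomorphic[OF h(1)], of "of_real s"] s by (simp add: u_def[abs_def])
        moreover have "T h = (\<lambda>z. T (f (r n)) z - T f0 z)"
        proof -
          have "T (\<lambda>z. f (r n) z + (- 1) * f0 z) = (\<lambda>z. T (f (r n)) z + T (\<lambda>z. (- 1) * f0 z) z)"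
            by (rule T_add[OF BMOA_holomorphic[OF f2(1)] BMOA_holomorphic[OF BMOA_cmult_le(1)[OF _ f0(1)]]]) simp
          then show ?thesis using T_cmult[OF BMOA_holomorphic[OF f0(1)], of "- 1"] by (simp add: h_def[abs_def])
        qed
        ultimately have "bmoa_norm p (\<lambda>z. (\<sigma> \<circ> r) n z - T f0 z) = bmoa_norm p (\<lambda>z. of_real (1 / s) * T u z)"
          by (simp add: f(2))
        also have "\<dots> = 1 / s * bmoa_norm p (T u)"
          using bmoa_norm_cmult[OF p(1) TuB, of "of_real (1 / s)"] s by (simp add: norm_divide)
        also have "\<dots> \<le> 1 / s * t" using \<open>bmoa_norm p (T u) \<le> t\<close> s by (intro mult_left_mono) auto
        also have "\<dots> = \<epsilon> / 2" using s by (simp add: t_def)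
        finally show "bmoa_norm p (\<lambda>z. (\<sigma> \<circ> r) n z - T f0 z) < \<epsilon>" using \<epsilon> by simp
      qed
    qed
    then show "\<exists>l r. l \<in> T ` ?B \<and> strict_mono r \<and> limitin mtopology (\<sigma> \<circ> r) l sequentially"
      using f0 f1(2) by blast
  qed
qed

end

text \<open>Point evaluations are bounded and separate the functions, so the separation hypothesis
  of the general lemma holds in both spaces.\<close>

lemma weakly_compact_of_compact_superset:
  assumes p: "1 < p" "p \<le> 2" and W: "W = BMOA p \<or> W = VMOA p"
    and K: "compactin (norm_topology W (bmoa_norm p)) K" and S: "S \<subseteq> K"
  shows "compactin (weak_topology W (bmoa_norm p)) (weak_topology W (bmoa_norm p) closure_of S)"
proof (rule norm_compact_imp_weak_compact[OF _ _ _ K S])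
  have WB: "W \<subseteq> BMOA p" using W VMOA_subset_BMOA by auto
  show "Metric_space W (\<lambda>f h. bmoa_norm p (\<lambda>z. f z - h z))"
    by (rule Metric_space.subspace[OF Metric_space_BMOA[OF p] WB])
  show "(\<lambda>z. f z - h z) \<in> W" if "f \<in> W" "h \<in> W" for f h
    using W
  proof
    assume W: "W = VMOA p"
    have "(\<lambda>z. f z + (- 1) * h z) \<in> VMOA p" using that W by (intro VMOA_add[OF p(1)] VMOA_cmult[OF p(1)]) auto
    then show ?thesis using W by simp
  qed (use that BMOA_diff(1)[OF p(1)] in auto)
  show "\<exists>\<Lambda>\<in>dual_space W (bmoa_norm p). \<Lambda> f \<noteq> \<Lambda> h" if fh: "f \<in> W" "h \<in> W" "f \<noteq> h" for f h
  proof -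
    obtain z where "z \<in> unit_disc" "f z \<noteq> h z"
      using analytic_disc_eqI[of f h] fh WB BMOA_analytic by blast
    then show ?thesis using fh evaluation_in_dual[OF p WB] by (intro bexI[of _ "\<lambda>f. f z"]) auto
  qed
qed

lemma norm_compact_closure_of_subset:
  assumes p: "1 < p" "p \<le> 2"
    and K: "compactin (norm_topology (BMOA p) (bmoa_norm p)) K" and S: "S \<subseteq> K"
  shows "compactin (norm_topology (BMOA p) (bmoa_norm p)) (norm_topology (BMOA p) (bmoa_norm p) closure_of S)"
proof -
  interpret Metric_space "BMOA p" "\<lambda>f h. bmoa_norm p (\<lambda>z. f z - h z)" by (rule Metric_space_BMOA[OF p])
  have K': "compactin mtopology K" using K unfolding norm_topology_def .
  have "closedin mtopology K" by (rule compactin_imp_closedin[OF Hausdorff_space_mtopology K'])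
  with S have "mtopology closure_of S \<subseteq> K" by (rule closure_of_minimal)
  then show ?thesis unfolding norm_topology_def by (rule closed_compactin[OF K' _ closedin_closure_of])
qed

theorem corollary5p1:
  fixes p :: real and g :: "complex \<Rightarrow> complex"
  assumes "1 < p" and "p < 2"
    and "g holomorphic_on unit_disc"
    and "bounded_operator (BMOA p) (bmoa_norm p) (BMOA p) (bmoa_norm p) (integral_operator g)"
  shows
    "(compact_operator (BMOA 2) (bmoa_norm 2) (BMOA p) (bmoa_norm p) (integral_operator g)
      \<longleftrightarrow> compact_operator (BMOA p) (bmoa_norm p) (BMOA p) (bmoa_norm p) (integral_operator g)) \<and>
     (compact_operator (BMOA p) (bmoa_norm p) (BMOA p) (bmoa_norm p) (integral_operator g)
      \<longleftrightarrow> weakly_compact_operator (BMOA p) (bmoa_norm p) (BMOA p) (bmoa_norm p) (integral_operator g)) \<and>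
     (weakly_compact_operator (BMOA p) (bmoa_norm p) (BMOA p) (bmoa_norm p) (integral_operator g)
      \<longleftrightarrow> weakly_compact_operator (VMOA p) (bmoa_norm p) (VMOA p) (bmoa_norm p) (integral_operator g)) \<and>
     (weakly_compact_operator (VMOA p) (bmoa_norm p) (VMOA p) (bmoa_norm p) (integral_operator g)
      \<longleftrightarrow> integral_operator g ` BMOA p \<subseteq> VMOA p) \<and>
     (integral_operator g ` BMOA p \<subseteq> VMOA p
      \<longleftrightarrow> integral_operator g ` BMOA 2 \<subseteq> VMOA p) \<and>
     (integral_operator g ` BMOA 2 \<subseteq> VMOA p
      \<longleftrightarrow> vanishing_log_carleson p g)"
    (is "(?i \<longleftrightarrow> ?ii) \<and> (_ \<longleftrightarrow> ?iii) \<and> (_ \<longleftrightarrow> ?iv) \<and> (_ \<longleftrightarrow> ?v) \<and> (_ \<longleftrightarrow> ?vi) \<and> (_ \<longleftrightarrow> ?vii)")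
proof -
  have p: "1 < p" "p \<le> 2" using assms by auto
  note g = assms(3)
  interpret bmoa_symbol p g by (rule bounded_imp_log_carleson(1)[OF p g assms(4)])
  obtain K where K: "0 \<le> K" "log_carleson p g K 2" using bounded_imp_log_carleson(2)[OF p g assms(4)] by blast
  have map: "T f \<in> BMOA p" if "f \<in> BMOA p" for f
    using assms(4) that by (auto simp: bounded_operator_def linear_operator_def)
  have sub2: "BMOA p \<subseteq> BMOA 2" using BMOA_subset_BMOA_2(1)[OF p] by auto
  have norm2: "bmoa_norm 2 f \<le> 11 * bmoa_norm p f" if "f \<in> BMOA p" for f by (rule BMOA_subset_BMOA_2(2)[OF p that])
  have an: "BMOA q \<subseteq> analytic_disc" for q by (auto simp: BMOA_def)
  \<comment> \<open>As 11 bounds the inclusion of \<open>BMOA p\<close> in \<open>BMOA 2\<close>,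
    this one set contains the images of the unit balls of \<open>BMOA 2\<close>,
    \<open>BMOA p\<close> and \<open>VMOA p\<close>; its norm compactness settles all four
    compactness statements.\<close>
  let ?K = "T ` {f \<in> BMOA 2. bmoa_norm 2 f \<le> 11}"
  note msB = Metric_space_BMOA[OF p]
  note msV = Metric_space.subspace[OF msB VMOA_subset_BMOA]
  have vanish: ?i ?ii ?iii ?iv ?v ?vi if v: vanishing
  proof -
    have T2: "T ` BMOA 2 \<subseteq> VMOA p" using T_VMOA[OF v] by auto
    then show ?vi .
    show ?v using T2 sub2 by auto
    have KB: "compactin (norm_topology (BMOA p) (bmoa_norm p)) ?K"
      by (rule T_compact_image[OF v msB VMOA_subset_BMOA])
    have KV: "compactin (norm_topology (VMOA p) (bmoa_norm p)) ?K"
      by (rule T_compact_image[OF v msV order_refl])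
    have S: "T ` {f \<in> BMOA p. bmoa_norm p f \<le> 1} \<subseteq> ?K"
      using sub2 norm2 by (intro image_mono) force
    have S2: "T ` {f \<in> BMOA 2. bmoa_norm 2 f \<le> 1} \<subseteq> ?K" by auto
    have SV: "T ` {f \<in> VMOA p. bmoa_norm p f \<le> 1} \<subseteq> ?K" using S VMOA_subset_BMOA by blast
    show ?i unfolding compact_operator_def
      using T2 VMOA_subset_BMOA norm_compact_closure_of_subset[OF p KB S2]
      by (intro conjI linear_integral_operator[OF g an]) auto
    show ?ii unfolding compact_operator_def
      using map norm_compact_closure_of_subset[OF p KB S]
      by (intro conjI linear_integral_operator[OF g an]) auto
    show ?iii unfolding weakly_compact_operator_def
      using map weakly_compact_of_compact_superset[OF p _ KB S]
      by (intro conjI linear_integral_operator[OF g an]) auto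
    show ?iv unfolding weakly_compact_operator_def
      using T2 sub2 VMOA_subset_BMOA weakly_compact_of_compact_superset[OF p _ KV SV] an
      by (intro conjI linear_integral_operator[OF g]) blast+
  qed
  have weak: vanishing if "S \<subseteq> BMOA p" "\<And>f. f \<in> VMOA p \<Longrightarrow> bmoa_norm p f \<le> d \<Longrightarrow> T f \<in> S" "0 < d"
    "compactin (weak_topology (BMOA p) (bmoa_norm p)) (weak_topology (BMOA p) (bmoa_norm p) closure_of S)" for S d
    using weakly_compact_imp_vanishing[OF map K _ that(1,2,3,4)] by blast
  \<comment> \<open>A set with norm compact closure has weakly compact weak closure, so norm
    compactness reduces to the weak case.\<close>
  have strong: vanishing if S: "S \<subseteq> BMOA p" "\<And>f. f \<in> VMOA p \<Longrightarrow> bmoa_norm p f \<le> d \<Longrightarrow> T f \<in> S" "0 < d"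
    and c: "compactin (norm_topology (BMOA p) (bmoa_norm p)) (norm_topology (BMOA p) (bmoa_norm p) closure_of S)" for S d
  proof (rule weak[OF S])
    have "topspace (norm_topology (BMOA p) (bmoa_norm p)) = BMOA p"
      unfolding norm_topology_def by (rule Metric_space.topspace_mtopology[OF msB])
    then have "S \<subseteq> norm_topology (BMOA p) (bmoa_norm p) closure_of S" using S(1) by (intro closure_of_subset) simp
    then show "compactin (weak_topology (BMOA p) (bmoa_norm p)) (weak_topology (BMOA p) (bmoa_norm p) closure_of S)"
      using weakly_compact_of_compact_superset[OF p _ c] by blast
  qed
  have iff_i: "?i \<Longrightarrow> vanishing"
  proof -
    assume i: ?i
    show vanishing
    \<comment> \<open>The ball of radius 1/11 in \<open>VMOA p\<close> lies in the unit ball of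
      \<open>BMOA 2\<close>, which accounts for the free radius in \<open>strong\<close>.\<close>
    proof (rule strong[of "T ` {f \<in> BMOA 2. bmoa_norm 2 f \<le> 1}" "1 / 11"])
      fix f assume f: "f \<in> VMOA p" "bmoa_norm p f \<le> 1 / 11"
      then have "f \<in> BMOA p" using VMOA_subset_BMOA by auto
      then show "T f \<in> T ` {f \<in> BMOA 2. bmoa_norm 2 f \<le> 1}"
        using sub2 norm2[of f] f(2) by (intro imageI) auto
    qed (use i in \<open>auto simp: compact_operator_def linear_operator_def\<close>)
  qed
  have iff_ii: "?ii \<Longrightarrow> vanishing"
    by (rule strong[of "T ` {f \<in> BMOA p. bmoa_norm p f \<le> 1}" 1])
      (use VMOA_subset_BMOA map in \<open>auto simp: compact_operator_def\<close>)
  have iff_iii: "?iii \<Longrightarrow> vanishing"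
    by (rule weak[of "T ` {f \<in> BMOA p. bmoa_norm p f \<le> 1}" 1])
      (use VMOA_subset_BMOA map in \<open>auto simp: weakly_compact_operator_def\<close>)
  have iff_iv: "?iv \<Longrightarrow> vanishing"
    by (rule weakly_compact_imp_vanishing[OF map K, of "VMOA p" "T ` {f \<in> VMOA p. bmoa_norm p f \<le> 1}" 1])
      (auto simp: weakly_compact_operator_def linear_operator_def)
  have iff_v: "?v \<Longrightarrow> vanishing" using not_vanishing_imp_not_VMOA by blast
  have iff_vi: "?vi \<Longrightarrow> vanishing" using not_vanishing_imp_not_VMOA sub2 by blast
  show ?thesis
    using vanish iff_i iff_ii iff_iii iff_iv iff_v iff_vi vanishing_iff by blast
qed

end
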